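(* Work in $\mathbf{CZF}$ and assume elementary NID. Then all M-types exist: for every function $f:B\to A$ between sets there is a final $P_f$-coalgebra.
   Context: For a function $f:B\to A$ and $a\in A$ write $B_a=f^{-1}(a)$. The polynomial functor $P_f$ sends a set $X$ to $P_f(X)=\{(a,t): a\in A,\ t:B_a\to X\}$ and a function $\alpha:X\to Y$ to $P_f(\alpha)(a,t)=(a,\alpha\circ t)$. A $P_f$-coalgebra is a set $X$ with a function $v:X\to P_f(X)$; a morphism $(X,v)\to(Y,w)$ is a function $\alpha:X\to Y$ with $w\circ\alpha=P_f(\alpha)\circ v$. A final $P_f$-coalgebra (the M-type of $f$) is a coalgebra to which every coalgebra has a unique morphism. A rule on a set $X$ is a pair $(a,b)$ of subsets of $X$, elementary if $a$ is a singleton; $Y\subseteq X$ is closed under it if $a\subseteq Y$ implies $b\cap Y$ inhabited. A class $M$ of subsets of $X$ is set-generated if there is a set $G\subseteq M$ with $\forall\alpha\in M\,\forall x\in\alpha\,\exists\beta\in G\,x\in\beta\subseteq\alpha$. Elementary NID: for every set $X$ and set $\mathcal R$ of elementary rules on $X$, the class of subsets of $X$ closed under all rules of $\mathcal R$ is set-generated. *)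

theory Defs
  imports Main
begin

text \<open>
  Statements made ``in CZF'' are rendered as derivability in a deeply embedded intuitionistic
  first-order theory: Isabelle/HOL is classical, and reading sets as HOL sets would make the
  principle NID provable outright. The language has the binary predicates membership and equality
  and no function symbols, so the only terms are variables (de Bruijn indices) and substitution is
  renaming of variables.
\<close>

datatype fm =
    Member nat nat
  | Equal nat nat
  | Falsum
  | Conj fm fm
  | Disj fm fm
  | Impl fm fm
  | Forall fm
  | Exists fm

primrec rename :: "(nat \<Rightarrow> nat) \<Rightarrow> fm \<Rightarrow> fm" where
  "rename r (Member i j) = Member (r i) (r j)"
| "rename r (Equal i j) = Equal (r i) (r j)"
| "rename r Falsum = Falsum"
| "rename r (Conj \<phi> \<psi>) = Conj (rename r \<phi>) (rename r \<psi>)"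
| "rename r (Disj \<phi> \<psi>) = Disj (rename r \<phi>) (rename r \<psi>)"
| "rename r (Impl \<phi> \<psi>) = Impl (rename r \<phi>) (rename r \<psi>)"
| "rename r (Forall \<phi>) = Forall (rename (case_nat 0 (\<lambda>i. Suc (r i))) \<phi>)"
| "rename r (Exists \<phi>) = Exists (rename (case_nat 0 (\<lambda>i. Suc (r i))) \<phi>)"

abbreviation lift :: "fm \<Rightarrow> fm" where
  "lift \<equiv> rename Suc"

text \<open>\<open>subst t \<phi>\<close> replaces variable 0 by the variable \<open>t\<close> and lowers all other indices.\<close>

abbreviation subst :: "nat \<Rightarrow> fm \<Rightarrow> fm" where
  "subst t \<equiv> rename (case_nat t (\<lambda>i. i))"

text \<open>
  Natural deduction for intuitionistic first-order logic with equality. The formulas in \<open>T\<close> are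
  axioms and the ones in \<open>\<Gamma>\<close> are hypotheses. Free variables of an axiom are parameters, implicitly
  universally quantified; hence the quantifier rules lift \<open>\<Gamma>\<close> but not \<open>T\<close>.
\<close>

inductive derives :: "fm set \<Rightarrow> fm set \<Rightarrow> fm \<Rightarrow> bool" for T where
  axiom: "\<phi> \<in> T \<Longrightarrow> derives T \<Gamma> \<phi>"
| hyp: "\<phi> \<in> \<Gamma> \<Longrightarrow> derives T \<Gamma> \<phi>"
| falsumE: "derives T \<Gamma> Falsum \<Longrightarrow> derives T \<Gamma> \<phi>"
| conjI: "derives T \<Gamma> \<phi> \<Longrightarrow> derives T \<Gamma> \<psi> \<Longrightarrow> derives T \<Gamma> (Conj \<phi> \<psi>)"
| conjE1: "derives T \<Gamma> (Conj \<phi> \<psi>) \<Longrightarrow> derives T \<Gamma> \<phi>"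
| conjE2: "derives T \<Gamma> (Conj \<phi> \<psi>) \<Longrightarrow> derives T \<Gamma> \<psi>"
| disjI1: "derives T \<Gamma> \<phi> \<Longrightarrow> derives T \<Gamma> (Disj \<phi> \<psi>)"
| disjI2: "derives T \<Gamma> \<psi> \<Longrightarrow> derives T \<Gamma> (Disj \<phi> \<psi>)"
| disjE: "derives T \<Gamma> (Disj \<phi> \<psi>) \<Longrightarrow> derives T (insert \<phi> \<Gamma>) \<chi> \<Longrightarrow>
    derives T (insert \<psi> \<Gamma>) \<chi> \<Longrightarrow> derives T \<Gamma> \<chi>"
| implI: "derives T (insert \<phi> \<Gamma>) \<psi> \<Longrightarrow> derives T \<Gamma> (Impl \<phi> \<psi>)"
| implE: "derives T \<Gamma> (Impl \<phi> \<psi>) \<Longrightarrow> derives T \<Gamma> \<phi> \<Longrightarrow> derives T \<Gamma> \<psi>"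
| forallI: "derives T (lift ` \<Gamma>) \<phi> \<Longrightarrow> derives T \<Gamma> (Forall \<phi>)"
| forallE: "derives T \<Gamma> (Forall \<phi>) \<Longrightarrow> derives T \<Gamma> (subst t \<phi>)"
| existsI: "derives T \<Gamma> (subst t \<phi>) \<Longrightarrow> derives T \<Gamma> (Exists \<phi>)"
| existsE: "derives T \<Gamma> (Exists \<phi>) \<Longrightarrow> derives T (insert \<phi> (lift ` \<Gamma>)) (lift \<psi>) \<Longrightarrow>
    derives T \<Gamma> \<psi>"
| equal_refl: "derives T \<Gamma> (Equal t t)"
| equal_subst: "derives T \<Gamma> (Equal s t) \<Longrightarrow> derives T \<Gamma> (subst s \<phi>) \<Longrightarrow> derives T \<Gamma> (subst t \<phi>)"

text \<open>The \<open>Suc\<close> in the bound of a quantifier keeps the bound different from the quantified variable.\<close>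

inductive bounded :: "fm \<Rightarrow> bool" where
  "bounded (Member i j)"
| "bounded (Equal i j)"
| "bounded Falsum"
| "bounded \<phi> \<Longrightarrow> bounded \<psi> \<Longrightarrow> bounded (Conj \<phi> \<psi>)"
| "bounded \<phi> \<Longrightarrow> bounded \<psi> \<Longrightarrow> bounded (Disj \<phi> \<psi>)"
| "bounded \<phi> \<Longrightarrow> bounded \<psi> \<Longrightarrow> bounded (Impl \<phi> \<psi>)"
| "bounded \<phi> \<Longrightarrow> bounded (Forall (Impl (Member 0 (Suc j)) \<phi>))"
| "bounded \<phi> \<Longrightarrow> bounded (Exists (Conj (Member 0 (Suc j)) \<phi>))"

text \<open>
  To write concrete formulas with ordinary bound variables, a term or formula is represented by
  the function that sends the number \<open>n\<close> of enclosing quantifiers to its de Bruijn form there. The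
  variable bound by the quantifier at depth \<open>n\<close> has index \<open>m - Suc n\<close> at depth \<open>m\<close>. The actual
  formula denoted by \<open>p\<close> is \<open>p 0\<close>.
\<close>

type_synonym trm = "nat \<Rightarrow> nat"
type_synonym form = "nat \<Rightarrow> fm"

definition fo_mem :: "trm \<Rightarrow> trm \<Rightarrow> form" (infix "\<^bold>\<in>" 50) where
  "(x \<^bold>\<in> y) = (\<lambda>n. Member (x n) (y n))"

definition fo_eq :: "trm \<Rightarrow> trm \<Rightarrow> form" (infix "\<^bold>=" 50) where
  "(x \<^bold>= y) = (\<lambda>n. Equal (x n) (y n))"

definition fo_false :: form ("\<^bold>\<bottom>") where
  "\<^bold>\<bottom> = (\<lambda>n. Falsum)"

definition fo_conj :: "form \<Rightarrow> form \<Rightarrow> form" (infixr "\<^bold>\<and>" 35) where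
  "(p \<^bold>\<and> q) = (\<lambda>n. Conj (p n) (q n))"

definition fo_disj :: "form \<Rightarrow> form \<Rightarrow> form" (infixr "\<^bold>\<or>" 30) where
  "(p \<^bold>\<or> q) = (\<lambda>n. Disj (p n) (q n))"

definition fo_imp :: "form \<Rightarrow> form \<Rightarrow> form" (infixr "\<^bold>\<longrightarrow>" 25) where
  "(p \<^bold>\<longrightarrow> q) = (\<lambda>n. Impl (p n) (q n))"

definition fo_iff :: "form \<Rightarrow> form \<Rightarrow> form" (infixr "\<^bold>\<longleftrightarrow>" 25) where
  "(p \<^bold>\<longleftrightarrow> q) = ((p \<^bold>\<longrightarrow> q) \<^bold>\<and> (q \<^bold>\<longrightarrow> p))"

definition fo_all :: "(trm \<Rightarrow> form) \<Rightarrow> form" (binder "\<^bold>\<forall>" 10) where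
  "fo_all F = (\<lambda>n. Forall (F (\<lambda>m. m - Suc n) (Suc n)))"

definition fo_ex :: "(trm \<Rightarrow> form) \<Rightarrow> form" (binder "\<^bold>\<exists>" 10) where
  "fo_ex F = (\<lambda>n. Exists (F (\<lambda>m. m - Suc n) (Suc n)))"

definition fo_ball :: "trm \<Rightarrow> (trm \<Rightarrow> form) \<Rightarrow> form" where
  "fo_ball a F = (\<^bold>\<forall>x. x \<^bold>\<in> a \<^bold>\<longrightarrow> F x)"

definition fo_bex :: "trm \<Rightarrow> (trm \<Rightarrow> form) \<Rightarrow> form" where
  "fo_bex a F = (\<^bold>\<exists>x. x \<^bold>\<in> a \<^bold>\<and> F x)"

definition fo_ex1 :: "(trm \<Rightarrow> form) \<Rightarrow> form" (binder "\<^bold>\<exists>!" 10) where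
  "fo_ex1 F = (\<^bold>\<exists>x. F x \<^bold>\<and> (\<^bold>\<forall>y. F y \<^bold>\<longrightarrow> y \<^bold>= x))"

syntax
  "_fo_ball" :: "pttrn \<Rightarrow> trm \<Rightarrow> form \<Rightarrow> form" ("(3\<^bold>\<forall>_\<^bold>\<in>_./ _)" [0, 51, 10] 10)
  "_fo_bex" :: "pttrn \<Rightarrow> trm \<Rightarrow> form \<Rightarrow> form" ("(3\<^bold>\<exists>_\<^bold>\<in>_./ _)" [0, 51, 10] 10)
translations
  "\<^bold>\<forall>x\<^bold>\<in>a. p" \<rightleftharpoons> "CONST fo_ball a (\<lambda>x. p)"
  "\<^bold>\<exists>x\<^bold>\<in>a. p" \<rightleftharpoons> "CONST fo_bex a (\<lambda>x. p)"

text \<open>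
  \<open>inst \<phi> [x\<^sub>0, \<dots>, x\<^sub>k]\<close> is the formula \<open>\<phi>(x\<^sub>0, \<dots>, x\<^sub>k)\<close> for an arbitrary formula \<open>\<phi>\<close> whose variables
  \<open>0, \<dots>, k\<close> are designated as arguments; the remaining variables of \<open>\<phi>\<close> are parameters and become
  the free variables \<open>0, 1, \<dots>\<close> of the axiom in which the instance occurs. In particular, no quantifier
  of a schema captures a parameter.
\<close>

definition inst :: "fm \<Rightarrow> trm list \<Rightarrow> form" where
  "inst \<phi> xs = (\<lambda>n. rename (\<lambda>i. if i < length xs then (xs ! i) n else i - length xs + n) \<phi>)"

definition fo_subset :: "trm \<Rightarrow> trm \<Rightarrow> form" (infix "\<^bold>\<subseteq>" 50) where
  "(a \<^bold>\<subseteq> b) = (\<^bold>\<forall>x\<^bold>\<in>a. x \<^bold>\<in> b)"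

definition extensionality :: form where
  "extensionality = (\<^bold>\<forall>a b. (\<^bold>\<forall>x. x \<^bold>\<in> a \<^bold>\<longleftrightarrow> x \<^bold>\<in> b) \<^bold>\<longrightarrow> a \<^bold>= b)"

definition pairing :: form where
  "pairing = (\<^bold>\<forall>a b. \<^bold>\<exists>c. \<^bold>\<forall>x. x \<^bold>\<in> c \<^bold>\<longleftrightarrow> x \<^bold>= a \<^bold>\<or> x \<^bold>= b)"

definition union_axiom :: form where
  "union_axiom = (\<^bold>\<forall>a. \<^bold>\<exists>c. \<^bold>\<forall>x. x \<^bold>\<in> c \<^bold>\<longleftrightarrow> (\<^bold>\<exists>u\<^bold>\<in>a. x \<^bold>\<in> u))"

definition is_inductive :: "trm \<Rightarrow> form" where
  "is_inductive a =
    ((\<^bold>\<exists>z\<^bold>\<in>a. \<^bold>\<forall>u. u \<^bold>\<in> z \<^bold>\<longrightarrow> \<^bold>\<bottom>) \<^bold>\<and>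
     (\<^bold>\<forall>x\<^bold>\<in>a. \<^bold>\<exists>y\<^bold>\<in>a. \<^bold>\<forall>u. u \<^bold>\<in> y \<^bold>\<longleftrightarrow> u \<^bold>\<in> x \<^bold>\<or> u \<^bold>= x))"

definition strong_infinity :: form where
  "strong_infinity = (\<^bold>\<exists>a. is_inductive a \<^bold>\<and> (\<^bold>\<forall>b. is_inductive b \<^bold>\<longrightarrow> a \<^bold>\<subseteq> b))"

definition set_induction :: "fm \<Rightarrow> form" where
  "set_induction \<phi> =
    ((\<^bold>\<forall>a. (\<^bold>\<forall>x\<^bold>\<in>a. inst \<phi> [x]) \<^bold>\<longrightarrow> inst \<phi> [a]) \<^bold>\<longrightarrow> (\<^bold>\<forall>a. inst \<phi> [a]))"

definition separation :: "fm \<Rightarrow> form" where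
  "separation \<phi> = (\<^bold>\<forall>a. \<^bold>\<exists>b. \<^bold>\<forall>x. x \<^bold>\<in> b \<^bold>\<longleftrightarrow> x \<^bold>\<in> a \<^bold>\<and> inst \<phi> [x])"

definition strong_collection :: "fm \<Rightarrow> form" where
  "strong_collection \<phi> =
    (\<^bold>\<forall>a. (\<^bold>\<forall>x\<^bold>\<in>a. \<^bold>\<exists>y. inst \<phi> [x, y]) \<^bold>\<longrightarrow>
      (\<^bold>\<exists>b. (\<^bold>\<forall>x\<^bold>\<in>a. \<^bold>\<exists>y\<^bold>\<in>b. inst \<phi> [x, y]) \<^bold>\<and> (\<^bold>\<forall>y\<^bold>\<in>b. \<^bold>\<exists>x\<^bold>\<in>a. inst \<phi> [x, y])))"

definition subset_collection :: "fm \<Rightarrow> form" where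
  "subset_collection \<phi> =
    (\<^bold>\<forall>a b. \<^bold>\<exists>c. \<^bold>\<forall>u. (\<^bold>\<forall>x\<^bold>\<in>a. \<^bold>\<exists>y\<^bold>\<in>b. inst \<phi> [x, y, u]) \<^bold>\<longrightarrow>
      (\<^bold>\<exists>d\<^bold>\<in>c. (\<^bold>\<forall>x\<^bold>\<in>a. \<^bold>\<exists>y\<^bold>\<in>d. inst \<phi> [x, y, u]) \<^bold>\<and> (\<^bold>\<forall>y\<^bold>\<in>d. \<^bold>\<exists>x\<^bold>\<in>a. inst \<phi> [x, y, u])))"

definition CZF :: "fm set" where
  "CZF = {extensionality 0, pairing 0, union_axiom 0, strong_infinity 0}
    \<union> {set_induction \<phi> 0 |\<phi>. True}
    \<union> {separation \<phi> 0 |\<phi>. bounded \<phi>}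
    \<union> {strong_collection \<phi> 0 |\<phi>. True}
    \<union> {subset_collection \<phi> 0 |\<phi>. True}"

definition is_singleton :: "trm \<Rightarrow> trm \<Rightarrow> form" where
  "is_singleton s x = (\<^bold>\<forall>z. z \<^bold>\<in> s \<^bold>\<longleftrightarrow> z \<^bold>= x)"

definition is_upair :: "trm \<Rightarrow> trm \<Rightarrow> trm \<Rightarrow> form" where
  "is_upair s x y = (\<^bold>\<forall>z. z \<^bold>\<in> s \<^bold>\<longleftrightarrow> z \<^bold>= x \<^bold>\<or> z \<^bold>= y)"

definition is_pair :: "trm \<Rightarrow> trm \<Rightarrow> trm \<Rightarrow> form" where
  "is_pair p x y = (\<^bold>\<forall>s. s \<^bold>\<in> p \<^bold>\<longleftrightarrow> is_singleton s x \<^bold>\<or> is_upair s x y)"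

text \<open>\<open>maps_to g x y\<close> says that the pair of \<open>x\<close> and \<open>y\<close> belongs to the graph \<open>g\<close>.\<close>

definition maps_to :: "trm \<Rightarrow> trm \<Rightarrow> trm \<Rightarrow> form" where
  "maps_to g x y = (\<^bold>\<exists>p\<^bold>\<in>g. is_pair p x y)"

definition is_function :: "trm \<Rightarrow> trm \<Rightarrow> trm \<Rightarrow> form" where
  "is_function g X Y =
    ((\<^bold>\<forall>p\<^bold>\<in>g. \<^bold>\<exists>x\<^bold>\<in>X. \<^bold>\<exists>y\<^bold>\<in>Y. is_pair p x y) \<^bold>\<and> (\<^bold>\<forall>x\<^bold>\<in>X. \<^bold>\<exists>!y. maps_to g x y))"

text \<open>\<open>h\<close> is the composite \<open>k \<circ> g\<close>.\<close>

definition is_comp :: "trm \<Rightarrow> trm \<Rightarrow> trm \<Rightarrow> form" where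
  "is_comp h k g =
    (\<^bold>\<forall>p. p \<^bold>\<in> h \<^bold>\<longleftrightarrow> (\<^bold>\<exists>x y z. maps_to g x y \<^bold>\<and> maps_to k y z \<^bold>\<and> is_pair p x z))"

definition is_elementary_rule :: "trm \<Rightarrow> trm \<Rightarrow> form" where
  "is_elementary_rule X r =
    (\<^bold>\<exists>a b. is_pair r a b \<^bold>\<and> a \<^bold>\<subseteq> X \<^bold>\<and> b \<^bold>\<subseteq> X \<^bold>\<and> (\<^bold>\<exists>x. is_singleton a x))"

definition is_closed_under :: "trm \<Rightarrow> trm \<Rightarrow> form" where
  "is_closed_under Y r =
    (\<^bold>\<forall>a b. is_pair r a b \<^bold>\<longrightarrow> a \<^bold>\<subseteq> Y \<^bold>\<longrightarrow> (\<^bold>\<exists>y. y \<^bold>\<in> b \<^bold>\<and> y \<^bold>\<in> Y))"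

text \<open>A class of sets is given by the formula \<open>M\<close> defining it.\<close>

definition set_generated :: "(trm \<Rightarrow> form) \<Rightarrow> form" where
  "set_generated M =
    (\<^bold>\<exists>G. (\<^bold>\<forall>\<beta>\<^bold>\<in>G. M \<beta>) \<^bold>\<and>
      (\<^bold>\<forall>\<alpha>. M \<alpha> \<^bold>\<longrightarrow> (\<^bold>\<forall>x\<^bold>\<in>\<alpha>. \<^bold>\<exists>\<beta>\<^bold>\<in>G. x \<^bold>\<in> \<beta> \<^bold>\<and> \<beta> \<^bold>\<subseteq> \<alpha>)))"

definition elementary_NID :: form where
  "elementary_NID =
    (\<^bold>\<forall>X R. (\<^bold>\<forall>r\<^bold>\<in>R. is_elementary_rule X r) \<^bold>\<longrightarrow>
      set_generated (\<lambda>Y. Y \<^bold>\<subseteq> X \<^bold>\<and> (\<^bold>\<forall>r\<^bold>\<in>R. is_closed_under Y r)))"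

definition is_fibre :: "trm \<Rightarrow> trm \<Rightarrow> trm \<Rightarrow> trm \<Rightarrow> form" where
  "is_fibre c B f a = (\<^bold>\<forall>b. b \<^bold>\<in> c \<^bold>\<longleftrightarrow> b \<^bold>\<in> B \<^bold>\<and> maps_to f b a)"

text \<open>\<open>is_poly_elem B A f X q a t\<close> says that \<open>q\<close> is the pair of \<open>a\<close> and \<open>t\<close>, where \<open>a\<close> is in \<open>A\<close> and
  \<open>t\<close> maps the fibre of \<open>a\<close> to \<open>X\<close>.\<close>

definition is_poly_elem :: "trm \<Rightarrow> trm \<Rightarrow> trm \<Rightarrow> trm \<Rightarrow> trm \<Rightarrow> trm \<Rightarrow> trm \<Rightarrow> form" where
  "is_poly_elem B A f X q a t =
    (a \<^bold>\<in> A \<^bold>\<and> (\<^bold>\<exists>c. is_fibre c B f a \<^bold>\<and> is_function t c X) \<^bold>\<and> is_pair q a t)"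

text \<open>\<open>P\<close> is the set obtained by applying the polynomial functor of \<open>f : B \<rightarrow> A\<close> to the set \<open>X\<close>.\<close>

definition is_poly :: "trm \<Rightarrow> trm \<Rightarrow> trm \<Rightarrow> trm \<Rightarrow> trm \<Rightarrow> form" where
  "is_poly B A f X P = (\<^bold>\<forall>q. q \<^bold>\<in> P \<^bold>\<longleftrightarrow> (\<^bold>\<exists>a t. is_poly_elem B A f X q a t))"

text \<open>\<open>m\<close> is the function obtained by applying the polynomial functor of \<open>f : B \<rightarrow> A\<close> to a function
  \<open>\<alpha>\<close> with domain \<open>X\<close>.\<close>

definition is_poly_map :: "trm \<Rightarrow> trm \<Rightarrow> trm \<Rightarrow> trm \<Rightarrow> trm \<Rightarrow> trm \<Rightarrow> form" where
  "is_poly_map B A f X \<alpha> m =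
    (\<^bold>\<forall>p. p \<^bold>\<in> m \<^bold>\<longleftrightarrow>
      (\<^bold>\<exists>a t s q q'. is_poly_elem B A f X q a t \<^bold>\<and> is_comp s \<alpha> t \<^bold>\<and> is_pair q' a s \<^bold>\<and> is_pair p q q'))"

definition is_coalgebra :: "trm \<Rightarrow> trm \<Rightarrow> trm \<Rightarrow> trm \<Rightarrow> trm \<Rightarrow> form" where
  "is_coalgebra B A f X v = (\<^bold>\<exists>P. is_poly B A f X P \<^bold>\<and> is_function v X P)"

text \<open>\<open>h\<close> below is the common value of the two composites in the coalgebra morphism square.\<close>

definition is_morphism :: "trm \<Rightarrow> trm \<Rightarrow> trm \<Rightarrow> trm \<Rightarrow> trm \<Rightarrow> trm \<Rightarrow> trm \<Rightarrow> trm \<Rightarrow> form" where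
  "is_morphism B A f X v Y w \<alpha> =
    (is_function \<alpha> X Y \<^bold>\<and>
     (\<^bold>\<exists>m h. is_poly_map B A f X \<alpha> m \<^bold>\<and> is_comp h w \<alpha> \<^bold>\<and> is_comp h m v))"

definition is_final_coalgebra :: "trm \<Rightarrow> trm \<Rightarrow> trm \<Rightarrow> trm \<Rightarrow> trm \<Rightarrow> form" where
  "is_final_coalgebra B A f X v =
    (is_coalgebra B A f X v \<^bold>\<and>
     (\<^bold>\<forall>Y w. is_coalgebra B A f Y w \<^bold>\<longrightarrow> (\<^bold>\<exists>!\<alpha>. is_morphism B A f Y w X v \<alpha>)))"

definition all_M_types_exist :: form where
  "all_M_types_exist =
    (\<^bold>\<forall>B A f. is_function f B A \<^bold>\<longrightarrow> (\<^bold>\<exists>X v. is_final_coalgebra B A f X v))"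

end

theory Submission
  imports Defs "HOL-Library.Countable"
begin

text \<open>
  The final coalgebra is the limit of \<open>1 \<leftarrow> P\<^sub>f(1) \<leftarrow> P\<^sub>f\<^sup>2(1) \<leftarrow> \<dots>\<close>. Already in CZF, subset collection
  gives exponentiation, so the functor preserves sets and each fibre \<open>B\<^sub>a\<close> commutes with the limit:
  a coherent sequence \<open>g\<close> with \<open>g(n + 1) = (a, s\<^sub>n)\<close> corresponds to \<open>(a, t)\<close>, where
  \<open>t(b)(n) = s\<^sub>n(b)\<close>. The morphism from a coalgebra \<open>(Y, u)\<close> sends \<open>y\<close> to the sequence of \<open>U\<^sub>n(y)\<close>,
  where \<open>U\<^sub>0\<close> is constant and \<open>U\<^sub>n\<^sub>+\<^sub>1 = P\<^sub>f(U\<^sub>n) \<circ> u\<close>; uniqueness is an induction on \<open>n\<close>.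

  Derivability is obtained semantically. The saturated theories extending CZF form a Kripke model
  in which truth is membership, and a sentence true at all its worlds is derivable. In this model the
  argument above can be carried out with Isabelle predicates in place of formulas, as long as
  the predicates used in the axiom schemas are shown to be definable.
\<close>

section \<open>Free variables and renaming of derivations\<close>

text \<open>The axiom schemas accept formulas, while the semantic argument handles arbitrary maps
  into truth values. The predicate \<open>dfn\<close> records which of these maps come from formulas
  with parameters, and its flag tells whether the formula is bounded, as separation requires. For
  this reason pairs, functions, successors and the elements of P_f(X) are restated by bounded
  conditions, and the official formulas are identified with them only at the end. Without power sets
  there is no set given beforehand that contains all P_f^n(1). The recursion therefore runs on sets,
  not on elements of a set, and gets its graph from strong collection. On the natural numbers the
  proof splits into zero or successor, which the leastness of omega provides. Level 0 is a single
  point and carries no information. The root of a tree first shows at level 1 and is the same at all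
  later levels, which is why level n of a subtree is read off at level n + 1 of the tree. The
  subtree at each b is then unique, so collecting the subtrees into a function on the fibre involves
  no choice.\<close>

primrec fv :: "fm \<Rightarrow> nat set" where
  "fv (Member i j) = {i, j}"
| "fv (Equal i j) = {i, j}"
| "fv Falsum = {}"
| "fv (Conj \<phi> \<psi>) = fv \<phi> \<union> fv \<psi>"
| "fv (Disj \<phi> \<psi>) = fv \<phi> \<union> fv \<psi>"
| "fv (Impl \<phi> \<psi>) = fv \<phi> \<union> fv \<psi>"
| "fv (Forall \<phi>) = {i. Suc i \<in> fv \<phi>}"
| "fv (Exists \<phi>) = {i. Suc i \<in> fv \<phi>}"

lemma finite_fv: "finite (fv \<phi>)"
proof (induction \<phi>)
  case (Forall \<phi>)
  then show ?case using finite_vimageI[of "fv \<phi>" Suc] by (simp add: vimage_def)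
next
  case (Exists \<phi>)
  then show ?case using finite_vimageI[of "fv \<phi>" Suc] by (simp add: vimage_def)
qed auto

lemma rename_cong: "(\<And>i. i \<in> fv \<phi> \<Longrightarrow> r i = s i) \<Longrightarrow> rename r \<phi> = rename s \<phi>"
proof (induction \<phi> arbitrary: r s)
  case (Forall \<phi>)
  show ?case unfolding rename.simps fm.inject by (rule Forall.IH) (use Forall.prems in \<open>auto split: nat.split\<close>)
next
  case (Exists \<phi>)
  show ?case unfolding rename.simps fm.inject by (rule Exists.IH) (use Exists.prems in \<open>auto split: nat.split\<close>)
next
  case (Conj \<phi> \<psi>)
  from Conj.IH[of r s] Conj.prems show ?case by simp
next
  case (Disj \<phi> \<psi>)
  from Disj.IH[of r s] Disj.prems show ?case by simp
next
  case (Impl \<phi> \<psi>)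
  from Impl.IH[of r s] Impl.prems show ?case by simp
qed simp_all

lemma case_nat_comp: "case_nat 0 (\<lambda>i. Suc (r i)) \<circ> case_nat 0 (\<lambda>i. Suc (s i)) = case_nat 0 (\<lambda>i. Suc ((r \<circ> s) i))"
  by (auto split: nat.split)

lemma rename_rename: "rename r (rename s \<phi>) = rename (r \<circ> s) \<phi>"
  by (induction \<phi> arbitrary: r s) (simp_all only: rename.simps case_nat_comp comp_apply)

lemma rename_ident: "(\<And>i. i \<in> fv \<phi> \<Longrightarrow> r i = i) \<Longrightarrow> rename r \<phi> = \<phi>"
proof (induction \<phi> arbitrary: r)
  case (Forall \<phi>)
  show ?case unfolding rename.simps fm.inject by (rule Forall.IH) (use Forall.prems in \<open>auto split: nat.split\<close>)
next
  case (Exists \<phi>)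
  show ?case unfolding rename.simps fm.inject by (rule Exists.IH) (use Exists.prems in \<open>auto split: nat.split\<close>)
qed simp_all

text \<open>Serves the binder cases of \<open>fv_rename\<close>, where the bound variable is fixed
  and all others are shifted past it.\<close>

lemma Suc_preimage_image:
  "{i. Suc i \<in> case_nat 0 (\<lambda>i. Suc (r i)) ` S} = r ` {i. Suc i \<in> S}"
proof (intro set_eqI iffI)
  fix i assume "i \<in> {i. Suc i \<in> case_nat 0 (\<lambda>i. Suc (r i)) ` S}"
  then obtain j where "j \<in> S" "Suc i = case_nat 0 (\<lambda>i. Suc (r i)) j"
    unfolding mem_Collect_eq image_iff by blast
  then show "i \<in> r ` {i. Suc i \<in> S}" by (cases j) simp_all
next
  fix i assume "i \<in> r ` {i. Suc i \<in> S}"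
  then obtain j where "Suc j \<in> S" "i = r j" by blast
  then show "i \<in> {i. Suc i \<in> case_nat 0 (\<lambda>i. Suc (r i)) ` S}"
    using imageI[of "Suc j" S "case_nat 0 (\<lambda>i. Suc (r i))"] by simp
qed

lemma fv_rename: "fv (rename r \<phi>) = r ` fv \<phi>"
  by (induction \<phi> arbitrary: r) (auto simp: Suc_preimage_image)

lemma rename_lift: "rename (case_nat 0 (\<lambda>i. Suc (r i))) (lift \<phi>) = lift (rename r \<phi>)"
  by (simp add: rename_rename comp_def)

lemma rename_subst: "rename r (subst t \<phi>) = subst (r t) (rename (case_nat 0 (\<lambda>i. Suc (r i))) \<phi>)"
  by (simp add: rename_rename) (rule rename_cong, auto split: nat.split)

text \<open>In the truth lemma the environment itself acts as a renaming. This identity turns an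
  instance of a quantifier body into the environment extended by the witness.\<close>

lemma subst_rename: "subst t (rename (case_nat 0 (\<lambda>i. Suc (r i))) \<phi>) = rename (case_nat t r) \<phi>"
  by (simp add: rename_rename) (rule rename_cong, auto split: nat.split)

section \<open>Structural properties of derivability\<close>

lemma weaken: "derives T \<Gamma> \<phi> \<Longrightarrow> \<Gamma> \<subseteq> \<Delta> \<Longrightarrow> derives T \<Delta> \<phi>"
proof (induction arbitrary: \<Delta> rule: derives.induct)
  case (axiom \<phi> \<Gamma>) then show ?case by (blast intro: derives.axiom)
next
  case (hyp \<phi> \<Gamma>) then show ?case by (blast intro: derives.hyp)
next
  case (falsumE \<Gamma> \<phi>) then show ?case by (blast intro: derives.falsumE)
next
  case (conjI \<Gamma> \<phi> \<psi>) then show ?case by (blast intro: derives.conjI)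
next
  case (conjE1 \<Gamma> \<phi> \<psi>) then show ?case by (blast intro: derives.conjE1)
next
  case (conjE2 \<Gamma> \<phi> \<psi>) then show ?case by (blast intro: derives.conjE2)
next
  case (disjI1 \<Gamma> \<phi> \<psi>) then show ?case by (blast intro: derives.disjI1)
next
  case (disjI2 \<Gamma> \<psi> \<phi>) then show ?case by (blast intro: derives.disjI2)
next
  case (disjE \<Gamma> \<phi> \<psi> \<chi>)
  show ?case
    by (rule derives.disjE[OF disjE.IH(1)[OF disjE.prems] disjE.IH(2) disjE.IH(3)])
      (rule insert_mono[OF disjE.prems])+
next
  case (implI \<phi> \<Gamma> \<psi>)
  show ?case by (rule derives.implI[OF implI.IH[OF insert_mono[OF implI.prems]]])
next
  case (implE \<Gamma> \<phi> \<psi>) then show ?case by (blast intro: derives.implE)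
next
  case (forallI \<Gamma> \<phi>)
  show ?case by (rule derives.forallI[OF forallI.IH[OF image_mono[OF forallI.prems]]])
next
  case (forallE \<Gamma> \<phi> t) then show ?case by (blast intro: derives.forallE)
next
  case (existsI \<Gamma> t \<phi>) then show ?case by (blast intro: derives.existsI)
next
  case (existsE \<Gamma> \<phi> \<psi>)
  show ?case
    by (rule derives.existsE[OF existsE.IH(1)[OF existsE.prems]
          existsE.IH(2)[OF insert_mono[OF image_mono[OF existsE.prems]]]])
next
  case (equal_refl \<Gamma> t) show ?case by (rule derives.equal_refl)
next
  case (equal_subst \<Gamma> s t \<phi>) then show ?case by (blast intro: derives.equal_subst)
qed

text \<open>T need not be closed under renaming. With no hypotheses, however, \<open>forallI\<close>
  followed by \<open>forallE\<close> replaces variable 0 by any variable, and iterating this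
  performs a simultaneous substitution.\<close>

lemma derives_rename_closed:
  assumes "derives T {} \<phi>"
  shows "derives T {} (rename r \<phi>)"
proof -
  have step: "derives T {} (rename (\<lambda>i. if i < n then r i else i - n) \<phi>)"
    if "derives T {} \<phi>" for n r \<phi>
    using that
  proof (induction n arbitrary: r \<phi>)
    case 0
    then show ?case by (simp add: rename_ident)
  next
    case (Suc n)
    \<comment> \<open>The value inserted is \<open>r 0 + n\<close> because the n rounds still to
      come lower it by n.\<close>
    have "derives T {} (subst (r 0 + n) \<phi>)"
      by (rule derives.forallE, rule derives.forallI) (simp add: Suc.prems)
    note Suc.IH[OF this, of "\<lambda>i. r (Suc i)"]
    moreover have "(\<lambda>i. if i < n then r (Suc i) else i - n) \<circ> case_nat (r 0 + n) (\<lambda>i. i)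
        = (\<lambda>i. if i < Suc n then r i else i - Suc n)"
      by (auto split: nat.split)
    ultimately show ?case by (simp add: rename_rename)
  qed
  \<comment> \<open>Only finitely many variables occur, so after enough rounds every one of them has
    been replaced by its value under r.\<close>
  obtain n where "fv \<phi> \<subseteq> {..<n}"
    using finite_fv[of \<phi>] by (auto simp: finite_nat_set_iff_bounded)
  then have "rename (\<lambda>i. if i < n then r i else i - n) \<phi> = rename r \<phi>"
    by (intro rename_cong) auto
  with step[OF assms] show ?thesis by metis
qed

text \<open>Every rule commutes with renaming except \<open>axiom\<close>, whose case passes through
  the empty context, where parameters can be generalized.\<close>

lemma derives_rename: "derives T \<Gamma> \<phi> \<Longrightarrow> derives T (rename r ` \<Gamma>) (rename r \<phi>)"
proof (induction arbitrary: r rule: derives.induct)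
  case (axiom \<phi> \<Gamma>)
  then show ?case
    using weaken[OF derives_rename_closed[OF derives.axiom]] by blast
next
  case (hyp \<phi> \<Gamma>) then show ?case by (blast intro: derives.hyp)
next
  case (falsumE \<Gamma> \<phi>) then show ?case by (simp add: derives.falsumE)
next
  case (conjI \<Gamma> \<phi> \<psi>) then show ?case by (simp add: derives.conjI)
next
  case (conjE1 \<Gamma> \<phi> \<psi>) then show ?case by (auto intro: derives.conjE1)
next
  case (conjE2 \<Gamma> \<phi> \<psi>) then show ?case by (auto intro: derives.conjE2)
next
  case (disjI1 \<Gamma> \<phi> \<psi>) then show ?case by (auto intro: derives.disjI1)
next
  case (disjI2 \<Gamma> \<psi> \<phi>) then show ?case by (auto intro: derives.disjI2)
next
  case (disjE \<Gamma> \<phi> \<psi> \<chi>)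
  from disjE.IH(1)[of r, simplified] disjE.IH(2)[of r] disjE.IH(3)[of r]
  show ?case unfolding image_insert by (rule derives.disjE)
next
  case (implI \<phi> \<Gamma> \<psi>)
  from implI.IH[of r] show ?case unfolding image_insert rename.simps by (rule derives.implI)
next
  case (implE \<Gamma> \<phi> \<psi>)
  from implE.IH(1)[of r] implE.IH(2)[of r] show ?case
    unfolding rename.simps by (rule derives.implE)
next
  case (forallI \<Gamma> \<phi>)
  from forallI.IH[of "case_nat 0 (\<lambda>i. Suc (r i))"]
  have "derives T (lift ` rename r ` \<Gamma>) (rename (case_nat 0 (\<lambda>i. Suc (r i))) \<phi>)"
    by (simp add: image_image rename_lift)
  then show ?case unfolding rename.simps by (rule derives.forallI)
next
  case (forallE \<Gamma> \<phi> t)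
  from derives.forallE[OF forallE.IH[of r, simplified]] show ?case
    by (simp add: rename_subst)
next
  case (existsI \<Gamma> t \<phi>)
  from existsI.IH[of r] have "derives T (rename r ` \<Gamma>) (subst (r t) (rename (case_nat 0 (\<lambda>i. Suc (r i))) \<phi>))"
    by (simp add: rename_subst)
  then show ?case unfolding rename.simps by (rule derives.existsI)
next
  case (existsE \<Gamma> \<phi> \<psi>)
  from existsE.IH(2)[of "case_nat 0 (\<lambda>i. Suc (r i))"]
  have "derives T (insert (rename (case_nat 0 (\<lambda>i. Suc (r i))) \<phi>) (lift ` rename r ` \<Gamma>)) (lift (rename r \<psi>))"
    by (simp add: image_image rename_lift)
  then show ?case by (rule derives.existsE[OF existsE.IH(1)[of r, simplified]])
next
  case (equal_refl \<Gamma> t) show ?case by (simp add: derives.equal_refl)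
next
  case (equal_subst \<Gamma> s t \<phi>)
  from equal_subst.IH(2)[of r] have "derives T (rename r ` \<Gamma>) (subst (r s) (rename (case_nat 0 (\<lambda>i. Suc (r i))) \<phi>))"
    by (simp add: rename_subst)
  from derives.equal_subst[OF equal_subst.IH(1)[of r, simplified] this] show ?case
    by (simp add: rename_subst)
qed

text \<open>Compactness. It lets underivability survive the union of the stages in
  \<open>saturated_extension\<close>.\<close>

lemma derives_finite: "derives T \<Gamma> \<phi> \<Longrightarrow> \<exists>\<Delta>. finite \<Delta> \<and> \<Delta> \<subseteq> \<Gamma> \<and> derives T \<Delta> \<phi>"
proof (induction rule: derives.induct)
  case (axiom \<phi> \<Gamma>) then show ?case by (blast intro: derives.axiom)
next
  case (hyp \<phi> \<Gamma>) then show ?case by (intro exI[of _ "{\<phi>}"]) (simp add: derives.hyp)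
next
  case (falsumE \<Gamma> \<phi>) then show ?case by (blast intro: derives.falsumE)
next
  case (conjI \<Gamma> \<phi> \<psi>)
  then obtain \<Delta> \<Delta>' where "finite \<Delta>" "\<Delta> \<subseteq> \<Gamma>" "derives T \<Delta> \<phi>" "finite \<Delta>'" "\<Delta>' \<subseteq> \<Gamma>" "derives T \<Delta>' \<psi>"
    by blast
  then show ?case
    by (intro exI[of _ "\<Delta> \<union> \<Delta>'"]) (simp, meson derives.conjI weaken Un_upper1 Un_upper2)
next
  case (conjE1 \<Gamma> \<phi> \<psi>) then show ?case by (blast intro: derives.conjE1)
next
  case (conjE2 \<Gamma> \<phi> \<psi>) then show ?case by (blast intro: derives.conjE2)
next
  case (disjI1 \<Gamma> \<phi> \<psi>) then show ?case by (blast intro: derives.disjI1)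
next
  case (disjI2 \<Gamma> \<psi> \<phi>) then show ?case by (blast intro: derives.disjI2)
next
  case (disjE \<Gamma> \<phi> \<psi> \<chi>)
  then obtain \<Delta>1 \<Delta>2 \<Delta>3 where D: "finite \<Delta>1" "\<Delta>1 \<subseteq> \<Gamma>" "derives T \<Delta>1 (Disj \<phi> \<psi>)"
    "finite \<Delta>2" "\<Delta>2 \<subseteq> insert \<phi> \<Gamma>" "derives T \<Delta>2 \<chi>"
    "finite \<Delta>3" "\<Delta>3 \<subseteq> insert \<psi> \<Gamma>" "derives T \<Delta>3 \<chi>"
    by blast
  let ?\<Delta> = "\<Delta>1 \<union> (\<Delta>2 - {\<phi>}) \<union> (\<Delta>3 - {\<psi>})"
  have "derives T ?\<Delta> \<chi>"
    by (rule derives.disjE[of _ _ \<phi> \<psi>])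
      (rule weaken[OF D(3)] weaken[OF D(6)] weaken[OF D(9)], blast)+
  then show ?case using D by (intro exI[of _ ?\<Delta>]) auto
next
  case (implI \<phi> \<Gamma> \<psi>)
  then obtain \<Delta> where D: "finite \<Delta>" "\<Delta> \<subseteq> insert \<phi> \<Gamma>" "derives T \<Delta> \<psi>" by blast
  have "derives T (\<Delta> - {\<phi>}) (Impl \<phi> \<psi>)"
    by (rule derives.implI, rule weaken[OF D(3)]) blast
  then show ?case using D by (intro exI[of _ "\<Delta> - {\<phi>}"]) auto
next
  case (implE \<Gamma> \<phi> \<psi>)
  then obtain \<Delta> \<Delta>' where "finite \<Delta>" "\<Delta> \<subseteq> \<Gamma>" "derives T \<Delta> (Impl \<phi> \<psi>)" "finite \<Delta>'" "\<Delta>' \<subseteq> \<Gamma>" "derives T \<Delta>' \<phi>"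
    by blast
  then show ?case
    by (intro exI[of _ "\<Delta> \<union> \<Delta>'"]) (simp, meson derives.implE weaken Un_upper1 Un_upper2)
next
  case (forallI \<Gamma> \<phi>)
  then obtain \<Delta> where "finite \<Delta>" "\<Delta> \<subseteq> lift ` \<Gamma>" "derives T \<Delta> \<phi>" by blast
  moreover from this obtain \<Delta>' where "\<Delta>' \<subseteq> \<Gamma>" "finite \<Delta>'" "\<Delta> = lift ` \<Delta>'"
    by (meson finite_subset_image)
  ultimately show ?case by (blast intro: derives.forallI)
next
  case (forallE \<Gamma> \<phi> t) then show ?case by (blast intro: derives.forallE)
next
  case (existsI \<Gamma> t \<phi>) then show ?case by (blast intro: derives.existsI)
next
  case (existsE \<Gamma> \<phi> \<psi>)
  then obtain \<Delta>1 \<Delta>2 where D: "finite \<Delta>1" "\<Delta>1 \<subseteq> \<Gamma>" "derives T \<Delta>1 (Exists \<phi>)"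
    "finite \<Delta>2" "\<Delta>2 \<subseteq> insert \<phi> (lift ` \<Gamma>)" "derives T \<Delta>2 (lift \<psi>)"
    by blast
  then have "finite (\<Delta>2 - {\<phi>})" "\<Delta>2 - {\<phi>} \<subseteq> lift ` \<Gamma>" by auto
  then obtain \<Delta>3 where D3: "\<Delta>3 \<subseteq> \<Gamma>" "finite \<Delta>3" "\<Delta>2 - {\<phi>} = lift ` \<Delta>3"
    by (meson finite_subset_image)
  have "derives T (\<Delta>1 \<union> \<Delta>3) \<psi>"
    by (rule derives.existsE[of _ _ \<phi>], rule weaken[OF D(3)], blast,
        rule weaken[OF D(6)]) (use D3 in blast)
  then show ?case using D D3 by (intro exI[of _ "\<Delta>1 \<union> \<Delta>3"]) auto
next
  case (equal_refl \<Gamma> t) show ?case by (blast intro: derives.equal_refl)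
next
  case (equal_subst \<Gamma> s t \<phi>)
  then obtain \<Delta> \<Delta>' where D: "finite \<Delta>" "\<Delta> \<subseteq> \<Gamma>" "derives T \<Delta> (Equal s t)"
    "finite \<Delta>'" "\<Delta>' \<subseteq> \<Gamma>" "derives T \<Delta>' (subst s \<phi>)"
    by blast
  then show ?case
    using derives.equal_subst[OF weaken[OF D(3) Un_upper1] weaken[OF D(6) Un_upper2]]
    by (intro exI[of _ "\<Delta> \<union> \<Delta>'"]) simp
qed

lemma derives_mono_axioms: "derives T \<Gamma> \<phi> \<Longrightarrow> T \<subseteq> U \<Longrightarrow> derives U \<Gamma> \<phi>"
proof (induction rule: derives.induct)
qed (blast intro: derives.intros)+

text \<open>This renaming turns the name c into the bound variable 0 and moves all other names up by
  one. On formulas without c it cannot be told from \<open>lift\<close>.\<close>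

lemma fresh_rename:
  assumes "c \<notin> fv \<psi>"
  shows "rename (\<lambda>i. if i = c then 0 else Suc i) \<psi> = lift \<psi>"
  using assms by (intro rename_cong) auto

lemma fresh_subst:
  assumes "c \<notin> fv (Forall \<phi>)"
  shows "rename (\<lambda>i. if i = c then 0 else Suc i) (subst c \<phi>) = \<phi>"
proof -
  have "Suc c \<notin> fv \<phi>" using assms by simp
  then have "rename ((\<lambda>i. if i = c then 0 else Suc i) \<circ> case_nat c (\<lambda>i. i)) \<phi> = \<phi>"
    by (intro rename_ident) (auto split: nat.split)
  then show ?thesis by (simp add: rename_rename)
qed

text \<open>The eigenvariable form of the quantifier rules, here and in
  \<open>existsE_fresh\<close>. Saturated theories contain witnesses with names, to which the de
  Bruijn rules do not apply directly.\<close>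

lemma forallI_fresh:
  assumes "derives T \<Gamma> (subst c \<phi>)" and "c \<notin> fv (Forall \<phi>)" and "\<And>\<psi>. \<psi> \<in> \<Gamma> \<Longrightarrow> c \<notin> fv \<psi>"
  shows "derives T \<Gamma> (Forall \<phi>)"
proof (rule derives.forallI)
  have "rename (\<lambda>i. if i = c then 0 else Suc i) ` \<Gamma> = lift ` \<Gamma>"
    using assms(3) fresh_rename by force
  then show "derives T (lift ` \<Gamma>) \<phi>"
    using derives_rename[OF assms(1), of "\<lambda>i. if i = c then 0 else Suc i"] fresh_subst[OF assms(2)]
    by simp
qed

lemma existsE_fresh:
  assumes "derives T \<Gamma> (Exists \<phi>)" and "derives T (insert (subst c \<phi>) \<Gamma>) \<chi>"
    and "c \<notin> fv (Exists \<phi>)" and "c \<notin> fv \<chi>" and "\<And>\<psi>. \<psi> \<in> \<Gamma> \<Longrightarrow> c \<notin> fv \<psi>"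
  shows "derives T \<Gamma> \<chi>"
proof (rule derives.existsE[OF assms(1)])
  have "rename (\<lambda>i. if i = c then 0 else Suc i) ` \<Gamma> = lift ` \<Gamma>"
    using assms(5) fresh_rename by force
  then show "derives T (insert \<phi> (lift ` \<Gamma>)) (lift \<chi>)"
    using derives_rename[OF assms(2), of "\<lambda>i. if i = c then 0 else Suc i"] fresh_subst[of c \<phi>]
      fresh_rename[OF assms(4)] assms(3)
    by simp
qed

section \<open>Completeness for a Kripke model of saturated theories\<close>

text \<open>
  Every stage adds infinitely many names, so that a theory using the names of stage \<open>k\<close> always
  has fresh witnesses at stage \<open>k + 1\<close>.
\<close>

definition names :: "nat \<Rightarrow> nat set" where
  "names k = {i. fst (prod_decode i) \<le> k}"

lemma names_mono: "k \<le> l \<Longrightarrow> names k \<subseteq> names l"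
  by (auto simp: names_def)

lemma infinite_names_diff: "infinite (names (Suc k) - names k)"
proof -
  have "range (\<lambda>j. prod_encode (Suc k, j)) \<subseteq> names (Suc k) - names k"
    by (auto simp: names_def)
  moreover have "infinite (range (\<lambda>j. prod_encode (Suc k, j)))"
    by (auto simp: finite_image_iff inj_on_def)
  ultimately show ?thesis using finite_subset by blast
qed

lemma names_nonempty: "\<exists>i. i \<in> names k"
  by (rule exI[of _ "prod_encode (0, 0)"]) (simp add: names_def)

text \<open>
  Inconsistent theories are allowed. Hence a world may force \<open>Falsum\<close>, and it then forces the
  interpretation of every formula, but not every truth value.
\<close>

definition saturated :: "fm set \<Rightarrow> nat \<Rightarrow> fm set \<Rightarrow> bool" where
  "saturated T k \<Gamma> \<longleftrightarrow>
    (\<forall>\<phi>\<in>\<Gamma>. fv \<phi> \<subseteq> names k) \<and>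
    (\<forall>\<phi>. fv \<phi> \<subseteq> names k \<longrightarrow> derives T \<Gamma> \<phi> \<longrightarrow> \<phi> \<in> \<Gamma>) \<and>
    (\<forall>\<phi> \<psi>. Disj \<phi> \<psi> \<in> \<Gamma> \<longrightarrow> \<phi> \<in> \<Gamma> \<or> \<psi> \<in> \<Gamma>) \<and>
    (\<forall>\<phi>. Exists \<phi> \<in> \<Gamma> \<longrightarrow> (\<exists>c\<in>names k. subst c \<phi> \<in> \<Gamma>))"

instance fm :: countable
  by countable_datatype

section \<open>Saturated extensions that omit a given formula\<close>

context
  fixes T :: "fm set" and k :: nat and \<chi> :: fm
begin

text \<open>The formula is accepted if \<chi> stays underivable. An existential formula brings along
  an instance at a name that occurs neither in it nor in \<chi> nor in \<Delta>, as
  \<open>existsE_fresh\<close> requires.\<close>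

definition add_formula :: "fm \<Rightarrow> fm set \<Rightarrow> fm set" where
  "add_formula \<phi> \<Delta> =
    (if fv \<phi> \<subseteq> names k \<and> \<not> derives T (insert \<phi> \<Delta>) \<chi>
     then (case \<phi> of
         Exists \<theta> \<Rightarrow> insert (subst (SOME c. c \<in> names k - fv \<phi> - fv \<chi> - \<Union> (fv ` \<Delta>)) \<theta>) (insert \<phi> \<Delta>)
       | _ \<Rightarrow> insert \<phi> \<Delta>)
     else \<Delta>)"

primrec add_formulas :: "fm set \<Rightarrow> nat \<Rightarrow> fm set" where
  "add_formulas \<Gamma> 0 = \<Gamma>"
| "add_formulas \<Gamma> (Suc n) = add_formula (from_nat n) (add_formulas \<Gamma> n)"

definition extensible :: "fm set \<Rightarrow> bool" where
  "extensible \<Delta> \<longleftrightarrow> \<Union> (fv ` \<Delta>) \<subseteq> names k \<and> infinite (names k - \<Union> (fv ` \<Delta>)) \<and> \<not> derives T \<Delta> \<chi>"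

lemma fv_subst: "fv (subst c \<theta>) \<subseteq> insert c (fv (Exists \<theta>))"
  by (auto simp: fv_rename split: nat.splits)

lemma infinite_diff_finite:
  assumes "infinite (A - B)" and "finite C" and "B' \<subseteq> B \<union> C"
  shows "infinite (A - B')"
proof
  assume "finite (A - B')"
  moreover have "A - B \<subseteq> (A - B') \<union> C" using assms(3) by blast
  ultimately show False using assms(1,2) finite_subset finite_UnI by metis
qed

text \<open>One step uses up finitely many names, so infinitely many remain. A fresh witness adds no
  consequence \<chi>: a derivation of \<chi> from the instance could be discharged by
  \<open>existsE_fresh\<close>.\<close>

lemma extensible_add:
  assumes "extensible \<Delta>"
  shows "extensible (add_formula \<phi> \<Delta>)"
proof (cases "fv \<phi> \<subseteq> names k \<and> \<not> derives T (insert \<phi> \<Delta>) \<chi>")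
  case True
  have simple: "extensible (insert \<phi> \<Delta>)"
    unfolding extensible_def
  proof (intro HOL.conjI)
    show "infinite (names k - \<Union> (fv ` insert \<phi> \<Delta>))"
      by (rule infinite_diff_finite[OF _ finite_fv[of \<phi>]]) (use assms in \<open>auto simp: extensible_def\<close>)
  qed (use assms True in \<open>auto simp: extensible_def\<close>)
  show ?thesis
  proof (cases "\<exists>\<theta>. \<phi> = Exists \<theta>")
    case ex: True
    then obtain \<theta> where \<phi>: "\<phi> = Exists \<theta>" by blast
    define c where "c = (SOME c. c \<in> names k - fv \<phi> - fv \<chi> - \<Union> (fv ` \<Delta>))"
    have "infinite (names k - (fv \<phi> \<union> fv \<chi> \<union> \<Union> (fv ` \<Delta>)))"
      by (rule infinite_diff_finite[of _ "\<Union> (fv ` \<Delta>)" "fv \<phi> \<union> fv \<chi>"])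
        (use assms finite_fv in \<open>auto simp: extensible_def\<close>)
    from infinite_imp_nonempty[OF this]
    obtain d where "d \<in> names k - fv \<phi> - fv \<chi> - \<Union> (fv ` \<Delta>)" by blast
    then have c: "c \<in> names k - fv \<phi> - fv \<chi> - \<Union> (fv ` \<Delta>)"
      unfolding c_def by (rule someI)
    have add: "add_formula \<phi> \<Delta> = insert (subst c \<theta>) (insert \<phi> \<Delta>)"
      using True by (simp add: add_formula_def \<phi> c_def)
    have fvc: "fv (subst c \<theta>) \<subseteq> insert c (fv \<phi>)"
      using fv_subst \<phi> by blast
    have "\<not> derives T (insert (subst c \<theta>) (insert \<phi> \<Delta>)) \<chi>"
    proof
      assume d: "derives T (insert (subst c \<theta>) (insert \<phi> \<Delta>)) \<chi>"
      have "derives T (insert \<phi> \<Delta>) \<chi>"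
        by (rule existsE_fresh[OF _ d]) (use c \<phi> in \<open>auto intro: derives.hyp\<close>)
      with True show False by blast
    qed
    moreover have "infinite (names k - \<Union> (fv ` insert (subst c \<theta>) (insert \<phi> \<Delta>)))"
      by (rule infinite_diff_finite[of _ "\<Union> (fv ` \<Delta>)" "insert c (fv \<phi>)"])
        (use assms finite_fv fvc in \<open>auto simp: extensible_def\<close>)
    moreover have "\<Union> (fv ` insert (subst c \<theta>) (insert \<phi> \<Delta>)) \<subseteq> names k"
      using assms True c fvc by (auto simp: extensible_def)
    ultimately show ?thesis by (simp add: extensible_def add)
  next
    case False
    then have "add_formula \<phi> \<Delta> = insert \<phi> \<Delta>"
      using True by (cases \<phi>) (auto simp: add_formula_def)
    with simple show ?thesis by simp
  qed
next
  case False
  then have "add_formula \<phi> \<Delta> = \<Delta>" by (auto simp: add_formula_def)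
  with assms show ?thesis by simp
qed

lemma add_formula_mono: "\<Delta> \<subseteq> add_formula \<phi> \<Delta>"
  by (cases \<phi>) (auto simp: add_formula_def)

lemma add_formulas_mono: "m \<le> n \<Longrightarrow> add_formulas \<Gamma> m \<subseteq> add_formulas \<Gamma> n"
  by (rule lift_Suc_mono_le[of "add_formulas \<Gamma>"]) (simp_all add: add_formula_mono)

text \<open>Each formula is considered at the stage given by its code, so the union is maximal among
  the sets that do not derive \<chi>. Maximality yields deductive closure and the disjunction
  property; the added instances yield witnesses.\<close>

lemma saturated_extension:
  assumes "extensible \<Gamma>"
  shows "\<exists>\<Delta>. saturated T k \<Delta> \<and> \<Gamma> \<subseteq> \<Delta> \<and> \<chi> \<notin> \<Delta>"
proof (intro exI HOL.conjI)
  let ?\<Delta> = "\<Union>n. add_formulas \<Gamma> n"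
  have ext: "extensible (add_formulas \<Gamma> n)" for n
    by (induction n) (simp_all add: assms extensible_add)
  have not_derives: "\<not> derives T ?\<Delta> \<chi>"
  proof
    assume "derives T ?\<Delta> \<chi>"
    from derives_finite[OF this] obtain \<Delta> where "finite \<Delta>" "\<Delta> \<subseteq> ?\<Delta>" and d: "derives T \<Delta> \<chi>"
      by blast
    from this(1,2) have "\<exists>n. \<Delta> \<subseteq> add_formulas \<Gamma> n"
    proof (induction \<Delta>)
      case (insert x F)
      then obtain m n where "F \<subseteq> add_formulas \<Gamma> m" "x \<in> add_formulas \<Gamma> n" by auto
      then have "insert x F \<subseteq> add_formulas \<Gamma> (max m n)"
        using add_formulas_mono[of m "max m n"] add_formulas_mono[of n "max m n"] by force
      then show ?case ..
    qed simp
    then obtain n where "\<Delta> \<subseteq> add_formulas \<Gamma> n" ..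
    from weaken[OF d this] ext[of n] show False by (simp add: extensible_def)
  qed
  have stage: "add_formula \<phi> (add_formulas \<Gamma> (to_nat \<phi>)) \<subseteq> ?\<Delta>" for \<phi>
    using UN_upper[OF UNIV_I, of "add_formulas \<Gamma>" "Suc (to_nat \<phi>)"] by simp
  have maximal: "\<phi> \<in> ?\<Delta>" if "fv \<phi> \<subseteq> names k" "\<not> derives T (insert \<phi> ?\<Delta>) \<chi>" for \<phi>
  proof -
    have "\<not> derives T (insert \<phi> (add_formulas \<Gamma> (to_nat \<phi>))) \<chi>"
      using that(2) weaken[OF _ insert_mono[OF UN_upper[OF UNIV_I, of "add_formulas \<Gamma>" "to_nat \<phi>"]]] by metis
    then have "\<phi> \<in> add_formula \<phi> (add_formulas \<Gamma> (to_nat \<phi>))"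
      using that(1) by (cases \<phi>) (auto simp: add_formula_def)
    with stage show ?thesis by blast
  qed
  have fv\<Delta>: "fv \<phi> \<subseteq> names k" if "\<phi> \<in> ?\<Delta>" for \<phi>
    using that ext by (auto simp: extensible_def)
  show "saturated T k ?\<Delta>"
    unfolding saturated_def
  proof (intro HOL.conjI allI impI ballI)
    fix \<phi> assume "fv \<phi> \<subseteq> names k" "derives T ?\<Delta> \<phi>"
    then show "\<phi> \<in> ?\<Delta>"
      by (meson maximal not_derives derives.implE derives.implI)
  next
    fix \<phi> \<psi> assume disj: "Disj \<phi> \<psi> \<in> ?\<Delta>"
    then have "\<not> derives T (insert \<phi> ?\<Delta>) \<chi> \<or> \<not> derives T (insert \<psi> ?\<Delta>) \<chi>"
      using not_derives derives.disjE[OF derives.hyp[OF disj]] by blast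
    with fv\<Delta>[OF disj] maximal[of \<phi>] maximal[of \<psi>] show "\<phi> \<in> ?\<Delta> \<or> \<psi> \<in> ?\<Delta>" by auto
  next
    fix \<theta> assume ex: "Exists \<theta> \<in> ?\<Delta>"
    let ?n = "to_nat (Exists \<theta>)"
    \<comment> \<open>This is the condition by which \<open>add_formula\<close> selected its
      witness, so \<open>Eps ?P\<close> is that very name.\<close>
    let ?P = "\<lambda>c. c \<in> names k - fv (Exists \<theta>) - fv \<chi> - \<Union> (fv ` add_formulas \<Gamma> ?n)"
    have "insert (Exists \<theta>) (add_formulas \<Gamma> ?n) \<subseteq> ?\<Delta>" using ex by blast
    from weaken[OF _ this] not_derives have "\<not> derives T (insert (Exists \<theta>) (add_formulas \<Gamma> ?n)) \<chi>"
      by metis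
    then have subst: "subst (Eps ?P) \<theta> \<in> add_formula (Exists \<theta>) (add_formulas \<Gamma> ?n)"
      using fv\<Delta>[OF ex] by (simp add: add_formula_def)
    have "infinite (names k - (fv (Exists \<theta>) \<union> fv \<chi> \<union> \<Union> (fv ` add_formulas \<Gamma> ?n)))"
      by (rule infinite_diff_finite[of _ "\<Union> (fv ` add_formulas \<Gamma> ?n)" "fv (Exists \<theta>) \<union> fv \<chi>"])
        (use ext[of ?n] finite_fv in \<open>auto simp: extensible_def simp del: fv.simps\<close>)
    from infinite_imp_nonempty[OF this] obtain d where "?P d" by blast
    then have "?P (Eps ?P)" by (rule someI)
    show "\<exists>c\<in>names k. subst c \<theta> \<in> ?\<Delta>"
    proof
      show "subst (Eps ?P) \<theta> \<in> ?\<Delta>" by (rule subsetD[OF stage subst])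
      show "Eps ?P \<in> names k" using \<open>?P (Eps ?P)\<close> by (rule DiffD1[OF DiffD1[OF DiffD1]])
    qed
  qed (use fv\<Delta> in blast)
  show "\<Gamma> \<subseteq> ?\<Delta>" using UN_upper[of 0 UNIV "add_formulas \<Gamma>"] by simp
  show "\<chi> \<notin> ?\<Delta>" using not_derives derives.hyp by blast
qed

end

section \<open>Worlds and their extensions\<close>

typedef world = "{w. saturated CZF (fst w) (snd w)}"
proof
  \<comment> \<open>The inconsistent theory over the names of stage 0 is saturated, so nonemptiness
    of the type does not rest on the consistency of CZF.\<close>
  show "(0, {\<phi>. fv \<phi> \<subseteq> names 0}) \<in> {w. saturated CZF (fst w) (snd w)}"
  proof -
    obtain c where c: "c \<in> names 0" using names_nonempty by blast
    have "fv (subst c \<phi>) \<subseteq> names 0" if "{i. Suc i \<in> fv \<phi>} \<subseteq> names 0" for \<phi>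
      using that c by (auto simp: fv_rename split: nat.splits)
    with c show ?thesis unfolding saturated_def by force
  qed
qed

definition stage :: "world \<Rightarrow> nat" where "stage w = fst (Rep_world w)"
definition theory_of :: "world \<Rightarrow> fm set" where "theory_of w = snd (Rep_world w)"

instantiation world :: preorder
begin

definition less_eq_world :: "world \<Rightarrow> world \<Rightarrow> bool" where
  "w \<le> w' \<longleftrightarrow> stage w \<le> stage w' \<and> theory_of w \<subseteq> theory_of w'"

definition less_world :: "world \<Rightarrow> world \<Rightarrow> bool" where
  "w < w' \<longleftrightarrow> w \<le> w' \<and> \<not> w' \<le> w" for w w' :: world

instance
  by standard (auto simp: less_eq_world_def less_world_def)

end

lemma saturated_world: "saturated CZF (stage w) (theory_of w)"
  using Rep_world[of w] by (simp add: stage_def theory_of_def)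

lemma world_exists: "saturated CZF k \<Gamma> \<Longrightarrow> \<exists>w. stage w = k \<and> theory_of w = \<Gamma>"
  by (metis Abs_world_inverse fst_conv mem_Collect_eq snd_conv stage_def theory_of_def)

lemma theory_closed: "fv \<phi> \<subseteq> names (stage w) \<Longrightarrow> derives CZF (theory_of w) \<phi> \<Longrightarrow> \<phi> \<in> theory_of w"
  using saturated_world[of w] by (simp add: saturated_def)

lemma theory_fv: "\<phi> \<in> theory_of w \<Longrightarrow> fv \<phi> \<subseteq> names (stage w)"
  using saturated_world[of w] by (simp add: saturated_def)

lemma theory_disj: "Disj \<phi> \<psi> \<in> theory_of w \<Longrightarrow> \<phi> \<in> theory_of w \<or> \<psi> \<in> theory_of w"
  using saturated_world[of w] by (simp add: saturated_def)

lemma theory_exists: "Exists \<phi> \<in> theory_of w \<Longrightarrow> \<exists>c\<in>names (stage w). subst c \<phi> \<in> theory_of w"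
  using saturated_world[of w] by (simp add: saturated_def)

text \<open>Besides the names of stage k only the single name c may occur in \<Gamma>, so infinitely
  many names of stage k + 1 are left as witnesses.\<close>

lemma world_extension:
  assumes "\<not> derives CZF \<Gamma> \<chi>" and "\<Union> (fv ` \<Gamma>) \<subseteq> insert c (names k)" and "c \<in> names (Suc k)"
  obtains w where "stage w = Suc k" "\<Gamma> \<subseteq> theory_of w" "\<chi> \<notin> theory_of w"
proof -
  have "infinite (names (Suc k) - \<Union> (fv ` \<Gamma>))"
    by (rule infinite_diff_finite[OF infinite_names_diff, of "{c}"]) (use assms(2) in auto)
  then have "extensible CZF (Suc k) \<chi> \<Gamma>"
    using assms names_mono[of k "Suc k"] by (auto simp: extensible_def)
  from saturated_extension[OF this] that show ?thesis by (metis world_exists)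
qed

section \<open>Truth values\<close>

typedef pv = "{U :: world set. \<forall>w\<in>U. \<forall>w'\<ge>w. w' \<in> U}"
  by blast

definition holds :: "world \<Rightarrow> pv \<Rightarrow> bool" (infix "\<Turnstile>" 45) where
  "w \<Turnstile> p \<longleftrightarrow> w \<in> Rep_pv p"

text \<open>The largest up-closed set of worlds at which P holds. Building all connectives with it
  makes them truth values by construction, with no separate monotonicity proofs.\<close>

definition always :: "(world \<Rightarrow> bool) \<Rightarrow> pv" where
  "always P = Abs_pv {w. \<forall>w'\<ge>w. P w'}"

lemma holds_always: "w \<Turnstile> always P \<longleftrightarrow> (\<forall>w'\<ge>w. P w')"
proof -
  have "{w. \<forall>w'\<ge>w. P w'} \<in> {U. \<forall>w\<in>U. \<forall>w'\<ge>w. w' \<in> U}"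
    by (auto intro: order_trans)
  then show ?thesis by (simp add: holds_def always_def Abs_pv_inverse)
qed

lemma up: "w \<Turnstile> p \<Longrightarrow> w \<le> w' \<Longrightarrow> w' \<Turnstile> p"
  using Rep_pv[of p] by (auto simp: holds_def)

lemma pv_eqI: "(\<And>w. w \<Turnstile> p \<longleftrightarrow> w \<Turnstile> q) \<Longrightarrow> p = q"
  by (metis Rep_pv_inject holds_def subsetI subset_antisym)

text \<open>The domain of a world consists of the names of its stage; \<open>ex x\<close> is the existence predicate.\<close>

definition ex :: "nat \<Rightarrow> pv" where
  "ex x = always (\<lambda>w. x \<in> names (stage w))"
definition mem :: "nat \<Rightarrow> nat \<Rightarrow> pv" where
  "mem x y = always (\<lambda>w. Member x y \<in> theory_of w)"
definition eq :: "nat \<Rightarrow> nat \<Rightarrow> pv" where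
  "eq x y = always (\<lambda>w. Equal x y \<in> theory_of w)"
definition bot :: pv where
  "bot = always (\<lambda>w. Falsum \<in> theory_of w)"
definition conj :: "pv \<Rightarrow> pv \<Rightarrow> pv" (infixr "\<sqinter>" 35) where
  "(p \<sqinter> q) = always (\<lambda>w. w \<Turnstile> p \<and> w \<Turnstile> q)"
definition disj :: "pv \<Rightarrow> pv \<Rightarrow> pv" (infixr "\<squnion>" 30) where
  "(p \<squnion> q) = always (\<lambda>w. w \<Turnstile> p \<or> w \<Turnstile> q)"
definition imp :: "pv \<Rightarrow> pv \<Rightarrow> pv" (infixr "\<rightarrow>" 25) where
  "(p \<rightarrow> q) = always (\<lambda>w. w \<Turnstile> p \<longrightarrow> w \<Turnstile> q)"
definition all :: "(nat \<Rightarrow> pv) \<Rightarrow> pv" where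
  "all P = always (\<lambda>w. \<forall>x. w \<Turnstile> ex x \<longrightarrow> w \<Turnstile> P x)"
definition exi :: "(nat \<Rightarrow> pv) \<Rightarrow> pv" where
  "exi P = always (\<lambda>w. \<exists>x. w \<Turnstile> ex x \<and> w \<Turnstile> P x)"

lemma holds_ex: "w \<Turnstile> ex x \<longleftrightarrow> x \<in> names (stage w)"
  using names_mono by (auto simp: ex_def holds_always less_eq_world_def)
lemma holds_mem: "w \<Turnstile> mem x y \<longleftrightarrow> Member x y \<in> theory_of w"
  by (auto simp: mem_def holds_always less_eq_world_def)
lemma holds_eq: "w \<Turnstile> eq x y \<longleftrightarrow> Equal x y \<in> theory_of w"
  by (auto simp: eq_def holds_always less_eq_world_def)
lemma holds_bot: "w \<Turnstile> bot \<longleftrightarrow> Falsum \<in> theory_of w"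
  by (auto simp: bot_def holds_always less_eq_world_def)
lemma holds_conj [simp]: "w \<Turnstile> (p \<sqinter> q) \<longleftrightarrow> w \<Turnstile> p \<and> w \<Turnstile> q"
  by (auto simp: conj_def holds_always intro: up)
lemma holds_disj [simp]: "w \<Turnstile> (p \<squnion> q) \<longleftrightarrow> w \<Turnstile> p \<or> w \<Turnstile> q"
  by (auto simp: disj_def holds_always intro: up)
lemma holds_imp [simp]: "w \<Turnstile> (p \<rightarrow> q) \<longleftrightarrow> (\<forall>w'\<ge>w. w' \<Turnstile> p \<longrightarrow> w' \<Turnstile> q)"
  by (simp add: imp_def holds_always)
lemma holds_all [simp]: "w \<Turnstile> all P \<longleftrightarrow> (\<forall>w'\<ge>w. \<forall>x. w' \<Turnstile> ex x \<longrightarrow> w' \<Turnstile> P x)"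
  by (simp add: all_def holds_always)
lemma holds_exi [simp]: "w \<Turnstile> exi P \<longleftrightarrow> (\<exists>x. w \<Turnstile> ex x \<and> w \<Turnstile> P x)"
  by (auto simp: exi_def holds_always intro: up)

section \<open>Interpretation of formulas, truth lemma and completeness\<close>

primrec sem :: "(nat \<Rightarrow> nat) \<Rightarrow> fm \<Rightarrow> pv" where
  "sem e (Member i j) = mem (e i) (e j)"
| "sem e (Equal i j) = eq (e i) (e j)"
| "sem e Falsum = bot"
| "sem e (Conj \<phi> \<psi>) = (sem e \<phi> \<sqinter> sem e \<psi>)"
| "sem e (Disj \<phi> \<psi>) = (sem e \<phi> \<squnion> sem e \<psi>)"
| "sem e (Impl \<phi> \<psi>) = (sem e \<phi> \<rightarrow> sem e \<psi>)"
| "sem e (Forall \<phi>) = all (\<lambda>x. sem (case_nat x e) \<phi>)"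
| "sem e (Exists \<phi>) = exi (\<lambda>x. sem (case_nat x e) \<phi>)"

definition ok :: "world \<Rightarrow> (nat \<Rightarrow> nat) \<Rightarrow> bool" where
  "ok w e \<longleftrightarrow> (\<forall>i. w \<Turnstile> ex (e i))"

lemma ok_up: "ok w e \<Longrightarrow> w \<le> w' \<Longrightarrow> ok w' e"
  by (auto simp: ok_def intro: up)

lemma ok_case_nat [simp]: "ok w (case_nat x e) \<longleftrightarrow> w \<Turnstile> ex x \<and> ok w e"
  by (auto simp: ok_def split: nat.splits)

lemma ok_fv: "ok w e \<Longrightarrow> fv (rename e \<phi>) \<subseteq> names (stage w)"
  by (auto simp: ok_def fv_rename holds_ex)

text \<open>The environment doubles as a renaming of the variables of \<phi> by names. Disjunction
  and existence are settled inside the world by saturation; implication and universal quantification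
  need a world at the next stage that omits a formula.\<close>

theorem truth: "ok w e \<Longrightarrow> w \<Turnstile> sem e \<phi> \<longleftrightarrow> rename e \<phi> \<in> theory_of w"
proof (induction \<phi> arbitrary: w e)
  case (Member i j) then show ?case by (simp add: holds_mem)
next
  case (Equal i j) then show ?case by (simp add: holds_eq)
next
  case Falsum then show ?case by (simp add: holds_bot)
next
  case (Conj \<phi> \<psi>)
  have "rename e (Conj \<phi> \<psi>) \<in> theory_of w \<longleftrightarrow> rename e \<phi> \<in> theory_of w \<and> rename e \<psi> \<in> theory_of w"
    using ok_fv[OF Conj.prems]
    by (metis derives.conjE1 derives.conjE2 derives.conjI derives.hyp rename.simps(4) theory_closed)
  then show ?case using Conj by simp
next
  case (Disj \<phi> \<psi>)
  have "rename e (Disj \<phi> \<psi>) \<in> theory_of w \<longleftrightarrow> rename e \<phi> \<in> theory_of w \<or> rename e \<psi> \<in> theory_of w"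
    using ok_fv[OF Disj.prems]
    by (metis derives.disjI1 derives.disjI2 derives.hyp rename.simps(5) theory_closed theory_disj)
  then show ?case using Disj by simp
next
  case (Impl \<phi> \<psi>)
  have "rename e (Impl \<phi> \<psi>) \<in> theory_of w \<longleftrightarrow>
      (\<forall>w'\<ge>w. rename e \<phi> \<in> theory_of w' \<longrightarrow> rename e \<psi> \<in> theory_of w')" (is "?L \<longleftrightarrow> ?R")
  proof
    assume ?L
    show ?R
    proof (intro allI impI)
      fix w' assume "w \<le> w'" "rename e \<phi> \<in> theory_of w'"
      with \<open>?L\<close> have "derives CZF (theory_of w') (rename e \<psi>)"
        by (metis derives.hyp derives.implE less_eq_world_def rename.simps(6) subsetD)
      with ok_fv[OF ok_up[OF Impl.prems \<open>w \<le> w'\<close>]] show "rename e \<psi> \<in> theory_of w'"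
        by (rule theory_closed)
    qed
  next
    assume ?R
    show ?L
    proof (rule ccontr)
      assume "\<not> ?L"
      \<comment> \<open>By \<open>implI\<close> the conclusion is underivable even from the theory
        enlarged by the antecedent. Some world of the next stage then contains the antecedent and
        omits the conclusion.\<close>
      then have nd: "\<not> derives CZF (insert (rename e \<phi>) (theory_of w)) (rename e \<psi>)"
        using ok_fv[OF Impl.prems] theory_closed derives.implI by (metis rename.simps(6))
      obtain c where c: "c \<in> names (stage w)" using names_nonempty by blast
      have fvs: "\<Union> (fv ` insert (rename e \<phi>) (theory_of w)) \<subseteq> insert c (names (stage w))"
        using ok_fv[OF Impl.prems] theory_fv by fastforce
      obtain w' where "stage w' = Suc (stage w)" "insert (rename e \<phi>) (theory_of w) \<subseteq> theory_of w'"
        "rename e \<psi> \<notin> theory_of w'"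
        using world_extension[OF nd fvs subsetD[OF names_mono c]] by (metis le_Suc_eq order_refl)
      with \<open>?R\<close> show False by (auto simp: less_eq_world_def)
    qed
  qed
  moreover have "w \<Turnstile> sem e (Impl \<phi> \<psi>) \<longleftrightarrow>
      (\<forall>w'\<ge>w. rename e \<phi> \<in> theory_of w' \<longrightarrow> rename e \<psi> \<in> theory_of w')"
    using Impl ok_up[OF Impl.prems] by simp
  ultimately show ?case by blast
next
  case (Forall \<phi>)
  have inst: "subst c (rename (case_nat 0 (\<lambda>i. Suc (e i))) \<phi>) = rename (case_nat c e) \<phi>" for c
    by (rule subst_rename)
  have "rename e (Forall \<phi>) \<in> theory_of w \<longleftrightarrow>
      (\<forall>w'\<ge>w. \<forall>c\<in>names (stage w'). rename (case_nat c e) \<phi> \<in> theory_of w')" (is "?L \<longleftrightarrow> ?R")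
  proof
    assume ?L
    show ?R
    proof (intro allI impI ballI)
      fix w' c assume le: "w \<le> w'" and c: "c \<in> names (stage w')"
      with \<open>?L\<close> have "derives CZF (theory_of w') (rename e (Forall \<phi>))"
        by (metis derives.hyp less_eq_world_def subsetD)
      from derives.forallE[OF this[unfolded rename.simps]] inst
      have "derives CZF (theory_of w') (rename (case_nat c e) \<phi>)" by metis
      moreover have "ok w' (case_nat c e)"
        using ok_up[OF Forall.prems le] c by (simp add: holds_ex)
      ultimately show "rename (case_nat c e) \<phi> \<in> theory_of w'"
        using theory_closed ok_fv by blast
    qed
  next
    assume ?R
    show ?L
    proof (rule ccontr)
      assume nL: "\<not> ?L"
      \<comment> \<open>A name unknown at w serves as eigenvariable. The world at the next stage
        knows this name and can omit the instance.\<close>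
      obtain c where c: "c \<in> names (Suc (stage w))" "c \<notin> names (stage w)"
        using infinite_imp_nonempty[OF infinite_names_diff[of "stage w"]] by blast
      have nd: "\<not> derives CZF (theory_of w) (rename (case_nat c e) \<phi>)"
      proof
        assume "derives CZF (theory_of w) (rename (case_nat c e) \<phi>)"
        then have "derives CZF (theory_of w) (rename e (Forall \<phi>))"
          unfolding inst[symmetric] rename.simps
          by (rule forallI_fresh) (use c ok_fv[OF Forall.prems, of "Forall \<phi>"] theory_fv in auto)
        then show False using nL theory_closed ok_fv[OF Forall.prems] by blast
      qed
      have fvs: "\<Union> (fv ` theory_of w) \<subseteq> insert c (names (stage w))"
        using theory_fv by fastforce
      obtain w' where "stage w' = Suc (stage w)" "theory_of w \<subseteq> theory_of w'"
        "rename (case_nat c e) \<phi> \<notin> theory_of w'"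
        using world_extension[OF nd fvs c(1)] by blast
      with \<open>?R\<close> c show False by (auto simp: less_eq_world_def)
    qed
  qed
  moreover have "w \<Turnstile> sem e (Forall \<phi>) \<longleftrightarrow>
      (\<forall>w'\<ge>w. \<forall>c\<in>names (stage w'). rename (case_nat c e) \<phi> \<in> theory_of w')"
    using Forall.IH ok_up[OF Forall.prems] by (auto simp: holds_ex)
  ultimately show ?case by blast
next
  case (Exists \<phi>)
  have inst: "subst c (rename (case_nat 0 (\<lambda>i. Suc (e i))) \<phi>) = rename (case_nat c e) \<phi>" for c
    by (rule subst_rename)
  have "rename e (Exists \<phi>) \<in> theory_of w \<longleftrightarrow>
      (\<exists>c\<in>names (stage w). rename (case_nat c e) \<phi> \<in> theory_of w)" (is "?L \<longleftrightarrow> ?R")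
  proof
    assume ?L then show ?R using theory_exists inst by (metis rename.simps(8))
  next
    assume ?R
    then have "derives CZF (theory_of w) (rename e (Exists \<phi>))"
      unfolding rename.simps by (metis derives.existsI derives.hyp inst)
    then show ?L using theory_closed ok_fv[OF Exists.prems] by blast
  qed
  then show ?case using Exists by (auto simp: holds_ex)
qed

text \<open>An underivable sentence is missing from some saturated theory and hence, by
  \<open>truth\<close>, fails at that world. A sentence is fixed by every renaming, so a constant
  environment suffices.\<close>

theorem completeness:
  assumes "fv \<phi> = {}" and "\<And>w e. ok w e \<Longrightarrow> w \<Turnstile> sem e \<phi>"
  shows "derives CZF {} \<phi>"
proof (rule ccontr)
  assume nd: "\<not> derives CZF {} \<phi>"
  obtain w where w: "\<phi> \<notin> theory_of w"
    by (rule world_extension[OF nd, of "prod_encode (0, 0)" 0]) (auto simp: names_def)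
  obtain c where "w \<Turnstile> ex c" using names_nonempty holds_ex by blast
  then have "ok w (\<lambda>_. c)" by (simp add: ok_def)
  from assms(2)[OF this] truth[OF this] have "rename (\<lambda>_. c) \<phi> \<in> theory_of w" by simp
  moreover have "rename (\<lambda>_. c) \<phi> = \<phi>" by (rule rename_ident) (simp add: assms(1))
  ultimately show False using w by simp
qed

section \<open>Definable predicates on the model\<close>

lemma mem_ex1: "w \<Turnstile> mem x y \<Longrightarrow> w \<Turnstile> ex x"
  and mem_ex2: "w \<Turnstile> mem x y \<Longrightarrow> w \<Turnstile> ex y"
  using theory_fv[of "Member x y" w] by (simp_all add: holds_mem holds_ex)

lemma eq_ex1: "w \<Turnstile> eq x y \<Longrightarrow> w \<Turnstile> ex x"
  and eq_ex2: "w \<Turnstile> eq x y \<Longrightarrow> w \<Turnstile> ex y"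
  using theory_fv[of "Equal x y" w] by (simp_all add: holds_eq holds_ex)

lemma ex_exists: "\<exists>x. w \<Turnstile> ex x"
  using names_nonempty holds_ex by blast

lemma eq_refl: "w \<Turnstile> ex x \<Longrightarrow> w \<Turnstile> eq x x"
  using theory_closed[OF _ derives.equal_refl] by (simp add: holds_ex holds_eq)

text \<open>Equality in the model is provable equality of names, not identity. The rule
  \<open>equal_subst\<close> makes it a congruence for the interpretations of formulas.\<close>

lemma sem_cong:
  assumes "ok w e" and eq: "w \<Turnstile> eq x y" and "w \<Turnstile> sem (case_nat x e) \<phi>"
  shows "w \<Turnstile> sem (case_nat y e) \<phi>"
proof -
  let ?\<phi> = "rename (case_nat 0 (\<lambda>i. Suc (e i))) \<phi>"
  have ok: "ok w (case_nat x e)" "ok w (case_nat y e)"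
    using assms(1) eq_ex1[OF eq] eq_ex2[OF eq] by simp_all
  have "derives CZF (theory_of w) (Equal x y)"
    using eq by (simp add: holds_eq derives.hyp)
  moreover have "derives CZF (theory_of w) (subst x ?\<phi>)"
    unfolding subst_rename using truth[OF ok(1)] assms(3) by (simp add: derives.hyp)
  ultimately have "derives CZF (theory_of w) (subst y ?\<phi>)" by (rule derives.equal_subst)
  then show ?thesis
    unfolding subst_rename using truth[OF ok(2)] theory_closed ok_fv[OF ok(2)] by blast
qed

lemma sem_bot:
  assumes "ok w e" and "w \<Turnstile> bot"
  shows "w \<Turnstile> sem e \<phi>"
  using assms(2) truth[OF assms(1)] theory_closed[OF ok_fv[OF assms(1)]]
  by (simp add: holds_bot derives.falsumE derives.hyp)

text \<open>The free variables of an axiom are parameters, which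
  \<open>derives_rename_closed\<close> replaces by the names in the environment.\<close>

lemma sem_axiom:
  assumes "\<phi> \<in> CZF" and "ok w e"
  shows "w \<Turnstile> sem e \<phi>"
proof -
  have "derives CZF (theory_of w) (rename e \<phi>)"
    by (rule weaken[OF derives_rename_closed[OF derives.axiom[OF assms(1)]]]) simp
  then show ?thesis using truth[OF assms(2)] theory_closed[OF ok_fv[OF assms(2)]] by blast
qed

lemma eq_sym: "w \<Turnstile> eq x y \<Longrightarrow> w \<Turnstile> eq y x"
  using sem_cong[of w "\<lambda>_. x" x y "Equal 0 (Suc 0)"] eq_refl[of w x] eq_ex1[of w x y]
  by (simp add: ok_def)

lemma eq_trans: "w \<Turnstile> eq x y \<Longrightarrow> w \<Turnstile> eq y z \<Longrightarrow> w \<Turnstile> eq x z"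
  using sem_cong[of w "\<lambda>_. z" y x "Equal 0 (Suc 0)"] eq_sym[of w x y] eq_ex2[of w y z]
  by (simp add: ok_def)

lemma mem_cong1: "w \<Turnstile> eq x y \<Longrightarrow> w \<Turnstile> mem x a \<Longrightarrow> w \<Turnstile> mem y a"
  using sem_cong[of w "\<lambda>_. a" x y "Member 0 (Suc 0)"] mem_ex2[of w x a]
  by (simp add: ok_def)

lemma mem_cong2: "w \<Turnstile> eq a b \<Longrightarrow> w \<Turnstile> mem x a \<Longrightarrow> w \<Turnstile> mem x b"
  using sem_cong[of w "\<lambda>_. x" a b "Member (Suc 0) 0"] mem_ex1[of w x a]
  by (simp add: ok_def)

definition iff :: "pv \<Rightarrow> pv \<Rightarrow> pv" where
  "iff p q = ((p \<rightarrow> q) \<sqinter> (q \<rightarrow> p))"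
text \<open>Bounded quantifiers range over the members directly. A member at a world exists there by
  \<open>mem_ex1\<close>, so no existence predicate appears; \<open>all_ball\<close> and
  \<open>exi_bex\<close> connect them with the formulas.\<close>

definition ball :: "nat \<Rightarrow> (nat \<Rightarrow> pv) \<Rightarrow> pv" where
  "ball a P = always (\<lambda>w. \<forall>x. w \<Turnstile> mem x a \<longrightarrow> w \<Turnstile> P x)"
definition bex :: "nat \<Rightarrow> (nat \<Rightarrow> pv) \<Rightarrow> pv" where
  "bex a P = always (\<lambda>w. \<exists>x. w \<Turnstile> mem x a \<and> w \<Turnstile> P x)"

lemma holds_iff [simp]: "w \<Turnstile> iff p q \<longleftrightarrow> (\<forall>w'\<ge>w. w' \<Turnstile> p \<longleftrightarrow> w' \<Turnstile> q)"
  by (auto simp: iff_def)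
lemma holds_ball [simp]: "w \<Turnstile> ball a P \<longleftrightarrow> (\<forall>w'\<ge>w. \<forall>x. w' \<Turnstile> mem x a \<longrightarrow> w' \<Turnstile> P x)"
  by (simp add: ball_def holds_always)
lemma holds_bex [simp]: "w \<Turnstile> bex a P \<longleftrightarrow> (\<exists>x. w \<Turnstile> mem x a \<and> w \<Turnstile> P x)"
  by (auto simp: bex_def holds_always intro: up)

text \<open>From depth n on, every further quantifier raises the index of t by exactly one. This
  ensures that the bound of a bounded quantifier, which is evaluated below that quantifier, still
  denotes the same variable.\<close>

definition wb :: "nat \<Rightarrow> trm \<Rightarrow> bool" where
  "wb n t \<longleftrightarrow> (\<forall>m\<ge>n. t (Suc m) = Suc (t m))"

lemma wb_bound [simp]: "n \<le> k \<Longrightarrow> wb (Suc k) (\<lambda>m. m - Suc n)"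
  by (auto simp: wb_def)
lemma wb_Suc [simp]: "wb n t \<Longrightarrow> wb (Suc n) t"
  by (auto simp: wb_def)
lemma wb_at_Suc [simp]: "wb n t \<Longrightarrow> t (Suc n) = Suc (t n)"
  by (simp add: wb_def)

lemma sem_fo [simp]:
  "sem e ((s \<^bold>\<in> t) n) = mem (e (s n)) (e (t n))"
  "sem e ((s \<^bold>= t) n) = eq (e (s n)) (e (t n))"
  "sem e (\<^bold>\<bottom> n) = bot"
  "sem e ((p \<^bold>\<and> q) n) = (sem e (p n) \<sqinter> sem e (q n))"
  "sem e ((p \<^bold>\<or> q) n) = (sem e (p n) \<squnion> sem e (q n))"
  "sem e ((p \<^bold>\<longrightarrow> q) n) = (sem e (p n) \<rightarrow> sem e (q n))"
  "sem e ((p \<^bold>\<longleftrightarrow> q) n) = iff (sem e (p n)) (sem e (q n))"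
  "sem e (fo_all F n) = all (\<lambda>x. sem (case_nat x e) (F (\<lambda>m. m - Suc n) (Suc n)))"
  "sem e (fo_ex F n) = exi (\<lambda>x. sem (case_nat x e) (F (\<lambda>m. m - Suc n) (Suc n)))"
  by (simp_all add: fo_mem_def fo_eq_def fo_false_def fo_conj_def fo_disj_def fo_imp_def fo_iff_def
      iff_def fo_all_def fo_ex_def)

lemma all_ball: "all (\<lambda>x. mem x a \<rightarrow> P x) = ball a P"
  by (rule pv_eqI) (auto intro: order_trans dest: mem_ex1)

lemma exi_bex: "exi (\<lambda>x. mem x a \<sqinter> P x) = bex a P"
  by (rule pv_eqI) (auto dest: mem_ex1)

lemma sem_fo_bounded [simp]:
  assumes "wb n t"
  shows "sem e (fo_ball t F n) = ball (e (t n)) (\<lambda>x. sem (case_nat x e) (F (\<lambda>m. m - Suc n) (Suc n)))"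
    and "sem e (fo_bex t F n) = bex (e (t n)) (\<lambda>x. sem (case_nat x e) (F (\<lambda>m. m - Suc n) (Suc n)))"
  using assms by (simp_all add: fo_ball_def fo_bex_def all_ball exi_bex)

lemma sem_rename: "sem e (rename r \<phi>) = sem (e \<circ> r) \<phi>"
proof (induction \<phi> arbitrary: e r)
  case (Forall \<phi>)
  have "case_nat x e \<circ> case_nat 0 (\<lambda>i. Suc (r i)) = case_nat x (e \<circ> r)" for x
    by (auto split: nat.split)
  with Forall show ?case by (simp only: rename.simps sem.simps)
next
  case (Exists \<phi>)
  have "case_nat x e \<circ> case_nat 0 (\<lambda>i. Suc (r i)) = case_nat x (e \<circ> r)" for x
    by (auto split: nat.split)
  with Exists show ?case by (simp only: rename.simps sem.simps)
qed simp_all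

lemma sem_inst:
  "sem e (inst \<phi> xs n) =
    sem (\<lambda>i. if i < length xs then e ((xs ! i) n) else e (i - length xs + n)) \<phi>"
  by (simp add: inst_def sem_rename comp_def if_distrib[of e])

lemma bounded_rename: "bounded \<phi> \<Longrightarrow> bounded (rename r \<phi>)"
  by (induction arbitrary: r rule: bounded.induct) (auto intro: bounded.intros)

text \<open>
  \<open>dfn b w P\<close> says that above \<open>w\<close> the predicate \<open>P\<close> of an environment is the interpretation of a
  formula (a bounded one if \<open>b\<close> holds) with parameters from the domain of \<open>w\<close>; these are the
  predicates to which the axiom schemas apply.
\<close>

definition term_at :: "world \<Rightarrow> ((nat \<Rightarrow> nat) \<Rightarrow> nat) \<Rightarrow> bool" where
  "term_at w t \<longleftrightarrow> (\<exists>i. t = (\<lambda>e. e i)) \<or> (\<exists>c. w \<Turnstile> ex c \<and> t = (\<lambda>e. c))"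

definition dfn :: "bool \<Rightarrow> world \<Rightarrow> ((nat \<Rightarrow> nat) \<Rightarrow> pv) \<Rightarrow> bool" where
  "dfn b w P \<longleftrightarrow> (\<exists>\<phi> r. (b \<longrightarrow> bounded \<phi>) \<and> (\<forall>i. term_at w (r i)) \<and>
    (\<forall>w'\<ge>w. \<forall>e. ok w' e \<longrightarrow> (w' \<Turnstile> P e \<longleftrightarrow> w' \<Turnstile> sem (\<lambda>i. r i e) \<phi>)))"

named_theorems dfn_intros

lemma term_var [dfn_intros]: "term_at w (\<lambda>e. e i)"
  by (auto simp: term_at_def)

lemma term_const [dfn_intros]: "w \<Turnstile> ex c \<Longrightarrow> term_at w (\<lambda>e. c)"
  by (auto simp: term_at_def)

lemma dfn_mem [dfn_intros]: "term_at w s \<Longrightarrow> term_at w t \<Longrightarrow> dfn b w (\<lambda>e. mem (s e) (t e))"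
  unfolding dfn_def
  by (intro exI[of _ "Member 0 (Suc 0)"] exI[of _ "case_nat s (\<lambda>_. t)"])
    (auto intro: bounded.intros split: nat.split)

lemma dfn_eq [dfn_intros]: "term_at w s \<Longrightarrow> term_at w t \<Longrightarrow> dfn b w (\<lambda>e. eq (s e) (t e))"
  unfolding dfn_def
  by (intro exI[of _ "Equal 0 (Suc 0)"] exI[of _ "case_nat s (\<lambda>_. t)"])
    (auto intro: bounded.intros split: nat.split)

text \<open>Existence is expressed by self-equality, which by \<open>eq_ex1\<close> holds only of
  names in the domain of the world.\<close>

lemma dfn_ex [dfn_intros]: "term_at w s \<Longrightarrow> dfn b w (\<lambda>e. ex (s e))"
  unfolding dfn_def
  by (intro exI[of _ "Equal 0 0"] exI[of _ "\<lambda>_. s"])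
    (auto intro: bounded.intros eq_refl dest: eq_ex1)

lemma dfn_bot [dfn_intros]: "dfn b w (\<lambda>e. bot)"
  unfolding dfn_def
  by (intro exI[of _ Falsum] exI[of _ "\<lambda>_ e. e 0"]) (auto intro: bounded.intros term_var)

text \<open>Two formulas are brought under one assignment of parameters by interleaving: the
  variables of the first become even, those of the second odd.\<close>

lemma dfn_merge:
  assumes "dfn b w P" and "dfn b w Q"
  obtains \<phi> \<psi> r where "b \<longrightarrow> bounded \<phi>" "b \<longrightarrow> bounded \<psi>" "\<forall>i. term_at w (r i)"
    "\<forall>w'\<ge>w. \<forall>e. ok w' e \<longrightarrow> (w' \<Turnstile> P e \<longleftrightarrow> w' \<Turnstile> sem (\<lambda>i. r i e) \<phi>)"
    "\<forall>w'\<ge>w. \<forall>e. ok w' e \<longrightarrow> (w' \<Turnstile> Q e \<longleftrightarrow> w' \<Turnstile> sem (\<lambda>i. r i e) \<psi>)"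
proof -
  from assms(1) obtain \<phi> r where 1: "b \<longrightarrow> bounded \<phi>" "\<forall>i. term_at w (r i)"
    "\<And>w' e. w \<le> w' \<Longrightarrow> ok w' e \<Longrightarrow> w' \<Turnstile> P e \<longleftrightarrow> w' \<Turnstile> sem (\<lambda>i. r i e) \<phi>"
    unfolding dfn_def by blast
  from assms(2) obtain \<psi> s where 2: "b \<longrightarrow> bounded \<psi>" "\<forall>i. term_at w (s i)"
    "\<And>w' e. w \<le> w' \<Longrightarrow> ok w' e \<Longrightarrow> w' \<Turnstile> Q e \<longleftrightarrow> w' \<Turnstile> sem (\<lambda>i. s i e) \<psi>"
    unfolding dfn_def by blast
  let ?r = "\<lambda>i. if even i then r (i div 2) else s (i div 2)"
  show thesis
  proof (rule that[of "rename (\<lambda>i. 2 * i) \<phi>" "rename (\<lambda>i. Suc (2 * i)) \<psi>" ?r])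
    show "\<forall>w'\<ge>w. \<forall>e. ok w' e \<longrightarrow> (w' \<Turnstile> P e \<longleftrightarrow> w' \<Turnstile> sem (\<lambda>i. ?r i e) (rename (\<lambda>i. 2 * i) \<phi>))"
      using 1(3) by (simp add: sem_rename comp_def)
    show "\<forall>w'\<ge>w. \<forall>e. ok w' e \<longrightarrow> (w' \<Turnstile> Q e \<longleftrightarrow> w' \<Turnstile> sem (\<lambda>i. ?r i e) (rename (\<lambda>i. Suc (2 * i)) \<psi>))"
      using 2(3) by (simp add: sem_rename comp_def)
  qed (use 1(1,2) 2(1,2) bounded_rename in auto)
qed

lemma dfn_conj [dfn_intros]:
  assumes "dfn b w P" and "dfn b w Q"
  shows "dfn b w (\<lambda>e. P e \<sqinter> Q e)"
proof -
  obtain \<phi> \<psi> r where m: "b \<longrightarrow> bounded \<phi>" "b \<longrightarrow> bounded \<psi>" "\<forall>i. term_at w (r i)"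
    "\<forall>w'\<ge>w. \<forall>e. ok w' e \<longrightarrow> (w' \<Turnstile> P e \<longleftrightarrow> w' \<Turnstile> sem (\<lambda>i. r i e) \<phi>)"
    "\<forall>w'\<ge>w. \<forall>e. ok w' e \<longrightarrow> (w' \<Turnstile> Q e \<longleftrightarrow> w' \<Turnstile> sem (\<lambda>i. r i e) \<psi>)"
    by (rule dfn_merge[OF assms])
  then show ?thesis unfolding dfn_def
    by (intro exI[of _ "Conj \<phi> \<psi>"] exI[of _ r]) (auto intro: bounded.intros)
qed

lemma dfn_disj [dfn_intros]:
  assumes "dfn b w P" and "dfn b w Q"
  shows "dfn b w (\<lambda>e. P e \<squnion> Q e)"
proof -
  obtain \<phi> \<psi> r where m: "b \<longrightarrow> bounded \<phi>" "b \<longrightarrow> bounded \<psi>" "\<forall>i. term_at w (r i)"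
    "\<forall>w'\<ge>w. \<forall>e. ok w' e \<longrightarrow> (w' \<Turnstile> P e \<longleftrightarrow> w' \<Turnstile> sem (\<lambda>i. r i e) \<phi>)"
    "\<forall>w'\<ge>w. \<forall>e. ok w' e \<longrightarrow> (w' \<Turnstile> Q e \<longleftrightarrow> w' \<Turnstile> sem (\<lambda>i. r i e) \<psi>)"
    by (rule dfn_merge[OF assms])
  then show ?thesis unfolding dfn_def
    by (intro exI[of _ "Disj \<phi> \<psi>"] exI[of _ r]) (auto intro: bounded.intros)
qed

lemma dfn_imp [dfn_intros]:
  assumes "dfn b w P" and "dfn b w Q"
  shows "dfn b w (\<lambda>e. P e \<rightarrow> Q e)"
proof -
  obtain \<phi> \<psi> r where m: "b \<longrightarrow> bounded \<phi>" "b \<longrightarrow> bounded \<psi>" "\<forall>i. term_at w (r i)"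
    "\<forall>w'\<ge>w. \<forall>e. ok w' e \<longrightarrow> (w' \<Turnstile> P e \<longleftrightarrow> w' \<Turnstile> sem (\<lambda>i. r i e) \<phi>)"
    "\<forall>w'\<ge>w. \<forall>e. ok w' e \<longrightarrow> (w' \<Turnstile> Q e \<longleftrightarrow> w' \<Turnstile> sem (\<lambda>i. r i e) \<psi>)"
    by (rule dfn_merge[OF assms])
  have "w' \<Turnstile> (P e \<rightarrow> Q e) \<longleftrightarrow> w' \<Turnstile> sem (\<lambda>i. r i e) (Impl \<phi> \<psi>)" if "w \<le> w'" "ok w' e" for w' e
    unfolding sem.simps holds_imp
    using m(4,5)[rule_format, OF order_trans[OF that(1)] ok_up[OF that(2)]] by blast
  with m show ?thesis unfolding dfn_def
    by (intro exI[of _ "Impl \<phi> \<psi>"] exI[of _ r]) (auto simp del: holds_imp sem.simps intro: bounded.intros)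
qed

lemma dfn_iff [dfn_intros]: "dfn b w P \<Longrightarrow> dfn b w Q \<Longrightarrow> dfn b w (\<lambda>e. iff (P e) (Q e))"
  unfolding iff_def by (intro dfn_conj dfn_imp)

text \<open>Under a quantifier a term either is the bound variable or does not depend on it; the
  Boolean j tells which.\<close>

lemma term_strip:
  assumes "term_at w t"
  shows "\<exists>u j. term_at w u \<and> (\<forall>x e. t (case_nat x e) = (if j then x else u e))"
proof -
  consider i where "t = (\<lambda>e. e (Suc i))" | "t = (\<lambda>e. e 0)" | c where "w \<Turnstile> ex c" "t = (\<lambda>e. c)"
    using assms unfolding term_at_def by (metis not0_implies_Suc)
  then show ?thesis
  proof cases
    case (1 i)
    then show ?thesis by (intro exI[of _ "\<lambda>e. e i"] exI[of _ False]) (simp add: term_var)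
  next
    case 2
    with assms show ?thesis by (intro exI[of _ t] exI[of _ True]) simp
  next
    case 3
    with assms show ?thesis by (intro exI[of _ t] exI[of _ False]) simp
  qed
qed

text \<open>Several variables of the representing formula may stand for the bound variable. All of
  them are identified with index 0, after which the formula can be quantified.\<close>

lemma dfn_body:
  assumes "dfn b w (\<lambda>e. Q (e 0) (\<lambda>i. e (Suc i)))"
  obtains \<psi> u where "b \<longrightarrow> bounded \<psi>" "\<forall>i. term_at w (u i)"
    "\<forall>w'\<ge>w. \<forall>e. ok w' e \<longrightarrow> (\<forall>x. w' \<Turnstile> ex x \<longrightarrow>
      (w' \<Turnstile> Q x e \<longleftrightarrow> w' \<Turnstile> sem (case_nat x (\<lambda>i. u i e)) \<psi>))"
proof -
  from assms obtain \<phi> r where 1: "b \<longrightarrow> bounded \<phi>" "\<forall>i. term_at w (r i)"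
    "\<forall>w'\<ge>w. \<forall>e. ok w' e \<longrightarrow> (w' \<Turnstile> Q (e 0) (\<lambda>i. e (Suc i)) \<longleftrightarrow> w' \<Turnstile> sem (\<lambda>i. r i e) \<phi>)"
    unfolding dfn_def by blast
  from 1(2) term_strip have "\<forall>i. \<exists>u j. term_at w u \<and> (\<forall>x e. r i (case_nat x e) = (if j then x else u e))"
    by blast
  then obtain u j where u: "\<And>i. term_at w (u i)" "\<And>i x e. r i (case_nat x e) = (if j i then x else u i e)"
    by metis
  have "case_nat x (\<lambda>i. u i e) \<circ> (\<lambda>i. if j i then 0 else Suc i) = (\<lambda>i. r i (case_nat x e))" for x e
    by (auto simp: u(2))
  moreover have "w' \<Turnstile> Q x e \<longleftrightarrow> w' \<Turnstile> sem (\<lambda>i. r i (case_nat x e)) \<phi>"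
    if "w \<le> w'" "ok w' e" "w' \<Turnstile> ex x" for w' e x
    using 1(3)[rule_format, OF that(1), of "case_nat x e"] that by simp
  ultimately show thesis
    by (intro that[of "rename (\<lambda>i. if j i then 0 else Suc i) \<phi>" u])
      (use 1(1) u(1) in \<open>auto simp: bounded_rename sem_rename\<close>)
qed

lemma dfn_all [dfn_intros]:
  assumes "dfn False w (\<lambda>e. Q (e 0) (\<lambda>i. e (Suc i)))"
  shows "dfn False w (\<lambda>e. all (\<lambda>x. Q x e))"
proof -
  obtain \<psi> u where u: "False \<longrightarrow> bounded \<psi>" "\<forall>i. term_at w (u i)"
    "\<forall>w'\<ge>w. \<forall>e. ok w' e \<longrightarrow> (\<forall>x. w' \<Turnstile> ex x \<longrightarrow>
      (w' \<Turnstile> Q x e \<longleftrightarrow> w' \<Turnstile> sem (case_nat x (\<lambda>i. u i e)) \<psi>))"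
    by (rule dfn_body[OF assms])
  have "w' \<Turnstile> all (\<lambda>x. Q x e) \<longleftrightarrow> w' \<Turnstile> sem (\<lambda>i. u i e) (Forall \<psi>)" if "w \<le> w'" "ok w' e" for w' e
    unfolding sem.simps holds_all
    using u(3)[rule_format, OF order_trans[OF that(1)] ok_up[OF that(2)]] by blast
  with u(2) show ?thesis unfolding dfn_def by blast
qed

lemma dfn_exi [dfn_intros]:
  assumes "dfn False w (\<lambda>e. Q (e 0) (\<lambda>i. e (Suc i)))"
  shows "dfn False w (\<lambda>e. exi (\<lambda>x. Q x e))"
proof -
  obtain \<psi> u where u: "False \<longrightarrow> bounded \<psi>" "\<forall>i. term_at w (u i)"
    "\<forall>w'\<ge>w. \<forall>e. ok w' e \<longrightarrow> (\<forall>x. w' \<Turnstile> ex x \<longrightarrow>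
      (w' \<Turnstile> Q x e \<longleftrightarrow> w' \<Turnstile> sem (case_nat x (\<lambda>i. u i e)) \<psi>))"
    by (rule dfn_body[OF assms])
  have "w' \<Turnstile> exi (\<lambda>x. Q x e) \<longleftrightarrow> w' \<Turnstile> sem (\<lambda>i. u i e) (Exists \<psi>)" if "w \<le> w'" "ok w' e" for w' e
    unfolding sem.simps holds_exi using u(3)[rule_format, OF that] by blast
  with u(2) show ?thesis unfolding dfn_def by blast
qed

lemma case_nat_shift: "case_nat x (\<lambda>i. case_nat t u i e) \<circ> case_nat 0 (\<lambda>i. Suc (Suc i)) = case_nat x (\<lambda>i. u i e)"
  by (auto split: nat.split)

lemma dfn_ball [dfn_intros]:
  assumes "term_at w t" and "dfn b w (\<lambda>e. Q (e 0) (\<lambda>i. e (Suc i)))"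
  shows "dfn b w (\<lambda>e. ball (t e) (\<lambda>x. Q x e))"
proof -
  obtain \<psi> u where u: "b \<longrightarrow> bounded \<psi>" "\<forall>i. term_at w (u i)"
    "\<forall>w'\<ge>w. \<forall>e. ok w' e \<longrightarrow> (\<forall>x. w' \<Turnstile> ex x \<longrightarrow>
      (w' \<Turnstile> Q x e \<longleftrightarrow> w' \<Turnstile> sem (case_nat x (\<lambda>i. u i e)) \<psi>))"
    by (rule dfn_body[OF assms(2)])
  \<comment> \<open>The bounding term t becomes parameter 0, hence index 1 below the quantifier, and
    the parameters of the body move up past it.\<close>
  let ?\<phi> = "Forall (Impl (Member 0 (Suc 0)) (rename (case_nat 0 (\<lambda>i. Suc (Suc i))) \<psi>))"
  have "sem (\<lambda>i. case_nat t u i e) ?\<phi> = ball (t e) (\<lambda>x. sem (case_nat x (\<lambda>i. u i e)) \<psi>)" for e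
    by (simp add: sem_rename case_nat_shift all_ball del: comp_apply)
  moreover have "w' \<Turnstile> ball (t e) (\<lambda>x. Q x e) \<longleftrightarrow> w' \<Turnstile> ball (t e) (\<lambda>x. sem (case_nat x (\<lambda>i. u i e)) \<psi>)"
    if "w \<le> w'" "ok w' e" for w' e
    unfolding holds_ball using u(3)[rule_format, OF order_trans[OF that(1)] ok_up[OF that(2)] mem_ex1] by blast
  moreover have "b \<longrightarrow> bounded ?\<phi>" using u(1) by (auto intro: bounded.intros bounded_rename)
  moreover have "\<forall>i. term_at w (case_nat t u i)" using u(2) assms(1) by (simp split: nat.split)
  ultimately show ?thesis unfolding dfn_def
    by (intro exI[of _ ?\<phi>] exI[of _ "case_nat t u"]) (simp only:, blast)
qed

lemma dfn_bex [dfn_intros]: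
  assumes "term_at w t" and "dfn b w (\<lambda>e. Q (e 0) (\<lambda>i. e (Suc i)))"
  shows "dfn b w (\<lambda>e. bex (t e) (\<lambda>x. Q x e))"
proof -
  obtain \<psi> u where u: "b \<longrightarrow> bounded \<psi>" "\<forall>i. term_at w (u i)"
    "\<forall>w'\<ge>w. \<forall>e. ok w' e \<longrightarrow> (\<forall>x. w' \<Turnstile> ex x \<longrightarrow>
      (w' \<Turnstile> Q x e \<longleftrightarrow> w' \<Turnstile> sem (case_nat x (\<lambda>i. u i e)) \<psi>))"
    by (rule dfn_body[OF assms(2)])
  let ?\<phi> = "Exists (Conj (Member 0 (Suc 0)) (rename (case_nat 0 (\<lambda>i. Suc (Suc i))) \<psi>))"
  have "sem (\<lambda>i. case_nat t u i e) ?\<phi> = bex (t e) (\<lambda>x. sem (case_nat x (\<lambda>i. u i e)) \<psi>)" for e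
    by (simp add: sem_rename case_nat_shift exi_bex del: comp_apply)
  moreover have "w' \<Turnstile> bex (t e) (\<lambda>x. Q x e) \<longleftrightarrow> w' \<Turnstile> bex (t e) (\<lambda>x. sem (case_nat x (\<lambda>i. u i e)) \<psi>)"
    if "w \<le> w'" "ok w' e" for w' e
    unfolding holds_bex using u(3)[rule_format, OF that mem_ex1] by blast
  moreover have "b \<longrightarrow> bounded ?\<phi>" using u(1) by (auto intro: bounded.intros bounded_rename)
  moreover have "\<forall>i. term_at w (case_nat t u i)" using u(2) assms(1) by (simp split: nat.split)
  ultimately show ?thesis unfolding dfn_def
    by (intro exI[of _ ?\<phi>] exI[of _ "case_nat t u"]) (simp only:, blast)
qed

text \<open>With the environment frozen to d beyond the first k places, a term is one of the k
  arguments or a constant. In the latter case slot l + k is reserved, so that different l cannot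
  collide.\<close>

lemma term_split:
  assumes "term_at w t" and "w \<Turnstile> ex d"
  shows "\<exists>m v. w \<Turnstile> ex v \<and> (\<forall>e. t (\<lambda>i. if i < k then e i else d) = (if m < k then e m else v))
    \<and> (k \<le> m \<longrightarrow> m = l + k)"
proof -
  consider i where "t = (\<lambda>e. e i)" "i < k" | i where "t = (\<lambda>e. e i)" "\<not> i < k" | c where "w \<Turnstile> ex c" "t = (\<lambda>e. c)"
    using assms(1) unfolding term_at_def by blast
  then show ?thesis
  proof cases
    case (1 i)
    with assms(2) show ?thesis by (intro exI[of _ i] exI[of _ d]) simp
  next
    case (2 i)
    with assms(2) show ?thesis by (intro exI[of _ "l + k"] exI[of _ d]) simp
  next
    case (3 c)
    then show ?thesis by (intro exI[of _ "l + k"] exI[of _ c]) simp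
  qed
qed

lemma dfn_parameters:
  assumes "dfn b w P" and d: "w \<Turnstile> ex d"
  obtains \<psi> v where "b \<longrightarrow> bounded \<psi>" "ok w v"
    "\<forall>w'\<ge>w. \<forall>e. (\<forall>i<k. w' \<Turnstile> ex (e i)) \<longrightarrow>
      (w' \<Turnstile> P (\<lambda>i. if i < k then e i else d) \<longleftrightarrow> w' \<Turnstile> sem (\<lambda>i. if i < k then e i else v (i - k)) \<psi>)"
proof -
  from assms(1) obtain \<phi> r where 1: "b \<longrightarrow> bounded \<phi>" "\<forall>i. term_at w (r i)"
    "\<forall>w'\<ge>w. \<forall>e. ok w' e \<longrightarrow> (w' \<Turnstile> P e \<longleftrightarrow> w' \<Turnstile> sem (\<lambda>i. r i e) \<phi>)"
    unfolding dfn_def by blast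
  from term_split[OF _ d] 1(2) have "\<forall>l. \<exists>m v. w \<Turnstile> ex v \<and>
      (\<forall>e. r l (\<lambda>i. if i < k then e i else d) = (if m < k then e m else v)) \<and> (k \<le> m \<longrightarrow> m = l + k)"
    by blast
  then obtain m v where m: "\<And>l. w \<Turnstile> ex (v l)"
    "\<And>l e. r l (\<lambda>i. if i < k then e i else d) = (if m l < k then e (m l) else v l)"
    "\<And>l. k \<le> m l \<Longrightarrow> m l = l + k"
    by metis
  have comp: "(\<lambda>i. if i < k then e i else v (i - k)) \<circ> m = (\<lambda>l. r l (\<lambda>i. if i < k then e i else d))" for e
  proof
    fix l
    show "((\<lambda>i. if i < k then e i else v (i - k)) \<circ> m) l = r l (\<lambda>i. if i < k then e i else d)"
      using m(3)[of l] by (cases "m l < k") (simp_all add: m(2))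
  qed
  show thesis
  proof (rule that[of "rename m \<phi>" v])
    show "ok w v" using m(1) by (simp add: ok_def)
    show "\<forall>w'\<ge>w. \<forall>e. (\<forall>i<k. w' \<Turnstile> ex (e i)) \<longrightarrow>
      (w' \<Turnstile> P (\<lambda>i. if i < k then e i else d) \<longleftrightarrow>
        w' \<Turnstile> sem (\<lambda>i. if i < k then e i else v (i - k)) (rename m \<phi>))"
    proof (intro allI impI)
      fix w' e assume le: "w \<le> w'" and e: "\<forall>i<k. w' \<Turnstile> ex (e i)"
      have "ok w' (\<lambda>i. if i < k then e i else d)"
        using e up[OF d le] by (simp add: ok_def)
      with 1(3) le show "w' \<Turnstile> P (\<lambda>i. if i < k then e i else d) \<longleftrightarrow>
          w' \<Turnstile> sem (\<lambda>i. if i < k then e i else v (i - k)) (rename m \<phi>)"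
        by (simp add: sem_rename comp del: comp_apply)
    qed
  qed (use 1(1) in \<open>simp add: bounded_rename\<close>)
qed

section \<open>The axioms in the model\<close>

definition with_args :: "nat list \<Rightarrow> (nat \<Rightarrow> nat) \<Rightarrow> nat \<Rightarrow> nat" where
  "with_args xs v i = (if i < length xs then xs ! i else v (i - length xs))"

lemma with_args_nth [simp]:
  "with_args (x # xs) v 0 = x"
  "with_args (x # xs) v (Suc i) = with_args xs v i"
  by (simp_all add: with_args_def)

lemma sem_inst_args [simp]:
  "sem e (inst \<phi> ts n) = sem (with_args (map (\<lambda>t. e (t n)) ts) (\<lambda>i. e (i + n))) \<phi>"
  by (auto simp: sem_inst with_args_def intro!: arg_cong[where f = "\<lambda>e. sem e \<phi>"])

lemma with_args_eq_case_nat: "with_args [x] v = case_nat x v"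
  by (auto simp: with_args_def split: nat.split)

text \<open>The shape in which the schemas take a formula: the first k variables are the arguments,
  the others are parameters with values in the domain of w. The name d only fills the rest of the
  environment.\<close>

lemma dfn_args:
  assumes "dfn b w P"
  obtains \<psi> v d where "b \<longrightarrow> bounded \<psi>" "ok w v"
    "\<forall>w'\<ge>w. \<forall>xs. length xs = k \<longrightarrow> (\<forall>x\<in>set xs. w' \<Turnstile> ex x) \<longrightarrow>
      (w' \<Turnstile> P (with_args xs (\<lambda>_. d)) \<longleftrightarrow> w' \<Turnstile> sem (with_args xs v) \<psi>)"
proof -
  obtain d where d: "w \<Turnstile> ex d" using ex_exists by blast
  obtain \<psi> v where v: "b \<longrightarrow> bounded \<psi>" "ok w v"
    and eq: "\<forall>w'\<ge>w. \<forall>e. (\<forall>i<k. w' \<Turnstile> ex (e i)) \<longrightarrow>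
      (w' \<Turnstile> P (\<lambda>i. if i < k then e i else d) \<longleftrightarrow> w' \<Turnstile> sem (\<lambda>i. if i < k then e i else v (i - k)) \<psi>)"
    by (rule dfn_parameters[OF assms d, where k = k])
  have "w' \<Turnstile> P (with_args xs (\<lambda>_. d)) \<longleftrightarrow> w' \<Turnstile> sem (with_args xs v) \<psi>"
    if "w \<le> w'" "length xs = k" "\<forall>x\<in>set xs. w' \<Turnstile> ex x" for w' xs
  proof -
    have "with_args xs f = (\<lambda>i. if i < k then xs ! i else f (i - k))" for f
      using that(2) by (auto simp: with_args_def)
    with eq[THEN spec, THEN mp, OF that(1), THEN spec, of "\<lambda>i. xs ! i"] that(2,3) show ?thesis by simp
  qed
  with v that show thesis by blast
qed

text \<open>An arbitrary map into truth values need not respect equality of names; a definable one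
  does, by \<open>sem_cong\<close>.\<close>

lemma dfn_cong:
  assumes "dfn b w (\<lambda>e. P (e 0))" and eq: "w \<Turnstile> eq x y" and "w \<Turnstile> P x"
  shows "w \<Turnstile> P y"
proof -
  obtain \<psi> v d where v0: "b \<longrightarrow> bounded \<psi>" and v: "ok w v" "\<forall>w'\<ge>w. \<forall>xs. length xs = 1 \<longrightarrow> (\<forall>x\<in>set xs. w' \<Turnstile> ex x) \<longrightarrow>
      (w' \<Turnstile> P (with_args xs (\<lambda>_. d) 0) \<longleftrightarrow> w' \<Turnstile> sem (with_args xs v) \<psi>)"
    by (rule dfn_args[OF assms(1), where k = 1])
  from sem_cong[OF v(1) eq, of \<psi>] v(2)[rule_format, of w "[x]"] v(2)[rule_format, of w "[y]"] assms(3) eq_ex1[OF eq] eq_ex2[OF eq]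
  show ?thesis by (simp add: with_args_eq_case_nat)
qed

text \<open>Ex falso holds only for definable truth values, since worlds may be inconsistent.\<close>

lemma dfn_bot_elim:
  assumes "dfn b w (\<lambda>e. P)" and "w \<Turnstile> bot"
  shows "w \<Turnstile> P"
proof -
  obtain \<psi> v d where v0: "b \<longrightarrow> bounded \<psi>" and v: "ok w v" "\<forall>w'\<ge>w. \<forall>xs. length xs = 0 \<longrightarrow> (\<forall>x\<in>set xs. w' \<Turnstile> ex x) \<longrightarrow>
      (w' \<Turnstile> P \<longleftrightarrow> w' \<Turnstile> sem (with_args xs v) \<psi>)"
    by (rule dfn_args[OF assms(1), where k = 0])
  from v(2)[rule_format, of w "[]"] sem_bot[OF v(1) assms(2), of \<psi>] show ?thesis
    by (simp add: with_args_def[abs_def])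
qed

lemma extensionality:
  assumes "w \<Turnstile> ex a" and "w \<Turnstile> ex b"
    and "\<And>w' z. w \<le> w' \<Longrightarrow> w' \<Turnstile> mem z a \<Longrightarrow> w' \<Turnstile> mem z b"
    and "\<And>w' z. w \<le> w' \<Longrightarrow> w' \<Turnstile> mem z b \<Longrightarrow> w' \<Turnstile> mem z a"
  shows "w \<Turnstile> eq a b"
proof -
  have "w \<Turnstile> sem (\<lambda>_. a) (extensionality 0)"
    by (rule sem_axiom) (use assms in \<open>auto simp: CZF_def ok_def\<close>)
  then have "\<forall>w'\<ge>w. \<forall>x. w' \<Turnstile> ex x \<longrightarrow> (\<forall>w''\<ge>w'. \<forall>y. w'' \<Turnstile> ex y \<longrightarrow>
      (\<forall>w3\<ge>w''. (\<forall>w4\<ge>w3. \<forall>z. w4 \<Turnstile> ex z \<longrightarrow> (\<forall>w5\<ge>w4. w5 \<Turnstile> mem z x \<longleftrightarrow> w5 \<Turnstile> mem z y)) \<longrightarrow> w3 \<Turnstile> eq x y))"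
    by (simp add: extensionality_def)
  note * = this[rule_format, OF order_refl assms(1) order_refl assms(2) order_refl]
  show ?thesis
  proof (rule *)
    fix w4 z w5 assume "w \<le> w4" "w4 \<le> w5"
    then have "w \<le> w5" by (rule order_trans)
    with assms(3,4) show "w5 \<Turnstile> mem z a \<longleftrightarrow> w5 \<Turnstile> mem z b" by blast
  qed
qed

lemma set_induction:
  assumes dfn: "dfn b w (\<lambda>e. P (e 0))"
    and step: "\<And>w' a. w \<le> w' \<Longrightarrow> w' \<Turnstile> ex a \<Longrightarrow> (\<And>w'' x. w' \<le> w'' \<Longrightarrow> w'' \<Turnstile> mem x a \<Longrightarrow> w'' \<Turnstile> P x) \<Longrightarrow> w' \<Turnstile> P a"
    and "w \<Turnstile> ex a"
  shows "w \<Turnstile> P a"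
proof -
  obtain \<psi> v d where v0: "b \<longrightarrow> bounded \<psi>" and v: "ok w v" "\<forall>w'\<ge>w. \<forall>xs. length xs = 1 \<longrightarrow> (\<forall>x\<in>set xs. w' \<Turnstile> ex x) \<longrightarrow>
      (w' \<Turnstile> P (with_args xs (\<lambda>_. d) 0) \<longleftrightarrow> w' \<Turnstile> sem (with_args xs v) \<psi>)"
    by (rule dfn_args[OF dfn, where k = 1])
  have P: "w' \<Turnstile> sem (with_args [x] v) \<psi> \<longleftrightarrow> w' \<Turnstile> P x" if "w \<le> w'" "w' \<Turnstile> ex x" for w' x
    using v(2)[THEN spec, THEN mp, OF that(1), THEN spec, of "[x]"] that by simp
  have "w \<Turnstile> sem v (set_induction \<psi> 0)"
    by (rule sem_axiom) (use v in \<open>auto simp: CZF_def\<close>)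
  then have "\<forall>w'\<ge>w. (\<forall>w''\<ge>w'. \<forall>a. w'' \<Turnstile> ex a \<longrightarrow> (\<forall>w3\<ge>w''. (\<forall>w4\<ge>w3. \<forall>x. w4 \<Turnstile> mem x a \<longrightarrow> w4 \<Turnstile> sem (with_args [x] v) \<psi>)
      \<longrightarrow> w3 \<Turnstile> sem (with_args [a] v) \<psi>)) \<longrightarrow> (\<forall>w''\<ge>w'. \<forall>a. w'' \<Turnstile> ex a \<longrightarrow> w'' \<Turnstile> sem (with_args [a] v) \<psi>)"
    by (simp add: set_induction_def)
  moreover have "\<forall>w''\<ge>w. \<forall>a. w'' \<Turnstile> ex a \<longrightarrow> (\<forall>w3\<ge>w''. (\<forall>w4\<ge>w3. \<forall>x. w4 \<Turnstile> mem x a \<longrightarrow> w4 \<Turnstile> sem (with_args [x] v) \<psi>)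
      \<longrightarrow> w3 \<Turnstile> sem (with_args [a] v) \<psi>)"
  proof (intro allI impI)
    fix w'' a w3
    assume le: "w \<le> w''" "w'' \<le> w3" and a: "w'' \<Turnstile> ex a"
      and IH: "\<forall>w4\<ge>w3. \<forall>x. w4 \<Turnstile> mem x a \<longrightarrow> w4 \<Turnstile> sem (with_args [x] v) \<psi>"
    note le3 = order_trans[OF le]
    have "w3 \<Turnstile> P a"
      by (rule step[OF le3 up[OF a le(2)]]) (use IH P[OF order_trans[OF le3] mem_ex1] in blast)
    then show "w3 \<Turnstile> sem (with_args [a] v) \<psi>"
      using P[OF le3 up[OF a le(2)]] by blast
  qed
  ultimately have "w \<Turnstile> sem (with_args [a] v) \<psi>"
    using assms(3) order_refl by blast
  with P assms(3) show ?thesis by blast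
qed

text \<open>The flag \<open>True\<close> certifies that the representing formula is bounded and thus
  belongs to the schema.\<close>

lemma separation:
  assumes dfn: "dfn True w (\<lambda>e. P (e 0))" and "w \<Turnstile> ex a"
  obtains b where "w \<Turnstile> ex b" "\<And>w' x. w \<le> w' \<Longrightarrow> w' \<Turnstile> mem x b \<longleftrightarrow> w' \<Turnstile> mem x a \<and> w' \<Turnstile> P x"
proof -
  obtain \<psi> v d where v: "True \<longrightarrow> bounded \<psi>" "ok w v" "\<forall>w'\<ge>w. \<forall>xs. length xs = 1 \<longrightarrow> (\<forall>x\<in>set xs. w' \<Turnstile> ex x) \<longrightarrow>
      (w' \<Turnstile> P (with_args xs (\<lambda>_. d) 0) \<longleftrightarrow> w' \<Turnstile> sem (with_args xs v) \<psi>)"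
    by (rule dfn_args[OF dfn, where k = 1])
  have P: "w' \<Turnstile> sem (with_args [x] v) \<psi> \<longleftrightarrow> w' \<Turnstile> P x" if "w \<le> w'" "w' \<Turnstile> ex x" for w' x
    using v(3)[THEN spec, THEN mp, OF that(1), THEN spec, of "[x]"] that by simp
  have "w \<Turnstile> sem v (separation \<psi> 0)"
    by (rule sem_axiom) (use v in \<open>auto simp: CZF_def\<close>)
  then have "\<forall>w'\<ge>w. \<forall>a. w' \<Turnstile> ex a \<longrightarrow> (\<exists>b. w' \<Turnstile> ex b \<and> (\<forall>w''\<ge>w'. \<forall>x. w'' \<Turnstile> ex x \<longrightarrow>
      (\<forall>w3\<ge>w''. w3 \<Turnstile> mem x b \<longleftrightarrow> w3 \<Turnstile> mem x a \<and> w3 \<Turnstile> sem (with_args [x] v) \<psi>)))"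
    by (simp add: separation_def)
  from this[rule_format, OF order_refl assms(2)] obtain b where b: "w \<Turnstile> ex b"
    "\<And>w' x. w \<le> w' \<Longrightarrow> w' \<Turnstile> ex x \<Longrightarrow> w' \<Turnstile> mem x b \<longleftrightarrow> w' \<Turnstile> mem x a \<and> w' \<Turnstile> sem (with_args [x] v) \<psi>"
    by blast
  have "w' \<Turnstile> mem x b \<longleftrightarrow> w' \<Turnstile> mem x a \<and> w' \<Turnstile> P x" if "w \<le> w'" for w' x
    using b(2)[OF that] P[OF that] mem_ex1 by metis
  with b(1) that show thesis by blast
qed

lemma strong_collection:
  assumes dfn: "dfn b w (\<lambda>e. P (e 0) (e (Suc 0)))" and a: "w \<Turnstile> ex a"
    and total: "\<And>w' x. w \<le> w' \<Longrightarrow> w' \<Turnstile> mem x a \<Longrightarrow> \<exists>y. w' \<Turnstile> ex y \<and> w' \<Turnstile> P x y"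
  obtains c where "w \<Turnstile> ex c" "\<And>w' x. w \<le> w' \<Longrightarrow> w' \<Turnstile> mem x a \<Longrightarrow> \<exists>y. w' \<Turnstile> mem y c \<and> w' \<Turnstile> P x y"
    "\<And>w' y. w \<le> w' \<Longrightarrow> w' \<Turnstile> mem y c \<Longrightarrow> \<exists>x. w' \<Turnstile> mem x a \<and> w' \<Turnstile> P x y"
proof -
  obtain \<psi> v d where v0: "b \<longrightarrow> bounded \<psi>" and v: "ok w v" "\<forall>w'\<ge>w. \<forall>xs. length xs = 2 \<longrightarrow> (\<forall>x\<in>set xs. w' \<Turnstile> ex x) \<longrightarrow>
      (w' \<Turnstile> P (with_args xs (\<lambda>_. d) 0) (with_args xs (\<lambda>_. d) (Suc 0)) \<longleftrightarrow> w' \<Turnstile> sem (with_args xs v) \<psi>)"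
    by (rule dfn_args[OF dfn, where k = 2])
  have P: "w' \<Turnstile> sem (with_args [x, y] v) \<psi> \<longleftrightarrow> w' \<Turnstile> P x y" if "w \<le> w'" "w' \<Turnstile> ex x" "w' \<Turnstile> ex y" for w' x y
    using v(2)[THEN spec, THEN mp, OF that(1), THEN spec, of "[x, y]"] that by simp
  have "w \<Turnstile> sem v (strong_collection \<psi> 0)"
    by (rule sem_axiom) (use v in \<open>auto simp: CZF_def\<close>)
  then have "\<forall>w'\<ge>w. \<forall>a. w' \<Turnstile> ex a \<longrightarrow> (\<forall>w''\<ge>w'.
     (\<forall>w3\<ge>w''. \<forall>x. w3 \<Turnstile> mem x a \<longrightarrow> (\<exists>y. w3 \<Turnstile> ex y \<and> w3 \<Turnstile> sem (with_args [x, y] v) \<psi>)) \<longrightarrow>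
     (\<exists>c. w'' \<Turnstile> ex c \<and>
      (\<forall>w3\<ge>w''. \<forall>x. w3 \<Turnstile> mem x a \<longrightarrow> (\<exists>y. w3 \<Turnstile> mem y c \<and> w3 \<Turnstile> sem (with_args [x, y] v) \<psi>)) \<and>
      (\<forall>w3\<ge>w''. \<forall>y. w3 \<Turnstile> mem y c \<longrightarrow> (\<exists>x. w3 \<Turnstile> mem x a \<and> w3 \<Turnstile> sem (with_args [x, y] v) \<psi>))))"
    by (simp add: strong_collection_def)
  note collection = this[THEN spec, THEN mp, OF order_refl, THEN spec, THEN mp, OF a,
      THEN spec, THEN mp, OF order_refl, THEN mp]
  have "\<forall>w3\<ge>w. \<forall>x. w3 \<Turnstile> mem x a \<longrightarrow> (\<exists>y. w3 \<Turnstile> ex y \<and> w3 \<Turnstile> sem (with_args [x, y] v) \<psi>)"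
  proof (intro allI impI)
    fix w' x assume le: "w \<le> w'" and x: "w' \<Turnstile> mem x a"
    from total[OF this] obtain y where y: "w' \<Turnstile> ex y" "w' \<Turnstile> P x y" by blast
    with P[OF le mem_ex1[OF x] y(1)]
    show "\<exists>y. w' \<Turnstile> ex y \<and> w' \<Turnstile> sem (with_args [x, y] v) \<psi>" by blast
  qed
  from collection[OF this]
  obtain c where c: "w \<Turnstile> ex c"
      "\<forall>w3\<ge>w. \<forall>x. w3 \<Turnstile> mem x a \<longrightarrow> (\<exists>y. w3 \<Turnstile> mem y c \<and> w3 \<Turnstile> sem (with_args [x, y] v) \<psi>)"
      "\<forall>w3\<ge>w. \<forall>y. w3 \<Turnstile> mem y c \<longrightarrow> (\<exists>x. w3 \<Turnstile> mem x a \<and> w3 \<Turnstile> sem (with_args [x, y] v) \<psi>)"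
    by blast
  show thesis
  proof (rule that[OF c(1)])
    fix w' x assume le: "w \<le> w'" and x: "w' \<Turnstile> mem x a"
    with c(2) obtain y where y: "w' \<Turnstile> mem y c" "w' \<Turnstile> sem (with_args [x, y] v) \<psi>" by blast
    with P[OF le mem_ex1[OF x] mem_ex1[OF y(1)]] show "\<exists>y. w' \<Turnstile> mem y c \<and> w' \<Turnstile> P x y" by blast
  next
    fix w' y assume le: "w \<le> w'" and y: "w' \<Turnstile> mem y c"
    with c(3) obtain x where x: "w' \<Turnstile> mem x a" "w' \<Turnstile> sem (with_args [x, y] v) \<psi>" by blast
    with P[OF le mem_ex1[OF x(1)] mem_ex1[OF y]] show "\<exists>x. w' \<Turnstile> mem x a \<and> w' \<Turnstile> P x y" by blast
  qed
qed

lemma subset_collection: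
  assumes dfn: "dfn b w (\<lambda>e. P (e 0) (e (Suc 0)) (e (Suc (Suc 0))))" and a: "w \<Turnstile> ex a" and b: "w \<Turnstile> ex b'"
  obtains c where "w \<Turnstile> ex c"
    "\<And>w' u. w \<le> w' \<Longrightarrow> w' \<Turnstile> ex u \<Longrightarrow>
      (\<And>w'' x. w' \<le> w'' \<Longrightarrow> w'' \<Turnstile> mem x a \<Longrightarrow> \<exists>y. w'' \<Turnstile> mem y b' \<and> w'' \<Turnstile> P x y u) \<Longrightarrow>
      \<exists>d. w' \<Turnstile> mem d c \<and> (\<forall>w''\<ge>w'. \<forall>x. w'' \<Turnstile> mem x a \<longrightarrow> (\<exists>y. w'' \<Turnstile> mem y d \<and> w'' \<Turnstile> P x y u)) \<and>
        (\<forall>w''\<ge>w'. \<forall>y. w'' \<Turnstile> mem y d \<longrightarrow> (\<exists>x. w'' \<Turnstile> mem x a \<and> w'' \<Turnstile> P x y u))"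
proof -
  obtain \<psi> v d where v0: "b \<longrightarrow> bounded \<psi>" and v: "ok w v" "\<forall>w'\<ge>w. \<forall>xs. length xs = 3 \<longrightarrow> (\<forall>x\<in>set xs. w' \<Turnstile> ex x) \<longrightarrow>
      (w' \<Turnstile> P (with_args xs (\<lambda>_. d) 0) (with_args xs (\<lambda>_. d) (Suc 0)) (with_args xs (\<lambda>_. d) (Suc (Suc 0)))
        \<longleftrightarrow> w' \<Turnstile> sem (with_args xs v) \<psi>)"
    by (rule dfn_args[OF dfn, where k = 3])
  have P: "w' \<Turnstile> sem (with_args [x, y, u] v) \<psi> \<longleftrightarrow> w' \<Turnstile> P x y u"
    if "w \<le> w'" "w' \<Turnstile> ex u" "w' \<Turnstile> ex x" "w' \<Turnstile> ex y" for w' x y u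
    using v(2)[THEN spec, THEN mp, OF that(1), THEN spec, of "[x, y, u]"] that by simp
  have "w \<Turnstile> sem v (subset_collection \<psi> 0)"
    by (rule sem_axiom) (use v in \<open>auto simp: CZF_def\<close>)
  then have "\<forall>w0\<ge>w. \<forall>a. w0 \<Turnstile> ex a \<longrightarrow> (\<forall>w1\<ge>w0. \<forall>b. w1 \<Turnstile> ex b \<longrightarrow> (\<exists>c. w1 \<Turnstile> ex c \<and> (\<forall>w'\<ge>w1. \<forall>u. w' \<Turnstile> ex u \<longrightarrow> (\<forall>w''\<ge>w'.
     (\<forall>w3\<ge>w''. \<forall>x. w3 \<Turnstile> mem x a \<longrightarrow> (\<exists>y. w3 \<Turnstile> mem y b \<and> w3 \<Turnstile> sem (with_args [x, y, u] v) \<psi>)) \<longrightarrow>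
     (\<exists>d. w'' \<Turnstile> mem d c \<and>
      (\<forall>w3\<ge>w''. \<forall>x. w3 \<Turnstile> mem x a \<longrightarrow> (\<exists>y. w3 \<Turnstile> mem y d \<and> w3 \<Turnstile> sem (with_args [x, y, u] v) \<psi>)) \<and>
      (\<forall>w3\<ge>w''. \<forall>y. w3 \<Turnstile> mem y d \<longrightarrow> (\<exists>x. w3 \<Turnstile> mem x a \<and> w3 \<Turnstile> sem (with_args [x, y, u] v) \<psi>)))))))"
    by (simp add: subset_collection_def)
  from this[THEN spec, THEN mp, OF order_refl, THEN spec, THEN mp, OF a,
      THEN spec, THEN mp, OF order_refl, THEN spec, THEN mp, OF b] obtain c where c: "w \<Turnstile> ex c" and
    c2: "\<forall>w'\<ge>w. \<forall>u. w' \<Turnstile> ex u \<longrightarrow> (\<forall>w''\<ge>w'.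
     (\<forall>w3\<ge>w''. \<forall>x. w3 \<Turnstile> mem x a \<longrightarrow> (\<exists>y. w3 \<Turnstile> mem y b' \<and> w3 \<Turnstile> sem (with_args [x, y, u] v) \<psi>)) \<longrightarrow>
     (\<exists>d. w'' \<Turnstile> mem d c \<and>
      (\<forall>w3\<ge>w''. \<forall>x. w3 \<Turnstile> mem x a \<longrightarrow> (\<exists>y. w3 \<Turnstile> mem y d \<and> w3 \<Turnstile> sem (with_args [x, y, u] v) \<psi>)) \<and>
      (\<forall>w3\<ge>w''. \<forall>y. w3 \<Turnstile> mem y d \<longrightarrow> (\<exists>x. w3 \<Turnstile> mem x a \<and> w3 \<Turnstile> sem (with_args [x, y, u] v) \<psi>))))"
    by blast
  show thesis
  proof (rule that[OF c])
    fix w' u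
    assume le: "w \<le> w'" and u: "w' \<Turnstile> ex u"
      and tot: "\<And>w'' x. w' \<le> w'' \<Longrightarrow> w'' \<Turnstile> mem x a \<Longrightarrow> \<exists>y. w'' \<Turnstile> mem y b' \<and> w'' \<Turnstile> P x y u"
    have P': "w'' \<Turnstile> sem (with_args [x, y, u] v) \<psi> \<longleftrightarrow> w'' \<Turnstile> P x y u"
      if "w' \<le> w''" "w'' \<Turnstile> mem x a" "w'' \<Turnstile> mem y z" for w'' x y z
      using P[OF order_trans[OF le that(1)] up[OF u that(1)]] mem_ex1 that by blast
    have tot': "\<forall>w3\<ge>w'. \<forall>x. w3 \<Turnstile> mem x a \<longrightarrow> (\<exists>y. w3 \<Turnstile> mem y b' \<and> w3 \<Turnstile> sem (with_args [x, y, u] v) \<psi>)"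
      using tot P' by blast
    from c2[THEN spec, THEN mp, OF le, THEN spec, THEN mp, OF u, THEN spec, THEN mp, OF order_refl, THEN mp, OF tot']
    obtain d where d: "w' \<Turnstile> mem d c"
      "\<forall>w3\<ge>w'. \<forall>x. w3 \<Turnstile> mem x a \<longrightarrow> (\<exists>y. w3 \<Turnstile> mem y d \<and> w3 \<Turnstile> sem (with_args [x, y, u] v) \<psi>)"
      "\<forall>w3\<ge>w'. \<forall>y. w3 \<Turnstile> mem y d \<longrightarrow> (\<exists>x. w3 \<Turnstile> mem x a \<and> w3 \<Turnstile> sem (with_args [x, y, u] v) \<psi>)"
      by blast
    show "\<exists>d. w' \<Turnstile> mem d c \<and> (\<forall>w''\<ge>w'. \<forall>x. w'' \<Turnstile> mem x a \<longrightarrow> (\<exists>y. w'' \<Turnstile> mem y d \<and> w'' \<Turnstile> P x y u)) \<and>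
        (\<forall>w''\<ge>w'. \<forall>y. w'' \<Turnstile> mem y d \<longrightarrow> (\<exists>x. w'' \<Turnstile> mem x a \<and> w'' \<Turnstile> P x y u))"
      using d P' by blast
  qed
qed

lemma upair_exists:
  assumes "w \<Turnstile> ex x" and "w \<Turnstile> ex y"
  obtains s where "w \<Turnstile> ex s" "\<And>w' z. w \<le> w' \<Longrightarrow> w' \<Turnstile> mem z s \<longleftrightarrow> w' \<Turnstile> eq z x \<or> w' \<Turnstile> eq z y"
proof -
  have "w \<Turnstile> sem (\<lambda>_. x) (pairing 0)"
    by (rule sem_axiom) (use assms in \<open>auto simp: CZF_def ok_def\<close>)
  then have "\<forall>w'\<ge>w. \<forall>x. w' \<Turnstile> ex x \<longrightarrow> (\<forall>w1\<ge>w'. \<forall>y. w1 \<Turnstile> ex y \<longrightarrow> (\<exists>s. w1 \<Turnstile> ex s \<and>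
      (\<forall>w2\<ge>w1. \<forall>z. w2 \<Turnstile> ex z \<longrightarrow> (\<forall>w3\<ge>w2. w3 \<Turnstile> mem z s \<longleftrightarrow> w3 \<Turnstile> eq z x \<or> w3 \<Turnstile> eq z y))))"
    by (simp add: pairing_def)
  from this[rule_format, OF order_refl assms(1) order_refl assms(2)] obtain s where s: "w \<Turnstile> ex s"
    "\<And>w2 z w3. w \<le> w2 \<Longrightarrow> w2 \<Turnstile> ex z \<Longrightarrow> w2 \<le> w3 \<Longrightarrow> w3 \<Turnstile> mem z s \<longleftrightarrow> w3 \<Turnstile> eq z x \<or> w3 \<Turnstile> eq z y"
    by blast
  show thesis
    by (rule that[OF s(1)]) (use s(2)[OF _ _ order_refl] mem_ex1 eq_ex1 in blast)
qed

lemma union_exists: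
  assumes "w \<Turnstile> ex a"
  obtains c where "w \<Turnstile> ex c" "\<And>w' z. w \<le> w' \<Longrightarrow> w' \<Turnstile> mem z c \<longleftrightarrow> (\<exists>u. w' \<Turnstile> mem u a \<and> w' \<Turnstile> mem z u)"
proof -
  have "w \<Turnstile> sem (\<lambda>_. a) (union_axiom 0)"
    by (rule sem_axiom) (use assms in \<open>auto simp: CZF_def ok_def\<close>)
  then have "\<forall>w'\<ge>w. \<forall>a. w' \<Turnstile> ex a \<longrightarrow> (\<exists>s. w' \<Turnstile> ex s \<and>
      (\<forall>w''\<ge>w'. \<forall>z. w'' \<Turnstile> ex z \<longrightarrow> (\<forall>w3\<ge>w''. w3 \<Turnstile> mem z s \<longleftrightarrow> (\<exists>u. w3 \<Turnstile> mem u a \<and> w3 \<Turnstile> mem z u))))"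
    by (simp add: union_axiom_def)
  from this[rule_format, OF order_refl assms(1)] obtain s where s: "w \<Turnstile> ex s"
    "\<And>w2 z w3. w \<le> w2 \<Longrightarrow> w2 \<Turnstile> ex z \<Longrightarrow> w2 \<le> w3 \<Longrightarrow> w3 \<Turnstile> mem z s \<longleftrightarrow> (\<exists>u. w3 \<Turnstile> mem u a \<and> w3 \<Turnstile> mem z u)"
    by blast
  show thesis
    by (rule that[OF s(1)]) (use s(2)[OF _ _ order_refl] mem_ex1 in blast)
qed

section \<open>Pairs and functions\<close>

lemma term_shift: "term_at w t \<Longrightarrow> term_at w (\<lambda>e. t (\<lambda>i. e (Suc i)))"
  by (auto simp: term_at_def)

lemma term_up: "term_at w t \<Longrightarrow> w \<le> w' \<Longrightarrow> term_at w' t"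
  by (auto simp: term_at_def intro: up)

lemma dfn_up: "dfn b w P \<Longrightarrow> w \<le> w' \<Longrightarrow> dfn b w' P"
  unfolding dfn_def by (meson term_up order_trans)

lemma dfn_cong2:
  assumes "dfn b w (\<lambda>e. P (e 0) (e (Suc 0)))" and x: "w \<Turnstile> eq x x'" and y: "w \<Turnstile> eq y y'" and "w \<Turnstile> P x y"
  shows "w \<Turnstile> P x' y'"
proof -
  obtain \<psi> v d where v0: "b \<longrightarrow> bounded \<psi>" and v: "ok w v" "\<forall>w'\<ge>w. \<forall>xs. length xs = 2 \<longrightarrow> (\<forall>x\<in>set xs. w' \<Turnstile> ex x) \<longrightarrow>
      (w' \<Turnstile> P (with_args xs (\<lambda>_. d) 0) (with_args xs (\<lambda>_. d) (Suc 0)) \<longleftrightarrow> w' \<Turnstile> sem (with_args xs v) \<psi>)"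
    by (rule dfn_args[OF assms(1), where k = 2])
  note P = v(2)[THEN spec, THEN mp, OF order_refl, THEN spec]
  \<comment> \<open>The lemma \<open>sem_cong\<close> replaces variable 0 only. Exchanging the first
    two variables makes it applicable to the second argument as well.\<close>
  let ?s = "case_nat (Suc 0) (case_nat 0 (\<lambda>i. Suc (Suc i)))"
  have "with_args [x, y] v \<circ> ?s = case_nat y (case_nat x v)" for x y
    by (auto simp: with_args_def split: nat.split)
  then have swap: "sem (with_args [x, y] v) (rename ?s \<psi>) = sem (case_nat y (case_nat x v)) \<psi>" for x y
    by (simp add: sem_rename del: comp_apply)
  have args: "with_args [x, y] v = case_nat x (case_nat y v)" for x y
    by (auto simp: with_args_def split: nat.split)
  note E = eq_ex1[OF x] eq_ex2[OF x] eq_ex1[OF y] eq_ex2[OF y]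
  have "w \<Turnstile> sem (case_nat x (case_nat y v)) \<psi>"
    using P[of "[x, y]"] assms(4) E by (simp add: args)
  then have "w \<Turnstile> sem (case_nat x' (case_nat y v)) \<psi>"
    using sem_cong[OF _ x] v(1) E by simp
  then have "w \<Turnstile> sem (case_nat y (case_nat x' v)) (rename ?s \<psi>)"
    unfolding args[symmetric] swap by (simp add: args)
  then have "w \<Turnstile> sem (case_nat y' (case_nat x' v)) (rename ?s \<psi>)"
    using sem_cong[OF _ y] v(1) E by simp
  then have "w \<Turnstile> sem (case_nat x' (case_nat y' v)) \<psi>"
    unfolding args[symmetric] swap by (simp add: args)
  then show ?thesis using P[of "[x', y']"] E by (simp add: args)
qed

text \<open>The bounded counterpart of \<open>is_upair\<close>, usable in separation. The two
  elements may coincide, so \<open>upr s x x\<close> also serves for singletons.\<close>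

definition upr :: "nat \<Rightarrow> nat \<Rightarrow> nat \<Rightarrow> pv" where
  "upr s x y = (mem x s \<sqinter> mem y s \<sqinter> ball s (\<lambda>z. eq z x \<squnion> eq z y))"

lemma dfn_upr [dfn_intros]:
  assumes "term_at w s" "term_at w x" "term_at w y"
  shows "dfn b w (\<lambda>e. upr (s e) (x e) (y e))"
  unfolding upr_def by (intro dfn_intros assms assms[THEN term_shift])

lemma uprD:
  assumes "w \<Turnstile> upr s x y"
  shows "w \<Turnstile> ex s" "w \<Turnstile> ex x" "w \<Turnstile> ex y" "w \<Turnstile> mem x s" "w \<Turnstile> mem y s"
    "w \<le> w' \<Longrightarrow> w' \<Turnstile> mem z s \<longleftrightarrow> w' \<Turnstile> eq z x \<or> w' \<Turnstile> eq z y"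
proof -
  show 1: "w \<Turnstile> mem x s" "w \<Turnstile> mem y s" using assms by (simp_all add: upr_def)
  then show "w \<Turnstile> ex s" "w \<Turnstile> ex x" "w \<Turnstile> ex y" by (auto intro: mem_ex1 mem_ex2)
  show "w' \<Turnstile> mem z s \<longleftrightarrow> w' \<Turnstile> eq z x \<or> w' \<Turnstile> eq z y" if "w \<le> w'"
  proof
    assume "w' \<Turnstile> mem z s"
    with assms that show "w' \<Turnstile> eq z x \<or> w' \<Turnstile> eq z y" by (simp add: upr_def)
  next
    assume "w' \<Turnstile> eq z x \<or> w' \<Turnstile> eq z y"
    then show "w' \<Turnstile> mem z s" using 1[THEN up, OF that] mem_cong1 eq_sym by blast
  qed
qed

lemma uprI:
  assumes "w \<Turnstile> ex x" "w \<Turnstile> ex y" "\<And>w' z. w \<le> w' \<Longrightarrow> w' \<Turnstile> mem z s \<longleftrightarrow> w' \<Turnstile> eq z x \<or> w' \<Turnstile> eq z y"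
  shows "w \<Turnstile> upr s x y"
  using assms eq_refl order_refl by (simp add: upr_def)

lemma upr_exists:
  assumes "w \<Turnstile> ex x" "w \<Turnstile> ex y"
  shows "\<exists>s. w \<Turnstile> upr s x y"
  by (rule upair_exists[OF assms]) (use uprI[OF assms] in blast)

lemma upr_unique:
  assumes "w \<Turnstile> upr s x y" "w \<Turnstile> upr s' x' y'" "w \<Turnstile> eq x x'" "w \<Turnstile> eq y y'"
  shows "w \<Turnstile> eq s s'"
proof (rule extensionality)
  fix w' z assume le: "w \<le> w'"
  note E = assms(3,4)[THEN up, OF le]
  have *: "w' \<Turnstile> mem z s \<longleftrightarrow> w' \<Turnstile> mem z s'"
    unfolding uprD(6)[OF assms(1) le] uprD(6)[OF assms(2) le]
    using E E[THEN eq_sym] eq_trans by blast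
  { assume "w' \<Turnstile> mem z s" with * show "w' \<Turnstile> mem z s'" by simp }
  { assume "w' \<Turnstile> mem z s'" with * show "w' \<Turnstile> mem z s" by simp }
qed (use assms uprD in blast)+

text \<open>The Kuratowski pair, again with all quantifiers bounded.\<close>

definition pr :: "nat \<Rightarrow> nat \<Rightarrow> nat \<Rightarrow> pv" where
  "pr p x y = (bex p (\<lambda>s. upr s x x) \<sqinter> bex p (\<lambda>s. upr s x y) \<sqinter> ball p (\<lambda>s. upr s x x \<squnion> upr s x y))"

lemma dfn_pr [dfn_intros]:
  assumes "term_at w p" "term_at w x" "term_at w y"
  shows "dfn b w (\<lambda>e. pr (p e) (x e) (y e))"
  unfolding pr_def by (intro dfn_intros assms assms[THEN term_shift])

lemma pr_ex:
  assumes "w \<Turnstile> pr p x y"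
  shows "w \<Turnstile> ex p" "w \<Turnstile> ex x" "w \<Turnstile> ex y"
  using assms by (auto simp: pr_def intro: mem_ex2 uprD)

lemma upr_cong: "w \<Turnstile> eq s s' \<Longrightarrow> w \<Turnstile> upr s x y \<Longrightarrow> w \<Turnstile> upr s' x y"
  by (rule dfn_cong[where P = "\<lambda>s. upr s x y" and b = True]) (auto intro!: dfn_intros intro: uprD)

lemma prD:
  assumes "w \<Turnstile> pr p x y" "w \<le> w'"
  shows "w' \<Turnstile> mem s p \<longleftrightarrow> w' \<Turnstile> upr s x x \<or> w' \<Turnstile> upr s x y"
proof
  assume "w' \<Turnstile> mem s p"
  with assms show "w' \<Turnstile> upr s x x \<or> w' \<Turnstile> upr s x y" by (simp add: pr_def)
next
  from up[OF assms] obtain s1 s2 where s: "w' \<Turnstile> mem s1 p" "w' \<Turnstile> upr s1 x x" "w' \<Turnstile> mem s2 p" "w' \<Turnstile> upr s2 x y"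
    by (auto simp: pr_def)
  note E = eq_refl[OF uprD(2)[OF s(4)]] eq_refl[OF uprD(3)[OF s(4)]]
  assume "w' \<Turnstile> upr s x x \<or> w' \<Turnstile> upr s x y"
  then show "w' \<Turnstile> mem s p"
    using upr_unique[OF s(2) _ E(1,1)] upr_unique[OF s(4) _ E] mem_cong1 s(1,3) by blast
qed

lemma prI:
  assumes "w \<Turnstile> ex x" "w \<Turnstile> ex y"
    "\<And>w' s. w \<le> w' \<Longrightarrow> w' \<Turnstile> mem s p \<longleftrightarrow> w' \<Turnstile> upr s x x \<or> w' \<Turnstile> upr s x y"
  shows "w \<Turnstile> pr p x y"
proof -
  obtain s1 s2 where "w \<Turnstile> upr s1 x x" "w \<Turnstile> upr s2 x y" using upr_exists assms(1,2) by blast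
  with assms(3)[OF order_refl] assms(3) show ?thesis by (auto simp: pr_def)
qed

lemma pr_exists:
  assumes "w \<Turnstile> ex x" "w \<Turnstile> ex y"
  shows "\<exists>p. w \<Turnstile> pr p x y"
proof -
  obtain s1 s2 where s: "w \<Turnstile> upr s1 x x" "w \<Turnstile> upr s2 x y" using upr_exists assms by blast
  then obtain p where p: "w \<Turnstile> upr p s1 s2" using upr_exists uprD(1) by blast
  have "w' \<Turnstile> upr z x x \<or> w' \<Turnstile> upr z x y" if le: "w \<le> w'" and z: "w' \<Turnstile> mem z p" for w' z
    using z[unfolded uprD(6)[OF p le]] s[THEN up, OF le] eq_sym upr_cong by blast
  then have "w \<Turnstile> pr p x y"
    using uprD(4,5)[OF p] s by (auto simp: pr_def)
  then show ?thesis ..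
qed

lemma pr_unique:
  assumes "w \<Turnstile> pr p x y" "w \<Turnstile> pr q x' y'" "w \<Turnstile> eq x x'" "w \<Turnstile> eq y y'"
  shows "w \<Turnstile> eq p q"
proof (rule extensionality)
  have cong: "w' \<Turnstile> upr s x' y'" if "w' \<Turnstile> upr s x y" "w' \<Turnstile> eq x x'" "w' \<Turnstile> eq y y'" for w' s x y x' y'
    by (rule dfn_cong2[where P = "\<lambda>x y. upr s x y" and b = True, OF _ that(2,3,1)])
      (intro dfn_intros uprD(1)[OF that(1)])
  fix w' s assume le: "w \<le> w'"
  note E = assms(3,4)[THEN up, OF le]
  have *: "w' \<Turnstile> mem s p \<longleftrightarrow> w' \<Turnstile> mem s q"
    unfolding prD[OF assms(1) le] prD[OF assms(2) le]
    using E E[THEN eq_sym] cong by blast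
  { assume "w' \<Turnstile> mem s p" with * show "w' \<Turnstile> mem s q" by simp }
  { assume "w' \<Turnstile> mem s q" with * show "w' \<Turnstile> mem s p" by simp }
qed (use assms pr_ex in blast)+

lemma pr_cong:
  assumes "w \<Turnstile> pr p x y" "w \<Turnstile> eq x x'" "w \<Turnstile> eq y y'"
  shows "w \<Turnstile> pr p x' y'"
  by (rule dfn_cong2[where P = "\<lambda>x y. pr p x y" and b = True, OF _ assms(2,3,1)])
    (intro dfn_intros pr_ex(1)[OF assms(1)])

lemma pr_cong1:
  assumes "w \<Turnstile> pr p x y" "w \<Turnstile> eq p q"
  shows "w \<Turnstile> pr q x y"
  by (rule dfn_cong[where P = "\<lambda>p. pr p x y" and b = True, OF _ assms(2,1)])
    (intro dfn_intros pr_ex(2,3)[OF assms(1)])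

text \<open>The classical proof splits on x = y, which is not decidable here. Comparing the
  singleton gives x = u. Then y = u or y = v, and v = x or v = y; in each of the four combinations y
  = v follows.\<close>

lemma pr_inject:
  assumes 1: "w \<Turnstile> pr p x y" and 2: "w \<Turnstile> pr p u v"
  shows "w \<Turnstile> eq x u" "w \<Turnstile> eq y v"
proof -
  note iff = prD[OF 1 order_refl] prD[OF 2 order_refl]
  note mem = uprD(6)[OF _ order_refl]
  obtain s1 s2 where s: "w \<Turnstile> upr s1 x x" "w \<Turnstile> upr s2 x y" using upr_exists pr_ex[OF 1] by blast
  obtain r2 where r: "w \<Turnstile> upr r2 u v" using upr_exists pr_ex[OF 2] by blast
  have "w \<Turnstile> upr s1 u u \<or> w \<Turnstile> upr s1 u v" using s iff by blast
  then have "w \<Turnstile> mem u s1" using uprD(4) by blast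
  then show xu: "w \<Turnstile> eq x u" using mem[OF s(1)] eq_sym by blast
  have "w \<Turnstile> upr s2 u u \<or> w \<Turnstile> upr s2 u v" using s iff by blast
  then have y: "w \<Turnstile> eq y u \<or> w \<Turnstile> eq y v" using uprD(5)[OF s(2)] mem by blast
  have "w \<Turnstile> upr r2 x x \<or> w \<Turnstile> upr r2 x y" using r iff by blast
  then have "w \<Turnstile> eq v x \<or> w \<Turnstile> eq v y" using uprD(5)[OF r] mem by blast
  with y xu show "w \<Turnstile> eq y v" using eq_trans eq_sym by blast
qed

definition mp :: "nat \<Rightarrow> nat \<Rightarrow> nat \<Rightarrow> pv" where
  "mp g x y = bex g (\<lambda>p. pr p x y)"

lemma dfn_mp [dfn_intros]:
  assumes "term_at w g" "term_at w x" "term_at w y"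
  shows "dfn b w (\<lambda>e. mp (g e) (x e) (y e))"
  unfolding mp_def by (intro dfn_intros assms assms[THEN term_shift])

lemma mp_ex:
  assumes "w \<Turnstile> mp g x y"
  shows "w \<Turnstile> ex g" "w \<Turnstile> ex x" "w \<Turnstile> ex y"
  using assms by (auto simp: mp_def intro: mem_ex2 pr_ex)

lemma mp_iff: "w \<Turnstile> mp g x y \<longleftrightarrow> (\<exists>p. w \<Turnstile> mem p g \<and> w \<Turnstile> pr p x y)"
  by (simp add: mp_def)

lemma mp_cong: "w \<Turnstile> mp g x y \<Longrightarrow> w \<Turnstile> eq x x' \<Longrightarrow> w \<Turnstile> eq y y' \<Longrightarrow> w \<Turnstile> mp g x' y'"
  unfolding mp_iff using pr_cong by blast

lemma mp_cong1: "w \<Turnstile> mp g x y \<Longrightarrow> w \<Turnstile> eq g g' \<Longrightarrow> w \<Turnstile> mp g' x y"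
  unfolding mp_iff using mem_cong2 by blast

lemma mp_mem: "w \<Turnstile> mp g x y \<Longrightarrow> w \<Turnstile> pr p x y \<Longrightarrow> w \<Turnstile> mem p g"
proof -
  assume "w \<Turnstile> mp g x y" and p: "w \<Turnstile> pr p x y"
  then obtain q where q: "w \<Turnstile> mem q g" "w \<Turnstile> pr q x y" by (auto simp: mp_iff)
  from pr_unique[OF q(2) p eq_refl[OF pr_ex(2)[OF p]] eq_refl[OF pr_ex(3)[OF p]]] q(1)
  show "w \<Turnstile> mem p g" by (rule mem_cong1)
qed

text \<open>Unique existence as in \<open>is_function\<close> quantifies over all sets. Here
  single-valuedness is restricted to values in Y, which makes the condition bounded;
  \<open>same_fn\<close> shows the agreement.\<close>

definition fn :: "nat \<Rightarrow> nat \<Rightarrow> nat \<Rightarrow> pv" where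
  "fn g X Y = (ex g \<sqinter> ex X \<sqinter> ex Y \<sqinter> ball g (\<lambda>p. bex X (\<lambda>x. bex Y (\<lambda>y. pr p x y)))
    \<sqinter> ball X (\<lambda>x. bex Y (\<lambda>y. mp g x y))
    \<sqinter> ball X (\<lambda>x. ball Y (\<lambda>y. ball Y (\<lambda>y'. mp g x y \<sqinter> mp g x y' \<rightarrow> eq y y'))))"

lemma dfn_fn [dfn_intros]:
  assumes "term_at w g" "term_at w X" "term_at w Y"
  shows "dfn b w (\<lambda>e. fn (g e) (X e) (Y e))"
  unfolding fn_def
  by (intro dfn_intros assms assms[THEN term_shift] assms[THEN term_shift, THEN term_shift]
      assms[THEN term_shift, THEN term_shift, THEN term_shift])

lemma fn_ex:
  assumes "w \<Turnstile> fn g X Y"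
  shows "w \<Turnstile> ex g" "w \<Turnstile> ex X" "w \<Turnstile> ex Y"
  using assms by (simp_all add: fn_def)

lemma fn_pair:
  assumes "w \<Turnstile> fn g X Y" "w \<Turnstile> mem p g"
  shows "\<exists>x y. w \<Turnstile> mem x X \<and> w \<Turnstile> mem y Y \<and> w \<Turnstile> pr p x y"
proof -
  from assms(1) have "w \<Turnstile> ball g (\<lambda>p. bex X (\<lambda>x. bex Y (\<lambda>y. pr p x y)))" unfolding fn_def by simp
  with assms(2) show ?thesis using order_refl by fastforce
qed

lemma fn_mem:
  assumes "w \<Turnstile> fn g X Y" "w \<Turnstile> mp g x y"
  shows "w \<Turnstile> mem x X" "w \<Turnstile> mem y Y"
proof -
  obtain p where p: "w \<Turnstile> mem p g" "w \<Turnstile> pr p x y" using assms(2) by (auto simp: mp_iff)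
  from fn_pair[OF assms(1) p(1)] obtain x' y' where "w \<Turnstile> mem x' X" "w \<Turnstile> mem y' Y" "w \<Turnstile> pr p x' y'" by blast
  with pr_inject[OF _ p(2)] mem_cong1 show "w \<Turnstile> mem x X" "w \<Turnstile> mem y Y" by blast+
qed

lemma fn_total:
  assumes "w \<Turnstile> fn g X Y" "w \<Turnstile> mem x X"
  shows "\<exists>y. w \<Turnstile> mem y Y \<and> w \<Turnstile> mp g x y"
proof -
  from assms(1) have "w \<Turnstile> ball X (\<lambda>x. bex Y (\<lambda>y. mp g x y))" unfolding fn_def by simp
  with assms(2) show ?thesis using order_refl by fastforce
qed

lemma fn_unique:
  assumes "w \<Turnstile> fn g X Y" "w \<Turnstile> mp g x y" "w \<Turnstile> mp g x y'"
  shows "w \<Turnstile> eq y y'"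
proof -
  from assms(1) have "w \<Turnstile> ball X (\<lambda>x. ball Y (\<lambda>y. ball Y (\<lambda>y'. mp g x y \<sqinter> mp g x y' \<rightarrow> eq y y')))"
    unfolding fn_def by simp
  then have "\<forall>w1\<ge>w. \<forall>x. w1 \<Turnstile> mem x X \<longrightarrow> (\<forall>w2\<ge>w1. \<forall>y. w2 \<Turnstile> mem y Y \<longrightarrow> (\<forall>w3\<ge>w2. \<forall>y'. w3 \<Turnstile> mem y' Y \<longrightarrow>
      (\<forall>w4\<ge>w3. w4 \<Turnstile> mp g x y \<and> w4 \<Turnstile> mp g x y' \<longrightarrow> w4 \<Turnstile> eq y y')))"
    by simp
  note this[THEN spec, THEN mp, OF order_refl, THEN spec, THEN mp, OF fn_mem(1)[OF assms(1,2)],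
      THEN spec, THEN mp, OF order_refl, THEN spec, THEN mp, OF fn_mem(2)[OF assms(1,2)],
      THEN spec, THEN mp, OF order_refl, THEN spec, THEN mp, OF fn_mem(2)[OF assms(1,3)],
      THEN spec, THEN mp, OF order_refl]
  with assms(2,3) show ?thesis by blast
qed

lemma fnI:
  assumes "w \<Turnstile> ex g" "w \<Turnstile> ex X" "w \<Turnstile> ex Y"
    and "\<And>w' p. w \<le> w' \<Longrightarrow> w' \<Turnstile> mem p g \<Longrightarrow> \<exists>x y. w' \<Turnstile> mem x X \<and> w' \<Turnstile> mem y Y \<and> w' \<Turnstile> pr p x y"
    and "\<And>w' x. w \<le> w' \<Longrightarrow> w' \<Turnstile> mem x X \<Longrightarrow> \<exists>y. w' \<Turnstile> mem y Y \<and> w' \<Turnstile> mp g x y"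
    and uniq: "\<And>w' x y y'. w \<le> w' \<Longrightarrow> w' \<Turnstile> mem x X \<Longrightarrow> w' \<Turnstile> mp g x y \<Longrightarrow> w' \<Turnstile> mp g x y' \<Longrightarrow> w' \<Turnstile> eq y y'"
  shows "w \<Turnstile> fn g X Y"
proof -
  have "w \<Turnstile> ball X (\<lambda>x. ball Y (\<lambda>y. ball Y (\<lambda>y'. mp g x y \<sqinter> mp g x y' \<rightarrow> eq y y')))"
    unfolding holds_ball holds_imp holds_conj
  proof (intro allI impI)
    fix w1 x w2 y w3 y' w4
    assume le: "w \<le> w1" "w1 \<le> w2" "w2 \<le> w3" "w3 \<le> w4" and x: "w1 \<Turnstile> mem x X"
      and y: "w4 \<Turnstile> mp g x y \<and> w4 \<Turnstile> mp g x y'"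
    have "w1 \<le> w4" by (rule order_trans[OF le(2) order_trans[OF le(3,4)]])
    with uniq[OF order_trans[OF le(1) this] up[OF x this]] y show "w4 \<Turnstile> eq y y'" by blast
  qed
  with assms(1-5) show ?thesis unfolding fn_def by simp
qed

text \<open>Only graphs are compared, so the codomains may differ. Each pair in one graph is matched
  with the value of the other function at the same argument.\<close>

lemma fn_ext:
  assumes g: "w \<Turnstile> fn g X Y" and g': "w \<Turnstile> fn g' X Y'"
    and agree: "\<And>w' x y y'. w \<le> w' \<Longrightarrow> w' \<Turnstile> mp g x y \<Longrightarrow> w' \<Turnstile> mp g' x y' \<Longrightarrow> w' \<Turnstile> eq y y'"
  shows "w \<Turnstile> eq g g'"
proof (rule extensionality[OF fn_ex(1)[OF g] fn_ex(1)[OF g']])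
  fix w' p assume le: "w \<le> w'"
  note G = up[OF g le] up[OF g' le]
  { assume p: "w' \<Turnstile> mem p g"
    from fn_pair[OF G(1) p] obtain x y where x: "w' \<Turnstile> mem x X" and pr: "w' \<Turnstile> pr p x y" by blast
    from fn_total[OF G(2) x] obtain y' where y': "w' \<Turnstile> mp g' x y'" by blast
    have "w' \<Turnstile> mp g x y" using p pr by (auto simp: mp_iff)
    from eq_sym[OF agree[OF le this y']] mp_cong[OF y' eq_refl[OF mem_ex1[OF x]]]
    show "w' \<Turnstile> mem p g'" using mp_mem pr by blast }
  { assume p: "w' \<Turnstile> mem p g'"
    from fn_pair[OF G(2) p] obtain x y where x: "w' \<Turnstile> mem x X" and pr: "w' \<Turnstile> pr p x y" by blast
    from fn_total[OF G(1) x] obtain y' where y': "w' \<Turnstile> mp g x y'" by blast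
    have "w' \<Turnstile> mp g' x y" using p pr by (auto simp: mp_iff)
    from agree[OF le y' this] mp_cong[OF y' eq_refl[OF mem_ex1[OF x]]]
    show "w' \<Turnstile> mem p g" using mp_mem pr by blast }
qed

section \<open>Sets from comprehension\<close>

text \<open>Says that the class given by \<psi> is the set Q. Separation provides this for a bounded
  condition, and \<open>cmp_cong\<close> carries it over to an equivalent unbounded one.\<close>

definition cmp :: "nat \<Rightarrow> (nat \<Rightarrow> pv) \<Rightarrow> pv" where
  "cmp Q \<psi> = (ex Q \<sqinter> all (\<lambda>z. iff (mem z Q) (\<psi> z)))"

lemma dfn_cmp [dfn_intros]:
  assumes "term_at w t" "dfn False w (\<lambda>e. \<psi> (e 0) (\<lambda>i. e (Suc i)))"
  shows "dfn False w (\<lambda>e. cmp (t e) (\<lambda>z. \<psi> z e))"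
  unfolding cmp_def by (intro dfn_intros assms assms(1)[THEN term_shift])

lemma cmpI:
  assumes "w \<Turnstile> ex Q" "\<And>w' z. w \<le> w' \<Longrightarrow> w' \<Turnstile> ex z \<Longrightarrow> w' \<Turnstile> mem z Q \<longleftrightarrow> w' \<Turnstile> \<psi> z"
  shows "w \<Turnstile> cmp Q \<psi>"
  unfolding cmp_def holds_conj holds_all holds_iff
proof (intro HOL.conjI allI impI)
  fix w1 z w2 assume "w \<le> w1" "w1 \<Turnstile> ex z" "w1 \<le> w2"
  then show "w2 \<Turnstile> mem z Q \<longleftrightarrow> w2 \<Turnstile> \<psi> z"
    by (intro assms(2) order_trans[of w w1 w2] up[of w1 _ w2])
qed (rule assms(1))

lemma cmp_ex: "w \<Turnstile> cmp Q \<psi> \<Longrightarrow> w \<Turnstile> ex Q"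
  by (simp add: cmp_def)

lemma cmpD:
  assumes "w \<Turnstile> cmp Q \<psi>" "w \<le> w'"
  shows "w' \<Turnstile> mem z Q \<longleftrightarrow> w' \<Turnstile> ex z \<and> w' \<Turnstile> \<psi> z"
  using up[OF assms] mem_ex1[of w' z Q] order_refl[of w'] unfolding cmp_def holds_conj holds_all holds_iff by blast

lemma cmp_mem: "w \<Turnstile> cmp Q \<psi> \<Longrightarrow> w \<Turnstile> mem z Q \<longleftrightarrow> w \<Turnstile> ex z \<and> w \<Turnstile> \<psi> z"
  by (rule cmpD[OF _ order_refl])

lemma cmp_unique: "w \<Turnstile> cmp Q \<psi> \<Longrightarrow> w \<Turnstile> cmp Q' \<psi> \<Longrightarrow> w \<Turnstile> eq Q Q'"
  by (rule extensionality) (simp_all add: cmpD cmp_ex)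

lemma cmp_cong:
  assumes "w \<Turnstile> cmp Q \<psi>" "\<And>w' z. w \<le> w' \<Longrightarrow> w' \<Turnstile> ex z \<Longrightarrow> w' \<Turnstile> \<psi> z \<longleftrightarrow> w' \<Turnstile> \<psi>' z"
  shows "w \<Turnstile> cmp Q \<psi>'"
  by (rule cmpI[OF cmp_ex[OF assms(1)]]) (use cmpD[OF assms(1)] assms(2) in blast)

lemma cmp_separation:
  assumes "dfn True w (\<lambda>e. P (e 0))" and "w \<Turnstile> ex a"
  shows "\<exists>Q. w \<Turnstile> cmp Q (\<lambda>z. mem z a \<sqinter> P z)"
proof -
  obtain b where "w \<Turnstile> ex b" "\<And>w' x. w \<le> w' \<Longrightarrow> w' \<Turnstile> mem x b \<longleftrightarrow> w' \<Turnstile> mem x a \<and> w' \<Turnstile> P x"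
    using separation[OF assms] by blast
  then show ?thesis by (intro exI[of _ b] cmpI) simp_all
qed

text \<open>Replacement. Strong collection yields a set that contains some image of every x and
  nothing but images; since images are unique up to equality, it contains all of them.\<close>

lemma image_set:
  assumes dfn: "dfn b w (\<lambda>e. P (e 0) (e (Suc 0)))" and a: "w \<Turnstile> ex a"
    and total: "\<And>w' x. w \<le> w' \<Longrightarrow> w' \<Turnstile> mem x a \<Longrightarrow> \<exists>y. w' \<Turnstile> ex y \<and> w' \<Turnstile> P x y"
    and uniq: "\<And>w' x y y'. w \<le> w' \<Longrightarrow> w' \<Turnstile> mem x a \<Longrightarrow> w' \<Turnstile> ex y \<Longrightarrow> w' \<Turnstile> P x y \<Longrightarrow>
      w' \<Turnstile> ex y' \<Longrightarrow> w' \<Turnstile> P x y' \<Longrightarrow> w' \<Turnstile> eq y y'"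
  shows "\<exists>c. w \<Turnstile> cmp c (\<lambda>y. bex a (\<lambda>x. P x y))"
proof -
  obtain c where c: "w \<Turnstile> ex c"
    "\<And>w' x. w \<le> w' \<Longrightarrow> w' \<Turnstile> mem x a \<Longrightarrow> \<exists>y. w' \<Turnstile> mem y c \<and> w' \<Turnstile> P x y"
    "\<And>w' y. w \<le> w' \<Longrightarrow> w' \<Turnstile> mem y c \<Longrightarrow> \<exists>x. w' \<Turnstile> mem x a \<and> w' \<Turnstile> P x y"
    using strong_collection[OF dfn a total] by blast
  have "w \<Turnstile> cmp c (\<lambda>y. bex a (\<lambda>x. P x y))"
  proof (rule cmpI[OF c(1)])
    fix w' y assume le: "w \<le> w'" and y: "w' \<Turnstile> ex y"
    show "w' \<Turnstile> mem y c \<longleftrightarrow> w' \<Turnstile> bex a (\<lambda>x. P x y)"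
    proof
      assume "w' \<Turnstile> mem y c"
      with c(3)[OF le] show "w' \<Turnstile> bex a (\<lambda>x. P x y)" by simp
    next
      assume "w' \<Turnstile> bex a (\<lambda>x. P x y)"
      then obtain x where x: "w' \<Turnstile> mem x a" "w' \<Turnstile> P x y" by auto
      from c(2)[OF le x(1)] obtain y' where y': "w' \<Turnstile> mem y' c" "w' \<Turnstile> P x y'" by blast
      from uniq[OF le x(1) mem_ex1[OF y'(1)] y'(2) y x(2)] y'(1) show "w' \<Turnstile> mem y c"
        by (rule mem_cong1)
    qed
  qed
  then show ?thesis ..
qed

text \<open>Lets the rules for definability treat a predicate variable whose arguments are terms of
  a longer environment, for instance below further quantifiers.\<close>

lemma dfn_subst2:
  assumes dfn: "dfn b w (\<lambda>e. P (e 0) (e (Suc 0)))" and s: "term_at w s" and t: "term_at w t"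
  shows "dfn b w (\<lambda>e. P (s e) (t e))"
proof -
  obtain \<phi> r where 1: "b \<longrightarrow> bounded \<phi>" "\<forall>i. term_at w (r i)"
    "\<forall>w'\<ge>w. \<forall>e. ok w' e \<longrightarrow> (w' \<Turnstile> P (e 0) (e (Suc 0)) \<longleftrightarrow> w' \<Turnstile> sem (\<lambda>i. r i e) \<phi>)"
    using dfn unfolding dfn_def by blast
  have ok: "w' \<Turnstile> ex (t e)" if "w \<le> w'" "ok w' e" "term_at w t" for w' e t
    using that up unfolding term_at_def ok_def by blast
  let ?e = "\<lambda>e :: nat \<Rightarrow> nat. case_nat (s e) (\<lambda>_. t e)"
  have "\<forall>l. term_at w (\<lambda>e. r l (?e e))"
  proof
    fix l
    from 1(2) consider k where "r l = (\<lambda>e. e k)" | c where "w \<Turnstile> ex c" "r l = (\<lambda>e. c)"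
      unfolding term_at_def by blast
    then show "term_at w (\<lambda>e. r l (?e e))"
    proof cases
      case (1 k)
      then show ?thesis using s t by (cases k) simp_all
    next
      case (2 c)
      then show ?thesis by (simp add: term_const)
    qed
  qed
  moreover have "w' \<Turnstile> P (s e) (t e) \<longleftrightarrow> w' \<Turnstile> sem (\<lambda>l. r l (?e e)) \<phi>" if "w \<le> w'" "ok w' e" for w' e
  proof -
    have "ok w' (?e e)" using ok[OF that s] ok[OF that t] by (simp add: ok_def split: nat.split)
    with 1(3)[THEN spec, THEN mp, OF that(1), THEN spec, of "?e e"] show ?thesis by simp
  qed
  ultimately show ?thesis unfolding dfn_def
    by (intro exI[of _ \<phi>] exI[of _ "\<lambda>l e. r l (?e e)"]) (use 1(1) in simp)
qed

text \<open>Replacement applied to the map from x to the pair of x and its value. No codomain is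
  required, and recursion with sets as values relies on this.\<close>

lemma graph_set:
  assumes dfn: "dfn False w (\<lambda>e. P (e 0) (e (Suc 0)))" and a: "w \<Turnstile> ex a"
    and total: "\<And>w' x. w \<le> w' \<Longrightarrow> w' \<Turnstile> mem x a \<Longrightarrow> \<exists>y. w' \<Turnstile> ex y \<and> w' \<Turnstile> P x y"
    and uniq: "\<And>w' x y y'. w \<le> w' \<Longrightarrow> w' \<Turnstile> mem x a \<Longrightarrow> w' \<Turnstile> ex y \<Longrightarrow> w' \<Turnstile> P x y \<Longrightarrow>
      w' \<Turnstile> ex y' \<Longrightarrow> w' \<Turnstile> P x y' \<Longrightarrow> w' \<Turnstile> eq y y'"
  obtains h where "w \<Turnstile> ex h"
    "\<And>w' x y. w \<le> w' \<Longrightarrow> w' \<Turnstile> mp h x y \<longleftrightarrow> w' \<Turnstile> mem x a \<and> w' \<Turnstile> ex y \<and> w' \<Turnstile> P x y"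
    "\<And>w' p. w \<le> w' \<Longrightarrow> w' \<Turnstile> mem p h \<Longrightarrow> \<exists>x y. w' \<Turnstile> mem x a \<and> w' \<Turnstile> ex y \<and> w' \<Turnstile> P x y \<and> w' \<Turnstile> pr p x y"
proof -
  let ?P = "\<lambda>x p. exi (\<lambda>y. P x y \<sqinter> pr p x y)"
  have "\<exists>c. w \<Turnstile> cmp c (\<lambda>p. bex a (\<lambda>x. ?P x p))"
  proof (rule image_set[OF _ a])
    show "dfn False w (\<lambda>e. exi (\<lambda>y. P (e 0) y \<sqinter> pr (e (Suc 0)) (e 0) y))"
      by (intro dfn_intros dfn_subst2[OF dfn])
  next
    fix w' x assume le: "w \<le> w'" and x: "w' \<Turnstile> mem x a"
    from total[OF this] obtain y where y: "w' \<Turnstile> ex y" "w' \<Turnstile> P x y" by blast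
    from pr_exists[OF mem_ex1[OF x] y(1)] obtain p where p: "w' \<Turnstile> pr p x y" by blast
    show "\<exists>p. w' \<Turnstile> ex p \<and> w' \<Turnstile> ?P x p"
      unfolding holds_exi holds_conj using y p pr_ex(1)[OF p] by blast
  next
    fix w' x p q
    assume le: "w \<le> w'" and x: "w' \<Turnstile> mem x a" and P: "w' \<Turnstile> ?P x p" "w' \<Turnstile> ?P x q"
    then obtain y y' where y: "w' \<Turnstile> ex y" "w' \<Turnstile> P x y" "w' \<Turnstile> pr p x y"
      and y': "w' \<Turnstile> ex y'" "w' \<Turnstile> P x y'" "w' \<Turnstile> pr q x y'" by auto
    show "w' \<Turnstile> eq p q"
      by (rule pr_unique[OF y(3) y'(3) eq_refl[OF mem_ex1[OF x]] uniq[OF le x y(1,2) y'(1,2)]])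
  qed
  then obtain h where h: "w \<Turnstile> cmp h (\<lambda>p. bex a (\<lambda>x. ?P x p))" by blast
  show thesis
  proof (rule that[OF cmp_ex[OF h]])
    fix w' p assume "w \<le> w'" "w' \<Turnstile> mem p h"
    then show "\<exists>x y. w' \<Turnstile> mem x a \<and> w' \<Turnstile> ex y \<and> w' \<Turnstile> P x y \<and> w' \<Turnstile> pr p x y"
      using cmpD[OF h] by auto
  next
    fix w' x y assume le: "w \<le> w'"
    show "w' \<Turnstile> mp h x y \<longleftrightarrow> w' \<Turnstile> mem x a \<and> w' \<Turnstile> ex y \<and> w' \<Turnstile> P x y"
    proof
      assume "w' \<Turnstile> mp h x y"
      then obtain p where "w' \<Turnstile> mem p h" and p: "w' \<Turnstile> pr p x y" by (auto simp: mp_iff)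
      then obtain x' y' where x': "w' \<Turnstile> mem x' a" "w' \<Turnstile> P x' y'" "w' \<Turnstile> pr p x' y'"
        using cmpD[OF h le] by auto
      note E = pr_inject[OF x'(3) p]
      from dfn_cong2[OF dfn_up[OF dfn le] E x'(2)] mem_cong1[OF E(1) x'(1)] eq_ex2[OF E(2)]
      show "w' \<Turnstile> mem x a \<and> w' \<Turnstile> ex y \<and> w' \<Turnstile> P x y" by blast
    next
      assume *: "w' \<Turnstile> mem x a \<and> w' \<Turnstile> ex y \<and> w' \<Turnstile> P x y"
      then obtain p where p: "w' \<Turnstile> pr p x y" using pr_exists mem_ex1 by blast
      have "w' \<Turnstile> mem p h"
        unfolding cmpD[OF h le] holds_bex holds_exi holds_conj using * p pr_ex(1)[OF p] by blast
      with p show "w' \<Turnstile> mp h x y" by (auto simp: mp_iff)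
    qed
  qed
qed

lemma function_set:
  assumes dfn: "dfn False w (\<lambda>e. P (e 0) (e (Suc 0)))" and X: "w \<Turnstile> ex X" and Y: "w \<Turnstile> ex Y"
    and total: "\<And>w' x. w \<le> w' \<Longrightarrow> w' \<Turnstile> mem x X \<Longrightarrow> \<exists>y. w' \<Turnstile> mem y Y \<and> w' \<Turnstile> P x y"
    and uniq: "\<And>w' x y y'. w \<le> w' \<Longrightarrow> w' \<Turnstile> mem x X \<Longrightarrow> w' \<Turnstile> ex y \<Longrightarrow> w' \<Turnstile> P x y \<Longrightarrow>
      w' \<Turnstile> ex y' \<Longrightarrow> w' \<Turnstile> P x y' \<Longrightarrow> w' \<Turnstile> eq y y'"
  shows "\<exists>h. w \<Turnstile> fn h X Y \<and>
    (\<forall>w'\<ge>w. \<forall>x y. w' \<Turnstile> mp h x y \<longleftrightarrow> w' \<Turnstile> mem x X \<and> w' \<Turnstile> ex y \<and> w' \<Turnstile> P x y)"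
proof -
  have total': "\<exists>y. w' \<Turnstile> ex y \<and> w' \<Turnstile> P x y" if "w \<le> w'" "w' \<Turnstile> mem x X" for w' x
    using total[OF that] mem_ex1 by blast
  have inY: "w' \<Turnstile> mem y Y" if "w \<le> w'" "w' \<Turnstile> mem x X" "w' \<Turnstile> ex y" "w' \<Turnstile> P x y" for w' x y
  proof -
    from total[OF that(1,2)] obtain y' where y': "w' \<Turnstile> mem y' Y" "w' \<Turnstile> P x y'" by blast
    from uniq[OF that(1,2) mem_ex1[OF y'(1)] y'(2) that(3,4)] y'(1) show ?thesis by (rule mem_cong1)
  qed
  show ?thesis
  proof (rule graph_set[OF dfn X total' uniq])
    fix h
    assume h: "w \<Turnstile> ex h"
      "\<And>w' x y. w \<le> w' \<Longrightarrow> w' \<Turnstile> mp h x y \<longleftrightarrow> w' \<Turnstile> mem x X \<and> w' \<Turnstile> ex y \<and> w' \<Turnstile> P x y"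
      "\<And>w' p. w \<le> w' \<Longrightarrow> w' \<Turnstile> mem p h \<Longrightarrow> \<exists>x y. w' \<Turnstile> mem x X \<and> w' \<Turnstile> ex y \<and> w' \<Turnstile> P x y \<and> w' \<Turnstile> pr p x y"
    have "w \<Turnstile> fn h X Y"
    proof (rule fnI[OF h(1) X Y])
      fix w' p assume le: "w \<le> w'" and "w' \<Turnstile> mem p h"
      from h(3)[OF this] inY[OF le] show "\<exists>x y. w' \<Turnstile> mem x X \<and> w' \<Turnstile> mem y Y \<and> w' \<Turnstile> pr p x y" by blast
    next
      fix w' x assume le: "w \<le> w'" and x: "w' \<Turnstile> mem x X"
      with total[OF this] h(2)[OF le] mem_ex1 show "\<exists>y. w' \<Turnstile> mem y Y \<and> w' \<Turnstile> mp h x y" by blast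
    next
      fix w' x y y' assume le: "w \<le> w'" and x: "w' \<Turnstile> mem x X" and "w' \<Turnstile> mp h x y" "w' \<Turnstile> mp h x y'"
      then show "w' \<Turnstile> eq y y'" using uniq[OF le x] unfolding h(2)[OF le] by blast
    qed
    with h(2) show ?thesis by blast
  qed
qed

text \<open>Replacement collects the sets given by the conditions \<psi> x, and the union axiom
  merges them.\<close>

lemma union_family:
  assumes dfn: "dfn False w (\<lambda>e. all (\<lambda>z. iff (mem z (e (Suc 0))) (\<psi> (e 0) z)))" and a: "w \<Turnstile> ex a"
    and set: "\<And>w' x. w \<le> w' \<Longrightarrow> w' \<Turnstile> mem x a \<Longrightarrow> \<exists>Q. w' \<Turnstile> cmp Q (\<psi> x)"
  shows "\<exists>U. w \<Turnstile> cmp U (\<lambda>z. bex a (\<lambda>x. \<psi> x z))"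
proof -
  have "\<exists>c. w \<Turnstile> cmp c (\<lambda>Q. bex a (\<lambda>x. cmp Q (\<psi> x)))"
  proof (rule image_set[OF _ a])
    show "dfn False w (\<lambda>e. cmp (e (Suc 0)) (\<psi> (e 0)))"
      unfolding cmp_def by (intro dfn_intros dfn)
    show "\<exists>Q. w' \<Turnstile> ex Q \<and> w' \<Turnstile> cmp Q (\<psi> x)" if "w \<le> w'" "w' \<Turnstile> mem x a" for w' x
      using set[OF that] cmp_ex by blast
  qed (rule cmp_unique)
  then obtain c where c: "w \<Turnstile> cmp c (\<lambda>Q. bex a (\<lambda>x. cmp Q (\<psi> x)))" by blast
  obtain U where U: "w \<Turnstile> ex U" "\<And>w' z. w \<le> w' \<Longrightarrow> w' \<Turnstile> mem z U \<longleftrightarrow> (\<exists>u. w' \<Turnstile> mem u c \<and> w' \<Turnstile> mem z u)"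
    using union_exists[OF cmp_ex[OF c]] by blast
  have "w \<Turnstile> cmp U (\<lambda>z. bex a (\<lambda>x. \<psi> x z))"
  proof (rule cmpI[OF U(1)])
    fix w' z assume le: "w \<le> w'" and z: "w' \<Turnstile> ex z"
    show "w' \<Turnstile> mem z U \<longleftrightarrow> w' \<Turnstile> bex a (\<lambda>x. \<psi> x z)"
    proof
      assume "w' \<Turnstile> mem z U"
      then obtain Q x where "w' \<Turnstile> mem z Q" "w' \<Turnstile> mem x a" "w' \<Turnstile> cmp Q (\<psi> x)"
        unfolding U(2)[OF le] cmpD[OF c le] by auto
      then show "w' \<Turnstile> bex a (\<lambda>x. \<psi> x z)" using cmp_mem by auto
    next
      assume "w' \<Turnstile> bex a (\<lambda>x. \<psi> x z)"
      then obtain x where x: "w' \<Turnstile> mem x a" "w' \<Turnstile> \<psi> x z" by auto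
      from set[OF le x(1)] obtain Q where Q: "w' \<Turnstile> cmp Q (\<psi> x)" by blast
      with x z have "w' \<Turnstile> mem z Q" using cmp_mem by blast
      moreover have "w' \<Turnstile> mem Q c" unfolding cmpD[OF c le] using cmp_ex[OF Q] Q x by auto
      ultimately show "w' \<Turnstile> mem z U" unfolding U(2)[OF le] by blast
    qed
  qed
  then show ?thesis ..
qed

section \<open>Products, exponentials and composites\<close>

definition prod_of :: "nat \<Rightarrow> nat \<Rightarrow> nat \<Rightarrow> pv" where
  "prod_of a b p = bex a (\<lambda>x. bex b (\<lambda>y. pr p x y))"

text \<open>In place of power sets, the product is formed as the union over x of the images of b
  under pairing with x.\<close>

lemma product_set:
  assumes a: "w \<Turnstile> ex a" and b: "w \<Turnstile> ex b"
  shows "\<exists>Q. w \<Turnstile> cmp Q (prod_of a b)"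
proof -
  have "\<exists>U. w \<Turnstile> cmp U (\<lambda>p. bex a (\<lambda>x. bex b (\<lambda>y. pr p x y)))"
  proof (rule union_family[OF _ a])
    show "dfn False w (\<lambda>e. all (\<lambda>z. iff (mem z (e (Suc 0))) (bex b (\<lambda>y. pr z (e 0) y))))"
      by (intro dfn_intros b)
    fix w' x assume le: "w \<le> w'" and x: "w' \<Turnstile> mem x a"
    note x' = mem_ex1[OF x]
    show "\<exists>Q. w' \<Turnstile> cmp Q (\<lambda>p. bex b (\<lambda>y. pr p x y))"
    proof (rule image_set[OF _ up[OF b le]])
      show "dfn False w' (\<lambda>e. pr (e (Suc 0)) x (e 0))" by (intro dfn_intros x')
      show "\<exists>p. w'' \<Turnstile> ex p \<and> w'' \<Turnstile> pr p x y" if "w' \<le> w''" "w'' \<Turnstile> mem y b" for w'' y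
        using pr_exists[OF up[OF x' that(1)] mem_ex1[OF that(2)]] pr_ex by blast
    qed (rule pr_unique, assumption, assumption, simp_all add: eq_refl pr_ex)
  qed
  then show ?thesis unfolding prod_of_def[abs_def] .
qed

text \<open>Subset collection is applied with the graph itself as the parameter u and with pairs as
  values. It yields a set c that contains every function from a to b, and separation by the bounded
  condition \<open>fn\<close> removes the rest.\<close>

lemma exponential:
  assumes a: "w \<Turnstile> ex a" and b: "w \<Turnstile> ex b"
  shows "\<exists>C. w \<Turnstile> cmp C (\<lambda>g. fn g a b)"
proof -
  obtain Z where Z: "w \<Turnstile> cmp Z (prod_of a b)" using product_set[OF a b] by blast
  \<comment> \<open>The formula says that y belongs to u and is a pair with first component x. For a
    function u there is exactly one such y for each x.\<close>
  have dfn: "dfn False w (\<lambda>e. mem (e (Suc 0)) (e (Suc (Suc 0))) \<sqinter> exi (\<lambda>y. pr (e (Suc 0)) (e 0) y))"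
    by (intro dfn_intros)
  obtain c where c: "w \<Turnstile> ex c" and c2:
    "\<And>w' u. w \<le> w' \<Longrightarrow> w' \<Turnstile> ex u \<Longrightarrow>
      (\<And>w'' x. w' \<le> w'' \<Longrightarrow> w'' \<Turnstile> mem x a \<Longrightarrow> \<exists>y. w'' \<Turnstile> mem y Z \<and> w'' \<Turnstile> (mem y u \<sqinter> exi (\<lambda>z. pr y x z))) \<Longrightarrow>
      \<exists>d. w' \<Turnstile> mem d c \<and> (\<forall>w''\<ge>w'. \<forall>x. w'' \<Turnstile> mem x a \<longrightarrow> (\<exists>y. w'' \<Turnstile> mem y d \<and> w'' \<Turnstile> (mem y u \<sqinter> exi (\<lambda>z. pr y x z)))) \<and>
        (\<forall>w''\<ge>w'. \<forall>y. w'' \<Turnstile> mem y d \<longrightarrow> (\<exists>x. w'' \<Turnstile> mem x a \<and> w'' \<Turnstile> (mem y u \<sqinter> exi (\<lambda>z. pr y x z))))"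
    by (rule subset_collection[OF dfn a cmp_ex[OF Z]]) blast
  have in_c: "w' \<Turnstile> mem g c" if le: "w \<le> w'" and g: "w' \<Turnstile> fn g a b" for w' g
  proof -
    have "\<exists>y. w'' \<Turnstile> mem y Z \<and> w'' \<Turnstile> (mem y g \<sqinter> exi (\<lambda>z. pr y x z))" if le': "w' \<le> w''" and x: "w'' \<Turnstile> mem x a" for w'' x
    proof -
      from fn_total[OF up[OF g le'] x] obtain y where y: "w'' \<Turnstile> mem y b" "w'' \<Turnstile> mp g x y" by blast
      then obtain p where p: "w'' \<Turnstile> mem p g" "w'' \<Turnstile> pr p x y" by (auto simp: mp_iff)
      have "w'' \<Turnstile> mem p Z"
        unfolding cmpD[OF Z order_trans[OF le le']] prod_of_def using mem_ex1[OF p(1)] x y p by auto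
      with p pr_ex(3)[OF p(2)] show ?thesis by auto
    qed
    from c2[OF le fn_ex(1)[OF g] this] obtain d where d: "w' \<Turnstile> mem d c"
      "\<forall>w''\<ge>w'. \<forall>x. w'' \<Turnstile> mem x a \<longrightarrow> (\<exists>y. w'' \<Turnstile> mem y d \<and> w'' \<Turnstile> (mem y g \<sqinter> exi (\<lambda>z. pr y x z)))"
      "\<forall>w''\<ge>w'. \<forall>y. w'' \<Turnstile> mem y d \<longrightarrow> (\<exists>x. w'' \<Turnstile> mem x a \<and> w'' \<Turnstile> (mem y g \<sqinter> exi (\<lambda>z. pr y x z)))"
      by blast
    \<comment> \<open>The set d is contained in g and has a pair over every x. As g is
      single-valued, nothing of g is missing from d.\<close>
    have "w' \<Turnstile> eq d g"
    proof (rule extensionality[OF mem_ex1[OF d(1)] fn_ex(1)[OF g]])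
      fix w'' p assume le': "w' \<le> w''"
      { assume "w'' \<Turnstile> mem p d" with d(3) le' show "w'' \<Turnstile> mem p g" by auto }
      { assume p: "w'' \<Turnstile> mem p g"
        from fn_pair[OF up[OF g le'] p] obtain x y where x: "w'' \<Turnstile> mem x a" "w'' \<Turnstile> pr p x y" by blast
        from d(2) le' x(1) obtain q where "w'' \<Turnstile> mem q d" "w'' \<Turnstile> (mem q g \<sqinter> exi (\<lambda>z. pr q x z))" by blast
        then obtain z where q: "w'' \<Turnstile> mem q d" "w'' \<Turnstile> mem q g" "w'' \<Turnstile> pr q x z" by auto
        have "w'' \<Turnstile> eq z y"
          by (rule fn_unique[OF up[OF g le']]) (use p x q in \<open>auto simp: mp_iff\<close>)
        from pr_unique[OF q(3) x(2) eq_refl[OF mem_ex1[OF x(1)]] this] q(1)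
        show "w'' \<Turnstile> mem p d" by (rule mem_cong1) }
    qed
    from mem_cong1[OF this d(1)] show ?thesis .
  qed
  have "dfn True w (\<lambda>e. fn (e 0) a b)" by (intro dfn_intros a b)
  from cmp_separation[OF this c] obtain C where "w \<Turnstile> cmp C (\<lambda>g. mem g c \<sqinter> fn g a b)" by blast
  then have "w \<Turnstile> cmp C (\<lambda>g. fn g a b)"
    by (rule cmp_cong) (use in_c in auto)
  then show ?thesis ..
qed

text \<open>The components x and y belong to the unordered pair of x and y, which belongs to the
  ordered pair. Two unions of g therefore suffice.\<close>

lemma field_set:
  assumes "w \<Turnstile> ex g"
  obtains M where "w \<Turnstile> ex M" "\<And>w' x y. w \<le> w' \<Longrightarrow> w' \<Turnstile> mp g x y \<Longrightarrow> w' \<Turnstile> mem x M \<and> w' \<Turnstile> mem y M"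
proof -
  obtain N where N: "w \<Turnstile> ex N" "\<And>w' z. w \<le> w' \<Longrightarrow> w' \<Turnstile> mem z N \<longleftrightarrow> (\<exists>u. w' \<Turnstile> mem u g \<and> w' \<Turnstile> mem z u)"
    using union_exists[OF assms] by blast
  obtain M where M: "w \<Turnstile> ex M" "\<And>w' z. w \<le> w' \<Longrightarrow> w' \<Turnstile> mem z M \<longleftrightarrow> (\<exists>u. w' \<Turnstile> mem u N \<and> w' \<Turnstile> mem z u)"
    using union_exists[OF N(1)] by blast
  show thesis
  proof (rule that[OF M(1)])
    fix w' x y assume le: "w \<le> w'" and "w' \<Turnstile> mp g x y"
    then obtain p where p: "w' \<Turnstile> mem p g" "w' \<Turnstile> pr p x y" by (auto simp: mp_iff)
    then obtain s where s: "w' \<Turnstile> mem s p" "w' \<Turnstile> upr s x y" by (auto simp: pr_def)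
    then show "w' \<Turnstile> mem x M \<and> w' \<Turnstile> mem y M"
      unfolding M(2)[OF le] N(2)[OF le] using p(1) uprD(4,5)[OF s(2)] by blast
  qed
qed

definition comp :: "nat \<Rightarrow> nat \<Rightarrow> nat \<Rightarrow> pv" where
  "comp h k g = cmp h (\<lambda>p. exi (\<lambda>x. exi (\<lambda>y. exi (\<lambda>z. mp g x y \<sqinter> mp k y z \<sqinter> pr p x z))))"

lemma dfn_comp [dfn_intros]:
  assumes "term_at w h" "term_at w k" "term_at w g"
  shows "dfn False w (\<lambda>e. comp (h e) (k e) (g e))"
  unfolding comp_def
  by (intro dfn_intros assms assms[THEN term_shift, THEN term_shift, THEN term_shift, THEN term_shift])

text \<open>The quantifiers of \<open>comp\<close> are unbounded. The fields of the two graphs bound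
  them, and the product of these fields contains the composite.\<close>

lemma comp_exists:
  assumes k: "w \<Turnstile> ex k" and g: "w \<Turnstile> ex g"
  shows "\<exists>h. w \<Turnstile> comp h k g"
proof -
  obtain M where M: "w \<Turnstile> ex M" "\<And>w' x y. w \<le> w' \<Longrightarrow> w' \<Turnstile> mp g x y \<Longrightarrow> w' \<Turnstile> mem x M \<and> w' \<Turnstile> mem y M"
    by (rule field_set[OF g]) blast
  obtain N where N: "w \<Turnstile> ex N" "\<And>w' x y. w \<le> w' \<Longrightarrow> w' \<Turnstile> mp k x y \<Longrightarrow> w' \<Turnstile> mem x N \<and> w' \<Turnstile> mem y N"
    by (rule field_set[OF k]) blast
  obtain Z where Z: "w \<Turnstile> cmp Z (prod_of M N)" using product_set[OF M(1) N(1)] by blast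
  have "dfn True w (\<lambda>e. bex M (\<lambda>x. bex M (\<lambda>y. bex N (\<lambda>z. mp g x y \<sqinter> mp k y z \<sqinter> pr (e 0) x z))))"
    by (intro dfn_intros M(1) N(1) k g)
  from cmp_separation[OF this cmp_ex[OF Z]] obtain h where
    h: "w \<Turnstile> cmp h (\<lambda>p. mem p Z \<sqinter> bex M (\<lambda>x. bex M (\<lambda>y. bex N (\<lambda>z. mp g x y \<sqinter> mp k y z \<sqinter> pr p x z))))"
    by blast
  have "w \<Turnstile> comp h k g" unfolding comp_def
  proof (rule cmp_cong[OF h])
    fix w' p assume le: "w \<le> w'" and p: "w' \<Turnstile> ex p"
    show "w' \<Turnstile> (mem p Z \<sqinter> bex M (\<lambda>x. bex M (\<lambda>y. bex N (\<lambda>z. mp g x y \<sqinter> mp k y z \<sqinter> pr p x z)))) \<longleftrightarrow>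
      w' \<Turnstile> exi (\<lambda>x. exi (\<lambda>y. exi (\<lambda>z. mp g x y \<sqinter> mp k y z \<sqinter> pr p x z)))" (is "?L \<longleftrightarrow> ?R")
    proof
      assume ?L
      then obtain x y z where *: "w' \<Turnstile> mp g x y" "w' \<Turnstile> mp k y z" "w' \<Turnstile> pr p x z" by auto
      then show ?R unfolding holds_exi holds_conj using mp_ex(2,3) by blast
    next
      assume ?R
      then obtain x y z where *: "w' \<Turnstile> mp g x y" "w' \<Turnstile> mp k y z" "w' \<Turnstile> pr p x z" by auto
      note m = M(2)[OF le *(1)] N(2)[OF le *(2)]
      have "w' \<Turnstile> mem p Z" unfolding cmpD[OF Z le] prod_of_def using p m *(3) by auto
      then show ?L unfolding holds_bex holds_conj using m * by blast
    qed
  qed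
  then show ?thesis ..
qed

lemma comp_ex: "w \<Turnstile> comp h k g \<Longrightarrow> w \<Turnstile> ex h"
  unfolding comp_def by (rule cmp_ex)

lemma comp_mp:
  assumes "w \<Turnstile> comp h k g" "w \<le> w'"
  shows "w' \<Turnstile> mp h x z \<longleftrightarrow> (\<exists>y. w' \<Turnstile> mp g x y \<and> w' \<Turnstile> mp k y z)"
proof
  assume "w' \<Turnstile> mp h x z"
  then obtain p where "w' \<Turnstile> mem p h" and p: "w' \<Turnstile> pr p x z" by (auto simp: mp_iff)
  then obtain x' y z' where *: "w' \<Turnstile> mp g x' y" "w' \<Turnstile> mp k y z'" "w' \<Turnstile> pr p x' z'"
    using cmpD[OF assms(1)[unfolded comp_def] assms(2)] by auto
  note E = pr_inject[OF *(3) p] eq_refl[OF mp_ex(3)[OF *(1)]]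
  from mp_cong[OF *(1) E(1,3)] mp_cong[OF *(2) E(3,2)] show "\<exists>y. w' \<Turnstile> mp g x y \<and> w' \<Turnstile> mp k y z" by blast
next
  assume "\<exists>y. w' \<Turnstile> mp g x y \<and> w' \<Turnstile> mp k y z"
  then obtain y where y: "w' \<Turnstile> mp g x y" "w' \<Turnstile> mp k y z" by blast
  from pr_exists[OF mp_ex(2)[OF y(1)] mp_ex(3)[OF y(2)]] obtain p where p: "w' \<Turnstile> pr p x z" by blast
  have "w' \<Turnstile> mem p h"
    unfolding cmpD[OF assms(1)[unfolded comp_def] assms(2)] holds_exi holds_conj
    using y p mp_ex(2,3)[OF y(1)] mp_ex(3)[OF y(2)] pr_ex(1)[OF p] by blast
  with p show "w' \<Turnstile> mp h x z" by (auto simp: mp_iff)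
qed

section \<open>Natural numbers and recursion\<close>

definition zero :: "nat \<Rightarrow> pv" where
  "zero z = (ex z \<sqinter> ball z (\<lambda>u. bot))"

text \<open>The von Neumann successor of m, stated with bounded quantifiers.\<close>

definition suc :: "nat \<Rightarrow> nat \<Rightarrow> pv" where
  "suc m n = (mem m n \<sqinter> ball m (\<lambda>u. mem u n) \<sqinter> ball n (\<lambda>u. mem u m \<squnion> eq u m))"

lemma dfn_zero [dfn_intros]:
  assumes "term_at w t"
  shows "dfn b w (\<lambda>e. zero (t e))"
  unfolding zero_def by (intro dfn_intros assms assms[THEN term_shift])

lemma dfn_suc [dfn_intros]:
  assumes "term_at w s" "term_at w t"
  shows "dfn b w (\<lambda>e. suc (s e) (t e))"
  unfolding suc_def by (intro dfn_intros assms assms[THEN term_shift])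

lemma bot_eq: "w \<Turnstile> bot \<Longrightarrow> w \<Turnstile> ex x \<Longrightarrow> w \<Turnstile> ex y \<Longrightarrow> w \<Turnstile> eq x y"
  by (rule dfn_bot_elim[where b = True]) (intro dfn_intros)

lemma bot_mem: "w \<Turnstile> bot \<Longrightarrow> w \<Turnstile> ex x \<Longrightarrow> w \<Turnstile> ex y \<Longrightarrow> w \<Turnstile> mem x y"
  by (rule dfn_bot_elim[where b = True]) (intro dfn_intros)

lemma zero_ex: "w \<Turnstile> zero z \<Longrightarrow> w \<Turnstile> ex z"
  by (simp add: zero_def)

lemma zeroD: "w \<Turnstile> zero z \<Longrightarrow> w \<Turnstile> mem u z \<Longrightarrow> w \<Turnstile> bot"
  unfolding zero_def holds_conj holds_ball using order_refl by blast

lemma zero_unique: "w \<Turnstile> zero z \<Longrightarrow> w \<Turnstile> zero z' \<Longrightarrow> w \<Turnstile> eq z z'"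
proof (rule extensionality)
  fix w' u
  assume z: "w \<Turnstile> zero z" "w \<Turnstile> zero z'" and le: "w \<le> w'"
  note Z = z[THEN up, OF le]
  { assume u: "w' \<Turnstile> mem u z"
    show "w' \<Turnstile> mem u z'" by (rule bot_mem[OF zeroD[OF Z(1) u] mem_ex1[OF u] zero_ex[OF Z(2)]]) }
  { assume u: "w' \<Turnstile> mem u z'"
    show "w' \<Turnstile> mem u z" by (rule bot_mem[OF zeroD[OF Z(2) u] mem_ex1[OF u] zero_ex[OF Z(1)]]) }
qed (rule zero_ex, assumption)+

lemma zero_cong: "w \<Turnstile> zero z \<Longrightarrow> w \<Turnstile> eq z z' \<Longrightarrow> w \<Turnstile> zero z'"
  by (rule dfn_cong[where P = zero and b = True]) (intro dfn_intros)

lemma suc_ex: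
  assumes "w \<Turnstile> suc m n"
  shows "w \<Turnstile> ex m" "w \<Turnstile> ex n"
  using assms by (auto simp: suc_def intro: mem_ex1 mem_ex2)

lemma sucD:
  assumes "w \<Turnstile> suc m n" "w \<le> w'"
  shows "w' \<Turnstile> mem u n \<longleftrightarrow> w' \<Turnstile> mem u m \<or> w' \<Turnstile> eq u m"
proof -
  from up[OF assms] have "w' \<Turnstile> mem m n" "w' \<Turnstile> mem u m \<Longrightarrow> w' \<Turnstile> mem u n"
    "w' \<Turnstile> mem u n \<Longrightarrow> w' \<Turnstile> mem u m \<or> w' \<Turnstile> eq u m"
    unfolding suc_def by simp_all
  then show ?thesis using mem_cong1 eq_sym by blast
qed

lemma sucI:
  assumes "w \<Turnstile> ex m" "\<And>w' u. w \<le> w' \<Longrightarrow> w' \<Turnstile> mem u n \<longleftrightarrow> w' \<Turnstile> mem u m \<or> w' \<Turnstile> eq u m"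
  shows "w \<Turnstile> suc m n"
  unfolding suc_def holds_conj holds_ball holds_disj using assms(2) eq_refl[OF assms(1)] order_refl[of w] by blast

lemma suc_unique:
  assumes "w \<Turnstile> suc m n" "w \<Turnstile> suc m n'"
  shows "w \<Turnstile> eq n n'"
  by (rule extensionality[OF suc_ex(2)[OF assms(1)] suc_ex(2)[OF assms(2)]])
    (simp_all add: sucD[OF assms(1)] sucD[OF assms(2)])

lemma suc_cong: "w \<Turnstile> suc m n \<Longrightarrow> w \<Turnstile> eq m m' \<Longrightarrow> w \<Turnstile> eq n n' \<Longrightarrow> w \<Turnstile> suc m' n'"
  by (rule dfn_cong2[where P = suc and b = True]) (intro dfn_intros)

lemma insert_exists:
  assumes h: "w \<Turnstile> ex h" and p: "w \<Turnstile> ex p"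
  obtains h' where "w \<Turnstile> ex h'" "\<And>w' q. w \<le> w' \<Longrightarrow> w' \<Turnstile> mem q h' \<longleftrightarrow> w' \<Turnstile> mem q h \<or> w' \<Turnstile> eq q p"
proof -
  obtain s where s: "w \<Turnstile> upr s p p" using upr_exists[OF p p] by blast
  obtain t where t: "w \<Turnstile> upr t h s" using upr_exists[OF h uprD(1)[OF s]] by blast
  obtain h' where h': "w \<Turnstile> ex h'" "\<And>w' z. w \<le> w' \<Longrightarrow> w' \<Turnstile> mem z h' \<longleftrightarrow> (\<exists>u. w' \<Turnstile> mem u t \<and> w' \<Turnstile> mem z u)"
    using union_exists[OF uprD(1)[OF t]] by blast
  show thesis
  proof (rule that[OF h'(1)])
    fix w' q assume le: "w \<le> w'"
    have "w' \<Turnstile> mem q h' \<longleftrightarrow> w' \<Turnstile> mem q h \<or> w' \<Turnstile> mem q s"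
      unfolding h'(2)[OF le] uprD(6)[OF t le]
      using mem_cong2 eq_refl[OF up[OF h le]] eq_refl[OF up[OF uprD(1)[OF s] le]] by blast
    then show "w' \<Turnstile> mem q h' \<longleftrightarrow> w' \<Turnstile> mem q h \<or> w' \<Turnstile> eq q p"
      unfolding uprD(6)[OF s le] by simp
  qed
qed

lemma suc_exists:
  assumes "w \<Turnstile> ex m"
  shows "\<exists>n. w \<Turnstile> suc m n"
  by (rule insert_exists[OF assms assms]) (use sucI[OF assms] in blast)

text \<open>Set induction on m: if n is a member of m and m of n, then the same cycle, seen from the
  member n of m, contradicts the induction hypothesis.\<close>

lemma no_membership_cycle:
  assumes "w \<Turnstile> mem n m" "w \<Turnstile> mem m n"
  shows "w \<Turnstile> bot"
proof -
  have "w \<Turnstile> all (\<lambda>n. mem n m \<sqinter> mem m n \<rightarrow> bot)"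
  proof (rule set_induction[OF _ _ mem_ex2[OF assms(1)]])
    show "dfn False w (\<lambda>e. all (\<lambda>n. mem n (e 0) \<sqinter> mem (e 0) n \<rightarrow> bot))" by (intro dfn_intros)
  next
    fix w' a
    assume IH: "\<And>w'' x. w' \<le> w'' \<Longrightarrow> w'' \<Turnstile> mem x a \<Longrightarrow> w'' \<Turnstile> all (\<lambda>n. mem n x \<sqinter> mem x n \<rightarrow> bot)"
    show "w' \<Turnstile> all (\<lambda>n. mem n a \<sqinter> mem a n \<rightarrow> bot)"
      unfolding holds_all holds_imp holds_conj
    proof (intro allI impI)
      fix w1 n w2 assume le: "w' \<le> w1" "w1 \<le> w2" and n: "w2 \<Turnstile> mem n a \<and> w2 \<Turnstile> mem a n"
      from IH[OF order_trans[OF le]] n have "w2 \<Turnstile> all (\<lambda>k. mem k n \<sqinter> mem n k \<rightarrow> bot)" by blast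
      with n mem_ex2 order_refl[of w2] show "w2 \<Turnstile> bot"
        unfolding holds_all holds_imp holds_conj by blast
    qed
  qed
  with assms mem_ex1[OF assms(1)] order_refl[of w] show ?thesis
    unfolding holds_all holds_imp holds_conj by blast
qed

text \<open>Both predecessors belong to n, so each is a member of the other or equal to it. Mutual
  membership is a cycle and gives \<open>bot\<close>, from which the equality follows because it is
  definable.\<close>

lemma suc_inject:
  assumes m: "w \<Turnstile> suc m n" and m': "w \<Turnstile> suc m' n"
  shows "w \<Turnstile> eq m m'"
proof -
  note E = eq_refl[OF suc_ex(1)[OF m]] eq_refl[OF suc_ex(1)[OF m']]
  have "w \<Turnstile> mem m m' \<or> w \<Turnstile> eq m m'"
    using sucD[OF m order_refl, of m] sucD[OF m' order_refl, of m] E by blast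
  moreover have "w \<Turnstile> mem m' m \<or> w \<Turnstile> eq m' m"
    using sucD[OF m order_refl, of m'] sucD[OF m' order_refl, of m'] E by blast
  ultimately show ?thesis
    using eq_sym no_membership_cycle bot_eq[OF _ suc_ex(1)[OF m] suc_ex(1)[OF m']] by blast
qed

lemma zero_suc: "w \<Turnstile> zero n \<Longrightarrow> w \<Turnstile> suc m n \<Longrightarrow> w \<Turnstile> bot"
  using zeroD sucD[OF _ order_refl] eq_refl suc_ex(1) by blast

text \<open>Besides closure, the decisive property is that every element is zero or the successor of
  an element. Induction follows from it by set induction.\<close>

definition omega :: "world \<Rightarrow> nat \<Rightarrow> bool" where
  "omega w W \<longleftrightarrow> w \<Turnstile> ex W \<and>
    (\<forall>w'\<ge>w. \<forall>z. w' \<Turnstile> zero z \<longrightarrow> w' \<Turnstile> mem z W) \<and>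
    (\<forall>w'\<ge>w. \<forall>m n. w' \<Turnstile> mem m W \<longrightarrow> w' \<Turnstile> suc m n \<longrightarrow> w' \<Turnstile> mem n W) \<and>
    (\<forall>w'\<ge>w. \<forall>n. w' \<Turnstile> mem n W \<longrightarrow> w' \<Turnstile> zero n \<or> (\<exists>m. w' \<Turnstile> mem m W \<and> w' \<Turnstile> suc m n)) \<and>
    (\<exists>z. w \<Turnstile> zero z)"

lemma omegaD:
  assumes "omega w W" "w \<le> w'"
  shows "w' \<Turnstile> ex W" "w' \<Turnstile> zero z \<Longrightarrow> w' \<Turnstile> mem z W"
    "w' \<Turnstile> mem m W \<Longrightarrow> w' \<Turnstile> suc m n \<Longrightarrow> w' \<Turnstile> mem n W"
    "w' \<Turnstile> mem n W \<Longrightarrow> w' \<Turnstile> zero n \<or> (\<exists>m. w' \<Turnstile> mem m W \<and> w' \<Turnstile> suc m n)"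
    "\<exists>z. w' \<Turnstile> zero z"
  using assms up unfolding omega_def by blast+

definition ind :: "nat \<Rightarrow> pv" where
  "ind a = (bex a zero \<sqinter> ball a (\<lambda>m. bex a (suc m)))"

lemma sem_is_inductive:
  assumes "ok w e" "wb n t"
  shows "w \<Turnstile> sem e (is_inductive t n) \<longleftrightarrow> w \<Turnstile> ind (e (t n))"
proof -
  have z: "(\<forall>w''\<ge>w'. \<forall>u. w'' \<Turnstile> ex u \<longrightarrow> (\<forall>w3\<ge>w''. w3 \<Turnstile> mem u z \<longrightarrow> w3 \<Turnstile> bot)) \<longleftrightarrow> w' \<Turnstile> zero z"
    if "w' \<Turnstile> mem z a" for w' z a
  proof
    assume *: "\<forall>w''\<ge>w'. \<forall>u. w'' \<Turnstile> ex u \<longrightarrow> (\<forall>w3\<ge>w''. w3 \<Turnstile> mem u z \<longrightarrow> w3 \<Turnstile> bot)"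
    show "w' \<Turnstile> zero z" unfolding zero_def holds_conj holds_ball
      using * mem_ex1 mem_ex1[OF that] order_refl by blast
  next
    assume "w' \<Turnstile> zero z"
    from zeroD[OF up[OF this]] show "\<forall>w''\<ge>w'. \<forall>u. w'' \<Turnstile> ex u \<longrightarrow> (\<forall>w3\<ge>w''. w3 \<Turnstile> mem u z \<longrightarrow> w3 \<Turnstile> bot)"
      using order_trans by blast
  qed
  have s: "(\<forall>w''\<ge>w'. \<forall>u. w'' \<Turnstile> ex u \<longrightarrow> (\<forall>w3\<ge>w''. w3 \<Turnstile> mem u n \<longleftrightarrow> w3 \<Turnstile> mem u m \<or> w3 \<Turnstile> eq u m)) \<longleftrightarrow> w' \<Turnstile> suc m n"
    if "w' \<Turnstile> mem m a" for w' m n a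
  proof
    assume *: "\<forall>w''\<ge>w'. \<forall>u. w'' \<Turnstile> ex u \<longrightarrow> (\<forall>w3\<ge>w''. w3 \<Turnstile> mem u n \<longleftrightarrow> w3 \<Turnstile> mem u m \<or> w3 \<Turnstile> eq u m)"
    show "w' \<Turnstile> suc m n"
      by (rule sucI[OF mem_ex1[OF that]]) (use * mem_ex1 eq_ex1 order_refl in blast)
  next
    assume "w' \<Turnstile> suc m n"
    from sucD[OF this] show "\<forall>w''\<ge>w'. \<forall>u. w'' \<Turnstile> ex u \<longrightarrow> (\<forall>w3\<ge>w''. w3 \<Turnstile> mem u n \<longleftrightarrow> w3 \<Turnstile> mem u m \<or> w3 \<Turnstile> eq u m)"
      using order_trans by blast
  qed
  show ?thesis
    using assms(2) by (simp add: is_inductive_def ind_def z s cong: HOL.conj_cong)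
qed

lemma omega_exists: "\<exists>W. omega w W"
proof -
  obtain d where d: "w \<Turnstile> ex d" using ex_exists by blast
  then have ok: "ok w (\<lambda>_. d)" by (simp add: ok_def)
  have "w \<Turnstile> sem (\<lambda>_. d) (strong_infinity 0)"
    by (rule sem_axiom[OF _ ok]) (simp add: CZF_def)
  then have "\<exists>W. w \<Turnstile> ex W \<and> w \<Turnstile> sem (case_nat W (\<lambda>_. d)) (is_inductive (\<lambda>m. m - Suc 0) (Suc 0)) \<and>
    (\<forall>w1\<ge>w. \<forall>b. w1 \<Turnstile> ex b \<longrightarrow> (\<forall>w2\<ge>w1.
      w2 \<Turnstile> sem (case_nat b (case_nat W (\<lambda>_. d))) (is_inductive (\<lambda>m. m - Suc (Suc 0)) (Suc (Suc 0))) \<longrightarrow>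
      (\<forall>w3\<ge>w2. \<forall>x. w3 \<Turnstile> mem x W \<longrightarrow> w3 \<Turnstile> mem x b)))"
    by (simp add: strong_infinity_def fo_subset_def)
  then obtain W where W0: "w \<Turnstile> ex W" "w \<Turnstile> sem (case_nat W (\<lambda>_. d)) (is_inductive (\<lambda>m. m - Suc 0) (Suc 0))" and
    least0: "\<forall>w1\<ge>w. \<forall>b. w1 \<Turnstile> ex b \<longrightarrow> (\<forall>w2\<ge>w1.
      w2 \<Turnstile> sem (case_nat b (case_nat W (\<lambda>_. d))) (is_inductive (\<lambda>m. m - Suc (Suc 0)) (Suc (Suc 0))) \<longrightarrow>
      (\<forall>w3\<ge>w2. \<forall>x. w3 \<Turnstile> mem x W \<longrightarrow> w3 \<Turnstile> mem x b))"
    by blast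
  have W: "w \<Turnstile> ex W" "w \<Turnstile> ind W"
    using W0 ok sem_is_inductive[of w "case_nat W (\<lambda>_. d)" "Suc 0" "\<lambda>m. m - Suc 0"] by simp_all
  have least: "w3 \<Turnstile> mem x b" if "w \<Turnstile> ex b" "w \<Turnstile> ind b" "w \<le> w3" "w3 \<Turnstile> mem x W" for b w3 x
  proof -
    have "w \<Turnstile> sem (case_nat b (case_nat W (\<lambda>_. d))) (is_inductive (\<lambda>m. m - Suc (Suc 0)) (Suc (Suc 0)))"
      using that ok W(1) sem_is_inductive[of w "case_nat b (case_nat W (\<lambda>_. d))" "Suc (Suc 0)" "\<lambda>m. m - Suc (Suc 0)"]
      by simp
    from least0[THEN spec, THEN mp, OF order_refl, THEN spec, THEN mp, OF that(1), THEN spec, THEN mp, OF order_refl,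
        THEN mp, OF this] that(3,4) show ?thesis by blast
  qed
  obtain z where z: "w \<Turnstile> mem z W" "w \<Turnstile> zero z" using W(2) by (auto simp: ind_def)
  have zW: "w' \<Turnstile> mem z' W" if "w \<le> w'" "w' \<Turnstile> zero z'" for w' z'
    by (rule mem_cong1[OF zero_unique[OF up[OF z(2) that(1)] that(2)] up[OF z(1) that(1)]])
  have s: "\<exists>n. w' \<Turnstile> mem n W \<and> w' \<Turnstile> suc m n" if "w \<le> w'" "w' \<Turnstile> mem m W" for w' m
    using W(2) that unfolding ind_def holds_conj holds_ball holds_bex by blast
  have sW: "w' \<Turnstile> mem n W" if "w \<le> w'" "w' \<Turnstile> mem m W" "w' \<Turnstile> suc m n" for w' m n
    using s[OF that(1,2)] suc_unique that(3) mem_cong1 by blast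
  \<comment> \<open>The elements of W that are zero or the successor of an element again form an
    inductive set. Leastness of W puts every element into it.\<close>
  have "dfn True w (\<lambda>e. zero (e 0) \<squnion> bex W (\<lambda>m. suc m (e 0)))" by (intro dfn_intros W(1))
  from cmp_separation[OF this W(1)] obtain b where
    b: "w \<Turnstile> cmp b (\<lambda>n. mem n W \<sqinter> (zero n \<squnion> bex W (\<lambda>m. suc m n)))" by blast
  have "w \<Turnstile> ind b" unfolding ind_def holds_conj holds_ball holds_bex
  proof (intro HOL.conjI allI impI)
    show "\<exists>x. w \<Turnstile> mem x b \<and> w \<Turnstile> zero x"
      using z zero_ex cmp_mem[OF b] by auto
  next
    fix w' m assume le: "w \<le> w'" and "w' \<Turnstile> mem m b"
    then have m: "w' \<Turnstile> mem m W" unfolding cmpD[OF b le] by simp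
    from s[OF le m] obtain n where n: "w' \<Turnstile> mem n W" "w' \<Turnstile> suc m n" by blast
    then have "w' \<Turnstile> mem n b" unfolding cmpD[OF b le] using m suc_ex by auto
    with n show "\<exists>x. w' \<Turnstile> mem x b \<and> w' \<Turnstile> suc m x" by blast
  qed
  from least[OF cmp_ex[OF b] this] have Wb: "w' \<Turnstile> mem n b" if "w \<le> w'" "w' \<Turnstile> mem n W" for w' n
    using that by blast
  have "w' \<Turnstile> zero n \<or> (\<exists>m. w' \<Turnstile> mem m W \<and> w' \<Turnstile> suc m n)" if "w \<le> w'" "w' \<Turnstile> mem n W" for w' n
    using Wb[OF that] unfolding cmpD[OF b that(1)] by simp
  with W(1) zW sW z(2) have "omega w W" unfolding omega_def by blast
  then show ?thesis ..
qed

text \<open>A predecessor is a member of its successor, so set induction covers the step.\<close>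

lemma omega_induct:
  assumes W: "omega w W" and dfn: "dfn False w (\<lambda>e. P (e 0))"
    and base: "\<And>w' z. w \<le> w' \<Longrightarrow> w' \<Turnstile> zero z \<Longrightarrow> w' \<Turnstile> P z"
    and step: "\<And>w' m n. w \<le> w' \<Longrightarrow> w' \<Turnstile> mem m W \<Longrightarrow> w' \<Turnstile> suc m n \<Longrightarrow> w' \<Turnstile> P m \<Longrightarrow> w' \<Turnstile> P n"
    and le: "w \<le> w'" and n: "w' \<Turnstile> mem n W"
  shows "w' \<Turnstile> P n"
proof -
  have "w' \<Turnstile> (mem n W \<rightarrow> P n)"
  proof (rule set_induction[OF _ _ mem_ex1[OF n]])
    show "dfn False w' (\<lambda>e. mem (e 0) W \<rightarrow> P (e 0))"
      by (intro dfn_intros dfn_up[OF dfn le] omegaD(1)[OF W le])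
  next
    fix w1 n
    assume le1: "w' \<le> w1" and IH: "\<And>w2 x. w1 \<le> w2 \<Longrightarrow> w2 \<Turnstile> mem x n \<Longrightarrow> w2 \<Turnstile> (mem x W \<rightarrow> P x)"
    show "w1 \<Turnstile> (mem n W \<rightarrow> P n)" unfolding holds_imp
    proof (intro allI impI)
      fix w2 assume le2: "w1 \<le> w2" and n: "w2 \<Turnstile> mem n W"
      note le' = order_trans[OF le order_trans[OF le1 le2]]
      from omegaD(4)[OF W le' n] show "w2 \<Turnstile> P n"
      proof (elim HOL.disjE exE HOL.conjE)
        assume "w2 \<Turnstile> zero n" then show ?thesis by (rule base[OF le'])
      next
        fix m assume m: "w2 \<Turnstile> mem m W" "w2 \<Turnstile> suc m n"
        then have "w2 \<Turnstile> mem m n" by (simp add: suc_def)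
        from IH[OF le2 this] m(1) have "w2 \<Turnstile> P m" unfolding holds_imp using order_refl by blast
        from step[OF le' m this] show ?thesis .
      qed
    qed
  qed
  with n show ?thesis unfolding holds_imp using order_refl by blast
qed

section \<open>Recursion on the natural numbers with sets as values\<close>

definition rec_seq :: "world \<Rightarrow> nat \<Rightarrow> nat \<Rightarrow> (nat \<Rightarrow> nat \<Rightarrow> pv) \<Rightarrow> nat \<Rightarrow> bool" where
  "rec_seq w W r0 \<Phi> \<rho> \<longleftrightarrow> w \<Turnstile> ex \<rho> \<and>
    (\<forall>w'\<ge>w. \<forall>n. w' \<Turnstile> mem n W \<longrightarrow> (\<exists>x. w' \<Turnstile> mp \<rho> n x)) \<and>
    (\<forall>w'\<ge>w. \<forall>n x y. w' \<Turnstile> mp \<rho> n x \<longrightarrow> w' \<Turnstile> mp \<rho> n y \<longrightarrow> w' \<Turnstile> eq x y) \<and>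
    (\<forall>w'\<ge>w. \<forall>z x. w' \<Turnstile> zero z \<longrightarrow> w' \<Turnstile> mp \<rho> z x \<longrightarrow> w' \<Turnstile> eq x r0) \<and>
    (\<forall>w'\<ge>w. \<forall>m n x y. w' \<Turnstile> suc m n \<longrightarrow> w' \<Turnstile> mp \<rho> m x \<longrightarrow> w' \<Turnstile> mp \<rho> n y \<longrightarrow> w' \<Turnstile> \<Phi> x y) \<and>
    (\<forall>w'\<ge>w. \<forall>n x. w' \<Turnstile> mp \<rho> n x \<longrightarrow> w' \<Turnstile> mem n W)"

lemma rec_seqD:
  assumes "rec_seq w W r0 \<Phi> \<rho>" "w \<le> w'"
  shows "w' \<Turnstile> ex \<rho>"
    "w' \<Turnstile> mem n W \<Longrightarrow> \<exists>x. w' \<Turnstile> mp \<rho> n x"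
    "w' \<Turnstile> mp \<rho> n x \<Longrightarrow> w' \<Turnstile> mp \<rho> n y \<Longrightarrow> w' \<Turnstile> eq x y"
    "w' \<Turnstile> zero z \<Longrightarrow> w' \<Turnstile> mp \<rho> z x \<Longrightarrow> w' \<Turnstile> eq x r0"
    "w' \<Turnstile> suc m n \<Longrightarrow> w' \<Turnstile> mp \<rho> m x \<Longrightarrow> w' \<Turnstile> mp \<rho> n y \<Longrightarrow> w' \<Turnstile> \<Phi> x y"
    "w' \<Turnstile> mp \<rho> n x \<Longrightarrow> w' \<Turnstile> mem n W"
  using assms up unfolding rec_seq_def by blast+

text \<open>The value at n is described by finite approximations. Induction shows that it exists and
  is unique, and \<open>graph_set\<close> then turns the description into a sequence although no set
  of possible values is known.\<close>

lemma recursion: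
  assumes W: "omega w W" and r0: "w \<Turnstile> ex r0"
    and dfn: "dfn False w (\<lambda>e. \<Phi> (e 0) (e (Suc 0)))"
    and total: "\<And>w' x. w \<le> w' \<Longrightarrow> w' \<Turnstile> ex x \<Longrightarrow> \<exists>y. w' \<Turnstile> ex y \<and> w' \<Turnstile> \<Phi> x y"
    and uniq: "\<And>w' x y y'. w \<le> w' \<Longrightarrow> w' \<Turnstile> ex x \<Longrightarrow> w' \<Turnstile> ex y \<Longrightarrow> w' \<Turnstile> ex y' \<Longrightarrow>
      w' \<Turnstile> \<Phi> x y \<Longrightarrow> w' \<Turnstile> \<Phi> x y' \<Longrightarrow> w' \<Turnstile> eq y y'"
  shows "\<exists>\<rho>. rec_seq w W r0 \<Phi> \<rho>"
proof -
  let ?step = "\<lambda>h n x. exi (\<lambda>m. exi (\<lambda>x'. suc m n \<sqinter> mp h m x' \<sqinter> \<Phi> x' x))"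
  \<comment> \<open>Every pair in h is justified: it is the start value at zero, or it arises by one
    step from a pair in h at the predecessor. Single-valuedness is not imposed on h but proved for
    \<open>\<psi>\<close>, the relation of being reached by some such h.\<close>
  define grd where "grd h = all (\<lambda>n. all (\<lambda>x. mp h n x \<rightarrow> (zero n \<sqinter> eq x r0) \<squnion> ?step h n x))" for h
  define \<psi> where "\<psi> n x = exi (\<lambda>h. grd h \<sqinter> mp h n x)" for n x
  note dfns = dfn_intros dfn_subst2[OF dfn] dfn_subst2[OF dfn_up[OF dfn]] r0 up[OF r0]
  have dfn_\<psi>: "dfn False w (\<lambda>e. \<psi> (e i) (e j))" for i j
    unfolding \<psi>_def grd_def by (intro dfns)
  have grdD: "(w' \<Turnstile> zero n \<and> w' \<Turnstile> eq x r0) \<or>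
      (\<exists>m x'. w' \<Turnstile> suc m n \<and> w' \<Turnstile> mp h m x' \<and> w' \<Turnstile> \<Phi> x' x)"
    if "w' \<Turnstile> grd h" "w' \<Turnstile> mp h n x" for w' h n x
  proof -
    have "w' \<Turnstile> ((zero n \<sqinter> eq x r0) \<squnion> ?step h n x)"
      using that mp_ex(2,3)[OF that(2)] order_refl[of w'] unfolding grd_def holds_all holds_imp by blast
    then show ?thesis by auto
  qed
  have grdI: "w' \<Turnstile> grd h"
    if "\<And>w'' n x. w' \<le> w'' \<Longrightarrow> w'' \<Turnstile> mp h n x \<Longrightarrow> (w'' \<Turnstile> zero n \<and> w'' \<Turnstile> eq x r0) \<or>
      (\<exists>m x'. w'' \<Turnstile> suc m n \<and> w'' \<Turnstile> mp h m x' \<and> w'' \<Turnstile> \<Phi> x' x)" for w' h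
    unfolding grd_def holds_all holds_imp holds_disj holds_exi holds_conj
  proof (intro allI impI)
    fix w1 n w2 x w3 assume le: "w' \<le> w1" "w1 \<le> w2" "w2 \<le> w3" and "w3 \<Turnstile> mp h n x"
    from that[OF order_trans[OF le(1) order_trans[OF le(2,3)]] this(4)] suc_ex mp_ex
    show "w3 \<Turnstile> zero n \<and> w3 \<Turnstile> eq x r0 \<or> (\<exists>m. w3 \<Turnstile> ex m \<and> (\<exists>x'. w3 \<Turnstile> ex x' \<and> w3 \<Turnstile> suc m n \<and> w3 \<Turnstile> mp h m x' \<and> w3 \<Turnstile> \<Phi> x' x))"
      by blast
  qed
  have \<psi>_zero: "w' \<Turnstile> eq x r0" if le: "w \<le> w'" and z: "w' \<Turnstile> zero n" and x: "w' \<Turnstile> \<psi> n x" for w' n x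
  proof -
    from x obtain h where h: "w' \<Turnstile> grd h" "w' \<Turnstile> mp h n x" by (auto simp: \<psi>_def)
    from grdD[OF this] show ?thesis
      using zero_suc[OF z] bot_eq[OF _ mp_ex(3)[OF h(2)] up[OF r0 le]] by blast
  qed
  have \<psi>_suc: "\<exists>x'. w' \<Turnstile> \<psi> m x' \<and> w' \<Turnstile> \<Phi> x' x" if le: "w \<le> w'" and s: "w' \<Turnstile> suc m n" and x: "w' \<Turnstile> \<psi> n x" for w' m n x
  proof -
    from x obtain h where h: "w' \<Turnstile> grd h" "w' \<Turnstile> mp h n x" by (auto simp: \<psi>_def)
    from grdD[OF this] show ?thesis
    proof (elim HOL.disjE exE HOL.conjE)
      assume "w' \<Turnstile> zero n"
      \<comment> \<open>This case is contradictory, but only definable statements follow from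
        \<open>bot\<close>. The existence of x' is therefore stated as a truth value first.\<close>
      from zero_suc[OF this s] have "w' \<Turnstile> exi (\<lambda>x'. \<psi> m x' \<sqinter> \<Phi> x' x)"
        by (rule dfn_bot_elim[where b = False, rotated])
          (intro dfn_intros dfn_subst2[OF dfn_up[OF dfn le]] dfn_subst2[OF dfn_up[OF dfn_\<psi>[of 0 "Suc 0"] le]] suc_ex(1)[OF s] mp_ex(3)[OF h(2)])
      then show ?thesis by auto
    next
      fix k x' assume k: "w' \<Turnstile> suc k n" "w' \<Turnstile> mp h k x'" "w' \<Turnstile> \<Phi> x' x"
      from mp_cong[OF k(2) suc_inject[OF k(1) s] eq_refl[OF mp_ex(3)[OF k(2)]]] h mp_ex(1)[OF h(2)]
      have "w' \<Turnstile> \<psi> m x'" by (auto simp: \<psi>_def)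
      with k(3) show ?thesis by blast
    qed
  qed
  have zero_\<psi>: "w' \<Turnstile> \<psi> z r0" if le: "w \<le> w'" and z: "w' \<Turnstile> zero z" for w' z
  proof -
    from pr_exists[OF zero_ex[OF z] up[OF r0 le]] obtain p where p: "w' \<Turnstile> pr p z r0" by blast
    \<comment> \<open>The approximation for zero consists of the single pair of z and r0.\<close>
    from upr_exists[OF pr_ex(1)[OF p] pr_ex(1)[OF p]] obtain h where h: "w' \<Turnstile> upr h p p" by blast
    have "w' \<Turnstile> grd h"
    proof (rule grdI, rule HOL.disjI1)
      fix w'' n x assume le': "w' \<le> w''" and "w'' \<Turnstile> mp h n x"
      then obtain q where "w'' \<Turnstile> eq q p" "w'' \<Turnstile> pr q n x"
        unfolding mp_iff uprD(6)[OF h le'] by blast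
      then have "w'' \<Turnstile> pr p n x" using pr_cong1 by blast
      note E = pr_inject[OF this up[OF p le']]
      from zero_cong[OF up[OF z le'] eq_sym[OF E(1)]] E(2) show "w'' \<Turnstile> zero n \<and> w'' \<Turnstile> eq x r0" by blast
    qed
    moreover have "w' \<Turnstile> mp h z r0" using p uprD(4)[OF h] by (auto simp: mp_iff)
    ultimately show ?thesis using uprD(1)[OF h] by (auto simp: \<psi>_def)
  qed
  have suc_\<psi>: "w' \<Turnstile> \<psi> n x" if le: "w \<le> w'" and s: "w' \<Turnstile> suc m n" and x': "w' \<Turnstile> \<psi> m x'"
    and \<Phi>: "w' \<Turnstile> \<Phi> x' x" and x: "w' \<Turnstile> ex x" for w' m n x' x
  proof -
    from x' obtain h where h: "w' \<Turnstile> grd h" "w' \<Turnstile> mp h m x'" by (auto simp: \<psi>_def)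
    from pr_exists[OF suc_ex(2)[OF s] x] obtain p where p: "w' \<Turnstile> pr p n x" by blast
    \<comment> \<open>Adding the pair of n and x to h keeps it justified: the old pairs keep their
      predecessors, and the new one is justified by the pair of m and x' in h.\<close>
    obtain h' where h': "w' \<Turnstile> ex h'" "\<And>w'' q. w' \<le> w'' \<Longrightarrow> w'' \<Turnstile> mem q h' \<longleftrightarrow> w'' \<Turnstile> mem q h \<or> w'' \<Turnstile> eq q p"
      by (rule insert_exists[OF mp_ex(1)[OF h(2)] pr_ex(1)[OF p]]) blast
    have sub: "w'' \<Turnstile> mp h' k y" if "w' \<le> w''" "w'' \<Turnstile> mp h k y" for w'' k y
      using that(2) h'(2)[OF that(1)] unfolding mp_iff by blast
    have "w' \<Turnstile> grd h'"
    proof (rule grdI)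
      fix w'' k y assume le': "w' \<le> w''" and "w'' \<Turnstile> mp h' k y"
      then obtain q where q: "w'' \<Turnstile> mem q h \<or> w'' \<Turnstile> eq q p" "w'' \<Turnstile> pr q k y"
        unfolding mp_iff h'(2)[OF le'] by blast
      from q(1) show "(w'' \<Turnstile> zero k \<and> w'' \<Turnstile> eq y r0) \<or> (\<exists>m x'. w'' \<Turnstile> suc m k \<and> w'' \<Turnstile> mp h' m x' \<and> w'' \<Turnstile> \<Phi> x' y)"
      proof
        assume "w'' \<Turnstile> mem q h"
        with q(2) have "w'' \<Turnstile> mp h k y" by (auto simp: mp_iff)
        from grdD[OF up[OF h(1) le'] this] sub[OF le'] show ?thesis by blast
      next
        assume "w'' \<Turnstile> eq q p"
        from pr_inject[OF up[OF p le'] pr_cong1[OF q(2) this]]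
        have E: "w'' \<Turnstile> eq n k" "w'' \<Turnstile> eq x y" .
        have "w'' \<Turnstile> suc m k" by (rule suc_cong[OF up[OF s le'] eq_refl[OF up[OF suc_ex(1)[OF s] le']] E(1)])
        moreover have "w'' \<Turnstile> \<Phi> x' y"
          by (rule dfn_cong2[OF dfn_up[OF dfn order_trans[OF le le']] eq_refl[OF up[OF mp_ex(3)[OF h(2)] le']] E(2) up[OF \<Phi> le']])
        ultimately show ?thesis using sub[OF le' up[OF h(2) le']] by blast
      qed
    qed
    moreover have "w' \<Turnstile> mp h' n x"
      unfolding mp_iff h'(2)[OF order_refl] using p eq_refl[OF pr_ex(1)[OF p]] by blast
    ultimately show ?thesis using h'(1) by (auto simp: \<psi>_def)
  qed
  let ?Q = "\<lambda>n. (exi (\<lambda>x. \<psi> n x) \<sqinter> all (\<lambda>x. all (\<lambda>y. \<psi> n x \<sqinter> \<psi> n y \<rightarrow> eq x y)))"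
  have QI: "w' \<Turnstile> ?Q n" if "w' \<Turnstile> ex x" "w' \<Turnstile> \<psi> n x"
    "\<And>w'' x y. w' \<le> w'' \<Longrightarrow> w'' \<Turnstile> ex x \<Longrightarrow> w'' \<Turnstile> ex y \<Longrightarrow> w'' \<Turnstile> \<psi> n x \<Longrightarrow> w'' \<Turnstile> \<psi> n y \<Longrightarrow> w'' \<Turnstile> eq x y" for w' n x
    unfolding holds_conj holds_exi holds_all holds_imp
  proof (intro HOL.conjI allI impI)
    show "\<exists>x. w' \<Turnstile> ex x \<and> w' \<Turnstile> \<psi> n x" using that(1,2) by blast
    fix w1 x w2 y w3 assume le: "w' \<le> w1" "w1 \<le> w2" "w2 \<le> w3" and e: "w1 \<Turnstile> ex x" "w2 \<Turnstile> ex y"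
      and p: "w3 \<Turnstile> \<psi> n x \<and> w3 \<Turnstile> \<psi> n y"
    from that(3)[OF order_trans[OF le(1) order_trans[OF le(2,3)]] up[OF e(1) order_trans[OF le(2,3)]] up[OF e(2) le(3)]] p
    show "w3 \<Turnstile> eq x y" by blast
  qed
  have QD: "w' \<Turnstile> eq x y" if "w' \<Turnstile> ?Q n" "w' \<Turnstile> \<psi> n x" "w' \<Turnstile> \<psi> n y" "w' \<Turnstile> ex x" "w' \<Turnstile> ex y" for w' n x y
    using that order_refl[of w'] unfolding holds_conj holds_all holds_imp by blast
  have \<psi>_ex: "w' \<Turnstile> ex x" if "w' \<Turnstile> \<psi> n x" for w' n x
    using that mp_ex(3) by (auto simp: \<psi>_def)
  have Q: "w' \<Turnstile> ?Q n" if le: "w \<le> w'" and n: "w' \<Turnstile> mem n W" for w' n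
  proof (rule omega_induct[OF W _ _ _ le n])
    show "dfn False w (\<lambda>e. exi (\<lambda>x. \<psi> (e 0) x) \<sqinter> all (\<lambda>x. all (\<lambda>y. \<psi> (e 0) x \<sqinter> \<psi> (e 0) y \<rightarrow> eq x y)))"
      by (intro dfn_intros dfn_\<psi>)
  next
    fix w' z assume le: "w \<le> w'" and z: "w' \<Turnstile> zero z"
    show "w' \<Turnstile> ?Q z"
    proof (rule QI[OF up[OF r0 le] zero_\<psi>[OF le z]])
      fix w'' x y assume le': "w' \<le> w''" and "w'' \<Turnstile> \<psi> z x" "w'' \<Turnstile> \<psi> z y"
      with \<psi>_zero[OF order_trans[OF le le'] up[OF z le']] eq_sym eq_trans show "w'' \<Turnstile> eq x y" by blast
    qed
  next
    fix w' m n assume le: "w \<le> w'" and s: "w' \<Turnstile> suc m n" and IH: "w' \<Turnstile> ?Q m"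
    from IH obtain x where x: "w' \<Turnstile> ex x" "w' \<Turnstile> \<psi> m x" by auto
    from total[OF le x(1)] obtain y where y: "w' \<Turnstile> ex y" "w' \<Turnstile> \<Phi> x y" by blast
    show "w' \<Turnstile> ?Q n"
    proof (rule QI[OF y(1) suc_\<psi>[OF le s x(2) y(2,1)]])
      fix w'' u v assume le': "w' \<le> w''" and e: "w'' \<Turnstile> ex u" "w'' \<Turnstile> ex v" and u: "w'' \<Turnstile> \<psi> n u" and v: "w'' \<Turnstile> \<psi> n v"
      note le'' = order_trans[OF le le']
      from \<psi>_suc[OF le'' up[OF s le'] u] obtain u' where u': "w'' \<Turnstile> \<psi> m u'" "w'' \<Turnstile> \<Phi> u' u" by blast
      from \<psi>_suc[OF le'' up[OF s le'] v] obtain v' where v': "w'' \<Turnstile> \<psi> m v'" "w'' \<Turnstile> \<Phi> v' v" by blast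
      have "w'' \<Turnstile> eq u' v'" by (rule QD[OF up[OF IH le'] u'(1) v'(1) \<psi>_ex[OF u'(1)] \<psi>_ex[OF v'(1)]])
      then have "w'' \<Turnstile> \<Phi> v' u" by (rule dfn_cong2[OF dfn_up[OF dfn le''] _ eq_refl[OF e(1)] u'(2)])
      from uniq[OF le'' \<psi>_ex[OF v'(1)] e this v'(2)] show "w'' \<Turnstile> eq u v" .
    qed
  qed
  have total': "\<exists>y. w' \<Turnstile> ex y \<and> w' \<Turnstile> \<psi> n y" if "w \<le> w'" "w' \<Turnstile> mem n W" for w' n
    using Q[OF that] by auto
  show ?thesis
  proof (rule graph_set[OF dfn_\<psi> omegaD(1)[OF W order_refl] total'])
    show "w' \<Turnstile> eq y y'" if "w \<le> w'" "w' \<Turnstile> mem x W" "w' \<Turnstile> ex y" "w' \<Turnstile> \<psi> x y" "w' \<Turnstile> ex y'" "w' \<Turnstile> \<psi> x y'" for w' x y y'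
      by (rule QD[OF Q[OF that(1,2)] that(4,6,3,5)])
    fix \<rho> assume \<rho>: "w \<Turnstile> ex \<rho>" "\<And>w' x y. w \<le> w' \<Longrightarrow> w' \<Turnstile> mp \<rho> x y \<longleftrightarrow> w' \<Turnstile> mem x W \<and> w' \<Turnstile> ex y \<and> w' \<Turnstile> \<psi> x y"
    have "rec_seq w W r0 \<Phi> \<rho>" unfolding rec_seq_def
    proof (intro HOL.conjI allI impI)
      show "w \<Turnstile> ex \<rho>" by (rule \<rho>(1))
    next
      fix w' n assume le: "w \<le> w'" and n: "w' \<Turnstile> mem n W"
      with total'[OF this] show "\<exists>x. w' \<Turnstile> mp \<rho> n x" unfolding \<rho>(2)[OF le] by blast
    next
      fix w' n x y assume le: "w \<le> w'" and "w' \<Turnstile> mp \<rho> n x" "w' \<Turnstile> mp \<rho> n y"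
      then show "w' \<Turnstile> eq x y" unfolding \<rho>(2)[OF le] using QD[OF Q[OF le]] by blast
    next
      fix w' z x assume le: "w \<le> w'" and "w' \<Turnstile> zero z" "w' \<Turnstile> mp \<rho> z x"
      then show "w' \<Turnstile> eq x r0" unfolding \<rho>(2)[OF le] using \<psi>_zero[OF le] by blast
    next
      fix w' m n x y assume le: "w \<le> w'" and s: "w' \<Turnstile> suc m n" and x: "w' \<Turnstile> mp \<rho> m x" and y: "w' \<Turnstile> mp \<rho> n y"
      from y \<psi>_suc[OF le s] obtain x' where x': "w' \<Turnstile> \<psi> m x'" "w' \<Turnstile> \<Phi> x' y" unfolding \<rho>(2)[OF le] by blast
      from x have x2: "w' \<Turnstile> mem m W" "w' \<Turnstile> \<psi> m x" unfolding \<rho>(2)[OF le] by blast+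
      have "w' \<Turnstile> eq x' x" by (rule QD[OF Q[OF le x2(1)] x'(1) x2(2) \<psi>_ex[OF x'(1)] \<psi>_ex[OF x2(2)]])
      then show "w' \<Turnstile> \<Phi> x y" by (rule dfn_cong2[OF dfn_up[OF dfn le] _ eq_refl[OF mp_ex(3)[OF y]] x'(2)])
    next
      fix w' n x assume le: "w \<le> w'" and "w' \<Turnstile> mp \<rho> n x"
      then show "w' \<Turnstile> mem n W" unfolding \<rho>(2)[OF le] by blast
    qed
    then show ?thesis ..
  qed
qed

section \<open>Polynomial functors\<close>

locale container =
  fixes w0 :: world and B A f :: nat
  assumes B: "w0 \<Turnstile> ex B" and A: "w0 \<Turnstile> ex A" and f: "w0 \<Turnstile> ex f"
begin

definition fib :: "nat \<Rightarrow> nat \<Rightarrow> pv" where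
  "fib c a = cmp c (\<lambda>b. mem b B \<sqinter> mp f b a)"

text \<open>\<open>fnf t a X\<close> says \<open>t : B\<^sub>a \<rightarrow> X\<close> by a bounded formula that does not mention the fibre \<open>B\<^sub>a\<close> as a set.\<close>

definition fnf :: "nat \<Rightarrow> nat \<Rightarrow> nat \<Rightarrow> pv" where
  "fnf t a X = (ex t \<sqinter> ex a \<sqinter> ex X \<sqinter> ball t (\<lambda>p. bex B (\<lambda>b. bex X (\<lambda>x. mp f b a \<sqinter> pr p b x)))
    \<sqinter> ball B (\<lambda>b. mp f b a \<rightarrow> bex X (\<lambda>x. mp t b x))
    \<sqinter> ball B (\<lambda>b. ball X (\<lambda>x. ball X (\<lambda>y. mp t b x \<sqinter> mp t b y \<rightarrow> eq x y))))"

lemma dfn_fnf: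
  assumes "w0 \<le> w" "term_at w t" "term_at w a" "term_at w X"
  shows "dfn b w (\<lambda>e. fnf (t e) (a e) (X e))"
  unfolding fnf_def
  by (intro dfn_intros assms(2-) assms(2-)[THEN term_shift] assms(2-)[THEN term_shift, THEN term_shift]
      assms(2-)[THEN term_shift, THEN term_shift, THEN term_shift] up[OF B assms(1)] up[OF f assms(1)])

lemma fib_exists:
  assumes "w0 \<le> w" "w \<Turnstile> ex a"
  shows "\<exists>c. w \<Turnstile> fib c a"
  unfolding fib_def
  by (rule cmp_separation) (intro dfn_intros assms(2) up[OF B assms(1)] up[OF f assms(1)])+

lemma fib_mem: "w \<Turnstile> fib c a \<Longrightarrow> w \<le> w' \<Longrightarrow> w' \<Turnstile> mem b c \<longleftrightarrow> w' \<Turnstile> mem b B \<and> w' \<Turnstile> mp f b a"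
  unfolding fib_def using cmpD mem_ex1 by simp blast

lemma fnf_ex:
  assumes "w \<Turnstile> fnf t a X"
  shows "w \<Turnstile> ex t" "w \<Turnstile> ex a" "w \<Turnstile> ex X"
  using assms by (simp_all add: fnf_def)

text \<open>Membership in the fibre has been unfolded in \<open>fnf\<close>. Once a set c is known
  to be the fibre, the general facts about functions with domain c become available.\<close>

lemma fnf_fn:
  assumes c: "w \<Turnstile> fib c a" and a: "w \<Turnstile> ex a"
  shows "w \<Turnstile> fnf t a X \<longleftrightarrow> w \<Turnstile> fn t c X"
proof
  assume t: "w \<Turnstile> fnf t a X"
  note t1 = t[unfolded fnf_def holds_conj holds_ball holds_bex holds_imp]
  show "w \<Turnstile> fn t c X"
  proof (rule fnI[OF fnf_ex(1)[OF t] cmp_ex[OF c[unfolded fib_def]] fnf_ex(3)[OF t]])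
    show "\<exists>x y. w' \<Turnstile> mem x c \<and> w' \<Turnstile> mem y X \<and> w' \<Turnstile> pr p x y" if le: "w \<le> w'" and p: "w' \<Turnstile> mem p t" for w' p
      unfolding fib_mem[OF c le] using t1 le p by blast
    show "\<exists>y. w' \<Turnstile> mem y X \<and> w' \<Turnstile> mp t x y" if le: "w \<le> w'" and x: "w' \<Turnstile> mem x c" for w' x
      using t1 le x[unfolded fib_mem[OF c le]] order_refl[of w'] by blast
    show "w' \<Turnstile> eq y y'" if le: "w \<le> w'" and x: "w' \<Turnstile> mem x c" and y: "w' \<Turnstile> mp t x y" "w' \<Turnstile> mp t x y'" for w' x y y'
    proof -
      have inX: "w' \<Turnstile> mem z X" if z: "w' \<Turnstile> mp t x z" for z
      proof -
        obtain p where p: "w' \<Turnstile> mem p t" "w' \<Turnstile> pr p x z" using z by (auto simp: mp_iff)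
        with t1 le obtain b z' where "w' \<Turnstile> mem z' X" "w' \<Turnstile> pr p b z'" by blast
        with pr_inject(2)[OF _ p(2)] mem_cong1 show ?thesis by blast
      qed
      from t1 have "\<forall>w1\<ge>w. \<forall>b. w1 \<Turnstile> mem b B \<longrightarrow> (\<forall>w2\<ge>w1. \<forall>y. w2 \<Turnstile> mem y X \<longrightarrow> (\<forall>w3\<ge>w2. \<forall>y'. w3 \<Turnstile> mem y' X \<longrightarrow>
          (\<forall>w4\<ge>w3. w4 \<Turnstile> mp t b y \<and> w4 \<Turnstile> mp t b y' \<longrightarrow> w4 \<Turnstile> eq y y')))" by blast
      from this[THEN spec, THEN mp, OF le, THEN spec, THEN mp, OF conjunct1[OF x[unfolded fib_mem[OF c le]]],
          THEN spec, THEN mp, OF order_refl, THEN spec, THEN mp, OF inX[OF y(1)],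
          THEN spec, THEN mp, OF order_refl, THEN spec, THEN mp, OF inX[OF y(2)], THEN spec, THEN mp, OF order_refl] y
      show ?thesis by blast
    qed
  qed
next
  assume t: "w \<Turnstile> fn t c X"
  show "w \<Turnstile> fnf t a X"
    unfolding fnf_def holds_conj holds_ball holds_bex holds_imp
  proof (intro HOL.conjI allI impI fn_ex[OF t] a)
    show "\<exists>b. w' \<Turnstile> mem b B \<and> (\<exists>x. w' \<Turnstile> mem x X \<and> w' \<Turnstile> mp f b a \<and> w' \<Turnstile> pr p b x)"
      if le: "w \<le> w'" and p: "w' \<Turnstile> mem p t" for w' p
      using fn_pair[OF up[OF t le] p] unfolding fib_mem[OF c le] by blast
    show "\<exists>x. w2 \<Turnstile> mem x X \<and> w2 \<Turnstile> mp t b x"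
      if le: "w \<le> w1" "w1 \<le> w2" and b: "w1 \<Turnstile> mem b B" "w2 \<Turnstile> mp f b a" for w1 w2 b
      using fn_total[OF up[OF t order_trans[OF le]]] up[OF b(1) le(2)] b(2)
      unfolding fib_mem[OF c order_trans[OF le]] by blast
    show "w4 \<Turnstile> eq x y" if le: "w \<le> w1" "w1 \<le> w2" "w2 \<le> w3" "w3 \<le> w4" and y: "w4 \<Turnstile> mp t b x \<and> w4 \<Turnstile> mp t b y"
      for w1 w2 w3 w4 b x y
      using fn_unique[OF up[OF t order_trans[OF le(1) order_trans[OF le(2) order_trans[OF le(3,4)]]]]] y by blast
  qed
qed

lemma fnf_fib:
  assumes "w0 \<le> w" "w \<Turnstile> fnf t a X"
  obtains c where "w \<Turnstile> fib c a" "w \<Turnstile> fn t c X"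
  using fib_exists[OF assms(1) fnf_ex(2)[OF assms(2)]] fnf_fn[OF _ fnf_ex(2)[OF assms(2)]] assms(2) by blast

lemma fnf_mem:
  assumes "w0 \<le> w" "w \<Turnstile> fnf t a X" "w \<Turnstile> mp t b x"
  shows "w \<Turnstile> mem b B" "w \<Turnstile> mp f b a" "w \<Turnstile> mem x X"
proof -
  obtain c where c: "w \<Turnstile> fib c a" "w \<Turnstile> fn t c X" by (rule fnf_fib[OF assms(1,2)])
  from fn_mem[OF c(2) assms(3)] fib_mem[OF c(1) order_refl]
  show "w \<Turnstile> mem b B" "w \<Turnstile> mp f b a" "w \<Turnstile> mem x X" by blast+
qed

lemma fnf_total:
  assumes "w0 \<le> w" "w \<Turnstile> fnf t a X" "w \<Turnstile> mem b B" "w \<Turnstile> mp f b a"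
  shows "\<exists>x. w \<Turnstile> mem x X \<and> w \<Turnstile> mp t b x"
proof -
  obtain c where c: "w \<Turnstile> fib c a" "w \<Turnstile> fn t c X" by (rule fnf_fib[OF assms(1,2)])
  from fn_total[OF c(2)] fib_mem[OF c(1) order_refl] assms(3,4) show ?thesis by blast
qed

lemma fnf_unique:
  assumes "w0 \<le> w" "w \<Turnstile> fnf t a X" "w \<Turnstile> mp t b x" "w \<Turnstile> mp t b y"
  shows "w \<Turnstile> eq x y"
proof -
  obtain c where c: "w \<Turnstile> fib c a" "w \<Turnstile> fn t c X" by (rule fnf_fib[OF assms(1,2)])
  from fn_unique[OF c(2) assms(3,4)] show ?thesis .
qed

lemma fnf_cong:
  assumes le: "w0 \<le> w" and t: "w \<Turnstile> fnf t a X" and "w \<Turnstile> eq t t'" "w \<Turnstile> eq a a'"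
  shows "w \<Turnstile> fnf t' a' X"
  by (rule dfn_cong2[where P = "\<lambda>t a. fnf t a X" and b = True, OF _ assms(3,4) t])
    (intro dfn_fnf dfn_intros le fnf_ex[OF t])

lemma fnf_ext:
  assumes le: "w0 \<le> w" and t: "w \<Turnstile> fnf t a X" and t': "w \<Turnstile> fnf t' a X'"
    and agree: "\<And>w' b x y. w \<le> w' \<Longrightarrow> w' \<Turnstile> mp t b x \<Longrightarrow> w' \<Turnstile> mp t' b y \<Longrightarrow> w' \<Turnstile> eq x y"
  shows "w \<Turnstile> eq t t'"
proof -
  obtain c where c: "w \<Turnstile> fib c a" "w \<Turnstile> fn t c X" by (rule fnf_fib[OF le t])
  from c(1) t' have "w \<Turnstile> fn t' c X'" using fnf_fn[OF _ fnf_ex(2)[OF t]] by blast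
  from fn_ext[OF c(2) this agree] show ?thesis .
qed

lemma fnf_codomain:
  assumes le: "w0 \<le> w" and t: "w \<Turnstile> fnf t a X" and Y: "w \<Turnstile> ex Y"
    and "\<And>w' b x. w \<le> w' \<Longrightarrow> w' \<Turnstile> mp t b x \<Longrightarrow> w' \<Turnstile> mem x Y"
  shows "w \<Turnstile> fnf t a Y"
proof -
  obtain c where c: "w \<Turnstile> fib c a" "w \<Turnstile> fn t c X" by (rule fnf_fib[OF le t])
  have "w \<Turnstile> fn t c Y"
  proof (rule fnI[OF fn_ex(1,2)[OF c(2)] Y])
    show "\<exists>x y. w' \<Turnstile> mem x c \<and> w' \<Turnstile> mem y Y \<and> w' \<Turnstile> pr p x y" if le': "w \<le> w'" and p: "w' \<Turnstile> mem p t" for w' p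
      using fn_pair[OF up[OF c(2) le'] p] assms(4)[OF le'] p unfolding mp_iff by blast
    show "\<exists>y. w' \<Turnstile> mem y Y \<and> w' \<Turnstile> mp t x y" if le': "w \<le> w'" and x: "w' \<Turnstile> mem x c" for w' x
      using fn_total[OF up[OF c(2) le'] x] assms(4)[OF le'] by blast
  qed (rule fn_unique[OF up[OF c(2)]])
  with fnf_fn[OF c(1) fnf_ex(2)[OF t]] show ?thesis by blast
qed

lemma fnf_exists:
  assumes le: "w0 \<le> w" and a: "w \<Turnstile> ex a" and X: "w \<Turnstile> ex X"
    and dfn: "dfn False w (\<lambda>e. P (e 0) (e (Suc 0)))"
    and total: "\<And>w' b. w \<le> w' \<Longrightarrow> w' \<Turnstile> mem b B \<Longrightarrow> w' \<Turnstile> mp f b a \<Longrightarrow> \<exists>x. w' \<Turnstile> mem x X \<and> w' \<Turnstile> P b x"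
    and uniq: "\<And>w' b x y. w \<le> w' \<Longrightarrow> w' \<Turnstile> mem b B \<Longrightarrow> w' \<Turnstile> mp f b a \<Longrightarrow> w' \<Turnstile> P b x \<Longrightarrow> w' \<Turnstile> P b y \<Longrightarrow>
      w' \<Turnstile> ex x \<Longrightarrow> w' \<Turnstile> ex y \<Longrightarrow> w' \<Turnstile> eq x y"
  shows "\<exists>t. w \<Turnstile> fnf t a X \<and> (\<forall>w'\<ge>w. \<forall>b x.
    w' \<Turnstile> mp t b x \<longleftrightarrow> w' \<Turnstile> mem b B \<and> w' \<Turnstile> mp f b a \<and> w' \<Turnstile> ex x \<and> w' \<Turnstile> P b x)"
proof -
  obtain c where c: "w \<Turnstile> fib c a" using fib_exists[OF le a] by blast
  have "\<exists>h. w \<Turnstile> fn h c X \<and>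
    (\<forall>w'\<ge>w. \<forall>x y. w' \<Turnstile> mp h x y \<longleftrightarrow> w' \<Turnstile> mem x c \<and> w' \<Turnstile> ex y \<and> w' \<Turnstile> P x y)"
  proof (rule function_set[OF dfn cmp_ex[OF c[unfolded fib_def]] X])
    show "\<exists>y. w' \<Turnstile> mem y X \<and> w' \<Turnstile> P x y" if "w \<le> w'" "w' \<Turnstile> mem x c" for w' x
      using total[OF that(1)] that(2)[unfolded fib_mem[OF c that(1)]] by blast
    show "w' \<Turnstile> eq y y'" if "w \<le> w'" "w' \<Turnstile> mem x c" "w' \<Turnstile> ex y" "w' \<Turnstile> P x y" "w' \<Turnstile> ex y'" "w' \<Turnstile> P x y'" for w' x y y'
      using uniq[OF that(1)] that(3-6) that(2)[unfolded fib_mem[OF c that(1)]] by blast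
  qed
  then obtain h where h: "w \<Turnstile> fn h c X"
    "\<forall>w'\<ge>w. \<forall>x y. w' \<Turnstile> mp h x y \<longleftrightarrow> w' \<Turnstile> mem x c \<and> w' \<Turnstile> ex y \<and> w' \<Turnstile> P x y" by blast
  have "w' \<Turnstile> mp h b x \<longleftrightarrow> w' \<Turnstile> mem b B \<and> w' \<Turnstile> mp f b a \<and> w' \<Turnstile> ex x \<and> w' \<Turnstile> P b x"
    if le: "w \<le> w'" for w' b x
    using h(2)[rule_format, OF le, of b x] fib_mem[OF c le, of b] by blast
  moreover have "w \<Turnstile> fnf h a X" using h(1) fnf_fn[OF c a] by blast
  ultimately show ?thesis by blast
qed

text \<open>Only the behaviour of k on X enters. This fits the level maps from Y to P_f^n(1), which
  are given as graphs without a fixed codomain.\<close>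

lemma comp_fnf:
  assumes le: "w0 \<le> w" and s: "w \<Turnstile> comp s k t" and t: "w \<Turnstile> fnf t a X" and Y: "w \<Turnstile> ex Y"
    and total: "\<And>w' x. w \<le> w' \<Longrightarrow> w' \<Turnstile> mem x X \<Longrightarrow> \<exists>y. w' \<Turnstile> mem y Y \<and> w' \<Turnstile> mp k x y"
    and uniq: "\<And>w' x y y'. w \<le> w' \<Longrightarrow> w' \<Turnstile> mem x X \<Longrightarrow> w' \<Turnstile> mp k x y \<Longrightarrow> w' \<Turnstile> mp k x y' \<Longrightarrow> w' \<Turnstile> eq y y'"
  shows "w \<Turnstile> fnf s a Y"
proof -
  obtain c where c: "w \<Turnstile> fib c a" "w \<Turnstile> fn t c X" by (rule fnf_fib[OF le t])
  have inY: "w' \<Turnstile> mem y Y" if le': "w \<le> w'" and x: "w' \<Turnstile> mem x X" "w' \<Turnstile> mp k x y" for w' x y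
    using total[OF le' x(1)] uniq[OF le' x(1) _ x(2)] mem_cong1 by blast
  have "w \<Turnstile> fn s c Y"
  proof (rule fnI[OF comp_ex[OF s] fn_ex(2)[OF c(2)] Y])
    fix w' p assume le': "w \<le> w'" and "w' \<Turnstile> mem p s"
    then obtain x y z where *: "w' \<Turnstile> mp t x y" "w' \<Turnstile> mp k y z" "w' \<Turnstile> pr p x z"
      using cmpD[OF s[unfolded comp_def] le'] by auto
    note m = fn_mem[OF up[OF c(2) le'] *(1)]
    from m(1) inY[OF le' m(2) *(2)] *(3) show "\<exists>x y. w' \<Turnstile> mem x c \<and> w' \<Turnstile> mem y Y \<and> w' \<Turnstile> pr p x y" by blast
  next
    fix w' b assume le': "w \<le> w'" and b: "w' \<Turnstile> mem b c"
    from fn_total[OF up[OF c(2) le'] b] obtain y where y: "w' \<Turnstile> mem y X" "w' \<Turnstile> mp t b y" by blast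
    from total[OF le' y(1)] y(2) show "\<exists>y. w' \<Turnstile> mem y Y \<and> w' \<Turnstile> mp s b y"
      unfolding comp_mp[OF s le'] by blast
  next
    fix w' b z z' assume le': "w \<le> w'" and "w' \<Turnstile> mp s b z" "w' \<Turnstile> mp s b z'"
    then obtain y y' where y: "w' \<Turnstile> mp t b y" "w' \<Turnstile> mp k y z" "w' \<Turnstile> mp t b y'" "w' \<Turnstile> mp k y' z'"
      unfolding comp_mp[OF s le'] by blast
    have "w' \<Turnstile> mp k y z'"
      by (rule mp_cong[OF y(4) fn_unique[OF up[OF c(2) le'] y(3,1)] eq_refl[OF mp_ex(3)[OF y(4)]]])
    from uniq[OF le' fn_mem(2)[OF up[OF c(2) le'] y(1)] y(2) this] show "w' \<Turnstile> eq z z'" .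
  qed
  with fnf_fn[OF c(1) fnf_ex(2)[OF t]] show ?thesis by blast
qed

definition pel :: "nat \<Rightarrow> nat \<Rightarrow> nat \<Rightarrow> nat \<Rightarrow> pv" where
  "pel X q a t = (mem a A \<sqinter> fnf t a X \<sqinter> pr q a t)"

definition isP :: "nat \<Rightarrow> nat \<Rightarrow> pv" where
  "isP X q = exi (\<lambda>a. exi (\<lambda>t. pel X q a t))"

lemma dfn_pel:
  assumes "w0 \<le> w" "term_at w X" "term_at w q" "term_at w a" "term_at w t"
  shows "dfn b w (\<lambda>e. pel (X e) (q e) (a e) (t e))"
  unfolding pel_def by (intro dfn_intros dfn_fnf assms up[OF A assms(1)])

lemma pel_iff: "w \<Turnstile> pel X q a t \<longleftrightarrow> w \<Turnstile> mem a A \<and> w \<Turnstile> fnf t a X \<and> w \<Turnstile> pr q a t"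
  by (simp add: pel_def)

lemma isP_iff: "w \<Turnstile> isP X q \<longleftrightarrow> (\<exists>a t. w \<Turnstile> pel X q a t)"
  unfolding isP_def holds_exi using pel_iff pr_ex by blast

lemma pel_inject:
  assumes "w \<Turnstile> pel X q a t" "w \<Turnstile> pel Y q a' t'"
  shows "w \<Turnstile> eq a a'" "w \<Turnstile> eq t t'"
  using assms pr_inject unfolding pel_iff by blast+

lemma pel_cong:
  assumes "w0 \<le> w" "w \<Turnstile> pel X q a t" "w \<Turnstile> eq a a'" "w \<Turnstile> eq t t'"
  shows "w \<Turnstile> pel X q a' t'"
  using assms fnf_cong[OF assms(1) _ assms(4,3)] mem_cong1 pr_cong unfolding pel_iff by blast

lemma pel_cong1: "w \<Turnstile> pel X q a t \<Longrightarrow> w \<Turnstile> eq q q' \<Longrightarrow> w \<Turnstile> pel X q' a t"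
  unfolding pel_iff using pr_cong1 by blast

text \<open>P_f(X) is the union over a in A of the pairs of a with functions from the fibre of a to
  X. These functions form a set by \<open>exponential\<close>.\<close>

lemma poly_exists:
  assumes le: "w0 \<le> w" and X: "w \<Turnstile> ex X"
  shows "\<exists>P. w \<Turnstile> cmp P (isP X)"
proof -
  have "\<exists>U. w \<Turnstile> cmp U (\<lambda>q. bex A (\<lambda>a. exi (\<lambda>t. pel X q a t)))"
  proof (rule union_family[OF _ up[OF A le]])
    show "dfn False w (\<lambda>e. all (\<lambda>z. iff (mem z (e (Suc 0))) (exi (\<lambda>t. pel X z (e 0) t))))"
      by (intro dfn_intros dfn_pel le X)
    fix w' a assume le': "w \<le> w'" and a: "w' \<Turnstile> mem a A"
    note le2 = order_trans[OF le le']
    obtain c where c: "w' \<Turnstile> fib c a" using fib_exists[OF le2 mem_ex1[OF a]] by blast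
    obtain C where C: "w' \<Turnstile> cmp C (\<lambda>g. fn g c X)"
      using exponential[OF cmp_ex[OF c[unfolded fib_def]] up[OF X le']] by blast
    have "\<exists>Q. w' \<Turnstile> cmp Q (\<lambda>q. bex C (\<lambda>t. pr q a t))"
    proof (rule image_set[OF _ cmp_ex[OF C]])
      show "dfn False w' (\<lambda>e. pr (e (Suc 0)) a (e 0))" by (intro dfn_intros mem_ex1[OF a])
      show "\<exists>y. w'' \<Turnstile> ex y \<and> w'' \<Turnstile> pr y a t" if "w' \<le> w''" "w'' \<Turnstile> mem t C" for w'' t
        using pr_exists[OF up[OF mem_ex1[OF a] that(1)] mem_ex1[OF that(2)]] pr_ex by blast
    qed (rule pr_unique, assumption, assumption, simp_all add: eq_refl pr_ex)
    then obtain Q where Q: "w' \<Turnstile> cmp Q (\<lambda>q. bex C (\<lambda>t. pr q a t))" by blast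
    have "w' \<Turnstile> cmp Q (\<lambda>q. exi (\<lambda>t. pel X q a t))"
    proof (rule cmp_cong[OF Q])
      fix w'' q assume le3: "w' \<le> w''"
      have "w'' \<Turnstile> mem t C \<longleftrightarrow> w'' \<Turnstile> fnf t a X" for t
        unfolding cmpD[OF C le3] fnf_fn[OF up[OF c le3] up[OF mem_ex1[OF a] le3]] using fn_ex(1) by blast
      then show "w'' \<Turnstile> bex C (\<lambda>t. pr q a t) \<longleftrightarrow> w'' \<Turnstile> exi (\<lambda>t. pel X q a t)"
        unfolding holds_bex holds_exi pel_iff using up[OF a le3] fnf_ex(1) by blast
    qed
    then show "\<exists>Q. w' \<Turnstile> cmp Q (\<lambda>q. exi (\<lambda>t. pel X q a t))" ..
  qed
  then obtain U where U: "w \<Turnstile> cmp U (\<lambda>q. bex A (\<lambda>a. exi (\<lambda>t. pel X q a t)))" by blast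
  have "w \<Turnstile> cmp U (isP X)"
    by (rule cmp_cong[OF U]) (unfold isP_def holds_bex holds_exi pel_iff, use mem_ex1 in blast)
  then show ?thesis ..
qed

end

section \<open>The limit of the finite approximations\<close>

lemma omega_up:
  assumes "omega w W" "w \<le> w'"
  shows "omega w' W"
  unfolding omega_def
  using omegaD(2-4)[OF assms(1) order_trans[OF assms(2)]] omegaD(1,5)[OF assms] by blast

lemma product_mp:
  assumes "w \<Turnstile> cmp Q (prod_of a b)" "w \<le> w'"
  shows "w' \<Turnstile> mp Q x y \<longleftrightarrow> w' \<Turnstile> mem x a \<and> w' \<Turnstile> mem y b"
proof
  assume "w' \<Turnstile> mp Q x y"
  then obtain p where "w' \<Turnstile> mem p Q" and p: "w' \<Turnstile> pr p x y" by (auto simp: mp_iff)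
  then obtain x' y' where "w' \<Turnstile> mem x' a" "w' \<Turnstile> mem y' b" "w' \<Turnstile> pr p x' y'"
    unfolding cmpD[OF assms] prod_of_def by auto
  with pr_inject[OF _ p] mem_cong1 show "w' \<Turnstile> mem x a \<and> w' \<Turnstile> mem y b" by blast
next
  assume xy: "w' \<Turnstile> mem x a \<and> w' \<Turnstile> mem y b"
  then obtain p where p: "w' \<Turnstile> pr p x y" using pr_exists mem_ex1 by blast
  then have "w' \<Turnstile> mem p Q" unfolding cmpD[OF assms] prod_of_def using xy pr_ex(1)[OF p] by auto
  with p show "w' \<Turnstile> mp Q x y" by (auto simp: mp_iff)
qed

text \<open>The functions t and t' are related by R pointwise: the extension of R to families with
  the same index set.\<close>

definition par :: "nat \<Rightarrow> nat \<Rightarrow> nat \<Rightarrow> pv" where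
  "par R t t' = all (\<lambda>b. all (\<lambda>z. all (\<lambda>z'. mp t b z \<sqinter> mp t' b z' \<rightarrow> mp R z z')))"

lemma parD:
  assumes "w \<Turnstile> par R t t'" "w \<Turnstile> mp t b z" "w \<Turnstile> mp t' b z'"
  shows "w \<Turnstile> mp R z z'"
  using assms mp_ex(2,3)[OF assms(2)] mp_ex(3)[OF assms(3)] order_refl[of w]
  unfolding par_def holds_all holds_imp holds_conj by blast

lemma parI:
  assumes "\<And>w' b z z'. w \<le> w' \<Longrightarrow> w' \<Turnstile> mp t b z \<Longrightarrow> w' \<Turnstile> mp t' b z' \<Longrightarrow> w' \<Turnstile> mp R z z'"
  shows "w \<Turnstile> par R t t'"
  unfolding par_def holds_all holds_imp holds_conj
proof (intro allI impI)
  fix w1 b w2 z w3 z' w4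
  assume le: "w \<le> w1" "w1 \<le> w2" "w2 \<le> w3" "w3 \<le> w4" and m: "w4 \<Turnstile> mp t b z \<and> w4 \<Turnstile> mp t' b z'"
  have "w \<le> w4" by (rule order_trans[OF le(1) order_trans[OF le(2) order_trans[OF le(3,4)]]])
  with assms m show "w4 \<Turnstile> mp R z z'" by blast
qed

lemma dfn_par [dfn_intros]:
  assumes "term_at w R" "term_at w t" "term_at w t'"
  shows "dfn False w (\<lambda>e. par (R e) (t e) (t' e))"
  unfolding par_def
  by (intro dfn_intros assms[THEN term_shift, THEN term_shift, THEN term_shift])

section \<open>The truncation relations between consecutive levels\<close>

context container
begin

text \<open>
  Let \<open>R\<^sub>0\<close> be the total relation from \<open>1\<close> to \<open>P\<^sub>f(1)\<close> and \<open>R\<^sub>n\<^sub>+\<^sub>1 = PHI R\<^sub>n\<close>. Then \<open>R\<^sub>n\<close> relates \<open>z\<close> in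
  \<open>P\<^sub>f\<^sup>n(1)\<close> to \<open>z'\<close> in \<open>P\<^sub>f\<^sup>n\<^sup>+\<^sup>1(1)\<close> iff \<open>z\<close> is the truncation of \<open>z'\<close>. Iterating this relation avoids a
  simultaneous recursion for the sets \<open>P\<^sub>f\<^sup>n(1)\<close> and the maps between them.
\<close>

definition PHI :: "nat \<Rightarrow> nat \<Rightarrow> pv" where
  "PHI R r = exi (\<lambda>M. exi (\<lambda>a. exi (\<lambda>t. exi (\<lambda>t'. exi (\<lambda>x. exi (\<lambda>x'.
    pel M x a t \<sqinter> pel M x' a t' \<sqinter> pr r x x' \<sqinter> par R t t'))))))"

lemma dfn_PHI:
  assumes "w0 \<le> w" "term_at w R" "term_at w r"
  shows "dfn False w (\<lambda>e. PHI (R e) (r e))"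
  unfolding PHI_def
  by (intro dfn_intros dfn_pel assms(1)
      assms(2-)[THEN term_shift, THEN term_shift, THEN term_shift, THEN term_shift, THEN term_shift, THEN term_shift])

lemma pel_ex:
  assumes "w \<Turnstile> pel X q a t"
  shows "w \<Turnstile> ex X" "w \<Turnstile> ex q" "w \<Turnstile> ex a" "w \<Turnstile> ex t"
  using assms fnf_ex pr_ex unfolding pel_iff by blast+

lemma PHI_iff:
  "w \<Turnstile> PHI R r \<longleftrightarrow> (\<exists>M a t t' x x'. w \<Turnstile> pel M x a t \<and> w \<Turnstile> pel M x' a t' \<and> w \<Turnstile> pr r x x' \<and> w \<Turnstile> par R t t')"
proof
  assume "w \<Turnstile> PHI R r"
  then show "\<exists>M a t t' x x'. w \<Turnstile> pel M x a t \<and> w \<Turnstile> pel M x' a t' \<and> w \<Turnstile> pr r x x' \<and> w \<Turnstile> par R t t'"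
    unfolding PHI_def holds_exi holds_conj by blast
next
  assume "\<exists>M a t t' x x'. w \<Turnstile> pel M x a t \<and> w \<Turnstile> pel M x' a t' \<and> w \<Turnstile> pr r x x' \<and> w \<Turnstile> par R t t'"
  then obtain M a t t' x x' where *: "w \<Turnstile> pel M x a t" "w \<Turnstile> pel M x' a t'" "w \<Turnstile> pr r x x'" "w \<Turnstile> par R t t'"
    by blast
  show "w \<Turnstile> PHI R r"
    unfolding PHI_def holds_exi holds_conj using * pel_ex[OF *(1)] pel_ex(2,4)[OF *(2)] by blast
qed

text \<open>In \<open>PHI\<close> the codomain is an unbounded existential variable. Since t and t'
  are defined on the same fibre and related by R, all their values lie in the field of R, which can
  replace any codomain.\<close>

lemma pel_codomain:
  assumes le: "w0 \<le> w" and x: "w \<Turnstile> pel M' x a t" and x': "w \<Turnstile> pel M' x' a t'" and par: "w \<Turnstile> par R t t'"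
    and M: "w \<Turnstile> ex M" and field: "\<And>w' x y. w \<le> w' \<Longrightarrow> w' \<Turnstile> mp R x y \<Longrightarrow> w' \<Turnstile> mem x M \<and> w' \<Turnstile> mem y M"
  shows "w \<Turnstile> pel M x a t" "w \<Turnstile> pel M x' a t'"
proof -
  have t: "w \<Turnstile> fnf t a M'" and t': "w \<Turnstile> fnf t' a M'" using x x' by (simp_all add: pel_iff)
  have "w \<Turnstile> fnf t a M"
  proof (rule fnf_codomain[OF le t M])
    fix w' b z assume le': "w \<le> w'" and z: "w' \<Turnstile> mp t b z"
    note le2 = order_trans[OF le le']
    from fnf_total[OF le2 up[OF t' le'] fnf_mem(1,2)[OF le2 up[OF t le'] z]] obtain z' where "w' \<Turnstile> mp t' b z'" by blast
    from field[OF le' parD[OF up[OF par le'] z this]] show "w' \<Turnstile> mem z M" by blast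
  qed
  with x show "w \<Turnstile> pel M x a t" by (simp add: pel_iff)
  have "w \<Turnstile> fnf t' a M"
  proof (rule fnf_codomain[OF le t' M])
    fix w' b z assume le': "w \<le> w'" and z: "w' \<Turnstile> mp t' b z"
    note le2 = order_trans[OF le le']
    from fnf_total[OF le2 up[OF t le'] fnf_mem(1,2)[OF le2 up[OF t' le'] z]] obtain z' where "w' \<Turnstile> mp t b z'" by blast
    from field[OF le' parD[OF up[OF par le'] this z]] show "w' \<Turnstile> mem z M" by blast
  qed
  with x' show "w \<Turnstile> pel M x' a t'" by (simp add: pel_iff)
qed

text \<open>Fixing M as a set containing the field of R bounds all quantifiers of
  \<open>PHI\<close>: x and x' range over P_f(M), and the pairs r over its square.\<close>

lemma PHI_set:
  assumes le: "w0 \<le> w" and R: "w \<Turnstile> ex R"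
  shows "\<exists>R'. w \<Turnstile> cmp R' (PHI R)"
proof -
  obtain M where M: "w \<Turnstile> ex M" "\<And>w' x y. w \<le> w' \<Longrightarrow> w' \<Turnstile> mp R x y \<Longrightarrow> w' \<Turnstile> mem x M \<and> w' \<Turnstile> mem y M"
    by (rule field_set[OF R]) blast
  obtain P where P: "w \<Turnstile> cmp P (isP M)" using poly_exists[OF le M(1)] by blast
  note P_ex = cmp_ex[OF P]
  \<comment> \<open>The functions t and t' are second components of elements of P_f(M). The field of
    P_f(M), read as a set of pairs, therefore bounds them.\<close>
  obtain L where L: "w \<Turnstile> ex L" "\<And>w' x y. w \<le> w' \<Longrightarrow> w' \<Turnstile> mp P x y \<Longrightarrow> w' \<Turnstile> mem x L \<and> w' \<Turnstile> mem y L"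
    by (rule field_set[OF P_ex]) blast
  obtain Z where Z: "w \<Turnstile> cmp Z (prod_of P P)" using product_set[OF P_ex P_ex] by blast
  let ?\<psi> = "\<lambda>r. bex P (\<lambda>x. bex P (\<lambda>x'. bex A (\<lambda>a. bex L (\<lambda>t. bex L (\<lambda>t'.
    pr x a t \<sqinter> pr x' a t' \<sqinter> pr r x x' \<sqinter>
    ball B (\<lambda>b. ball M (\<lambda>z. ball M (\<lambda>z'. mp t b z \<sqinter> mp t' b z' \<rightarrow> mp R z z'))))))))"
  have "dfn True w (\<lambda>e. ?\<psi> (e 0))"
    by (intro dfn_intros P_ex M(1) L(1) R up[OF A le] up[OF B le])
  from cmp_separation[OF this cmp_ex[OF Z]] obtain Q where Q: "w \<Turnstile> cmp Q (\<lambda>r. mem r Z \<sqinter> ?\<psi> r)" by blast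
  have "w \<Turnstile> cmp Q (PHI R)"
  proof (rule cmp_cong[OF Q])
    fix w' r assume le': "w \<le> w'" and r: "w' \<Turnstile> ex r"
    note le2 = order_trans[OF le le']
    show "w' \<Turnstile> (mem r Z \<sqinter> ?\<psi> r) \<longleftrightarrow> w' \<Turnstile> PHI R r"
    proof
      assume "w' \<Turnstile> (mem r Z \<sqinter> ?\<psi> r)"
      then have "w' \<Turnstile> ?\<psi> r" by simp
      then obtain x x' a t t' where x: "w' \<Turnstile> mem x P" "w' \<Turnstile> mem x' P" "w' \<Turnstile> pr x a t" "w' \<Turnstile> pr x' a t'" "w' \<Turnstile> pr r x x'"
        and p: "w' \<Turnstile> ball B (\<lambda>b. ball M (\<lambda>z. ball M (\<lambda>z'. mp t b z \<sqinter> mp t' b z' \<rightarrow> mp R z z')))"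
        unfolding holds_bex holds_conj by blast
      have pel: "w' \<Turnstile> pel M y a s" if "w' \<Turnstile> mem y P" "w' \<Turnstile> pr y a s" for y s
      proof -
        from that(1) obtain a0 s0 where y: "w' \<Turnstile> pel M y a0 s0" unfolding cmpD[OF P le'] isP_iff by blast
        from pr_inject[OF _ that(2)] y have "w' \<Turnstile> eq a0 a" "w' \<Turnstile> eq s0 s" unfolding pel_iff by blast+
        from pel_cong[OF le2 y this] show ?thesis .
      qed
      note t = pel[OF x(1,3)] pel[OF x(2,4)]
      have "w' \<Turnstile> par R t t'"
      proof (rule parI)
        fix w'' b z z' assume le3: "w' \<le> w''" and m: "w'' \<Turnstile> mp t b z" "w'' \<Turnstile> mp t' b z'"
        note le4 = order_trans[OF le2 le3]
        have f: "w'' \<Turnstile> fnf t a M" "w'' \<Turnstile> fnf t' a M" using t[THEN up, OF le3] by (simp_all add: pel_iff)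
        from up[OF p le3] fnf_mem(1,3)[OF le4 f(1) m(1)] fnf_mem(3)[OF le4 f(2) m(2)] m order_refl[of w'']
        show "w'' \<Turnstile> mp R z z'" unfolding holds_ball holds_imp holds_conj by blast
      qed
      with t x(5) show "w' \<Turnstile> PHI R r" unfolding PHI_iff by blast
    next
      assume "w' \<Turnstile> PHI R r"
      then obtain M' a t t' x x' where x: "w' \<Turnstile> pel M' x a t" "w' \<Turnstile> pel M' x' a t'" "w' \<Turnstile> pr r x x'" "w' \<Turnstile> par R t t'"
        unfolding PHI_iff by blast
      have "w' \<Turnstile> pel M x a t" "w' \<Turnstile> pel M x' a t'"
        using pel_codomain[OF le2 x(1,2,4) up[OF M(1) le'] M(2)[OF order_trans[OF le']]] by blast+
      note pel = this
      have P': "w' \<Turnstile> mem x P" "w' \<Turnstile> mem x' P"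
        unfolding cmpD[OF P le'] isP_iff using pel pel_ex(2) by blast+
      have pr: "w' \<Turnstile> pr x a t" "w' \<Turnstile> pr x' a t'" and a: "w' \<Turnstile> mem a A" using pel by (simp_all add: pel_iff)
      have "w' \<Turnstile> mem t L" "w' \<Turnstile> mem t' L"
        using L(2)[OF le', of a t] L(2)[OF le', of a t'] P' pr by (auto simp: mp_iff)
      moreover have "w' \<Turnstile> mem r Z"
        unfolding cmpD[OF Z le'] prod_of_def using r P' x(3) by auto
      moreover have "w' \<Turnstile> ball B (\<lambda>b. ball M (\<lambda>z. ball M (\<lambda>z'. mp t b z \<sqinter> mp t' b z' \<rightarrow> mp R z z')))"
        unfolding holds_ball holds_imp holds_conj
      proof (intro allI impI)
        fix w1 b w2 z w3 z' w4
        assume l: "w' \<le> w1" "w1 \<le> w2" "w2 \<le> w3" "w3 \<le> w4" and m: "w4 \<Turnstile> mp t b z \<and> w4 \<Turnstile> mp t' b z'"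
        have "w' \<le> w4" by (rule order_trans[OF l(1) order_trans[OF l(2) order_trans[OF l(3,4)]]])
        from parD[OF up[OF x(4) this]] m show "w4 \<Turnstile> mp R z z'" by blast
      qed
      ultimately show "w' \<Turnstile> (mem r Z \<sqinter> ?\<psi> r)"
        unfolding holds_bex holds_conj using P' pr a x(3) by blast
    qed
  qed
  then show ?thesis ..
qed

lemma PHI_mp:
  assumes le: "w0 \<le> w" and R': "w \<Turnstile> cmp R' (PHI R)" and m: "w \<Turnstile> mp R' x x'"
  obtains M a t t' where "w \<Turnstile> pel M x a t" "w \<Turnstile> pel M x' a t'" "w \<Turnstile> par R t t'"
proof -
  from m obtain r where "w \<Turnstile> mem r R'" and r: "w \<Turnstile> pr r x x'" by (auto simp: mp_iff)
  then obtain M a t t' y y' where y: "w \<Turnstile> pel M y a t" "w \<Turnstile> pel M y' a t'" "w \<Turnstile> pr r y y'" "w \<Turnstile> par R t t'"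
    unfolding cmp_mem[OF R'] PHI_iff by blast
  from pel_cong1[OF y(1) pr_inject(1)[OF y(3) r]] pel_cong1[OF y(2) pr_inject(2)[OF y(3) r]] y(4) that
  show thesis by blast
qed

lemma PHI_mpI:
  assumes "w \<Turnstile> cmp R' (PHI R)" "w \<Turnstile> pel M x a t" "w \<Turnstile> pel M x' a t'" "w \<Turnstile> par R t t'"
  shows "w \<Turnstile> mp R' x x'"
proof -
  from pr_exists[OF pel_ex(2)[OF assms(2)] pel_ex(2)[OF assms(3)]] obtain r where r: "w \<Turnstile> pr r x x'" by blast
  with assms(2-) have "w \<Turnstile> mem r R'" unfolding cmp_mem[OF assms(1)] PHI_iff using pr_ex(1) by blast
  with r show ?thesis by (auto simp: mp_iff)
qed

end

text \<open>
  \<open>\<rho>\<close> is the sequence of the \<open>R\<^sub>n\<close> and \<open>X\<close> the set of coherent sequences. The sets \<open>F\<close> and \<open>N\<close>, which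
  contain all \<open>R\<^sub>n\<close> and all elements of the fields of the \<open>R\<^sub>n\<close>, only keep the quantifiers bounded.
\<close>

locale limit = container +
  fixes W z0 one P1 R0 \<rho> F N X :: nat
  assumes W: "omega w0 W"
    and z0: "w0 \<Turnstile> zero z0"
    and one: "w0 \<Turnstile> upr one z0 z0"
    and P1: "w0 \<Turnstile> cmp P1 (isP one)"
    and R0: "w0 \<Turnstile> cmp R0 (prod_of one P1)"
    and \<rho>: "rec_seq w0 W R0 (\<lambda>R R'. cmp R' (PHI R)) \<rho>"
    and F: "w0 \<Turnstile> ex F" "\<And>w n R. w0 \<le> w \<Longrightarrow> w \<Turnstile> mp \<rho> n R \<Longrightarrow> w \<Turnstile> mem R F"
    and N: "w0 \<Turnstile> ex N" "\<And>w n R x y. w0 \<le> w \<Longrightarrow> w \<Turnstile> mp \<rho> n R \<Longrightarrow> w \<Turnstile> mp R x y \<Longrightarrow> w \<Turnstile> mem x N \<and> w \<Turnstile> mem y N"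
    and X: "w0 \<Turnstile> cmp X (\<lambda>g. fn g W N \<sqinter> ball W (\<lambda>m. ball W (\<lambda>n. suc m n \<rightarrow> ball F (\<lambda>R. ball N (\<lambda>z. ball N (\<lambda>z'.
      mp \<rho> m R \<sqinter> mp g m z \<sqinter> mp g n z' \<rightarrow> mp R z z'))))))"
begin

lemma X_fn: "w0 \<le> w \<Longrightarrow> w \<Turnstile> mem g X \<Longrightarrow> w \<Turnstile> fn g W N"
  using cmpD[OF X] by simp

lemma X_coherent:
  assumes le: "w0 \<le> w" and g: "w \<Turnstile> mem g X" and s: "w \<Turnstile> suc m n" and R: "w \<Turnstile> mp \<rho> m R"
    and z: "w \<Turnstile> mp g m z" and z': "w \<Turnstile> mp g n z'"
  shows "w \<Turnstile> mp R z z'"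
proof -
  have "w \<Turnstile> ball W (\<lambda>m. ball W (\<lambda>n. suc m n \<rightarrow> ball F (\<lambda>R. ball N (\<lambda>z. ball N (\<lambda>z'.
      mp \<rho> m R \<sqinter> mp g m z \<sqinter> mp g n z' \<rightarrow> mp R z z')))))"
    using g unfolding cmpD[OF X le] holds_conj by blast
  with fn_mem[OF X_fn[OF le g] z] fn_mem[OF X_fn[OF le g] z'] s F(2)[OF le R] R z z' order_refl[of w]
  show ?thesis unfolding holds_ball holds_imp holds_conj by blast
qed

lemma X_intro:
  assumes le: "w0 \<le> w" and g: "w \<Turnstile> fn g W N"
    and coh: "\<And>w' m n R z z'. w \<le> w' \<Longrightarrow> w' \<Turnstile> suc m n \<Longrightarrow> w' \<Turnstile> mp \<rho> m R \<Longrightarrow> w' \<Turnstile> mp g m z \<Longrightarrow>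
      w' \<Turnstile> mp g n z' \<Longrightarrow> w' \<Turnstile> mp R z z'"
  shows "w \<Turnstile> mem g X"
  unfolding cmpD[OF X le] holds_conj holds_ball holds_imp
proof (intro HOL.conjI allI impI fn_ex(1)[OF g] g)
  fix w1 m w2 n w3 w4 R w5 z w6 z' w7
  assume l: "w \<le> w1" "w1 \<le> w2" "w2 \<le> w3" "w3 \<le> w4" "w4 \<le> w5" "w5 \<le> w6" "w6 \<le> w7"
    and s: "w3 \<Turnstile> suc m n" and m: "w7 \<Turnstile> mp \<rho> m R \<and> w7 \<Turnstile> mp g m z \<and> w7 \<Turnstile> mp g n z'"
  have l3: "w3 \<le> w7" by (rule order_trans[OF l(4) order_trans[OF l(5) order_trans[OF l(6,7)]]])
  have "w \<le> w7" by (rule order_trans[OF l(1) order_trans[OF l(2) order_trans[OF l(3) l3]]])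
  from coh[OF this up[OF s l3]] m show "w7 \<Turnstile> mp R z z'" by blast
qed

lemma level_zero:
  assumes le: "w0 \<le> w" and "w \<Turnstile> zero m" and R: "w \<Turnstile> mp \<rho> m R"
  shows "w \<Turnstile> mp R z z' \<longleftrightarrow> w \<Turnstile> eq z z0 \<and> w \<Turnstile> ex z' \<and> w \<Turnstile> isP one z'"
proof -
  have E: "w \<Turnstile> eq R R0" by (rule rec_seqD(4)[OF \<rho> le assms(2) R])
  have "w \<Turnstile> mp R z z' \<longleftrightarrow> w \<Turnstile> mp R0 z z'" using mp_cong1 E eq_sym[OF E] by blast
  then show ?thesis
    unfolding product_mp[OF R0 le] uprD(6)[OF one le] cmpD[OF P1 le] by blast
qed

lemma level_suc:
  assumes le: "w0 \<le> w" and "w \<Turnstile> suc m n" and "w \<Turnstile> mp \<rho> m R" "w \<Turnstile> mp \<rho> n R'"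
  shows "w \<Turnstile> cmp R' (PHI R)"
  using rec_seqD(5)[OF \<rho> le assms(2-)] .

lemma level_exists: "w0 \<le> w \<Longrightarrow> w \<Turnstile> mem n W \<Longrightarrow> \<exists>R. w \<Turnstile> mp \<rho> n R"
  using rec_seqD(2)[OF \<rho>] .

text \<open>Coherence between indices 0 and 1 puts the entry at 0 on the left of R_0, where only the
  point z0 occurs.\<close>

lemma X_zero:
  assumes le: "w0 \<le> w" and g: "w \<Turnstile> mem g X" and n: "w \<Turnstile> zero n" and z: "w \<Turnstile> mp g n z"
  shows "w \<Turnstile> eq z z0"
proof -
  note nW = fn_mem(1)[OF X_fn[OF le g] z]
  obtain m where m: "w \<Turnstile> suc n m" using suc_exists[OF mem_ex1[OF nW]] by blast
  obtain z' where z': "w \<Turnstile> mp g m z'" using fn_total[OF X_fn[OF le g] omegaD(3)[OF W le nW m]] by blast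
  obtain R where R: "w \<Turnstile> mp \<rho> n R" using level_exists[OF le nW] by blast
  from X_coherent[OF le g m R z z'] level_zero[OF le n R] show ?thesis by blast
qed

text \<open>An entry at a successor index stands on the right of some R_n. Everything there is an
  element of P_f of some set: of the one-point set if n is zero, and of the set named in
  \<open>PHI\<close> otherwise.\<close>

lemma X_shape:
  assumes le: "w0 \<le> w" and g: "w \<Turnstile> mem g X" and s: "w \<Turnstile> suc n m" and x: "w \<Turnstile> mp g m x"
  shows "\<exists>M a t. w \<Turnstile> pel M x a t"
proof -
  note gf = X_fn[OF le g]
  have nW: "w \<Turnstile> mem n W"
  proof -
    from omegaD(4)[OF W le fn_mem(1)[OF gf x]] show ?thesis
    proof (elim HOL.disjE exE HOL.conjE)
      assume "w \<Turnstile> zero m"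
      from zero_suc[OF this s] show ?thesis by (rule bot_mem[OF _ suc_ex(1)[OF s] omegaD(1)[OF W le]])
    next
      fix k assume "w \<Turnstile> mem k W" "w \<Turnstile> suc k m"
      with suc_inject[OF _ s] mem_cong1 show ?thesis by blast
    qed
  qed
  obtain y where y: "w \<Turnstile> mp g n y" using fn_total[OF gf nW] by blast
  obtain R where R: "w \<Turnstile> mp \<rho> n R" using level_exists[OF le nW] by blast
  note yx = X_coherent[OF le g s R y x]
  from omegaD(4)[OF W le nW] show ?thesis
  proof (elim HOL.disjE exE HOL.conjE)
    assume "w \<Turnstile> zero n"
    from yx[unfolded level_zero[OF le this R]] show ?thesis unfolding isP_iff by blast
  next
    fix k assume k: "w \<Turnstile> mem k W" "w \<Turnstile> suc k n"
    obtain R1 where R1: "w \<Turnstile> mp \<rho> k R1" using level_exists[OF le k(1)] by blast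
    show ?thesis by (rule PHI_mp[OF le level_suc[OF le k(2) R1 R] yx]) blast
  qed
qed

text \<open>The root is taken from the entry at index 1. Since \<open>PHI\<close> only relates pairs
  with equal first components, induction along the sequence carries the root to all later
  entries.\<close>

lemma X_root:
  assumes le: "w0 \<le> w" and g: "w \<Turnstile> mem g X"
  shows "\<exists>a. w \<Turnstile> mem a A \<and> (\<forall>w'\<ge>w. \<forall>n m x. w' \<Turnstile> mem n W \<longrightarrow> w' \<Turnstile> suc n m \<longrightarrow> w' \<Turnstile> mp g m x \<longrightarrow> (\<exists>M t. w' \<Turnstile> pel M x a t))"
proof -
  obtain z where z: "w \<Turnstile> zero z" using omegaD(5)[OF W le] by blast
  obtain m where m: "w \<Turnstile> suc z m" using suc_exists[OF zero_ex[OF z]] by blast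
  have mW: "w \<Turnstile> mem m W" by (rule omegaD(3)[OF W le omegaD(2)[OF W le z] m])
  obtain x where x: "w \<Turnstile> mp g m x" using fn_total[OF X_fn[OF le g] mW] by blast
  obtain M a t where a: "w \<Turnstile> pel M x a t" using X_shape[OF le g m x] by blast
  let ?Q = "\<lambda>n. all (\<lambda>m. all (\<lambda>x. suc n m \<sqinter> mp g m x \<rightarrow> exi (\<lambda>M. exi (\<lambda>t. pel M x a t))))"
  have QD: "\<exists>M t. w' \<Turnstile> pel M x a t" if "w' \<Turnstile> ?Q n" "w' \<Turnstile> suc n m" "w' \<Turnstile> mp g m x" for w' n m x
    using that suc_ex(2)[OF that(2)] mp_ex(3)[OF that(3)] order_refl[of w']
    unfolding holds_all holds_imp holds_conj holds_exi by blast
  have QI: "w' \<Turnstile> ?Q n" if "\<And>w'' m x. w' \<le> w'' \<Longrightarrow> w'' \<Turnstile> suc n m \<Longrightarrow> w'' \<Turnstile> mp g m x \<Longrightarrow> \<exists>M t. w'' \<Turnstile> pel M x a t" for w' n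
    unfolding holds_all holds_imp holds_conj holds_exi
  proof (intro allI impI)
    fix w1 m w2 x w3 assume l: "w' \<le> w1" "w1 \<le> w2" "w2 \<le> w3" and mx: "w3 \<Turnstile> suc n m \<and> w3 \<Turnstile> mp g m x"
    from that[OF order_trans[OF l(1) order_trans[OF l(2,3)]]] mx obtain M t where t: "w3 \<Turnstile> pel M x a t" by blast
    show "\<exists>M. w3 \<Turnstile> ex M \<and> (\<exists>t. w3 \<Turnstile> ex t \<and> w3 \<Turnstile> pel M x a t)"
      by (intro exI HOL.conjI, rule pel_ex(1)[OF t], rule pel_ex(4)[OF t], rule t)
  qed
  have "w' \<Turnstile> ?Q n" if le': "w \<le> w'" and n: "w' \<Turnstile> mem n W" for w' n
  proof (rule omega_induct[OF _ _ _ _ le' n])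
    show "omega w W" by (rule omega_up[OF W le])
    show "dfn False w (\<lambda>e. ?Q (e 0))" by (intro dfn_intros dfn_pel le pel_ex(3)[OF a] mem_ex1[OF g])
  next
    fix w' z' assume le': "w \<le> w'" and z': "w' \<Turnstile> zero z'"
    show "w' \<Turnstile> ?Q z'"
    proof (rule QI)
      fix w'' m' x' assume le'': "w' \<le> w''" and m': "w'' \<Turnstile> suc z' m'" and x': "w'' \<Turnstile> mp g m' x'"
      note l = order_trans[OF le' le'']
      have "w'' \<Turnstile> suc z m'"
        by (rule suc_cong[OF m' zero_unique[OF up[OF z' le''] up[OF z l]] eq_refl[OF suc_ex(2)[OF m']]])
      note E = suc_unique[OF this up[OF m l]]
      have "w'' \<Turnstile> mp g m x'" by (rule mp_cong[OF x' E eq_refl[OF mp_ex(3)[OF x']]])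
      from pel_cong1[OF up[OF a l] fn_unique[OF up[OF X_fn[OF le g] l] up[OF x l] this]]
      show "\<exists>M t. w'' \<Turnstile> pel M x' a t" by blast
    qed
  next
    fix w' k n assume le': "w \<le> w'" and k: "w' \<Turnstile> mem k W" "w' \<Turnstile> suc k n" and IH: "w' \<Turnstile> ?Q k"
    show "w' \<Turnstile> ?Q n"
    proof (rule QI)
      fix w'' m x assume le'': "w' \<le> w''" and m: "w'' \<Turnstile> suc n m" and x: "w'' \<Turnstile> mp g m x"
      note l = order_trans[OF le' le''] and k = k[THEN up, OF le'']
      note l0 = order_trans[OF le l] and g' = up[OF g l]
      note gf = X_fn[OF l0 g']
      note nW = omegaD(3)[OF W l0 k]
      obtain y where y: "w'' \<Turnstile> mp g n y" using fn_total[OF gf nW] by blast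
      obtain M t where t: "w'' \<Turnstile> pel M y a t" using QD[OF up[OF IH le''] k(2) y] by blast
      obtain R where R: "w'' \<Turnstile> mp \<rho> n R" using level_exists[OF l0 nW] by blast
      obtain R1 where R1: "w'' \<Turnstile> mp \<rho> k R1" using level_exists[OF l0 k(1)] by blast
      show "\<exists>M t. w'' \<Turnstile> pel M x a t"
      proof (rule PHI_mp[OF l0 level_suc[OF l0 k(2) R1 R] X_coherent[OF l0 g' m R y x]])
        fix M' a' t' t'' assume "w'' \<Turnstile> pel M' y a' t'" and x: "w'' \<Turnstile> pel M' x a' t''"
        from pel_inject(1)[OF this(1) t] have "w'' \<Turnstile> eq a' a" .
        from pel_cong[OF l0 x this eq_refl[OF pel_ex(4)[OF x]]] show ?thesis by blast
      qed
    qed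
  qed
  with QD have "\<forall>w'\<ge>w. \<forall>n m x. w' \<Turnstile> mem n W \<longrightarrow> w' \<Turnstile> suc n m \<longrightarrow> w' \<Turnstile> mp g m x \<longrightarrow> (\<exists>M t. w' \<Turnstile> pel M x a t)" by blast
  moreover have "w \<Turnstile> mem a A" using a by (simp add: pel_iff)
  ultimately show ?thesis by blast
qed

end

section \<open>Roots and subtrees; uniqueness of morphisms\<close>

context limit
begin

text \<open>If \<open>g(n + 1) = (a, s)\<close>, then \<open>s b\<close> is level \<open>n\<close> of the subtree of \<open>g\<close> at \<open>b\<close>.\<close>

definition sub :: "nat \<Rightarrow> nat \<Rightarrow> nat \<Rightarrow> nat \<Rightarrow> nat \<Rightarrow> pv" where
  "sub g a b n z = exi (\<lambda>m. exi (\<lambda>x. exi (\<lambda>s. suc n m \<sqinter> mp g m x \<sqinter> pr x a s \<sqinter> mp s b z)))"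

lemma dfn_sub:
  assumes "w0 \<le> w" "term_at w g" "term_at w a" "term_at w b" "term_at w n" "term_at w z"
  shows "dfn False w (\<lambda>e. sub (g e) (a e) (b e) (n e) (z e))"
  unfolding sub_def by (intro dfn_intros assms(2-)[THEN term_shift, THEN term_shift, THEN term_shift])

lemma sub_iff: "w \<Turnstile> sub g a b n z \<longleftrightarrow> (\<exists>m x s. w \<Turnstile> suc n m \<and> w \<Turnstile> mp g m x \<and> w \<Turnstile> pr x a s \<and> w \<Turnstile> mp s b z)"
  unfolding sub_def holds_exi holds_conj using suc_ex(2) pr_ex by blast

lemma X_function:
  assumes le: "w0 \<le> w" and g: "w \<Turnstile> mem g X" and "w \<Turnstile> suc n m" "w \<Turnstile> mp g m x" and s: "w \<Turnstile> pr x a s"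
  shows "\<exists>M. w \<Turnstile> pel M x a s"
proof -
  obtain M a' t where t: "w \<Turnstile> pel M x a' t" using X_shape[OF assms(1-4)] by blast
  then have "w \<Turnstile> pr x a' t" by (simp add: pel_iff)
  from pel_cong[OF le t pr_inject[OF this s]] show ?thesis ..
qed

lemma X_next_unique:
  assumes le: "w0 \<le> w" and g: "w \<Turnstile> mem g X" and m: "w \<Turnstile> suc n m" "w \<Turnstile> mp g m x" and m': "w \<Turnstile> suc n m'" "w \<Turnstile> mp g m' x'"
  shows "w \<Turnstile> eq x x'"
  by (rule fn_unique[OF X_fn[OF le g] m(2)])
    (rule mp_cong[OF m'(2) suc_unique[OF m'(1) m(1)] eq_refl[OF mp_ex(3)[OF m'(2)]]])

lemma sub_unique:
  assumes le: "w0 \<le> w" and g: "w \<Turnstile> mem g X" and "w \<Turnstile> sub g a b n z" "w \<Turnstile> sub g a b n z'"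
  shows "w \<Turnstile> eq z z'"
proof -
  from assms(3) obtain m x s where 1: "w \<Turnstile> suc n m" "w \<Turnstile> mp g m x" "w \<Turnstile> pr x a s" "w \<Turnstile> mp s b z"
    unfolding sub_iff by blast
  from assms(4) obtain m' x' s' where 2: "w \<Turnstile> suc n m'" "w \<Turnstile> mp g m' x'" "w \<Turnstile> pr x' a s'" "w \<Turnstile> mp s' b z'"
    unfolding sub_iff by blast
  have "w \<Turnstile> pr x' a s" by (rule pr_cong1[OF 1(3) X_next_unique[OF le g 1(1,2) 2(1,2)]])
  from mp_cong1[OF 2(4) pr_inject(2)[OF 2(3) this]] have "w \<Turnstile> mp s b z'" .
  moreover obtain M where "w \<Turnstile> pel M x a s" using X_function[OF le g 1(1-3)] by blast
  ultimately show ?thesis using fnf_unique[OF le _ 1(4)] unfolding pel_iff by blast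
qed

text \<open>The entries at n + 1 and n + 2 are related by \<open>PHI\<close> of R_n, so their second
  components are related by R_n at each b. This is coherence of the subtree between n and n +
  1.\<close>

lemma sub_coherent:
  assumes le: "w0 \<le> w" and g: "w \<Turnstile> mem g X" and n: "w \<Turnstile> suc n n'" and R: "w \<Turnstile> mp \<rho> n R"
    and z: "w \<Turnstile> sub g a b n z" and z': "w \<Turnstile> sub g a b n' z'"
  shows "w \<Turnstile> mp R z z'"
proof -
  from z obtain m x s where 1: "w \<Turnstile> suc n m" "w \<Turnstile> mp g m x" "w \<Turnstile> pr x a s" "w \<Turnstile> mp s b z"
    unfolding sub_iff by blast
  from z' obtain m' x' s' where 2: "w \<Turnstile> suc n' m'" "w \<Turnstile> mp g m' x'" "w \<Turnstile> pr x' a s'" "w \<Turnstile> mp s' b z'"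
    unfolding sub_iff by blast
  have x: "w \<Turnstile> mp g n' x"
    by (rule mp_cong[OF 1(2) suc_unique[OF 1(1) n] eq_refl[OF mp_ex(3)[OF 1(2)]]])
  obtain R' where R': "w \<Turnstile> mp \<rho> n' R'" using level_exists[OF le fn_mem(1)[OF X_fn[OF le g] x]] by blast
  show ?thesis
  proof (rule PHI_mp[OF le level_suc[OF le n R R'] X_coherent[OF le g 2(1) R' x 2(2)]])
    fix M a1 t t' assume t: "w \<Turnstile> pel M x a1 t" "w \<Turnstile> pel M x' a1 t'" and par: "w \<Turnstile> par R t t'"
    have p: "w \<Turnstile> pr x a1 t" "w \<Turnstile> pr x' a1 t'" using t by (simp_all add: pel_iff)
    show ?thesis
      by (rule parD[OF par mp_cong1[OF 1(4) pr_inject(2)[OF 1(3) p(1)]] mp_cong1[OF 2(4) pr_inject(2)[OF 2(3) p(2)]]])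
  qed
qed

definition rooted :: "world \<Rightarrow> nat \<Rightarrow> nat \<Rightarrow> bool" where
  "rooted w g a \<longleftrightarrow> w \<Turnstile> mem a A \<and>
    (\<forall>w'\<ge>w. \<forall>n m x. w' \<Turnstile> mem n W \<longrightarrow> w' \<Turnstile> suc n m \<longrightarrow> w' \<Turnstile> mp g m x \<longrightarrow> (\<exists>M t. w' \<Turnstile> pel M x a t))"

lemma sub_total:
  assumes le: "w0 \<le> w" and g: "w \<Turnstile> mem g X" and root: "rooted w g a"
    and b: "w \<Turnstile> mem b B" "w \<Turnstile> mp f b a" and n: "w \<Turnstile> mem n W"
  shows "\<exists>z. w \<Turnstile> mem z N \<and> w \<Turnstile> sub g a b n z"
proof -
  note gf = X_fn[OF le g]
  obtain m where m: "w \<Turnstile> suc n m" using suc_exists[OF mem_ex1[OF n]] by blast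
  note mW = omegaD(3)[OF W le n m]
  \<comment> \<open>The entry at n + 2 serves to place z in N: it supplies a value to which z is
    related by R_n, and N contains the fields of these relations.\<close>
  obtain m' where m': "w \<Turnstile> suc m m'" using suc_exists[OF mem_ex1[OF mW]] by blast
  obtain x where x: "w \<Turnstile> mp g m x" using fn_total[OF gf mW] by blast
  obtain x' where x': "w \<Turnstile> mp g m' x'" using fn_total[OF gf omegaD(3)[OF W le mW m']] by blast
  obtain M s where s: "w \<Turnstile> pel M x a s" using root n m x order_refl[of w] unfolding rooted_def by blast
  then have s': "w \<Turnstile> fnf s a M" "w \<Turnstile> pr x a s" by (simp_all add: pel_iff)
  obtain z where z: "w \<Turnstile> mp s b z" using fnf_total[OF le s'(1) b] by blast
  obtain R where R: "w \<Turnstile> mp \<rho> n R" using level_exists[OF le n] by blast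
  obtain R' where R': "w \<Turnstile> mp \<rho> m R'" using level_exists[OF le mW] by blast
  have "w \<Turnstile> mem z N"
  proof (rule PHI_mp[OF le level_suc[OF le m R R'] X_coherent[OF le g m' R' x x']])
    fix M' a' t t' assume t: "w \<Turnstile> pel M' x a' t" "w \<Turnstile> pel M' x' a' t'" and par: "w \<Turnstile> par R t t'"
    note E = pel_inject[OF s t(1)]
    have "w \<Turnstile> mp f b a'" by (rule mp_cong[OF b(2) eq_refl[OF mem_ex1[OF b(1)]] E(1)])
    with fnf_total[OF le _ b(1)] t(2) obtain z' where "w \<Turnstile> mp t' b z'" unfolding pel_iff by blast
    from N(2)[OF le R parD[OF par mp_cong1[OF z E(2)] this]] show ?thesis by blast
  qed
  with m x s'(2) z show ?thesis unfolding sub_iff by blast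
qed

definition subtree :: "nat \<Rightarrow> nat \<Rightarrow> nat \<Rightarrow> nat \<Rightarrow> pv" where
  "subtree g a b k = (mem k X \<sqinter> all (\<lambda>n. all (\<lambda>z. iff (mp k n z) (mem n W \<sqinter> sub g a b n z))))"

lemma subtree_mp:
  assumes "w \<Turnstile> subtree g a b k" "w \<le> w'"
  shows "w' \<Turnstile> mp k n z \<longleftrightarrow> w' \<Turnstile> mem n W \<and> w' \<Turnstile> sub g a b n z"
proof -
  have "w' \<Turnstile> ex n \<Longrightarrow> w' \<Turnstile> ex z \<Longrightarrow> w' \<Turnstile> mp k n z \<longleftrightarrow> w' \<Turnstile> mem n W \<and> w' \<Turnstile> sub g a b n z"
    using up[OF assms] order_refl[of w'] unfolding subtree_def holds_all holds_iff holds_conj by blast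
  moreover have "w' \<Turnstile> sub g a b n z \<Longrightarrow> w' \<Turnstile> ex n \<and> w' \<Turnstile> ex z"
    unfolding sub_iff using suc_ex(1) mp_ex(3) by blast
  ultimately show ?thesis using mp_ex(2,3) by blast
qed

lemma subtree_exists:
  assumes le: "w0 \<le> w" and g: "w \<Turnstile> mem g X" and root: "rooted w g a"
    and b: "w \<Turnstile> mem b B" "w \<Turnstile> mp f b a"
  shows "\<exists>k. w \<Turnstile> subtree g a b k"
proof -
  have a: "w \<Turnstile> ex a" by (rule mp_ex(3)[OF b(2)])
  have "\<exists>k. w \<Turnstile> fn k W N \<and> (\<forall>w'\<ge>w. \<forall>n z. w' \<Turnstile> mp k n z \<longleftrightarrow> w' \<Turnstile> mem n W \<and> w' \<Turnstile> ex z \<and> w' \<Turnstile> sub g a b n z)"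
  proof (rule function_set[OF _ omegaD(1)[OF W le] up[OF N(1) le]])
    show "dfn False w (\<lambda>e. sub g a b (e 0) (e (Suc 0)))"
      by (intro dfn_sub dfn_intros le mem_ex1[OF g] a mem_ex1[OF b(1)])
    show "\<exists>z. w' \<Turnstile> mem z N \<and> w' \<Turnstile> sub g a b n z" if l: "w \<le> w'" and n: "w' \<Turnstile> mem n W" for w' n
    proof (rule sub_total[OF order_trans[OF le l] up[OF g l] _ b[THEN up, OF l] n])
      show "rooted w' g a" using root up[OF _ l] order_trans[OF l] unfolding rooted_def by blast
    qed
    show "w' \<Turnstile> eq z z'" if "w \<le> w'" "w' \<Turnstile> mem n W" "w' \<Turnstile> ex z" "w' \<Turnstile> sub g a b n z" "w' \<Turnstile> ex z'" "w' \<Turnstile> sub g a b n z'" for w' n z z'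
      by (rule sub_unique[OF order_trans[OF le that(1)] up[OF g that(1)] that(4,6)])
  qed
  then obtain k where k: "w \<Turnstile> fn k W N"
    and k2: "\<forall>w'\<ge>w. \<forall>n z. w' \<Turnstile> mp k n z \<longleftrightarrow> w' \<Turnstile> mem n W \<and> w' \<Turnstile> ex z \<and> w' \<Turnstile> sub g a b n z" by blast
  have "w \<Turnstile> mem k X"
  proof (rule X_intro[OF le k])
    fix w' m n R z z' assume l: "w \<le> w'" and s: "w' \<Turnstile> suc m n" "w' \<Turnstile> mp \<rho> m R" and "w' \<Turnstile> mp k m z" "w' \<Turnstile> mp k n z'"
    then have "w' \<Turnstile> sub g a b m z" "w' \<Turnstile> sub g a b n z'" using k2 by blast+
    from sub_coherent[OF order_trans[OF le l] up[OF g l] s this] show "w' \<Turnstile> mp R z z'" .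
  qed
  moreover have "w \<Turnstile> all (\<lambda>n. all (\<lambda>z. iff (mp k n z) (mem n W \<sqinter> sub g a b n z)))"
    unfolding holds_all holds_iff holds_conj
  proof (intro allI impI)
    fix w1 n w2 z w3 assume l: "w \<le> w1" "w1 \<le> w2" "w2 \<le> w3" and z: "w2 \<Turnstile> ex z"
    from k2[THEN spec, THEN mp, OF order_trans[OF l(1) order_trans[OF l(2,3)]]] up[OF z l(3)]
    show "w3 \<Turnstile> mp k n z \<longleftrightarrow> w3 \<Turnstile> mem n W \<and> w3 \<Turnstile> sub g a b n z" by blast
  qed
  ultimately show ?thesis unfolding subtree_def holds_conj by blast
qed

text \<open>The tree \<open>g\<close> has root \<open>a\<close> and its subtrees are given by \<open>t : B\<^sub>a \<rightarrow> X\<close>.\<close>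

definition VV :: "nat \<Rightarrow> nat \<Rightarrow> nat \<Rightarrow> pv" where
  "VV g a t = ball W (\<lambda>n. all (\<lambda>m. all (\<lambda>x. suc n m \<sqinter> mp g m x \<rightarrow>
    exi (\<lambda>s. pr x a s \<sqinter> all (\<lambda>b. all (\<lambda>k. mp t b k \<rightarrow> exi (\<lambda>z. mp k n z \<sqinter> mp s b z)))))))"

lemma dfn_VV:
  assumes "w0 \<le> w" "term_at w g" "term_at w a" "term_at w t"
  shows "dfn False w (\<lambda>e. VV (g e) (a e) (t e))"
  unfolding VV_def
  by (intro dfn_intros assms(2-)[THEN term_shift, THEN term_shift, THEN term_shift] omegaD(1)[OF W assms(1)]
      assms(2-)[THEN term_shift, THEN term_shift, THEN term_shift, THEN term_shift]
      assms(2-)[THEN term_shift, THEN term_shift, THEN term_shift, THEN term_shift, THEN term_shift, THEN term_shift])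

lemma VVD:
  assumes "w \<Turnstile> VV g a t" "w \<Turnstile> mem n W" "w \<Turnstile> suc n m" "w \<Turnstile> mp g m x"
  obtains s where "w \<Turnstile> pr x a s"
    "\<And>w' b k. w \<le> w' \<Longrightarrow> w' \<Turnstile> mp t b k \<Longrightarrow> \<exists>z. w' \<Turnstile> mp k n z \<and> w' \<Turnstile> mp s b z"
proof -
  have "w \<Turnstile> exi (\<lambda>s. pr x a s \<sqinter> all (\<lambda>b. all (\<lambda>k. mp t b k \<rightarrow> exi (\<lambda>z. mp k n z \<sqinter> mp s b z))))"
    using assms(1)[unfolded VV_def holds_ball holds_all holds_imp holds_conj, THEN spec, THEN mp, OF order_refl,
        THEN spec, THEN mp, OF assms(2), THEN spec, THEN mp, OF order_refl, THEN spec, THEN mp, OF suc_ex(2)[OF assms(3)],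
        THEN spec, THEN mp, OF order_refl, THEN spec, THEN mp, OF mp_ex(3)[OF assms(4)], THEN spec, THEN mp, OF order_refl]
      assms(3,4) by simp
  then obtain s where s: "w \<Turnstile> pr x a s" "w \<Turnstile> all (\<lambda>b. all (\<lambda>k. mp t b k \<rightarrow> exi (\<lambda>z. mp k n z \<sqinter> mp s b z)))"
    unfolding holds_exi holds_conj by blast
  show thesis
  proof (rule that[OF s(1)])
    fix w' b k assume le: "w \<le> w'" and k: "w' \<Turnstile> mp t b k"
    from up[OF s(2) le] k mp_ex(2,3)[OF k] order_refl[of w']
    show "\<exists>z. w' \<Turnstile> mp k n z \<and> w' \<Turnstile> mp s b z"
      unfolding holds_all holds_imp holds_exi holds_conj by blast
  qed
qed

lemma VVI:
  assumes "\<And>w' n m x. w \<le> w' \<Longrightarrow> w' \<Turnstile> mem n W \<Longrightarrow> w' \<Turnstile> suc n m \<Longrightarrow> w' \<Turnstile> mp g m x \<Longrightarrow>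
    \<exists>s. w' \<Turnstile> pr x a s \<and> (\<forall>w''\<ge>w'. \<forall>b k. w'' \<Turnstile> mp t b k \<longrightarrow> (\<exists>z. w'' \<Turnstile> mp k n z \<and> w'' \<Turnstile> mp s b z))"
  shows "w \<Turnstile> VV g a t"
  unfolding VV_def holds_ball holds_all holds_imp
proof (intro allI impI)
  fix w1 n w2 m w3 x w4 assume l: "w \<le> w1" "w1 \<le> w2" "w2 \<le> w3" "w3 \<le> w4" and n: "w1 \<Turnstile> mem n W"
    and mx: "w4 \<Turnstile> (suc n m \<sqinter> mp g m x)"
  have l1: "w1 \<le> w4" by (rule order_trans[OF l(2) order_trans[OF l(3,4)]])
  have "w \<le> w4" by (rule order_trans[OF l(1) order_trans[OF l(2) order_trans[OF l(3,4)]]])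
  from assms[OF this up[OF n l1]] mx obtain s where s: "w4 \<Turnstile> pr x a s"
    "\<forall>w''\<ge>w4. \<forall>b k. w'' \<Turnstile> mp t b k \<longrightarrow> (\<exists>z. w'' \<Turnstile> mp k n z \<and> w'' \<Turnstile> mp s b z)"
    unfolding holds_conj by blast
  have "w4 \<Turnstile> all (\<lambda>b. all (\<lambda>k. mp t b k \<rightarrow> exi (\<lambda>z. mp k n z \<sqinter> mp s b z)))"
    unfolding holds_all holds_imp holds_exi holds_conj
  proof (intro allI impI)
    fix w5 b w6 k w7 assume l: "w4 \<le> w5" "w5 \<le> w6" "w6 \<le> w7" and k: "w7 \<Turnstile> mp t b k"
    have "w4 \<le> w7" by (rule order_trans[OF l(1) order_trans[OF l(2,3)]])
    with s(2) k mp_ex(3) show "\<exists>z. w7 \<Turnstile> ex z \<and> w7 \<Turnstile> mp k n z \<and> w7 \<Turnstile> mp s b z" by blast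
  qed
  with s(1) pr_ex(3)[OF s(1)]
  show "w4 \<Turnstile> exi (\<lambda>s. pr x a s \<sqinter> all (\<lambda>b. all (\<lambda>k. mp t b k \<rightarrow> exi (\<lambda>z. mp k n z \<sqinter> mp s b z))))"
    unfolding holds_exi holds_conj by blast
qed

text \<open>The root comes from \<open>X_root\<close>. At each b of its fibre the subtree exists by
  \<open>subtree_exists\<close> and is unique because its entries are, so the subtrees form a
  function into X.\<close>

lemma val_exists:
  assumes le: "w0 \<le> w" and g: "w \<Turnstile> mem g X"
  shows "\<exists>q a t. w \<Turnstile> pel X q a t \<and> w \<Turnstile> VV g a t"
proof -
  obtain a where root: "rooted w g a" using X_root[OF le g] unfolding rooted_def by blast
  then have a: "w \<Turnstile> mem a A" by (simp add: rooted_def)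
  have rooted: "rooted w' g a" if "w \<le> w'" for w'
    using root up[OF a that] order_trans[OF that] unfolding rooted_def by blast
  have "\<exists>t. w \<Turnstile> fnf t a X \<and> (\<forall>w'\<ge>w. \<forall>b k.
    w' \<Turnstile> mp t b k \<longleftrightarrow> w' \<Turnstile> mem b B \<and> w' \<Turnstile> mp f b a \<and> w' \<Turnstile> ex k \<and> w' \<Turnstile> subtree g a b k)"
  proof (rule fnf_exists[OF le mem_ex1[OF a] cmp_ex[OF X, THEN up, OF le]])
    show "dfn False w (\<lambda>e. subtree g a (e 0) (e (Suc 0)))"
      unfolding subtree_def
      by (intro dfn_intros dfn_sub le mem_ex1[OF a] mem_ex1[OF g] up[OF cmp_ex[OF X] le] omegaD(1)[OF W le])
    show "\<exists>k. w' \<Turnstile> mem k X \<and> w' \<Turnstile> subtree g a b k" if l: "w \<le> w'" and b: "w' \<Turnstile> mem b B" "w' \<Turnstile> mp f b a" for w' b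
      using subtree_exists[OF order_trans[OF le l] up[OF g l] rooted[OF l] b] unfolding subtree_def holds_conj by blast
    show "w' \<Turnstile> eq k k'" if l: "w \<le> w'" and k: "w' \<Turnstile> subtree g a b k" "w' \<Turnstile> subtree g a b k'" for w' b k k'
    proof -
      note l0 = order_trans[OF le l]
      have kX: "w' \<Turnstile> mem k X" "w' \<Turnstile> mem k' X" using k by (simp_all add: subtree_def)
      show ?thesis
      proof (rule fn_ext[OF X_fn[OF l0 kX(1)] X_fn[OF l0 kX(2)]])
        fix w'' n z z' assume l': "w' \<le> w''" and "w'' \<Turnstile> mp k n z" "w'' \<Turnstile> mp k' n z'"
        then show "w'' \<Turnstile> eq z z'"
          unfolding subtree_mp[OF k(1) l'] subtree_mp[OF k(2) l']
          using sub_unique[OF order_trans[OF l0 l'] up[OF g order_trans[OF l l']]] by blast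
      qed
    qed
  qed
  then obtain t where t: "w \<Turnstile> fnf t a X" and t2: "\<forall>w'\<ge>w. \<forall>b k.
    w' \<Turnstile> mp t b k \<longleftrightarrow> w' \<Turnstile> mem b B \<and> w' \<Turnstile> mp f b a \<and> w' \<Turnstile> ex k \<and> w' \<Turnstile> subtree g a b k" by blast
  obtain q where q: "w \<Turnstile> pr q a t" using pr_exists[OF mem_ex1[OF a] fnf_ex(1)[OF t]] by blast
  have "w \<Turnstile> VV g a t"
  proof (rule VVI)
    fix w' n m x assume l: "w \<le> w'" and n: "w' \<Turnstile> mem n W" and m: "w' \<Turnstile> suc n m" and x: "w' \<Turnstile> mp g m x"
    obtain M s where "w' \<Turnstile> pel M x a s"
      using root[unfolded rooted_def] l n m x by blast
    then have s: "w' \<Turnstile> fnf s a M" "w' \<Turnstile> pr x a s" by (simp_all add: pel_iff)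
    have "\<exists>z. w'' \<Turnstile> mp k n z \<and> w'' \<Turnstile> mp s b z" if l': "w' \<le> w''" and k: "w'' \<Turnstile> mp t b k" for w'' b k
    proof -
      have b: "w'' \<Turnstile> mem b B" "w'' \<Turnstile> mp f b a" "w'' \<Turnstile> subtree g a b k"
        using t2[THEN spec, THEN mp, OF order_trans[OF l l']] k by blast+
      obtain z where z: "w'' \<Turnstile> mp s b z"
        using fnf_total[OF order_trans[OF le order_trans[OF l l']] up[OF s(1) l'] b(1,2)] by blast
      have "w'' \<Turnstile> sub g a b n z" unfolding sub_iff using up[OF m l'] up[OF x l'] up[OF s(2) l'] z by blast
      then have "w'' \<Turnstile> mp k n z" unfolding subtree_mp[OF b(3) order_refl] using up[OF n l'] by blast
      with z show ?thesis by blast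
    qed
    with s(2) show "\<exists>s. w' \<Turnstile> pr x a s \<and> (\<forall>w''\<ge>w'. \<forall>b k. w'' \<Turnstile> mp t b k \<longrightarrow> (\<exists>z. w'' \<Turnstile> mp k n z \<and> w'' \<Turnstile> mp s b z))"
      by blast
  qed
  moreover have "w \<Turnstile> pel X q a t" using a t q by (simp add: pel_iff)
  ultimately show ?thesis by blast
qed

text \<open>The root can be read off at index 1. Entry n of the subtree at b is the value at b of
  the second component of entry n + 1, so both functions give subtrees with the same
  entries.\<close>

lemma val_unique:
  assumes le: "w0 \<le> w" and g: "w \<Turnstile> mem g X" and 1: "w \<Turnstile> VV g a t" "w \<Turnstile> fnf t a X" and 2: "w \<Turnstile> VV g a' t'" "w \<Turnstile> fnf t' a' X"
  shows "w \<Turnstile> eq a a'" "w \<Turnstile> eq t t'"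
proof -
  obtain z where z: "w \<Turnstile> zero z" using omegaD(5)[OF W le] by blast
  obtain m where m: "w \<Turnstile> suc z m" using suc_exists[OF zero_ex[OF z]] by blast
  note zW = omegaD(2)[OF W le z]
  obtain x where x: "w \<Turnstile> mp g m x" using fn_total[OF X_fn[OF le g] omegaD(3)[OF W le zW m]] by blast
  obtain s where "w \<Turnstile> pr x a s" by (rule VVD[OF 1(1) zW m x])
  moreover obtain s' where "w \<Turnstile> pr x a' s'" by (rule VVD[OF 2(1) zW m x])
  ultimately show E: "w \<Turnstile> eq a a'" by (rule pr_inject(1))
  have t': "w \<Turnstile> fnf t' a X" by (rule fnf_cong[OF le 2(2) eq_refl[OF fnf_ex(1)[OF 2(2)]] eq_sym[OF E]])
  show "w \<Turnstile> eq t t'"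
  proof (rule fnf_ext[OF le 1(2) t'])
    fix w' b k k' assume l: "w \<le> w'" and k: "w' \<Turnstile> mp t b k" and k': "w' \<Turnstile> mp t' b k'"
    note l0 = order_trans[OF le l]
    note kX = fnf_mem(3)[OF l0 up[OF 1(2) l] k] fnf_mem(3)[OF l0 up[OF 2(2) l] k']
    show "w' \<Turnstile> eq k k'"
    proof (rule fn_ext[OF X_fn[OF l0 kX(1)] X_fn[OF l0 kX(2)]])
      fix w'' n z z' assume l': "w' \<le> w''" and z: "w'' \<Turnstile> mp k n z" and z': "w'' \<Turnstile> mp k' n z'"
      note l2 = order_trans[OF l l'] and l3 = order_trans[OF l0 l']
      note kf = X_fn[OF l3 up[OF kX(1) l']] X_fn[OF l3 up[OF kX(2) l']]
      note nW = fn_mem(1)[OF kf(1) z]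
      obtain m where m: "w'' \<Turnstile> suc n m" using suc_exists[OF mem_ex1[OF nW]] by blast
      note g' = up[OF g l2]
      obtain x where x: "w'' \<Turnstile> mp g m x" using fn_total[OF X_fn[OF l3 g'] omegaD(3)[OF W l3 nW m]] by blast
      show "w'' \<Turnstile> eq z z'"
      proof (rule VVD[OF up[OF 1(1) l2] nW m x], rule VVD[OF up[OF 2(1) l2] nW m x])
        fix s s'
        assume s: "w'' \<Turnstile> pr x a s" "\<And>w' b k. w'' \<le> w' \<Longrightarrow> w' \<Turnstile> mp t b k \<Longrightarrow> \<exists>z. w' \<Turnstile> mp k n z \<and> w' \<Turnstile> mp s b z"
          and s': "w'' \<Turnstile> pr x a' s'" "\<And>w' b k. w'' \<le> w' \<Longrightarrow> w' \<Turnstile> mp t' b k \<Longrightarrow> \<exists>z. w' \<Turnstile> mp k n z \<and> w' \<Turnstile> mp s' b z"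
        obtain y where y: "w'' \<Turnstile> mp k n y" "w'' \<Turnstile> mp s b y" using s(2)[OF order_refl up[OF k l']] by blast
        obtain y' where y': "w'' \<Turnstile> mp k' n y'" "w'' \<Turnstile> mp s' b y'" using s'(2)[OF order_refl up[OF k' l']] by blast
        obtain M where M: "w'' \<Turnstile> fnf s a M" using X_function[OF l3 g' m x s(1)] unfolding pel_iff by blast
        have "w'' \<Turnstile> eq y y'"
          by (rule fnf_unique[OF l3 M y(2) mp_cong1[OF y'(2) pr_inject(2)[OF s'(1) s(1)]]])
        with fn_unique[OF kf(1) z y(1)] fn_unique[OF kf(2) y'(1) z'] eq_trans show "w'' \<Turnstile> eq z z'" by blast
      qed
    qed
  qed
qed

text \<open>The coalgebra morphisms into the limit, with its structure map replaced by \<open>VV\<close>.\<close>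

definition mor :: "world \<Rightarrow> nat \<Rightarrow> nat \<Rightarrow> nat \<Rightarrow> bool" where
  "mor w Y u \<alpha> \<longleftrightarrow> w \<Turnstile> fn \<alpha> Y X \<and> (\<forall>w'\<ge>w. \<forall>y q a t g. w' \<Turnstile> mp u y q \<longrightarrow> w' \<Turnstile> pel Y q a t \<longrightarrow> w' \<Turnstile> mp \<alpha> y g \<longrightarrow>
    (\<exists>s. w' \<Turnstile> comp s \<alpha> t \<and> w' \<Turnstile> VV g a s))"

lemma coalgebra_total:
  assumes "w \<Turnstile> cmp PY (isP Y)" "w \<Turnstile> fn u Y PY" "w \<Turnstile> mem y Y"
  obtains q a t where "w \<Turnstile> mp u y q" "w \<Turnstile> pel Y q a t"
proof -
  obtain q where q: "w \<Turnstile> mem q PY" "w \<Turnstile> mp u y q" using fn_total[OF assms(2,3)] by blast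
  from q(1) q(2) that show thesis unfolding cmp_mem[OF assms(1)] isP_iff by blast
qed

text \<open>Entry n + 1 of the image of y consists of the label of y and the entries n of the images
  of the successors of y. Hence agreement at n for all elements of Y gives agreement at n +
  1.\<close>

lemma mor_unique:
  assumes le: "w0 \<le> w" and PY: "w \<Turnstile> cmp PY (isP Y)" and u: "w \<Turnstile> fn u Y PY"
    and \<alpha>: "mor w Y u \<alpha>" and \<alpha>': "mor w Y u \<alpha>'"
  shows "w \<Turnstile> eq \<alpha> \<alpha>'"
proof -
  have f1: "w \<Turnstile> fn \<alpha> Y X" and f2: "w \<Turnstile> fn \<alpha>' Y X" using \<alpha> \<alpha>' by (simp_all add: mor_def)
  \<comment> \<open>All y are treated at once, because the induction step passes from y to its
    successors.\<close>
  let ?Q = "\<lambda>n. all (\<lambda>y. all (\<lambda>g. all (\<lambda>g'. all (\<lambda>z. all (\<lambda>z'.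
    mp \<alpha> y g \<sqinter> mp \<alpha>' y g' \<sqinter> mp g n z \<sqinter> mp g' n z' \<rightarrow> eq z z')))))"
  have QI: "w' \<Turnstile> ?Q n" if "\<And>w'' y g g' z z'. w' \<le> w'' \<Longrightarrow> w'' \<Turnstile> mp \<alpha> y g \<Longrightarrow> w'' \<Turnstile> mp \<alpha>' y g' \<Longrightarrow> w'' \<Turnstile> mp g n z \<Longrightarrow>
      w'' \<Turnstile> mp g' n z' \<Longrightarrow> w'' \<Turnstile> eq z z'" for w' n
    unfolding holds_all holds_imp holds_conj
  proof (intro allI impI)
    fix w1 y w2 g w3 g' w4 z w5 z' w6
    assume l: "w' \<le> w1" "w1 \<le> w2" "w2 \<le> w3" "w3 \<le> w4" "w4 \<le> w5" "w5 \<le> w6"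
      and m: "w6 \<Turnstile> mp \<alpha> y g \<and> w6 \<Turnstile> mp \<alpha>' y g' \<and> w6 \<Turnstile> mp g n z \<and> w6 \<Turnstile> mp g' n z'"
    have "w' \<le> w6" by (rule order_trans[OF l(1) order_trans[OF l(2) order_trans[OF l(3) order_trans[OF l(4) order_trans[OF l(5,6)]]]]])
    from that[OF this] m show "w6 \<Turnstile> eq z z'" by blast
  qed
  have QD: "w' \<Turnstile> eq z z'" if "w' \<Turnstile> ?Q n" "w' \<Turnstile> mp \<alpha> y g" "w' \<Turnstile> mp \<alpha>' y g'" "w' \<Turnstile> mp g n z" "w' \<Turnstile> mp g' n z'" for w' n y g g' z z'
    using that(1)[unfolded holds_all holds_imp holds_conj, THEN spec, THEN mp, OF order_refl, THEN spec, THEN mp, OF mp_ex(2)[OF that(2)],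
        THEN spec, THEN mp, OF order_refl, THEN spec, THEN mp, OF mp_ex(3)[OF that(2)],
        THEN spec, THEN mp, OF order_refl, THEN spec, THEN mp, OF mp_ex(3)[OF that(3)],
        THEN spec, THEN mp, OF order_refl, THEN spec, THEN mp, OF mp_ex(3)[OF that(4)],
        THEN spec, THEN mp, OF order_refl, THEN spec, THEN mp, OF mp_ex(3)[OF that(5)], THEN spec, THEN mp, OF order_refl]
      that(2-) by blast
  have Q: "w' \<Turnstile> ?Q n" if l: "w \<le> w'" and n: "w' \<Turnstile> mem n W" for w' n
  proof (rule omega_induct[OF omega_up[OF W le] _ _ _ l n])
    show "dfn False w (\<lambda>e. ?Q (e 0))" by (intro dfn_intros fn_ex(1)[OF f1] fn_ex(1)[OF f2])
  next
    fix w' n assume l: "w \<le> w'" and n: "w' \<Turnstile> zero n"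
    show "w' \<Turnstile> ?Q n"
    proof (rule QI)
      fix w'' y g g' z z' assume l': "w' \<le> w''" and g: "w'' \<Turnstile> mp \<alpha> y g" "w'' \<Turnstile> mp \<alpha>' y g'" and z: "w'' \<Turnstile> mp g n z" "w'' \<Turnstile> mp g' n z'"
      note l2 = order_trans[OF l l'] and l0 = order_trans[OF le order_trans[OF l l']]
      from X_zero[OF l0 fn_mem(2)[OF up[OF f1 l2] g(1)] up[OF n l'] z(1)] X_zero[OF l0 fn_mem(2)[OF up[OF f2 l2] g(2)] up[OF n l'] z(2)]
      show "w'' \<Turnstile> eq z z'" using eq_trans eq_sym by blast
    qed
  next
    fix w' n m assume l: "w \<le> w'" and n: "w' \<Turnstile> mem n W" and m: "w' \<Turnstile> suc n m" and IH: "w' \<Turnstile> ?Q n"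
    show "w' \<Turnstile> ?Q m"
    proof (rule QI)
      fix w'' y g g' x x' assume l': "w' \<le> w''" and g: "w'' \<Turnstile> mp \<alpha> y g" "w'' \<Turnstile> mp \<alpha>' y g'" and x: "w'' \<Turnstile> mp g m x" "w'' \<Turnstile> mp g' m x'"
      note l2 = order_trans[OF l l'] note l0 = order_trans[OF le l2]
      note gX = fn_mem(2)[OF up[OF f1 l2] g(1)] fn_mem(2)[OF up[OF f2 l2] g(2)]
      obtain q a t where q: "w'' \<Turnstile> mp u y q" "w'' \<Turnstile> pel Y q a t"
        by (rule coalgebra_total[OF up[OF PY l2] up[OF u l2] fn_mem(1)[OF up[OF f1 l2] g(1)]])
      obtain s where s: "w'' \<Turnstile> comp s \<alpha> t" "w'' \<Turnstile> VV g a s" using \<alpha> l2 q g(1) unfolding mor_def by blast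
      obtain s' where s': "w'' \<Turnstile> comp s' \<alpha>' t" "w'' \<Turnstile> VV g' a s'" using \<alpha>' l2 q g(2) unfolding mor_def by blast
      note n' = up[OF n l'] and m' = up[OF m l']
      have t: "w'' \<Turnstile> fnf t a Y" using q(2) by (simp add: pel_iff)
      show "w'' \<Turnstile> eq x x'"
      proof (rule VVD[OF s(2) n' m' x(1)], rule VVD[OF s'(2) n' m' x(2)])
        fix r r'
        assume r: "w'' \<Turnstile> pr x a r" "\<And>w' b k. w'' \<le> w' \<Longrightarrow> w' \<Turnstile> mp s b k \<Longrightarrow> \<exists>z. w' \<Turnstile> mp k n z \<and> w' \<Turnstile> mp r b z"
          and r': "w'' \<Turnstile> pr x' a r'" "\<And>w' b k. w'' \<le> w' \<Longrightarrow> w' \<Turnstile> mp s' b k \<Longrightarrow> \<exists>z. w' \<Turnstile> mp k n z \<and> w' \<Turnstile> mp r' b z"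
        obtain M where M: "w'' \<Turnstile> fnf r a M" using X_function[OF l0 gX(1) m' x(1) r(1)] unfolding pel_iff by blast
        obtain M' where M': "w'' \<Turnstile> fnf r' a M'" using X_function[OF l0 gX(2) m' x(2) r'(1)] unfolding pel_iff by blast
        have "w'' \<Turnstile> eq r r'"
        proof (rule fnf_ext[OF l0 M M'])
          fix w3 b z z' assume l3: "w'' \<le> w3" and z: "w3 \<Turnstile> mp r b z" "w3 \<Turnstile> mp r' b z'"
          note l4 = order_trans[OF l2 l3] note l5 = order_trans[OF le l4]
          obtain y1 where y1: "w3 \<Turnstile> mem y1 Y" "w3 \<Turnstile> mp t b y1"
            using fnf_total[OF l5 up[OF t l3] fnf_mem(1,2)[OF l5 up[OF M l3] z(1)]] by blast
          obtain k where k: "w3 \<Turnstile> mp \<alpha> y1 k" using fn_total[OF up[OF f1 l4] y1(1)] by blast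
          obtain k' where k': "w3 \<Turnstile> mp \<alpha>' y1 k'" using fn_total[OF up[OF f2 l4] y1(1)] by blast
          have "w3 \<Turnstile> mp s b k" unfolding comp_mp[OF s(1) l3] using y1(2) k by blast
          from r(2)[OF l3 this] obtain v where v: "w3 \<Turnstile> mp k n v" "w3 \<Turnstile> mp r b v" by blast
          have "w3 \<Turnstile> mp s' b k'" unfolding comp_mp[OF s'(1) l3] using y1(2) k' by blast
          from r'(2)[OF l3 this] obtain v' where v': "w3 \<Turnstile> mp k' n v'" "w3 \<Turnstile> mp r' b v'" by blast
          have "w3 \<Turnstile> eq v v'" by (rule QD[OF up[OF IH order_trans[OF l' l3]] k k' v(1) v'(1)])
          with fnf_unique[OF l5 up[OF M l3] z(1) v(2)] fnf_unique[OF l5 up[OF M' l3] v'(2) z(2)] eq_trans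
          show "w3 \<Turnstile> eq z z'" by blast
        qed
        from pr_unique[OF r(1) r'(1) eq_refl[OF pr_ex(2)[OF r(1)]] this] show "w'' \<Turnstile> eq x x'" .
      qed
    qed
  qed
  show ?thesis
  proof (rule fn_ext[OF f1 f2])
    fix w' y g g' assume l: "w \<le> w'" and g: "w' \<Turnstile> mp \<alpha> y g" "w' \<Turnstile> mp \<alpha>' y g'"
    note l0 = order_trans[OF le l]
    note gf = X_fn[OF l0 fn_mem(2)[OF up[OF f1 l] g(1)]] X_fn[OF l0 fn_mem(2)[OF up[OF f2 l] g(2)]]
    show "w' \<Turnstile> eq g g'"
    proof (rule fn_ext[OF gf])
      fix w'' n z z' assume l': "w' \<le> w''" and z: "w'' \<Turnstile> mp g n z" "w'' \<Turnstile> mp g' n z'"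
      show "w'' \<Turnstile> eq z z'"
        by (rule QD[OF Q[OF order_trans[OF l l'] fn_mem(1)[OF up[OF gf(1) l'] z(1)]] g[THEN up, OF l'] z])
    qed
  qed
qed

end

section \<open>Existence of morphisms\<close>

lemma comp_cong:
  assumes "w \<Turnstile> comp h k g" "w \<Turnstile> eq g g'"
  shows "w \<Turnstile> comp h k g'"
proof -
  have "w \<Turnstile> cmp h (\<lambda>p. exi (\<lambda>x. exi (\<lambda>y. exi (\<lambda>z. mp g' x y \<sqinter> mp k y z \<sqinter> pr p x z))))"
  proof (rule cmp_cong[OF assms(1)[unfolded comp_def]])
    fix w' p assume le: "w \<le> w'"
    have "w' \<Turnstile> mp g x y \<longleftrightarrow> w' \<Turnstile> mp g' x y" for x y
      using mp_cong1 up[OF assms(2) le] eq_sym[OF up[OF assms(2) le]] by blast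
    then show "w' \<Turnstile> exi (\<lambda>x. exi (\<lambda>y. exi (\<lambda>z. mp g x y \<sqinter> mp k y z \<sqinter> pr p x z))) \<longleftrightarrow>
      w' \<Turnstile> exi (\<lambda>x. exi (\<lambda>y. exi (\<lambda>z. mp g' x y \<sqinter> mp k y z \<sqinter> pr p x z)))"
      unfolding holds_exi holds_conj by simp
  qed
  then show ?thesis unfolding comp_def .
qed

lemma comp_unique: "w \<Turnstile> comp h k g \<Longrightarrow> w \<Turnstile> comp h' k g \<Longrightarrow> w \<Turnstile> eq h h'"
  unfolding comp_def by (rule cmp_unique)

context limit
begin

text \<open>
  If \<open>U : Y \<rightarrow> P\<^sub>f\<^sup>n(1)\<close> is level \<open>n\<close> of the morphism to be constructed, then level \<open>n + 1\<close> is
  \<open>P\<^sub>f(U) \<circ> u\<close>.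
\<close>

definition unfold :: "nat \<Rightarrow> nat \<Rightarrow> nat \<Rightarrow> nat \<Rightarrow> nat \<Rightarrow> pv" where
  "unfold Y u U y x = exi (\<lambda>q. exi (\<lambda>a. exi (\<lambda>t. exi (\<lambda>s.
    mp u y q \<sqinter> pel Y q a t \<sqinter> comp s U t \<sqinter> pr x a s))))"

definition unfolds :: "nat \<Rightarrow> nat \<Rightarrow> nat \<Rightarrow> nat \<Rightarrow> pv" where
  "unfolds Y u U p = exi (\<lambda>y. exi (\<lambda>x. unfold Y u U y x \<sqinter> pr p y x))"

lemma dfn_unfold:
  assumes "w0 \<le> w" "term_at w Y" "term_at w u" "term_at w U" "term_at w y" "term_at w x"
  shows "dfn False w (\<lambda>e. unfold (Y e) (u e) (U e) (y e) (x e))"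
  unfolding unfold_def
  by (intro dfn_intros dfn_pel assms(1) assms(2-)[THEN term_shift, THEN term_shift, THEN term_shift, THEN term_shift])

lemma unfold_iff: "w \<Turnstile> unfold Y u U y x \<longleftrightarrow>
    (\<exists>q a t s. w \<Turnstile> mp u y q \<and> w \<Turnstile> pel Y q a t \<and> w \<Turnstile> comp s U t \<and> w \<Turnstile> pr x a s)"
proof
  assume "w \<Turnstile> unfold Y u U y x"
  then show "\<exists>q a t s. w \<Turnstile> mp u y q \<and> w \<Turnstile> pel Y q a t \<and> w \<Turnstile> comp s U t \<and> w \<Turnstile> pr x a s"
    unfolding unfold_def holds_exi holds_conj by blast
next
  assume "\<exists>q a t s. w \<Turnstile> mp u y q \<and> w \<Turnstile> pel Y q a t \<and> w \<Turnstile> comp s U t \<and> w \<Turnstile> pr x a s"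
  then obtain q a t s where *: "w \<Turnstile> mp u y q" "w \<Turnstile> pel Y q a t" "w \<Turnstile> comp s U t" "w \<Turnstile> pr x a s" by blast
  show "w \<Turnstile> unfold Y u U y x"
    unfolding unfold_def holds_exi holds_conj using * pel_ex(2-4)[OF *(2)] comp_ex[OF *(3)] by blast
qed

lemma unfolds_mp:
  assumes "w \<Turnstile> cmp U' (unfolds Y u U)" "w \<le> w'"
  shows "w' \<Turnstile> mp U' y x \<longleftrightarrow> w' \<Turnstile> unfold Y u U y x"
proof
  assume "w' \<Turnstile> mp U' y x"
  then obtain p where "w' \<Turnstile> mem p U'" and p: "w' \<Turnstile> pr p y x" by (auto simp: mp_iff)
  then obtain y' x' where 1: "w' \<Turnstile> unfold Y u U y' x'" "w' \<Turnstile> pr p y' x'"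
    unfolding cmpD[OF assms] unfolds_def by auto
  then obtain q a t s where *: "w' \<Turnstile> mp u y' q" "w' \<Turnstile> pel Y q a t" "w' \<Turnstile> comp s U t" "w' \<Turnstile> pr x' a s"
    unfolding unfold_iff by blast
  note E = pr_inject[OF 1(2) p]
  from mp_cong[OF *(1) E(1) eq_refl[OF mp_ex(3)[OF *(1)]]] pr_cong1[OF *(4) E(2)] *(2,3)
  show "w' \<Turnstile> unfold Y u U y x" unfolding unfold_iff by blast
next
  assume x: "w' \<Turnstile> unfold Y u U y x"
  then have e: "w' \<Turnstile> ex y" "w' \<Turnstile> ex x" unfolding unfold_iff using mp_ex(2) pr_ex(1) by blast+
  then obtain p where p: "w' \<Turnstile> pr p y x" using pr_exists by blast
  with x e have "w' \<Turnstile> mem p U'"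
    unfolding cmpD[OF assms] unfolds_def holds_exi holds_conj using pr_ex(1) by blast
  with p show "w' \<Turnstile> mp U' y x" by (auto simp: mp_iff)
qed

text \<open>The representation of the value of u is existentially quantified in
  \<open>unfold\<close>. As u is a function, it may be replaced by any representation already at
  hand.\<close>

lemma unfold_normal:
  assumes le: "w0 \<le> w" and u: "w \<Turnstile> fn u Y PY" and q: "w \<Turnstile> mp u y q" "w \<Turnstile> pel Y q a t"
    and x: "w \<Turnstile> unfold Y u U y x"
  obtains s where "w \<Turnstile> comp s U t" "w \<Turnstile> pr x a s"
proof -
  from x obtain q' a' t' s where *: "w \<Turnstile> mp u y q'" "w \<Turnstile> pel Y q' a' t'" "w \<Turnstile> comp s U t'" "w \<Turnstile> pr x a' s"
    unfolding unfold_iff by blast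
  note E = pel_inject[OF pel_cong1[OF *(2) fn_unique[OF u *(1) q(1)]] q(2)]
  from comp_cong[OF *(3) E(2)] pr_cong[OF *(4) E(1) eq_refl[OF comp_ex[OF *(3)]]] that show thesis by blast
qed

lemma unfold_unique:
  assumes le: "w0 \<le> w" and u: "w \<Turnstile> fn u Y PY" and x: "w \<Turnstile> unfold Y u U y x" "w \<Turnstile> unfold Y u U y x'"
  shows "w \<Turnstile> eq x x'"
proof -
  from x(1) obtain q a t s where *: "w \<Turnstile> mp u y q" "w \<Turnstile> pel Y q a t" "w \<Turnstile> comp s U t" "w \<Turnstile> pr x a s"
    unfolding unfold_iff by blast
  obtain s' where s': "w \<Turnstile> comp s' U t" "w \<Turnstile> pr x' a s'" by (rule unfold_normal[OF le u *(1,2) x(2)])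
  show ?thesis by (rule pr_unique[OF *(4) s'(2) eq_refl[OF pel_ex(3)[OF *(2)]] comp_unique[OF *(3) s'(1)]])
qed

text \<open>Here U is an arbitrary set, as \<open>recursion\<close> demands of its step relation;
  composites of arbitrary sets exist by \<open>comp_exists\<close>.\<close>

lemma unfold_total:
  assumes PY: "w \<Turnstile> cmp PY (isP Y)" and u: "w \<Turnstile> fn u Y PY" and U: "w \<Turnstile> ex U" and y: "w \<Turnstile> mem y Y"
  shows "\<exists>x. w \<Turnstile> unfold Y u U y x"
proof -
  obtain q a t where q: "w \<Turnstile> mp u y q" "w \<Turnstile> pel Y q a t" by (rule coalgebra_total[OF PY u y])
  obtain s where s: "w \<Turnstile> comp s U t" using comp_exists[OF U pel_ex(4)[OF q(2)]] by blast
  obtain x where "w \<Turnstile> pr x a s" using pr_exists[OF pel_ex(3)[OF q(2)] comp_ex[OF s]] by blast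
  with q s show ?thesis unfolding unfold_iff by blast
qed

lemma unfolds_set:
  assumes le: "w0 \<le> w" and PY: "w \<Turnstile> cmp PY (isP Y)" and u: "w \<Turnstile> fn u Y PY" and U: "w \<Turnstile> ex U"
  shows "\<exists>U'. w \<Turnstile> cmp U' (unfolds Y u U)"
proof (rule graph_set)
  show "dfn False w (\<lambda>e. unfold Y u U (e 0) (e (Suc 0)))"
    by (intro dfn_unfold dfn_intros le fn_ex[OF u] U)
  show "w \<Turnstile> ex Y" by (rule fn_ex(2)[OF u])
  show "\<exists>x. w' \<Turnstile> ex x \<and> w' \<Turnstile> unfold Y u U y x" if l: "w \<le> w'" and y: "w' \<Turnstile> mem y Y" for w' y
    using unfold_total[OF up[OF PY l] up[OF u l] up[OF U l] y] unfold_iff pr_ex(1) by blast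
  show "w' \<Turnstile> eq x x'" if l: "w \<le> w'" and "w' \<Turnstile> unfold Y u U y x" "w' \<Turnstile> unfold Y u U y x'" for w' y x x'
    by (rule unfold_unique[OF order_trans[OF le l] up[OF u l] that(2,3)])
  fix h assume h: "w \<Turnstile> ex h"
    "\<And>w' y x. w \<le> w' \<Longrightarrow> w' \<Turnstile> mp h y x \<longleftrightarrow> w' \<Turnstile> mem y Y \<and> w' \<Turnstile> ex x \<and> w' \<Turnstile> unfold Y u U y x"
    "\<And>w' p. w \<le> w' \<Longrightarrow> w' \<Turnstile> mem p h \<Longrightarrow> \<exists>y x. w' \<Turnstile> mem y Y \<and> w' \<Turnstile> ex x \<and> w' \<Turnstile> unfold Y u U y x \<and> w' \<Turnstile> pr p y x"
  have "w \<Turnstile> cmp h (unfolds Y u U)"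
  proof (rule cmpI[OF h(1)])
    fix w' p assume l: "w \<le> w'"
    show "w' \<Turnstile> mem p h \<longleftrightarrow> w' \<Turnstile> unfolds Y u U p"
    proof
      assume "w' \<Turnstile> mem p h"
      from h(3)[OF l this] show "w' \<Turnstile> unfolds Y u U p"
        unfolding unfolds_def holds_exi holds_conj using mem_ex1 by blast
    next
      assume "w' \<Turnstile> unfolds Y u U p"
      then obtain y x where x: "w' \<Turnstile> ex x" "w' \<Turnstile> unfold Y u U y x" "w' \<Turnstile> pr p y x"
        unfolding unfolds_def holds_exi holds_conj by blast
      have "w' \<Turnstile> mem y Y" using x(2) fn_mem(1)[OF up[OF u l]] unfolding unfold_iff by blast
      with x h(2)[OF l] have "w' \<Turnstile> mp h y x" by blast
      then show "w' \<Turnstile> mem p h" using mp_mem x(3) by blast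
    qed
  qed
  then show ?thesis ..
qed

text \<open>The level maps U_n come from \<open>recursion\<close>. An induction shows that U_n(y) is
  the truncation of U_{n+1}(y), so the values at y form a coherent sequence, which is the image of
  y.\<close>

lemma mor_exists:
  assumes le: "w0 \<le> w" and PY: "w \<Turnstile> cmp PY (isP Y)" and u: "w \<Turnstile> fn u Y PY"
  shows "\<exists>\<alpha>. mor w Y u \<alpha>"
proof -
  note W' = omega_up[OF W le]
  note Y = fn_ex(2)[OF u]
  have zone: "w' \<Turnstile> mem z0 one" if "w \<le> w'" for w' using up[OF uprD(4)[OF one] order_trans[OF le that]] .
  have "\<exists>U0. w \<Turnstile> fn U0 Y one \<and> (\<forall>w'\<ge>w. \<forall>y x. w' \<Turnstile> mp U0 y x \<longleftrightarrow> w' \<Turnstile> mem y Y \<and> w' \<Turnstile> ex x \<and> w' \<Turnstile> eq x z0)"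
  proof (rule function_set[OF _ Y up[OF uprD(1)[OF one] le]])
    show "dfn False w (\<lambda>e. eq (e (Suc 0)) z0)" by (intro dfn_intros up[OF zero_ex[OF z0] le])
    show "\<exists>x. w' \<Turnstile> mem x one \<and> w' \<Turnstile> eq x z0" if "w \<le> w'" for w'
      using zone[OF that] eq_refl mem_ex1 by blast
  qed (use eq_sym eq_trans in blast)
  then obtain U0 where U0: "w \<Turnstile> fn U0 Y one"
    "\<forall>w'\<ge>w. \<forall>y x. w' \<Turnstile> mp U0 y x \<longleftrightarrow> w' \<Turnstile> mem y Y \<and> w' \<Turnstile> ex x \<and> w' \<Turnstile> eq x z0" by blast
  have "\<exists>\<upsilon>. rec_seq w W U0 (\<lambda>U U'. cmp U' (unfolds Y u U)) \<upsilon>"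
  proof (rule recursion[OF W' fn_ex(1)[OF U0(1)]])
    show "dfn False w (\<lambda>e. cmp (e (Suc 0)) (unfolds Y u (e 0)))"
      unfolding unfolds_def by (intro dfn_intros dfn_unfold le fn_ex[OF u])
    show "\<exists>U'. w' \<Turnstile> ex U' \<and> w' \<Turnstile> cmp U' (unfolds Y u U)" if l: "w \<le> w'" and U: "w' \<Turnstile> ex U" for w' U
      using unfolds_set[OF order_trans[OF le l] up[OF PY l] up[OF u l] U] cmp_ex by blast
  qed (rule cmp_unique)
  then obtain \<upsilon> where \<upsilon>: "rec_seq w W U0 (\<lambda>U U'. cmp U' (unfolds Y u U)) \<upsilon>" by blast
  \<comment> \<open>Unfolding any set gives a relation that is total and single-valued on Y. The
    three facts below therefore follow from this case distinction without induction.\<close>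
  have cases: "(w' \<Turnstile> zero n \<and> w' \<Turnstile> eq U U0) \<or> (\<exists>m U1. w' \<Turnstile> suc m n \<and> w' \<Turnstile> mp \<upsilon> m U1 \<and> w' \<Turnstile> cmp U (unfolds Y u U1))"
    if l: "w \<le> w'" and U: "w' \<Turnstile> mp \<upsilon> n U" for w' n U
    using omegaD(4)[OF W' l rec_seqD(6)[OF \<upsilon> l U]] rec_seqD(4)[OF \<upsilon> l _ U] rec_seqD(2)[OF \<upsilon> l] rec_seqD(5)[OF \<upsilon> l _ _ U]
    by blast
  have dom: "w' \<Turnstile> mem y Y" if l: "w \<le> w'" and U: "w' \<Turnstile> mp \<upsilon> n U" and x: "w' \<Turnstile> mp U y x" for w' n U y x
  proof -
    from cases[OF l U] show ?thesis
    proof (elim HOL.disjE exE HOL.conjE)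
      assume "w' \<Turnstile> eq U U0"
      from mp_cong1[OF x this] U0(2) l show ?thesis by blast
    next
      fix m U1 assume c: "w' \<Turnstile> cmp U (unfolds Y u U1)"
      from x show ?thesis unfolding unfolds_mp[OF c order_refl] unfold_iff using fn_mem(1)[OF up[OF u l]] by blast
    qed
  qed
  have total: "\<exists>x. w' \<Turnstile> mp U y x" if l: "w \<le> w'" and U: "w' \<Turnstile> mp \<upsilon> n U" and y: "w' \<Turnstile> mem y Y" for w' n U y
  proof -
    from cases[OF l U] show ?thesis
    proof (elim HOL.disjE exE HOL.conjE)
      assume "w' \<Turnstile> eq U U0"
      from fn_total[OF up[OF U0(1) l] y] mp_cong1[OF _ eq_sym[OF this]] show ?thesis by blast
    next
      fix m U1 assume "w' \<Turnstile> mp \<upsilon> m U1" and c: "w' \<Turnstile> cmp U (unfolds Y u U1)"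
      from unfold_total[OF up[OF PY l] up[OF u l] mp_ex(3)[OF this(1)] y] show ?thesis
        unfolding unfolds_mp[OF c order_refl] .
    qed
  qed
  have unique: "w' \<Turnstile> eq x x'" if l: "w \<le> w'" and U: "w' \<Turnstile> mp \<upsilon> n U" and x: "w' \<Turnstile> mp U y x" "w' \<Turnstile> mp U y x'" for w' n U y x x'
  proof -
    from cases[OF l U] show ?thesis
    proof (elim HOL.disjE exE HOL.conjE)
      assume "w' \<Turnstile> eq U U0"
      from fn_unique[OF up[OF U0(1) l] x[THEN mp_cong1, OF this]] show ?thesis .
    next
      fix m U1 assume c: "w' \<Turnstile> cmp U (unfolds Y u U1)"
      from unfold_unique[OF order_trans[OF le l] up[OF u l] x[unfolded unfolds_mp[OF c order_refl]]] show ?thesis .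
    qed
  qed
  \<comment> \<open>Consecutive level maps are compatible with truncation. Again all y are treated
    at once, since the step refers to the successors of y.\<close>
  let ?Q = "\<lambda>n. all (\<lambda>m. all (\<lambda>U. all (\<lambda>U'. all (\<lambda>R. all (\<lambda>y. all (\<lambda>x. all (\<lambda>x'.
    suc n m \<sqinter> mp \<upsilon> n U \<sqinter> mp \<upsilon> m U' \<sqinter> mp \<rho> n R \<sqinter> mp U y x \<sqinter> mp U' y x' \<rightarrow> mp R x x')))))))"
  have QI: "w' \<Turnstile> ?Q n" if "\<And>w'' m U U' R y x x'. w' \<le> w'' \<Longrightarrow> w'' \<Turnstile> suc n m \<Longrightarrow> w'' \<Turnstile> mp \<upsilon> n U \<Longrightarrow> w'' \<Turnstile> mp \<upsilon> m U' \<Longrightarrow>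
      w'' \<Turnstile> mp \<rho> n R \<Longrightarrow> w'' \<Turnstile> mp U y x \<Longrightarrow> w'' \<Turnstile> mp U' y x' \<Longrightarrow> w'' \<Turnstile> mp R x x'" for w' n
    unfolding holds_all holds_imp holds_conj
  proof (intro allI impI)
    fix w1 m w2 U w3 U' w4 R w5 y w6 x w7 x' w8
    assume l: "w' \<le> w1" "w1 \<le> w2" "w2 \<le> w3" "w3 \<le> w4" "w4 \<le> w5" "w5 \<le> w6" "w6 \<le> w7" "w7 \<le> w8"
      and m: "w8 \<Turnstile> suc n m \<and> w8 \<Turnstile> mp \<upsilon> n U \<and> w8 \<Turnstile> mp \<upsilon> m U' \<and> w8 \<Turnstile> mp \<rho> n R \<and> w8 \<Turnstile> mp U y x \<and> w8 \<Turnstile> mp U' y x'"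
    have "w' \<le> w8"
      by (rule order_trans[OF l(1) order_trans[OF l(2) order_trans[OF l(3) order_trans[OF l(4)
        order_trans[OF l(5) order_trans[OF l(6) order_trans[OF l(7,8)]]]]]]])
    from that[OF this] m show "w8 \<Turnstile> mp R x x'" by blast
  qed
  have QD: "w' \<Turnstile> mp R x x'" if "w' \<Turnstile> ?Q n" "w' \<Turnstile> suc n m" "w' \<Turnstile> mp \<upsilon> n U" "w' \<Turnstile> mp \<upsilon> m U'" "w' \<Turnstile> mp \<rho> n R"
    "w' \<Turnstile> mp U y x" "w' \<Turnstile> mp U' y x'" for w' n m U U' R y x x'
    using that(1)[unfolded holds_all holds_imp holds_conj, THEN spec, THEN mp, OF order_refl, THEN spec, THEN mp, OF suc_ex(2)[OF that(2)],
        THEN spec, THEN mp, OF order_refl, THEN spec, THEN mp, OF mp_ex(3)[OF that(3)],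
        THEN spec, THEN mp, OF order_refl, THEN spec, THEN mp, OF mp_ex(3)[OF that(4)],
        THEN spec, THEN mp, OF order_refl, THEN spec, THEN mp, OF mp_ex(3)[OF that(5)],
        THEN spec, THEN mp, OF order_refl, THEN spec, THEN mp, OF mp_ex(2)[OF that(6)],
        THEN spec, THEN mp, OF order_refl, THEN spec, THEN mp, OF mp_ex(3)[OF that(6)],
        THEN spec, THEN mp, OF order_refl, THEN spec, THEN mp, OF mp_ex(3)[OF that(7)], THEN spec, THEN mp, OF order_refl]
      that(2-) by blast
  have Q: "w' \<Turnstile> ?Q n" if l: "w \<le> w'" and n: "w' \<Turnstile> mem n W" for w' n
  proof (rule omega_induct[OF W' _ _ _ l n])
    show "dfn False w (\<lambda>e. ?Q (e 0))" by (intro dfn_intros rec_seqD(1)[OF \<upsilon> order_refl] rec_seqD(1)[OF \<rho> le])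
  next
    fix w' n assume l: "w \<le> w'" and n: "w' \<Turnstile> zero n"
    show "w' \<Turnstile> ?Q n"
    proof (rule QI)
      fix w'' m U U' R y x x'
      assume l': "w' \<le> w''" and m: "w'' \<Turnstile> suc n m" and U: "w'' \<Turnstile> mp \<upsilon> n U" and U': "w'' \<Turnstile> mp \<upsilon> m U'"
        and R: "w'' \<Turnstile> mp \<rho> n R" and x: "w'' \<Turnstile> mp U y x" and x': "w'' \<Turnstile> mp U' y x'"
      note l2 = order_trans[OF l l'] note l0 = order_trans[OF le l2]
      note n' = up[OF n l']
      have U_U0: "w'' \<Turnstile> eq U U0" by (rule rec_seqD(4)[OF \<upsilon> l2 n' U])
      have "w'' \<Turnstile> eq x z0" using mp_cong1[OF x U_U0] U0(2) l2 by blast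
      moreover obtain q a t s where *: "w'' \<Turnstile> pel Y q a t" "w'' \<Turnstile> comp s U t" "w'' \<Turnstile> pr x' a s"
        using x' unfolding unfolds_mp[OF rec_seqD(5)[OF \<upsilon> l2 m U U'] order_refl] unfold_iff by blast
      have t: "w'' \<Turnstile> fnf t a Y" and a: "w'' \<Turnstile> mem a A" using *(1) by (simp_all add: pel_iff)
      \<comment> \<open>U_0 sends everything to the point, so U_1(y) lies in P_f of the one-point
        set. This is all that R_0 asks of its second argument.\<close>
      have "w'' \<Turnstile> fnf s a one"
      proof (rule comp_fnf[OF l0 *(2) t up[OF uprD(1)[OF one] l0]])
        fix w3 y assume l3: "w'' \<le> w3" and y: "w3 \<Turnstile> mem y Y"
        from fn_total[OF up[OF U0(1) order_trans[OF l2 l3]] y] mp_cong1[OF _ eq_sym[OF up[OF U_U0 l3]]]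
        show "\<exists>z. w3 \<Turnstile> mem z one \<and> w3 \<Turnstile> mp U y z" by blast
      next
        fix w3 y z z' assume l3: "w'' \<le> w3" and "w3 \<Turnstile> mp U y z" "w3 \<Turnstile> mp U y z'"
        from unique[OF order_trans[OF l2 l3] up[OF U l3] this(2,3)] show "w3 \<Turnstile> eq z z'" .
      qed
      with a *(3) have "w'' \<Turnstile> isP one x'" unfolding isP_iff pel_iff by blast
      ultimately show "w'' \<Turnstile> mp R x x'" unfolding level_zero[OF l0 n' R] using mp_ex(3)[OF x'] by blast
    qed
  next
    fix w' k n assume l: "w \<le> w'" and k: "w' \<Turnstile> mem k W" and n: "w' \<Turnstile> suc k n" and IH: "w' \<Turnstile> ?Q k"
    show "w' \<Turnstile> ?Q n"
    proof (rule QI)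
      fix w'' m U U' R y x x'
      assume l': "w' \<le> w''" and m: "w'' \<Turnstile> suc n m" and U: "w'' \<Turnstile> mp \<upsilon> n U" and U': "w'' \<Turnstile> mp \<upsilon> m U'"
        and R: "w'' \<Turnstile> mp \<rho> n R" and x: "w'' \<Turnstile> mp U y x" and x': "w'' \<Turnstile> mp U' y x'"
      note l2 = order_trans[OF l l'] note l0 = order_trans[OF le l2]
      note n' = up[OF n l'] and k' = up[OF k l'] and IH' = up[OF IH l'] and u' = up[OF u l2]
      obtain U1 where U1: "w'' \<Turnstile> mp \<upsilon> k U1" using rec_seqD(2)[OF \<upsilon> l2 k'] by blast
      obtain R1 where R1: "w'' \<Turnstile> mp \<rho> k R1" using level_exists[OF l0 k'] by blast
      note cU = rec_seqD(5)[OF \<upsilon> l2 n' U1 U] and cU' = rec_seqD(5)[OF \<upsilon> l2 m U U']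
      obtain q a t s where *: "w'' \<Turnstile> mp u y q" "w'' \<Turnstile> pel Y q a t" "w'' \<Turnstile> comp s U1 t" "w'' \<Turnstile> pr x a s"
        using x unfolding unfolds_mp[OF cU order_refl] unfold_iff by blast
      obtain s' where s': "w'' \<Turnstile> comp s' U t" "w'' \<Turnstile> pr x' a s'"
        by (rule unfold_normal[OF l0 u' *(1,2) x'[unfolded unfolds_mp[OF cU' order_refl]]])
      have t: "w'' \<Turnstile> fnf t a Y" and a: "w'' \<Turnstile> mem a A" using *(2) by (simp_all add: pel_iff)
      have step: "w3 \<Turnstile> mp R1 z z'" if "w'' \<le> w3" "w3 \<Turnstile> mp U1 y z" "w3 \<Turnstile> mp U y z'" for w3 y z z'
        by (rule QD[OF IH'[THEN up, OF that(1)] n'[THEN up, OF that(1)] U1[THEN up, OF that(1)] U[THEN up, OF that(1)]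
              R1[THEN up, OF that(1)] that(2,3)])
      \<comment> \<open>\<open>PHI\<close> needs one codomain for both functions s and s', although
        their values come from different levels. The set N contains all levels and serves for
        both.\<close>
      note N' = up[OF N(1) l0]
      have inN: "w3 \<Turnstile> mem z N \<and> w3 \<Turnstile> mem z' N" if "w'' \<le> w3" "w3 \<Turnstile> mp U1 y z" "w3 \<Turnstile> mp U y z'" for w3 y z z'
        by (rule N(2)[OF order_trans[OF l0 that(1)] up[OF R1 that(1)] step[OF that]])
      have both: "\<exists>z z'. w3 \<Turnstile> mp U1 y z \<and> w3 \<Turnstile> mp U y z'" if "w'' \<le> w3" "w3 \<Turnstile> mem y Y" for w3 y
        using total[OF order_trans[OF l2 that(1)] up[OF U1 that(1)] that(2)] total[OF order_trans[OF l2 that(1)] up[OF U that(1)] that(2)]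
        by blast
      have "w'' \<Turnstile> fnf s a N"
        by (rule comp_fnf[OF l0 *(3) t N']) (use both inN unique[OF order_trans[OF l2] up[OF U1]] in blast)+
      moreover have "w'' \<Turnstile> fnf s' a N"
        by (rule comp_fnf[OF l0 s'(1) t N']) (use both inN unique[OF order_trans[OF l2] up[OF U]] in blast)+
      moreover have "w'' \<Turnstile> par R1 s s'"
      proof (rule parI)
        fix w3 b z z' assume l3: "w'' \<le> w3" and "w3 \<Turnstile> mp s b z" "w3 \<Turnstile> mp s' b z'"
        then obtain y1 y2 where y: "w3 \<Turnstile> mp t b y1" "w3 \<Turnstile> mp U1 y1 z" "w3 \<Turnstile> mp t b y2" "w3 \<Turnstile> mp U y2 z'"
          unfolding comp_mp[OF *(3) l3] comp_mp[OF s'(1) l3] by blast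
        have "w3 \<Turnstile> mp U y1 z'"
          by (rule mp_cong[OF y(4) fnf_unique[OF order_trans[OF l0 l3] up[OF t l3] y(3,1)] eq_refl[OF mp_ex(3)[OF y(4)]]])
        from step[OF l3 y(2) this] show "w3 \<Turnstile> mp R1 z z'" .
      qed
      ultimately show "w'' \<Turnstile> mp R x x'"
        using PHI_mpI[OF level_suc[OF l0 n' R1 R]] a *(4) s'(2) unfolding pel_iff by blast
    qed
  qed
  \<comment> \<open>Says that x is U_n(y). The map U_n is quantified because the recursion
    determines it only up to equality.\<close>
  let ?K = "\<lambda>y n x. exi (\<lambda>U. mp \<upsilon> n U \<sqinter> mp U y x)"
  have K: "w' \<Turnstile> ?K y n x \<longleftrightarrow> (\<exists>U. w' \<Turnstile> mp \<upsilon> n U \<and> w' \<Turnstile> mp U y x)" for w' y n x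
    unfolding holds_exi holds_conj using mp_ex(3) by blast
  have K_unique: "w' \<Turnstile> eq x x'" if l: "w \<le> w'" and "w' \<Turnstile> ?K y n x" "w' \<Turnstile> ?K y n x'" for w' y n x x'
  proof -
    from that(2,3) obtain U U' where U: "w' \<Turnstile> mp \<upsilon> n U" "w' \<Turnstile> mp U y x" "w' \<Turnstile> mp \<upsilon> n U'" "w' \<Turnstile> mp U' y x'"
      unfolding K by blast
    from unique[OF l U(1,2) mp_cong1[OF U(4) rec_seqD(3)[OF \<upsilon> l U(3,1)]]] show ?thesis .
  qed
  have K_coherent: "w' \<Turnstile> mp R x x'" if l: "w \<le> w'" and "w' \<Turnstile> suc n m" "w' \<Turnstile> mp \<rho> n R" "w' \<Turnstile> ?K y n x" "w' \<Turnstile> ?K y m x'"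
    for w' n m R y x x'
  proof -
    from that(4,5) obtain U U' where U: "w' \<Turnstile> mp \<upsilon> n U" "w' \<Turnstile> mp U y x" "w' \<Turnstile> mp \<upsilon> m U'" "w' \<Turnstile> mp U' y x'"
      unfolding K by blast
    from QD[OF Q[OF l rec_seqD(6)[OF \<upsilon> l U(1)]] that(2) U(1,3) that(3) U(2,4)] show ?thesis .
  qed
  have K_total: "\<exists>x. w' \<Turnstile> mem x N \<and> w' \<Turnstile> ?K y n x" if l: "w \<le> w'" and y: "w' \<Turnstile> mem y Y" and n: "w' \<Turnstile> mem n W" for w' y n
  proof -
    note l0 = order_trans[OF le l]
    \<comment> \<open>The next level is needed to place U_n(y) in N: it is related by R_n to the
      value at y of the following level map.\<close>
    obtain m where m: "w' \<Turnstile> suc n m" using suc_exists[OF mem_ex1[OF n]] by blast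
    obtain U where U: "w' \<Turnstile> mp \<upsilon> n U" using rec_seqD(2)[OF \<upsilon> l n] by blast
    obtain U' where U': "w' \<Turnstile> mp \<upsilon> m U'" using rec_seqD(2)[OF \<upsilon> l omegaD(3)[OF W' l n m]] by blast
    obtain R where R: "w' \<Turnstile> mp \<rho> n R" using level_exists[OF l0 n] by blast
    obtain x where x: "w' \<Turnstile> mp U y x" using total[OF l U y] by blast
    obtain x' where x': "w' \<Turnstile> mp U' y x'" using total[OF l U' y] by blast
    from N(2)[OF l0 R QD[OF Q[OF l n] m U U' R x x']] U x show ?thesis unfolding K by blast
  qed
  \<comment> \<open>Says that g is the sequence of all U_n(y). Membership in X is included, so that
    two such g are functions on W and can be compared entry by entry.\<close>
  let ?G = "\<lambda>y g. mem g X \<sqinter> all (\<lambda>n. all (\<lambda>x. iff (mp g n x) (mem n W \<sqinter> ?K y n x)))"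
  have G: "w' \<Turnstile> mp g n x \<longleftrightarrow> w' \<Turnstile> ?K y n x" if "w \<le> w1" "w1 \<Turnstile> ?G y g" "w1 \<le> w'" for w1 w' y g n x
  proof -
    have "w' \<Turnstile> ex n \<Longrightarrow> w' \<Turnstile> ex x \<Longrightarrow> w' \<Turnstile> mp g n x \<longleftrightarrow> w' \<Turnstile> mem n W \<and> w' \<Turnstile> ?K y n x"
      using up[OF that(2,3)] order_refl[of w'] unfolding holds_conj holds_all holds_iff by blast
    moreover have "w' \<Turnstile> ?K y n x \<Longrightarrow> w' \<Turnstile> mem n W"
      unfolding K using rec_seqD(6)[OF \<upsilon> order_trans[OF that(1,3)]] by blast
    moreover have "w' \<Turnstile> ?K y n x \<Longrightarrow> w' \<Turnstile> ex n \<and> w' \<Turnstile> ex x"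
      unfolding K using mp_ex(2,3) by blast
    ultimately show ?thesis using mp_ex(2,3) by blast
  qed
  have G_exists: "\<exists>g. w1 \<Turnstile> ?G y g" if l: "w \<le> w1" and y: "w1 \<Turnstile> mem y Y" for w1 y
  proof -
    note l0 = order_trans[OF le l]
    have "\<exists>g. w1 \<Turnstile> fn g W N \<and> (\<forall>w'\<ge>w1. \<forall>n x. w' \<Turnstile> mp g n x \<longleftrightarrow> w' \<Turnstile> mem n W \<and> w' \<Turnstile> ex x \<and> w' \<Turnstile> ?K y n x)"
    proof (rule function_set[OF _ omegaD(1)[OF W l0] up[OF N(1) l0]])
      show "dfn False w1 (\<lambda>e. ?K y (e 0) (e (Suc 0)))"
        by (intro dfn_intros rec_seqD(1)[OF \<upsilon> l] mem_ex1[OF y])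
      show "\<exists>x. w' \<Turnstile> mem x N \<and> w' \<Turnstile> ?K y n x" if "w1 \<le> w'" "w' \<Turnstile> mem n W" for w' n
        using K_total[OF order_trans[OF l that(1)] up[OF y that(1)] that(2)] .
      show "w' \<Turnstile> eq x x'" if "w1 \<le> w'" "w' \<Turnstile> ?K y n x" "w' \<Turnstile> ?K y n x'" for w' n x x'
        using K_unique[OF order_trans[OF l that(1)] that(2,3)] .
    qed
    then obtain g where g: "w1 \<Turnstile> fn g W N"
      and g2: "\<forall>w'\<ge>w1. \<forall>n x. w' \<Turnstile> mp g n x \<longleftrightarrow> w' \<Turnstile> mem n W \<and> w' \<Turnstile> ex x \<and> w' \<Turnstile> ?K y n x" by blast
    have "w1 \<Turnstile> mem g X"
    proof (rule X_intro[OF l0 g])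
      fix w' m n R z z' assume l': "w1 \<le> w'" and s: "w' \<Turnstile> suc m n" "w' \<Turnstile> mp \<rho> m R" and "w' \<Turnstile> mp g m z" "w' \<Turnstile> mp g n z'"
      then have "w' \<Turnstile> ?K y m z" "w' \<Turnstile> ?K y n z'" using g2 by blast+
      from K_coherent[OF order_trans[OF l l'] s this] show "w' \<Turnstile> mp R z z'" .
    qed
    moreover have "w1 \<Turnstile> all (\<lambda>n. all (\<lambda>x. iff (mp g n x) (mem n W \<sqinter> ?K y n x)))"
      unfolding holds_all holds_iff holds_conj
    proof (intro allI impI)
      fix w2 n w3 x w4 assume l: "w1 \<le> w2" "w2 \<le> w3" "w3 \<le> w4" and z: "w3 \<Turnstile> ex x"
      from g2[THEN spec, THEN mp, OF order_trans[OF l(1) order_trans[OF l(2,3)]]] up[OF z l(3)]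
      show "w4 \<Turnstile> mp g n x \<longleftrightarrow> w4 \<Turnstile> mem n W \<and> w4 \<Turnstile> ?K y n x" by blast
    qed
    ultimately show ?thesis unfolding holds_conj by blast
  qed
  have "\<exists>\<alpha>. w \<Turnstile> fn \<alpha> Y X \<and> (\<forall>w'\<ge>w. \<forall>y g. w' \<Turnstile> mp \<alpha> y g \<longleftrightarrow> w' \<Turnstile> mem y Y \<and> w' \<Turnstile> ex g \<and> w' \<Turnstile> ?G y g)"
  proof (rule function_set[OF _ Y up[OF cmp_ex[OF X] le]])
    show "dfn False w (\<lambda>e. ?G (e 0) (e (Suc 0)))"
      by (intro dfn_intros up[OF cmp_ex[OF X] le] omegaD(1)[OF W le] rec_seqD(1)[OF \<upsilon> order_refl])
    show "\<exists>g. w' \<Turnstile> mem g X \<and> w' \<Turnstile> ?G y g" if "w \<le> w'" "w' \<Turnstile> mem y Y" for w' y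
      using G_exists[OF that] unfolding holds_conj by blast
    show "w' \<Turnstile> eq g g'" if l: "w \<le> w'" and g: "w' \<Turnstile> ?G y g" "w' \<Turnstile> ?G y g'" for w' y g g'
    proof -
      note l0 = order_trans[OF le l]
      have gX: "w' \<Turnstile> mem g X" "w' \<Turnstile> mem g' X" using g unfolding holds_conj by blast+
      show ?thesis
      proof (rule fn_ext[OF X_fn[OF l0 gX(1)] X_fn[OF l0 gX(2)]])
        fix w'' n x x' assume l': "w' \<le> w''" and x: "w'' \<Turnstile> mp g n x" "w'' \<Turnstile> mp g' n x'"
        show "w'' \<Turnstile> eq x x'"
          by (rule K_unique[OF order_trans[OF l l'] x(1)[unfolded G[OF l g(1) l']] x(2)[unfolded G[OF l g(2) l']]])
      qed
    qed
  qed
  then obtain \<alpha> where \<alpha>: "w \<Turnstile> fn \<alpha> Y X"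
    and \<alpha>2: "\<forall>w'\<ge>w. \<forall>y g. w' \<Turnstile> mp \<alpha> y g \<longleftrightarrow> w' \<Turnstile> mem y Y \<and> w' \<Turnstile> ex g \<and> w' \<Turnstile> ?G y g" by blast
  have "mor w Y u \<alpha>" unfolding mor_def
  proof (intro HOL.conjI allI impI \<alpha>)
    fix w' y q a t g assume l: "w \<le> w'" and q: "w' \<Turnstile> mp u y q" "w' \<Turnstile> pel Y q a t" and g: "w' \<Turnstile> mp \<alpha> y g"
    note l0 = order_trans[OF le l]
    have gG: "w' \<Turnstile> ?G y g" using \<alpha>2 l g by blast
    obtain s where s: "w' \<Turnstile> comp s \<alpha> t" using comp_exists[OF up[OF fn_ex(1)[OF \<alpha>] l] pel_ex(4)[OF q(2)]] by blast
    \<comment> \<open>Entry n + 1 of g is the pair of a and the composite of U_n with t. Its value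
      at b is U_n(t(b)), which is entry n of the image of t(b).\<close>
    have "w' \<Turnstile> VV g a s"
    proof (rule VVI)
      fix w'' n m x assume l': "w' \<le> w''" and n: "w'' \<Turnstile> mem n W" and m: "w'' \<Turnstile> suc n m" and x: "w'' \<Turnstile> mp g m x"
      note l2 = order_trans[OF l l'] note l3 = order_trans[OF le l2]
      obtain U' where U': "w'' \<Turnstile> mp \<upsilon> m U'" "w'' \<Turnstile> mp U' y x" using x unfolding G[OF l gG l'] K by blast
      obtain U where U: "w'' \<Turnstile> mp \<upsilon> n U" using rec_seqD(2)[OF \<upsilon> l2 n] by blast
      obtain r where r: "w'' \<Turnstile> comp r U t" "w'' \<Turnstile> pr x a r"
        by (rule unfold_normal[OF l3 up[OF u l2] up[OF q(1) l'] up[OF q(2) l']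
              U'(2)[unfolded unfolds_mp[OF rec_seqD(5)[OF \<upsilon> l2 m U U'(1)] order_refl]]])
      have "\<exists>z. w3 \<Turnstile> mp k n z \<and> w3 \<Turnstile> mp r b z" if l4: "w'' \<le> w3" and k: "w3 \<Turnstile> mp s b k" for w3 b k
      proof -
        note l5 = order_trans[OF l2 l4]
        obtain y1 where y1: "w3 \<Turnstile> mp t b y1" "w3 \<Turnstile> mp \<alpha> y1 k"
          using k unfolding comp_mp[OF s order_trans[OF l' l4]] by blast
        have kG: "w3 \<Turnstile> mem y1 Y" "w3 \<Turnstile> ?G y1 k" using \<alpha>2 l5 y1(2) by blast+
        obtain z where z: "w3 \<Turnstile> mp U y1 z" using total[OF l5 up[OF U l4] kG(1)] by blast
        have "w3 \<Turnstile> mp r b z" unfolding comp_mp[OF r(1) l4] using y1(1) z by blast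
        moreover have "w3 \<Turnstile> mp k n z" unfolding G[OF l5 kG(2) order_refl] K using up[OF U l4] z by blast
        ultimately show ?thesis by blast
      qed
      with r(2) show "\<exists>r. w'' \<Turnstile> pr x a r \<and> (\<forall>w3\<ge>w''. \<forall>b k. w3 \<Turnstile> mp s b k \<longrightarrow> (\<exists>z. w3 \<Turnstile> mp k n z \<and> w3 \<Turnstile> mp r b z))"
        by blast
    qed
    with s show "\<exists>s. w' \<Turnstile> comp s \<alpha> t \<and> w' \<Turnstile> VV g a s" by blast
  qed
  then show ?thesis ..
qed

end

section \<open>The coalgebra structure on the limit\<close>

lemma (in container) limit_exists: "\<exists>W z0 one P1 R0 \<rho> F N X. limit w0 B A f W z0 one P1 R0 \<rho> F N X"
proof -
  obtain W where W: "omega w0 W" using omega_exists by blast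
  obtain z0 where z0: "w0 \<Turnstile> zero z0" using omegaD(5)[OF W order_refl] by blast
  obtain one where one: "w0 \<Turnstile> upr one z0 z0" using upr_exists[OF zero_ex[OF z0] zero_ex[OF z0]] by blast
  obtain P1 where P1: "w0 \<Turnstile> cmp P1 (isP one)" using poly_exists[OF order_refl uprD(1)[OF one]] by blast
  obtain R0 where R0: "w0 \<Turnstile> cmp R0 (prod_of one P1)" using product_set[OF uprD(1)[OF one] cmp_ex[OF P1]] by blast
  have "\<exists>\<rho>. rec_seq w0 W R0 (\<lambda>R R'. cmp R' (PHI R)) \<rho>"
  proof (rule recursion[OF W cmp_ex[OF R0]])
    show "dfn False w0 (\<lambda>e. cmp (e (Suc 0)) (PHI (e 0)))" by (intro dfn_intros dfn_PHI order_refl)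
    show "\<exists>R'. w \<Turnstile> ex R' \<and> w \<Turnstile> cmp R' (PHI R)" if "w0 \<le> w" "w \<Turnstile> ex R" for w R
      using PHI_set[OF that] cmp_ex by blast
  qed (rule cmp_unique)
  then obtain \<rho> where \<rho>: "rec_seq w0 W R0 (\<lambda>R R'. cmp R' (PHI R)) \<rho>" by blast
  note \<rho>_ex = rec_seqD(1)[OF \<rho> order_refl]
  obtain F where F: "w0 \<Turnstile> ex F" "\<And>w n R. w0 \<le> w \<Longrightarrow> w \<Turnstile> mp \<rho> n R \<Longrightarrow> w \<Turnstile> mem R F"
    by (rule field_set[OF \<rho>_ex]) blast
  \<comment> \<open>The union of F contains every pair in every R_n, so its field can serve as
    N.\<close>
  obtain U where U: "w0 \<Turnstile> ex U" "\<And>w r. w0 \<le> w \<Longrightarrow> w \<Turnstile> mem r U \<longleftrightarrow> (\<exists>R. w \<Turnstile> mem R F \<and> w \<Turnstile> mem r R)"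
    using union_exists[OF F(1)] by blast
  obtain N where N: "w0 \<Turnstile> ex N" "\<And>w x y. w0 \<le> w \<Longrightarrow> w \<Turnstile> mp U x y \<Longrightarrow> w \<Turnstile> mem x N \<and> w \<Turnstile> mem y N"
    by (rule field_set[OF U(1)]) blast
  have N': "w \<Turnstile> mem x N \<and> w \<Turnstile> mem y N" if "w0 \<le> w" "w \<Turnstile> mp \<rho> n R" "w \<Turnstile> mp R x y" for w n R x y
  proof -
    from that(3) obtain r where "w \<Turnstile> mem r R" "w \<Turnstile> pr r x y" by (auto simp: mp_iff)
    with U(2)[OF that(1)] F(2)[OF that(1,2)] have "w \<Turnstile> mp U x y" unfolding mp_iff by blast
    from N(2)[OF that(1) this] show ?thesis .
  qed
  note W_ex = omegaD(1)[OF W order_refl]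
  obtain C where C: "w0 \<Turnstile> cmp C (\<lambda>g. fn g W N)" using exponential[OF W_ex N(1)] by blast
  let ?coh = "\<lambda>g. ball W (\<lambda>m. ball W (\<lambda>n. suc m n \<rightarrow> ball F (\<lambda>R. ball N (\<lambda>z. ball N (\<lambda>z'.
      mp \<rho> m R \<sqinter> mp g m z \<sqinter> mp g n z' \<rightarrow> mp R z z')))))"
  have "dfn True w0 (\<lambda>e. ?coh (e 0))" by (intro dfn_intros W_ex F(1) N(1) \<rho>_ex)
  from cmp_separation[OF this cmp_ex[OF C]] obtain X where X: "w0 \<Turnstile> cmp X (\<lambda>g. mem g C \<sqinter> ?coh g)" by blast
  have "w0 \<Turnstile> cmp X (\<lambda>g. fn g W N \<sqinter> ?coh g)"
    by (rule cmp_cong[OF X]) (unfold holds_conj, use cmpD[OF C] in blast)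
  then have "limit w0 B A f W z0 one P1 R0 \<rho> F N X"
    using W z0 one P1 R0 \<rho> F N(1) N' by unfold_locales
  then show ?thesis by blast
qed

context limit
begin

definition val :: "nat \<Rightarrow> nat \<Rightarrow> pv" where
  "val g q = exi (\<lambda>a. exi (\<lambda>t. pel X q a t \<sqinter> VV g a t))"

lemma val_iff: "w \<Turnstile> val g q \<longleftrightarrow> (\<exists>a t. w \<Turnstile> pel X q a t \<and> w \<Turnstile> VV g a t)"
  unfolding val_def holds_exi holds_conj using pel_ex(3,4) by blast

definition is_structure :: "nat \<Rightarrow> nat \<Rightarrow> bool" where
  "is_structure PX v \<longleftrightarrow> w0 \<Turnstile> cmp PX (isP X) \<and> w0 \<Turnstile> fn v X PX \<and>
    (\<forall>w\<ge>w0. \<forall>g q. w \<Turnstile> mp v g q \<longleftrightarrow> w \<Turnstile> mem g X \<and> w \<Turnstile> ex q \<and> w \<Turnstile> val g q)"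

lemma structure_exists: "\<exists>PX v. is_structure PX v"
proof -
  obtain PX where PX: "w0 \<Turnstile> cmp PX (isP X)" using poly_exists[OF order_refl cmp_ex[OF X]] by blast
  have "\<exists>v. w0 \<Turnstile> fn v X PX \<and> (\<forall>w\<ge>w0. \<forall>g q. w \<Turnstile> mp v g q \<longleftrightarrow> w \<Turnstile> mem g X \<and> w \<Turnstile> ex q \<and> w \<Turnstile> val g q)"
  proof (rule function_set[OF _ cmp_ex[OF X] cmp_ex[OF PX]])
    show "dfn False w0 (\<lambda>e. val (e 0) (e (Suc 0)))"
      unfolding val_def by (intro dfn_intros dfn_pel dfn_VV order_refl cmp_ex[OF X])
    show "\<exists>q. w \<Turnstile> mem q PX \<and> w \<Turnstile> val g q" if le: "w0 \<le> w" and g: "w \<Turnstile> mem g X" for w g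
    proof -
      from val_exists[OF that] obtain q a t where q: "w \<Turnstile> pel X q a t" "w \<Turnstile> VV g a t" by blast
      then have "w \<Turnstile> mem q PX" unfolding cmpD[OF PX le] isP_iff using pel_ex(2) by blast
      with q show ?thesis unfolding val_iff by blast
    qed
    show "w \<Turnstile> eq q q'" if le: "w0 \<le> w" and g: "w \<Turnstile> mem g X" and "w \<Turnstile> val g q" "w \<Turnstile> val g q'" for w g q q'
    proof -
      from that(3,4) obtain a t a' t' where *: "w \<Turnstile> pel X q a t" "w \<Turnstile> VV g a t" "w \<Turnstile> pel X q' a' t'" "w \<Turnstile> VV g a' t'"
        unfolding val_iff by blast
      then have t: "w \<Turnstile> fnf t a X" "w \<Turnstile> pr q a t" "w \<Turnstile> fnf t' a' X" "w \<Turnstile> pr q' a' t'" by (simp_all add: pel_iff)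
      show ?thesis by (rule pr_unique[OF t(2,4) val_unique[OF le g *(2) t(1) *(4) t(3)]])
    qed
  qed
  with PX show ?thesis unfolding is_structure_def by blast
qed

end

section \<open>Coalgebra morphisms as the formulas define them\<close>

context container
begin

definition pmap :: "nat \<Rightarrow> nat \<Rightarrow> nat \<Rightarrow> pv" where
  "pmap Y \<alpha> m = cmp m (\<lambda>p. exi (\<lambda>a. exi (\<lambda>t. exi (\<lambda>s. exi (\<lambda>q. exi (\<lambda>q'.
    pel Y q a t \<sqinter> comp s \<alpha> t \<sqinter> pr q' a s \<sqinter> pr p q q'))))))"

definition morphism :: "nat \<Rightarrow> nat \<Rightarrow> nat \<Rightarrow> nat \<Rightarrow> nat \<Rightarrow> pv" where
  "morphism Y u X v \<alpha> = (fn \<alpha> Y X \<sqinter> exi (\<lambda>m. exi (\<lambda>h. pmap Y \<alpha> m \<sqinter> comp h v \<alpha> \<sqinter> comp h m u)))"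

lemma pmap_mp:
  assumes "w \<Turnstile> pmap Y \<alpha> m" "w \<le> w'"
  shows "w' \<Turnstile> mp m q q' \<longleftrightarrow> (\<exists>a t s. w' \<Turnstile> pel Y q a t \<and> w' \<Turnstile> comp s \<alpha> t \<and> w' \<Turnstile> pr q' a s)"
proof
  assume "w' \<Turnstile> mp m q q'"
  then obtain p where "w' \<Turnstile> mem p m" and p: "w' \<Turnstile> pr p q q'" by (auto simp: mp_iff)
  then obtain a t s q1 q1' where *: "w' \<Turnstile> pel Y q1 a t" "w' \<Turnstile> comp s \<alpha> t" "w' \<Turnstile> pr q1' a s" "w' \<Turnstile> pr p q1 q1'"
    unfolding cmpD[OF assms(1)[unfolded pmap_def] assms(2)] holds_exi holds_conj by blast
  from pel_cong1[OF *(1) pr_inject(1)[OF *(4) p]] *(2) pr_cong1[OF *(3) pr_inject(2)[OF *(4) p]]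
  show "\<exists>a t s. w' \<Turnstile> pel Y q a t \<and> w' \<Turnstile> comp s \<alpha> t \<and> w' \<Turnstile> pr q' a s" by blast
next
  assume "\<exists>a t s. w' \<Turnstile> pel Y q a t \<and> w' \<Turnstile> comp s \<alpha> t \<and> w' \<Turnstile> pr q' a s"
  then obtain a t s where *: "w' \<Turnstile> pel Y q a t" "w' \<Turnstile> comp s \<alpha> t" "w' \<Turnstile> pr q' a s" by blast
  obtain p where p: "w' \<Turnstile> pr p q q'" using pr_exists[OF pel_ex(2)[OF *(1)] pr_ex(1)[OF *(3)]] by blast
  have "w' \<Turnstile> mem p m"
    unfolding cmpD[OF assms(1)[unfolded pmap_def] assms(2)] holds_exi holds_conj
    using * p pel_ex(2-4)[OF *(1)] comp_ex[OF *(2)] pr_ex(1)[OF *(3)] pr_ex(1)[OF p] by blast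
  with p show "w' \<Turnstile> mp m q q'" by (auto simp: mp_iff)
qed

lemma pmap_exists:
  assumes le: "w0 \<le> w" and PY: "w \<Turnstile> cmp PY (isP Y)" and Y: "w \<Turnstile> ex Y" and \<alpha>: "w \<Turnstile> ex \<alpha>"
  shows "\<exists>m. w \<Turnstile> pmap Y \<alpha> m"
proof -
  let ?P = "\<lambda>q q'. exi (\<lambda>a. exi (\<lambda>t. exi (\<lambda>s. pel Y q a t \<sqinter> comp s \<alpha> t \<sqinter> pr q' a s)))"
  have P: "w' \<Turnstile> ?P q q' \<longleftrightarrow> (\<exists>a t s. w' \<Turnstile> pel Y q a t \<and> w' \<Turnstile> comp s \<alpha> t \<and> w' \<Turnstile> pr q' a s)" for w' q q'
    unfolding holds_exi holds_conj using pel_ex(3,4) comp_ex by blast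
  show ?thesis
  proof (rule graph_set)
    show "dfn False w (\<lambda>e. ?P (e 0) (e (Suc 0)))" by (intro dfn_intros dfn_pel le Y \<alpha>)
    show "w \<Turnstile> ex PY" by (rule cmp_ex[OF PY])
    show "\<exists>q'. w' \<Turnstile> ex q' \<and> w' \<Turnstile> ?P q q'" if l: "w \<le> w'" and q: "w' \<Turnstile> mem q PY" for w' q
    proof -
      obtain a t where t: "w' \<Turnstile> pel Y q a t" using q unfolding cmpD[OF PY l] isP_iff by blast
      obtain s where s: "w' \<Turnstile> comp s \<alpha> t" using comp_exists[OF up[OF \<alpha> l] pel_ex(4)[OF t]] by blast
      obtain q' where "w' \<Turnstile> pr q' a s" using pr_exists[OF pel_ex(3)[OF t] comp_ex[OF s]] by blast
      with t s pr_ex(1) show ?thesis unfolding P by blast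
    qed
    show "w' \<Turnstile> eq q1 q2" if "w' \<Turnstile> ?P q q1" "w' \<Turnstile> ?P q q2" for w' q q1 q2
    proof -
      from that(1) obtain a t s where 1: "w' \<Turnstile> pel Y q a t" "w' \<Turnstile> comp s \<alpha> t" "w' \<Turnstile> pr q1 a s" unfolding P by blast
      from that(2) obtain a' t' s' where 2: "w' \<Turnstile> pel Y q a' t'" "w' \<Turnstile> comp s' \<alpha> t'" "w' \<Turnstile> pr q2 a' s'" unfolding P by blast
      note E = pel_inject[OF 1(1) 2(1)]
      show ?thesis by (rule pr_unique[OF 1(3) 2(3) E(1) comp_unique[OF comp_cong[OF 1(2) E(2)] 2(2)]])
    qed
    fix m assume m: "w \<Turnstile> ex m"
      "\<And>w' q q'. w \<le> w' \<Longrightarrow> w' \<Turnstile> mp m q q' \<longleftrightarrow> w' \<Turnstile> mem q PY \<and> w' \<Turnstile> ex q' \<and> w' \<Turnstile> ?P q q'"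
      "\<And>w' p. w \<le> w' \<Longrightarrow> w' \<Turnstile> mem p m \<Longrightarrow> \<exists>q q'. w' \<Turnstile> mem q PY \<and> w' \<Turnstile> ex q' \<and> w' \<Turnstile> ?P q q' \<and> w' \<Turnstile> pr p q q'"
    have "w \<Turnstile> pmap Y \<alpha> m" unfolding pmap_def
    proof (rule cmpI[OF m(1)])
      fix w' p assume l: "w \<le> w'"
      show "w' \<Turnstile> mem p m \<longleftrightarrow> w' \<Turnstile> exi (\<lambda>a. exi (\<lambda>t. exi (\<lambda>s. exi (\<lambda>q. exi (\<lambda>q'.
          pel Y q a t \<sqinter> comp s \<alpha> t \<sqinter> pr q' a s \<sqinter> pr p q q')))))" (is "_ \<longleftrightarrow> ?R")
      proof
        assume "w' \<Turnstile> mem p m"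
        from m(3)[OF l this] obtain q q' where "w' \<Turnstile> ?P q q'" and p: "w' \<Turnstile> pr p q q'" by blast
        then obtain a t s where *: "w' \<Turnstile> pel Y q a t" "w' \<Turnstile> comp s \<alpha> t" "w' \<Turnstile> pr q' a s" unfolding P by blast
        show ?R unfolding holds_exi holds_conj
          using * p pel_ex(2-4)[OF *(1)] comp_ex[OF *(2)] pr_ex(1)[OF *(3)] by blast
      next
        assume ?R
        then obtain a t s q q' where *: "w' \<Turnstile> pel Y q a t" "w' \<Turnstile> comp s \<alpha> t" "w' \<Turnstile> pr q' a s" "w' \<Turnstile> pr p q q'"
          unfolding holds_exi holds_conj by blast
        have "w' \<Turnstile> mem q PY" unfolding cmpD[OF PY l] isP_iff using *(1) pel_ex(2) by blast
        moreover have "w' \<Turnstile> ?P q q'" unfolding P using * by blast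
        ultimately have "w' \<Turnstile> mp m q q'" unfolding m(2)[OF l] using pr_ex(1)[OF *(3)] by blast
        from mp_mem[OF this *(4)] show "w' \<Turnstile> mem p m" .
      qed
    qed
    then show ?thesis ..
  qed
qed

end

lemma (in limit) VV_cong:
  assumes "w0 \<le> w" "w \<Turnstile> VV g a t" "w \<Turnstile> eq a a'" "w \<Turnstile> eq t t'" "w \<Turnstile> ex g"
  shows "w \<Turnstile> VV g a' t'"
  by (rule dfn_cong2[where P = "\<lambda>a t. VV g a t" and b = False, OF _ assms(3,4,2)])
    (intro dfn_VV dfn_intros assms(1,5))

lemma (in limit) morphism_iff:
  assumes le: "w0 \<le> w" and PY: "w \<Turnstile> cmp PY (isP Y)" and u: "w \<Turnstile> fn u Y PY" and v: "is_structure PX v"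
  shows "w \<Turnstile> morphism Y u X v \<alpha> \<longleftrightarrow> mor w Y u \<alpha>"
proof -
  have PX: "w0 \<Turnstile> cmp PX (isP X)" and vf: "w0 \<Turnstile> fn v X PX" using v by (simp_all add: is_structure_def)
  have v_mp: "w' \<Turnstile> mp v g q \<longleftrightarrow> w' \<Turnstile> mem g X \<and> w' \<Turnstile> ex q \<and> w' \<Turnstile> val g q" if "w0 \<le> w'" for w' g q
    using v that unfolding is_structure_def by blast
  show ?thesis
  proof
    assume "w \<Turnstile> morphism Y u X v \<alpha>"
    then obtain m h where \<alpha>: "w \<Turnstile> fn \<alpha> Y X" and m: "w \<Turnstile> pmap Y \<alpha> m" and h: "w \<Turnstile> comp h v \<alpha>" "w \<Turnstile> comp h m u"
      unfolding morphism_def holds_conj holds_exi by blast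
    show "mor w Y u \<alpha>" unfolding mor_def
    proof (intro HOL.conjI allI impI \<alpha>)
      fix w' y q a t g assume l: "w \<le> w'" and q: "w' \<Turnstile> mp u y q" "w' \<Turnstile> pel Y q a t" and g: "w' \<Turnstile> mp \<alpha> y g"
      note l0 = order_trans[OF le l]
      obtain q1 where q1: "w' \<Turnstile> mp v g q1" using fn_total[OF up[OF vf l0] fn_mem(2)[OF up[OF \<alpha> l] g]] by blast
      then have "w' \<Turnstile> mp h y q1" unfolding comp_mp[OF h(1) l] using g by blast
      then obtain q2 where q2: "w' \<Turnstile> mp u y q2" "w' \<Turnstile> mp m q2 q1" unfolding comp_mp[OF h(2) l] by blast
      from q2(2) obtain a1 t1 s where *: "w' \<Turnstile> pel Y q2 a1 t1" "w' \<Turnstile> comp s \<alpha> t1" "w' \<Turnstile> pr q1 a1 s"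
        unfolding pmap_mp[OF m l] by blast
      note E = pel_inject[OF pel_cong1[OF *(1) fn_unique[OF up[OF u l] q2(1) q(1)]] q(2)]
      from q1 obtain a2 t2 where t2: "w' \<Turnstile> pel X q1 a2 t2" "w' \<Turnstile> VV g a2 t2" unfolding v_mp[OF l0] val_iff by blast
      then have "w' \<Turnstile> pr q1 a2 t2" by (simp add: pel_iff)
      note E2 = pr_inject[OF this *(3)]
      from VV_cong[OF l0 t2(2) eq_trans[OF E2(1) E(1)] E2(2) mp_ex(3)[OF g]] comp_cong[OF *(2) E(2)]
      show "\<exists>s. w' \<Turnstile> comp s \<alpha> t \<and> w' \<Turnstile> VV g a s" by blast
    qed
  next
    assume mor: "mor w Y u \<alpha>"
    then have \<alpha>: "w \<Turnstile> fn \<alpha> Y X" by (simp add: mor_def)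
    obtain m where m: "w \<Turnstile> pmap Y \<alpha> m" using pmap_exists[OF le PY fn_ex(2)[OF u] fn_ex(1)[OF \<alpha>]] by blast
    obtain h where h: "w \<Turnstile> comp h v \<alpha>" using comp_exists[OF up[OF fn_ex(1)[OF vf] le] fn_ex(1)[OF \<alpha>]] by blast
    \<comment> \<open>The two composites agree as relations. One composite h is known to be a set,
      and this agreement makes the same h the other composite.\<close>
    have square: "(\<exists>g. w' \<Turnstile> mp \<alpha> y g \<and> w' \<Turnstile> mp v g q1) \<longleftrightarrow> (\<exists>q. w' \<Turnstile> mp u y q \<and> w' \<Turnstile> mp m q q1)"
      if l: "w \<le> w'" for w' y q1
    proof -
      note l0 = order_trans[OF le l] and \<alpha>' = up[OF \<alpha> l] and u' = up[OF u l]
      show ?thesis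
      proof
        assume "\<exists>g. w' \<Turnstile> mp \<alpha> y g \<and> w' \<Turnstile> mp v g q1"
        then obtain g where g: "w' \<Turnstile> mp \<alpha> y g" "w' \<Turnstile> mp v g q1" by blast
        obtain q a t where q: "w' \<Turnstile> mp u y q" "w' \<Turnstile> pel Y q a t"
          by (rule coalgebra_total[OF up[OF PY l] u' fn_mem(1)[OF \<alpha>' g(1)]])
        obtain s where s: "w' \<Turnstile> comp s \<alpha> t" "w' \<Turnstile> VV g a s" using mor l q g(1) unfolding mor_def by blast
        from g(2) obtain a1 t1 where t1: "w' \<Turnstile> pel X q1 a1 t1" "w' \<Turnstile> VV g a1 t1" unfolding v_mp[OF l0] val_iff by blast
        then have t1': "w' \<Turnstile> fnf t1 a1 X" "w' \<Turnstile> pr q1 a1 t1" by (simp_all add: pel_iff)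
        have "w' \<Turnstile> fnf t a Y" using q(2) by (simp add: pel_iff)
        then have "w' \<Turnstile> fnf s a X"
          by (rule comp_fnf[OF l0 s(1) _ up[OF cmp_ex[OF X] l0]])
            (use fn_total[OF up[OF \<alpha>']] fn_unique[OF up[OF \<alpha>']] in blast)+
        note E = val_unique[OF l0 fn_mem(2)[OF \<alpha>' g(1)] t1(2) t1'(1) s(2) this]
        from pr_cong[OF t1'(2) E] q s(1) show "\<exists>q. w' \<Turnstile> mp u y q \<and> w' \<Turnstile> mp m q q1"
          unfolding pmap_mp[OF m l] by blast
      next
        assume "\<exists>q. w' \<Turnstile> mp u y q \<and> w' \<Turnstile> mp m q q1"
        then obtain q a t s where q: "w' \<Turnstile> mp u y q" "w' \<Turnstile> pel Y q a t" and s: "w' \<Turnstile> comp s \<alpha> t" "w' \<Turnstile> pr q1 a s"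
          unfolding pmap_mp[OF m l] by blast
        obtain g where g: "w' \<Turnstile> mem g X" "w' \<Turnstile> mp \<alpha> y g" using fn_total[OF \<alpha>' fn_mem(1)[OF u' q(1)]] by blast
        obtain s2 where s2: "w' \<Turnstile> comp s2 \<alpha> t" "w' \<Turnstile> VV g a s2" using mor l q g(2) unfolding mor_def by blast
        have a: "w' \<Turnstile> mem a A" and t: "w' \<Turnstile> fnf t a Y" using q(2) by (simp_all add: pel_iff)
        have VV: "w' \<Turnstile> VV g a s"
          by (rule VV_cong[OF l0 s2(2) eq_refl[OF mem_ex1[OF a]] comp_unique[OF s2(1) s(1)] mem_ex1[OF g(1)]])
        have "w' \<Turnstile> fnf s a X"
          by (rule comp_fnf[OF l0 s(1) t up[OF cmp_ex[OF X] l0]])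
            (use fn_total[OF up[OF \<alpha>']] fn_unique[OF up[OF \<alpha>']] in blast)+
        with a s(2) have "w' \<Turnstile> pel X q1 a s" by (simp add: pel_iff)
        with VV have "w' \<Turnstile> val g q1" unfolding val_iff by blast
        with g pr_ex(1)[OF s(2)] show "\<exists>g. w' \<Turnstile> mp \<alpha> y g \<and> w' \<Turnstile> mp v g q1" unfolding v_mp[OF l0] by blast
      qed
    qed
    have "w \<Turnstile> comp h m u" unfolding comp_def
    proof (rule cmp_cong[OF h[unfolded comp_def]])
      fix w' p assume l: "w \<le> w'"
      have *: "w' \<Turnstile> exi (\<lambda>x. exi (\<lambda>y. exi (\<lambda>z. mp g x y \<sqinter> mp k y z \<sqinter> pr p x z))) \<longleftrightarrow>
        (\<exists>x z. (\<exists>y. w' \<Turnstile> mp g x y \<and> w' \<Turnstile> mp k y z) \<and> w' \<Turnstile> pr p x z)" for g k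
        unfolding holds_exi holds_conj using mp_ex(2,3) by blast
      show "w' \<Turnstile> exi (\<lambda>x. exi (\<lambda>y. exi (\<lambda>z. mp \<alpha> x y \<sqinter> mp v y z \<sqinter> pr p x z))) \<longleftrightarrow>
        w' \<Turnstile> exi (\<lambda>x. exi (\<lambda>y. exi (\<lambda>z. mp u x y \<sqinter> mp m y z \<sqinter> pr p x z)))"
        unfolding * square[OF l] ..
    qed
    with \<alpha> m h comp_ex[OF h] cmp_ex[OF m[unfolded pmap_def]]
    show "w \<Turnstile> morphism Y u X v \<alpha>" unfolding morphism_def holds_conj holds_exi by blast
  qed
qed

section \<open>Reading the formulas in the model\<close>

text \<open>Agreement is required at all later worlds as well. This makes it a congruence for
  implication and the universal quantifier, so formulas can be replaced part by part by the bounded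
  predicates.\<close>

definition same :: "world \<Rightarrow> pv \<Rightarrow> pv \<Rightarrow> bool" where
  "same w p q \<longleftrightarrow> (\<forall>w'\<ge>w. w' \<Turnstile> p \<longleftrightarrow> w' \<Turnstile> q)"

lemma sameD: "same w p q \<Longrightarrow> w \<Turnstile> p \<longleftrightarrow> w \<Turnstile> q"
  by (auto simp: same_def)

lemma sameI: "(\<And>w'. w \<le> w' \<Longrightarrow> w' \<Turnstile> p \<longleftrightarrow> w' \<Turnstile> q) \<Longrightarrow> same w p q"
  by (simp add: same_def)

lemma same_trans: "same w p q \<Longrightarrow> same w q r \<Longrightarrow> same w p r"
  by (simp add: same_def)

named_theorems same_intros

lemma same_refl: "same w p p"
  by (simp add: same_def)

lemma same_conj [same_intros]: "same w p p' \<Longrightarrow> same w q q' \<Longrightarrow> same w (p \<sqinter> q) (p' \<sqinter> q')"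
  by (simp add: same_def)

lemma same_disj [same_intros]: "same w p p' \<Longrightarrow> same w q q' \<Longrightarrow> same w (p \<squnion> q) (p' \<squnion> q')"
  by (simp add: same_def)

lemma same_imp [same_intros]:
  assumes "same w p p'" "same w q q'"
  shows "same w (p \<rightarrow> q) (p' \<rightarrow> q')"
proof (rule sameI)
  fix w1 assume le: "w \<le> w1"
  have "w2 \<Turnstile> p \<longleftrightarrow> w2 \<Turnstile> p'" "w2 \<Turnstile> q \<longleftrightarrow> w2 \<Turnstile> q'" if "w1 \<le> w2" for w2
    using assms order_trans[OF le that] unfolding same_def by blast+
  then show "w1 \<Turnstile> (p \<rightarrow> q) \<longleftrightarrow> w1 \<Turnstile> (p' \<rightarrow> q')" unfolding holds_imp by blast
qed

lemma same_iff [same_intros]: "same w p p' \<Longrightarrow> same w q q' \<Longrightarrow> same w (iff p q) (iff p' q')"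
  unfolding iff_def by (intro same_intros)

lemma same_all [same_intros]:
  assumes "\<And>w' x. w \<le> w' \<Longrightarrow> w' \<Turnstile> ex x \<Longrightarrow> same w' (P x) (Q x)"
  shows "same w (all P) (all Q)"
proof (rule sameI)
  fix w1 assume le: "w \<le> w1"
  have "w2 \<Turnstile> P x \<longleftrightarrow> w2 \<Turnstile> Q x" if "w1 \<le> w2" "w2 \<Turnstile> ex x" for w2 x
    using sameD[OF assms[OF order_trans[OF le that(1)] that(2)]] .
  then show "w1 \<Turnstile> all P \<longleftrightarrow> w1 \<Turnstile> all Q" unfolding holds_all by blast
qed

lemma same_exi [same_intros]:
  assumes "\<And>w' x. w \<le> w' \<Longrightarrow> w' \<Turnstile> ex x \<Longrightarrow> same w' (P x) (Q x)"
  shows "same w (exi P) (exi Q)"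
proof (rule sameI)
  fix w1 assume le: "w \<le> w1"
  have "w1 \<Turnstile> P x \<longleftrightarrow> w1 \<Turnstile> Q x" if "w1 \<Turnstile> ex x" for x
    using sameD[OF assms[OF le that]] .
  then show "w1 \<Turnstile> exi P \<longleftrightarrow> w1 \<Turnstile> exi Q" unfolding holds_exi by blast
qed

lemma same_ball [same_intros]:
  assumes "\<And>w' x. w \<le> w' \<Longrightarrow> w' \<Turnstile> ex x \<Longrightarrow> same w' (P x) (Q x)"
  shows "same w (ball a P) (ball a Q)"
  unfolding all_ball[symmetric] by (intro same_intros same_refl assms)

lemma same_bex [same_intros]:
  assumes "\<And>w' x. w \<le> w' \<Longrightarrow> w' \<Turnstile> ex x \<Longrightarrow> same w' (P x) (Q x)"
  shows "same w (bex a P) (bex a Q)"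
  unfolding exi_bex[symmetric] by (intro same_intros same_refl assms)

lemma ok_extend: "w \<le> w' \<Longrightarrow> ok w e \<Longrightarrow> w' \<Turnstile> ex x \<Longrightarrow> ok w' (case_nat x e)"
  using ok_up by simp

lemma ok_ex: "ok w e \<Longrightarrow> e i = x \<Longrightarrow> w \<Turnstile> ex x"
  by (auto simp: ok_def)

lemma same_upr:
  assumes "w \<Turnstile> ex s" "w \<Turnstile> ex x" "w \<Turnstile> ex y"
  shows "same w (all (\<lambda>z. iff (mem z s) (eq z x \<squnion> eq z y))) (upr s x y)"
proof (rule sameI)
  fix w' assume le: "w \<le> w'"
  show "w' \<Turnstile> all (\<lambda>z. iff (mem z s) (eq z x \<squnion> eq z y)) \<longleftrightarrow> w' \<Turnstile> upr s x y"
  proof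
    assume *: "w' \<Turnstile> all (\<lambda>z. iff (mem z s) (eq z x \<squnion> eq z y))"
    show "w' \<Turnstile> upr s x y"
    proof (rule uprI[OF up[OF assms(2) le] up[OF assms(3) le]])
      fix w'' z assume "w' \<le> w''"
      with * have "w'' \<Turnstile> ex z \<Longrightarrow> w'' \<Turnstile> mem z s \<longleftrightarrow> w'' \<Turnstile> eq z x \<or> w'' \<Turnstile> eq z y"
        unfolding holds_all holds_iff holds_disj using order_refl[of w''] by blast
      then show "w'' \<Turnstile> mem z s \<longleftrightarrow> w'' \<Turnstile> eq z x \<or> w'' \<Turnstile> eq z y" using mem_ex1 eq_ex1 by blast
    qed
  next
    assume u: "w' \<Turnstile> upr s x y"
    show "w' \<Turnstile> all (\<lambda>z. iff (mem z s) (eq z x \<squnion> eq z y))"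
      unfolding holds_all holds_iff holds_disj
    proof (intro allI impI)
      fix w1 z w2 assume "w' \<le> w1" "w1 \<le> w2"
      from uprD(6)[OF u order_trans[OF this]] show "w2 \<Turnstile> mem z s \<longleftrightarrow> w2 \<Turnstile> eq z x \<or> w2 \<Turnstile> eq z y" .
    qed
  qed
qed

lemma same_is_upair [same_intros]:
  assumes "ok w e" "wb n s" "wb n x" "wb n y" "e (s n) = s'" "e (x n) = x'" "e (y n) = y'"
  shows "same w (sem e (is_upair s x y n)) (upr s' x' y')"
  using same_upr[OF assms(1)[THEN ok_ex, OF assms(5)] assms(1)[THEN ok_ex, OF assms(6)] assms(1)[THEN ok_ex, OF assms(7)]] assms
  by (simp add: is_upair_def)

lemma same_is_singleton [same_intros]:
  assumes "ok w e" "wb n s" "wb n x" "e (s n) = s'" "e (x n) = x'"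
  shows "same w (sem e (is_singleton s x n)) (upr s' x' x')"
proof -
  have "same w (sem e (is_singleton s x n)) (all (\<lambda>z. iff (mem z s') (eq z x' \<squnion> eq z x')))"
    using assms by (simp add: is_singleton_def same_def)
  from same_trans[OF this same_upr] show ?thesis using assms(1)[THEN ok_ex] assms(4,5) by blast
qed

lemma same_pr:
  assumes "w \<Turnstile> ex p" "w \<Turnstile> ex x" "w \<Turnstile> ex y"
  shows "same w (all (\<lambda>s. iff (mem s p) (upr s x x \<squnion> upr s x y))) (pr p x y)"
proof (rule sameI)
  fix w' assume le: "w \<le> w'"
  show "w' \<Turnstile> all (\<lambda>s. iff (mem s p) (upr s x x \<squnion> upr s x y)) \<longleftrightarrow> w' \<Turnstile> pr p x y"
  proof
    assume *: "w' \<Turnstile> all (\<lambda>s. iff (mem s p) (upr s x x \<squnion> upr s x y))"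
    show "w' \<Turnstile> pr p x y"
    proof (rule prI[OF up[OF assms(2) le] up[OF assms(3) le]])
      fix w'' s assume "w' \<le> w''"
      with * have "w'' \<Turnstile> ex s \<Longrightarrow> w'' \<Turnstile> mem s p \<longleftrightarrow> w'' \<Turnstile> upr s x x \<or> w'' \<Turnstile> upr s x y"
        unfolding holds_all holds_iff holds_disj using order_refl[of w''] by blast
      then show "w'' \<Turnstile> mem s p \<longleftrightarrow> w'' \<Turnstile> upr s x x \<or> w'' \<Turnstile> upr s x y" using mem_ex1 uprD(1) by blast
    qed
  next
    assume u: "w' \<Turnstile> pr p x y"
    show "w' \<Turnstile> all (\<lambda>s. iff (mem s p) (upr s x x \<squnion> upr s x y))"
      unfolding holds_all holds_iff holds_disj
    proof (intro allI impI)
      fix w1 s w2 assume "w' \<le> w1" "w1 \<le> w2"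
      from prD[OF u order_trans[OF this]] show "w2 \<Turnstile> mem s p \<longleftrightarrow> w2 \<Turnstile> upr s x x \<or> w2 \<Turnstile> upr s x y" .
    qed
  qed
qed

lemma same_is_pair [same_intros]:
  assumes "ok w e" "wb n p" "wb n x" "wb n y" "e (p n) = p'" "e (x n) = x'" "e (y n) = y'"
  shows "same w (sem e (is_pair p x y n)) (pr p' x' y')"
proof -
  have "same w (sem e (is_pair p x y n)) (all (\<lambda>s. iff (mem s p') (upr s x' x' \<squnion> upr s x' y')))"
    unfolding is_pair_def sem_fo
    by (intro same_intros ok_extend) (use assms in \<open>simp_all add: same_refl\<close>)
  from same_trans[OF this same_pr] show ?thesis using assms(1)[THEN ok_ex] assms(5-7) by blast
qed

lemma same_maps_to [same_intros]:
  assumes "ok w e" "wb n g" "wb n x" "wb n y" "e (g n) = g'" "e (x n) = x'" "e (y n) = y'"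
  shows "same w (sem e (maps_to g x y n)) (mp g' x' y')"
  unfolding maps_to_def mp_def sem_fo_bounded[OF assms(2)] assms(5)
  by (intro same_intros ok_extend) (use assms in \<open>simp_all\<close>)

text \<open>The first conjunct forces all values of g into Y. Uniqueness among all sets therefore
  agrees with uniqueness among the members of Y.\<close>

lemma same_fn:
  assumes "w \<Turnstile> ex g" "w \<Turnstile> ex X" "w \<Turnstile> ex Y"
  shows "same w (ball g (\<lambda>p. bex X (\<lambda>x. bex Y (\<lambda>y. pr p x y))) \<sqinter>
    ball X (\<lambda>x. exi (\<lambda>y. mp g x y \<sqinter> all (\<lambda>y'. mp g x y' \<rightarrow> eq y' y)))) (fn g X Y)"
proof (rule sameI)
  fix w' assume le: "w \<le> w'"
  note E = assms[THEN up, OF le]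
  show "w' \<Turnstile> (ball g (\<lambda>p. bex X (\<lambda>x. bex Y (\<lambda>y. pr p x y))) \<sqinter>
    ball X (\<lambda>x. exi (\<lambda>y. mp g x y \<sqinter> all (\<lambda>y'. mp g x y' \<rightarrow> eq y' y)))) \<longleftrightarrow> w' \<Turnstile> fn g X Y" (is "?L \<longleftrightarrow> ?R")
  proof
    assume L: ?L
    have pair: "\<exists>x y. w'' \<Turnstile> mem x X \<and> w'' \<Turnstile> mem y Y \<and> w'' \<Turnstile> pr p x y" if "w' \<le> w''" "w'' \<Turnstile> mem p g" for w'' p
      using L that unfolding holds_conj holds_ball holds_bex by blast
    have inY: "w'' \<Turnstile> mem y Y" if "w' \<le> w''" "w'' \<Turnstile> mp g x y" for w'' x y
    proof -
      from that(2) obtain p where p: "w'' \<Turnstile> mem p g" "w'' \<Turnstile> pr p x y" unfolding mp_iff by blast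
      from pair[OF that(1) p(1)] pr_inject(2)[OF _ p(2)] mem_cong1 show ?thesis by blast
    qed
    have ex1: "\<exists>y. w'' \<Turnstile> mp g x y \<and> w'' \<Turnstile> all (\<lambda>y'. mp g x y' \<rightarrow> eq y' y)" if "w' \<le> w''" "w'' \<Turnstile> mem x X" for w'' x
      using L that unfolding holds_conj holds_ball holds_exi by blast
    show ?R
    proof (rule fnI[OF E pair])
      show "\<exists>y. w'' \<Turnstile> mem y Y \<and> w'' \<Turnstile> mp g x y" if "w' \<le> w''" "w'' \<Turnstile> mem x X" for w'' x
        using ex1[OF that] inY[OF that(1)] by blast
      show "w'' \<Turnstile> eq y y'" if "w' \<le> w''" "w'' \<Turnstile> mem x X" "w'' \<Turnstile> mp g x y" "w'' \<Turnstile> mp g x y'" for w'' x y y'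
      proof -
        from ex1[OF that(1,2)] obtain z where "w'' \<Turnstile> all (\<lambda>y'. mp g x y' \<rightarrow> eq y' z)" by blast
        then have "w'' \<Turnstile> eq y z" "w'' \<Turnstile> eq y' z"
          using that(3,4) mp_ex(3)[OF that(3)] mp_ex(3)[OF that(4)] order_refl[of w''] unfolding holds_all holds_imp by blast+
        then show ?thesis using eq_trans eq_sym by blast
      qed
    qed
  next
    assume R: ?R
    show ?L unfolding holds_conj
    proof
      show "w' \<Turnstile> ball g (\<lambda>p. bex X (\<lambda>x. bex Y (\<lambda>y. pr p x y)))"
        unfolding holds_ball holds_bex using fn_pair[OF up[OF R]] by blast
      show "w' \<Turnstile> ball X (\<lambda>x. exi (\<lambda>y. mp g x y \<sqinter> all (\<lambda>y'. mp g x y' \<rightarrow> eq y' y)))"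
        unfolding holds_ball
      proof (intro allI impI)
        fix w1 x assume l: "w' \<le> w1" and x: "w1 \<Turnstile> mem x X"
        from fn_total[OF up[OF R l] x] obtain y where y: "w1 \<Turnstile> mp g x y" by blast
        have "w1 \<Turnstile> all (\<lambda>y'. mp g x y' \<rightarrow> eq y' y)"
          unfolding holds_all holds_imp
        proof (intro allI impI)
          fix w2 y' w3 assume l': "w1 \<le> w2" "w2 \<le> w3" and y': "w3 \<Turnstile> mp g x y'"
          show "w3 \<Turnstile> eq y' y"
            by (rule fn_unique[OF up[OF R order_trans[OF l order_trans[OF l']]] y' up[OF y order_trans[OF l']]])
        qed
        with y mp_ex(3)[OF y] show "w1 \<Turnstile> exi (\<lambda>y. mp g x y \<sqinter> all (\<lambda>y'. mp g x y' \<rightarrow> eq y' y))"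
          unfolding holds_exi holds_conj by blast
      qed
    qed
  qed
qed

lemma same_is_function [same_intros]:
  assumes "ok w e" "wb n g" "wb n X" "wb n Y" "e (g n) = g'" "e (X n) = X'" "e (Y n) = Y'"
  shows "same w (sem e (is_function g X Y n)) (fn g' X' Y')"
proof -
  have "same w (sem e (is_function g X Y n)) (ball g' (\<lambda>p. bex X' (\<lambda>x. bex Y' (\<lambda>y. pr p x y))) \<sqinter>
    ball X' (\<lambda>x. exi (\<lambda>y. mp g' x y \<sqinter> all (\<lambda>y'. mp g' x y' \<rightarrow> eq y' y))))"
    unfolding is_function_def fo_ex1_def
    by (simp add: assms(2-7)) (intro same_intros ok_extend; use assms in \<open>simp add: same_refl\<close>)
  from same_trans[OF this same_fn] show ?thesis using assms(1)[THEN ok_ex] assms(5-7) by blast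
qed

lemma same_cmp:
  assumes "w \<Turnstile> ex Q" "\<And>w' z. w \<le> w' \<Longrightarrow> w' \<Turnstile> ex z \<Longrightarrow> same w' (P z) (\<psi> z)"
  shows "same w (all (\<lambda>z. iff (mem z Q) (P z))) (cmp Q \<psi>)"
proof -
  have "same w (all (\<lambda>z. iff (mem z Q) (P z))) (all (\<lambda>z. iff (mem z Q) (\<psi> z)))"
    by (intro same_intros same_refl assms(2))
  moreover have "same w (all (\<lambda>z. iff (mem z Q) (\<psi> z))) (cmp Q \<psi>)"
    by (rule sameI) (use up[OF assms(1)] in \<open>auto simp: cmp_def simp del: holds_all\<close>)
  ultimately show ?thesis by (rule same_trans)
qed

lemma same_is_comp [same_intros]:
  assumes "ok w e" "wb n h" "wb n k" "wb n g" "e (h n) = h'" "e (k n) = k'" "e (g n) = g'"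
  shows "same w (sem e (is_comp h k g n)) (comp h' k' g')"
  unfolding is_comp_def comp_def
  by (simp add: assms(2-7)) (intro same_cmp same_intros ok_extend ok_ex[OF assms(1,5)]; use assms in \<open>simp add: same_refl\<close>)

context container
begin

lemma same_is_fibre:
  assumes "ok w e" "wb n c" "wb n Bt" "wb n ft" "wb n a" "e (c n) = c'" "e (Bt n) = B" "e (ft n) = f" "e (a n) = a'"
  shows "same w (sem e (is_fibre c Bt ft a n)) (fib c' a')"
  unfolding is_fibre_def fib_def
  by (simp add: assms(2-9)) (intro same_cmp same_intros ok_extend ok_ex[OF assms(1,6)]; use assms in \<open>simp add: same_refl\<close>)

text \<open>The formula refers to the fibre by an existential quantifier. Every fibre is a set by
  \<open>fib_exists\<close>, so this reference can be replaced by \<open>fnf\<close>.\<close>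

lemma same_pel:
  assumes "w0 \<le> w" "w \<Turnstile> ex a"
  shows "same w (mem a A \<sqinter> exi (\<lambda>c. fib c a \<sqinter> fn t c X) \<sqinter> pr q a t) (pel X q a t)"
proof (rule sameI)
  fix w' assume le: "w \<le> w'"
  have "w' \<Turnstile> exi (\<lambda>c. fib c a \<sqinter> fn t c X) \<longleftrightarrow> w' \<Turnstile> fnf t a X"
  proof
    assume "w' \<Turnstile> exi (\<lambda>c. fib c a \<sqinter> fn t c X)"
    then show "w' \<Turnstile> fnf t a X" unfolding holds_exi holds_conj using fnf_fn[OF _ up[OF assms(2) le]] by blast
  next
    assume t: "w' \<Turnstile> fnf t a X"
    obtain c where "w' \<Turnstile> fib c a" "w' \<Turnstile> fn t c X" by (rule fnf_fib[OF order_trans[OF assms(1) le] t])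
    then show "w' \<Turnstile> exi (\<lambda>c. fib c a \<sqinter> fn t c X)" unfolding holds_exi holds_conj using fn_ex(2) by blast
  qed
  then show "w' \<Turnstile> (mem a A \<sqinter> exi (\<lambda>c. fib c a \<sqinter> fn t c X) \<sqinter> pr q a t) \<longleftrightarrow> w' \<Turnstile> pel X q a t"
    unfolding pel_iff holds_conj by blast
qed

lemma same_is_poly_elem:
  assumes le: "w0 \<le> w" and ok: "ok w e"
    and "wb n Bt" "wb n At" "wb n ft" "wb n X" "wb n q" "wb n a" "wb n t"
    and "e (Bt n) = B" "e (At n) = A" "e (ft n) = f" "e (X n) = X'" "e (q n) = q'" "e (a n) = a'" "e (t n) = t'"
  shows "same w (sem e (is_poly_elem Bt At ft X q a t n)) (pel X' q' a' t')"
proof -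
  have "same w (sem e (is_poly_elem Bt At ft X q a t n)) (mem a' A \<sqinter> exi (\<lambda>c. fib c a' \<sqinter> fn t' c X') \<sqinter> pr q' a' t')"
    unfolding is_poly_elem_def
    by (simp add: assms(3-)) (intro same_is_fibre same_intros ok_extend; use assms in \<open>simp add: same_refl\<close>)
  from same_trans[OF this same_pel[OF le ok_ex[OF ok assms(15)]]] show ?thesis .
qed

text \<open>The inner worlds lie above w and hence above w0; the first alternative of the proof
  method chains these inequalities, the second evaluates the de Bruijn indices.\<close>

lemma same_is_poly:
  assumes le: "w0 \<le> w" and ok: "ok w e"
    and "wb n Bt" "wb n At" "wb n ft" "wb n X" "wb n P"
    and "e (Bt n) = B" "e (At n) = A" "e (ft n) = f" "e (X n) = X'" "e (P n) = P'"
  shows "same w (sem e (is_poly Bt At ft X P n)) (cmp P' (isP X'))"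
  unfolding is_poly_def isP_def[abs_def]
  by (simp add: assms(3-)) (intro same_cmp same_is_poly_elem same_intros ok_extend ok_ex[OF ok assms(12)];
    ((insert le, (erule order_trans[rotated])+, rule order_refl) | use assms in \<open>simp add: same_refl\<close>))

lemma same_is_poly_map:
  assumes le: "w0 \<le> w" and ok: "ok w e"
    and "wb n Bt" "wb n At" "wb n ft" "wb n X" "wb n \<alpha>" "wb n m"
    and "e (Bt n) = B" "e (At n) = A" "e (ft n) = f" "e (X n) = X'" "e (\<alpha> n) = \<alpha>'" "e (m n) = m'"
  shows "same w (sem e (is_poly_map Bt At ft X \<alpha> m n)) (pmap X' \<alpha>' m')"
  unfolding is_poly_map_def pmap_def
  by (simp add: assms(3-)) (intro same_cmp same_is_poly_elem same_intros ok_extend ok_ex[OF ok assms(14)];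
    ((insert le, (erule order_trans[rotated])+, rule order_refl) | use assms in \<open>simp add: same_refl\<close>))

lemma same_is_coalgebra:
  assumes le: "w0 \<le> w" and ok: "ok w e"
    and "wb n Bt" "wb n At" "wb n ft" "wb n X" "wb n v"
    and "e (Bt n) = B" "e (At n) = A" "e (ft n) = f" "e (X n) = X'" "e (v n) = v'"
  shows "same w (sem e (is_coalgebra Bt At ft X v n)) (exi (\<lambda>P. cmp P (isP X') \<sqinter> fn v' X' P))"
  unfolding is_coalgebra_def
  by (simp add: assms(3-)) (intro same_is_poly same_intros ok_extend;
    ((insert le, (erule order_trans[rotated])+, rule order_refl) | use assms in \<open>simp add: same_refl\<close>))

lemma same_is_morphism:
  assumes le: "w0 \<le> w" and ok: "ok w e"
    and "wb n Bt" "wb n At" "wb n ft" "wb n Y" "wb n u" "wb n X" "wb n v" "wb n \<alpha>"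
    and "e (Bt n) = B" "e (At n) = A" "e (ft n) = f" "e (Y n) = Y'" "e (u n) = u'"
      "e (X n) = X'" "e (v n) = v'" "e (\<alpha> n) = \<alpha>'"
  shows "same w (sem e (is_morphism Bt At ft Y u X v \<alpha> n)) (morphism Y' u' X' v' \<alpha>')"
  unfolding is_morphism_def morphism_def
  by (simp add: assms(3-)) (intro same_is_poly_map same_intros ok_extend;
    ((insert le, (erule order_trans[rotated])+, rule order_refl) | use assms in \<open>simp add: same_refl\<close>))

lemma same_is_final_coalgebra:
  assumes le: "w0 \<le> w" and ok: "ok w e"
    and "wb n Bt" "wb n At" "wb n ft" "wb n X" "wb n v"
    and "e (Bt n) = B" "e (At n) = A" "e (ft n) = f" "e (X n) = X'" "e (v n) = v'"
  shows "same w (sem e (is_final_coalgebra Bt At ft X v n))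
    (exi (\<lambda>P. cmp P (isP X') \<sqinter> fn v' X' P) \<sqinter>
      all (\<lambda>Y. all (\<lambda>u. exi (\<lambda>P. cmp P (isP Y) \<sqinter> fn u Y P) \<rightarrow>
        exi (\<lambda>\<alpha>. morphism Y u X' v' \<alpha> \<sqinter> all (\<lambda>\<beta>. morphism Y u X' v' \<beta> \<rightarrow> eq \<beta> \<alpha>)))))"
  unfolding is_final_coalgebra_def fo_ex1_def
  by (simp add: assms(3-)) (intro same_is_coalgebra same_is_morphism same_intros ok_extend;
    ((insert le, (erule order_trans[rotated])+, rule order_refl) | use assms in \<open>simp add: same_refl\<close>))

end

section \<open>Finality\<close>

lemma all2_impI:
  assumes "\<And>w' x y. w \<le> w' \<Longrightarrow> w' \<Turnstile> P x y \<Longrightarrow> w' \<Turnstile> Q x y"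
  shows "w \<Turnstile> all (\<lambda>x. all (\<lambda>y. P x y \<rightarrow> Q x y))"
  unfolding holds_all holds_imp
proof (intro allI impI)
  fix w1 x w2 y w3
  assume "w \<le> w1" "w1 \<le> w2" "w2 \<le> w3" and P: "w3 \<Turnstile> P x y"
  from assms[OF order_trans[OF order_trans[OF this(1,2)] this(3)] P] show "w3 \<Turnstile> Q x y" .
qed

text \<open>Stronger than \<open>wb\<close>: the bound t m < m says that the term refers to an
  enclosing quantifier. This keeps the free variables of a formula at depth n below n.\<close>

definition scoped :: "nat \<Rightarrow> trm \<Rightarrow> bool" where
  "scoped n t \<longleftrightarrow> (\<forall>m\<ge>n. t m < m \<and> t (Suc m) = Suc (t m))"

lemma scoped_bound [simp]: "n \<le> k \<Longrightarrow> scoped (Suc k) (\<lambda>m. m - Suc n)"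
  by (auto simp: scoped_def)
lemma scoped_Suc [simp]: "scoped n t \<Longrightarrow> scoped (Suc n) t"
  by (simp add: scoped_def)

definition closed_at :: "nat \<Rightarrow> form \<Rightarrow> bool" where
  "closed_at n p \<longleftrightarrow> fv (p n) \<subseteq> {..<n}"

named_theorems closed_intros

lemma closed_at_fo [closed_intros]:
  "scoped n s \<Longrightarrow> scoped n t \<Longrightarrow> closed_at n (s \<^bold>\<in> t)"
  "scoped n s \<Longrightarrow> scoped n t \<Longrightarrow> closed_at n (s \<^bold>= t)"
  "closed_at n p \<Longrightarrow> closed_at n q \<Longrightarrow> closed_at n (p \<^bold>\<and> q)"
  "closed_at n p \<Longrightarrow> closed_at n q \<Longrightarrow> closed_at n (p \<^bold>\<or> q)"
  "closed_at n p \<Longrightarrow> closed_at n q \<Longrightarrow> closed_at n (p \<^bold>\<longrightarrow> q)"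
  "closed_at n p \<Longrightarrow> closed_at n q \<Longrightarrow> closed_at n (p \<^bold>\<longleftrightarrow> q)"
  by (auto simp: closed_at_def scoped_def fo_mem_def fo_eq_def fo_conj_def fo_disj_def fo_imp_def fo_iff_def)

lemma closed_at_fo_all [closed_intros]:
  "closed_at (Suc n) (F (\<lambda>m. m - Suc n)) \<Longrightarrow> closed_at n (fo_all F)"
  "closed_at (Suc n) (F (\<lambda>m. m - Suc n)) \<Longrightarrow> closed_at n (fo_ex F)"
  by (auto simp: closed_at_def fo_all_def fo_ex_def)

lemma closed_at_fo_ball [closed_intros]:
  "scoped n t \<Longrightarrow> closed_at (Suc n) (F (\<lambda>m. m - Suc n)) \<Longrightarrow> closed_at n (fo_ball t F)"
  "scoped n t \<Longrightarrow> closed_at (Suc n) (F (\<lambda>m. m - Suc n)) \<Longrightarrow> closed_at n (fo_bex t F)"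
  unfolding fo_ball_def fo_bex_def by (intro closed_intros; simp)+

lemma closed_at_is_pair [closed_intros]:
  "scoped n p \<Longrightarrow> scoped n x \<Longrightarrow> scoped n y \<Longrightarrow> closed_at n (is_pair p x y)"
  unfolding is_pair_def is_singleton_def is_upair_def by (intro closed_intros; simp)

lemma closed_at_maps_to [closed_intros]:
  "scoped n g \<Longrightarrow> scoped n x \<Longrightarrow> scoped n y \<Longrightarrow> closed_at n (maps_to g x y)"
  unfolding maps_to_def by (intro closed_intros; simp)

lemma closed_at_is_function [closed_intros]:
  "scoped n g \<Longrightarrow> scoped n X \<Longrightarrow> scoped n Y \<Longrightarrow> closed_at n (is_function g X Y)"
  unfolding is_function_def fo_ex1_def by (intro closed_intros; simp)

lemma closed_at_is_comp [closed_intros]: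
  "scoped n h \<Longrightarrow> scoped n k \<Longrightarrow> scoped n g \<Longrightarrow> closed_at n (is_comp h k g)"
  unfolding is_comp_def by (intro closed_intros; simp)

lemma closed_at_is_poly_elem [closed_intros]:
  "scoped n B \<Longrightarrow> scoped n A \<Longrightarrow> scoped n f \<Longrightarrow> scoped n X \<Longrightarrow> scoped n q \<Longrightarrow> scoped n a \<Longrightarrow> scoped n t \<Longrightarrow>
    closed_at n (is_poly_elem B A f X q a t)"
  unfolding is_poly_elem_def is_fibre_def by (intro closed_intros; simp)

lemma closed_at_is_coalgebra [closed_intros]:
  "scoped n B \<Longrightarrow> scoped n A \<Longrightarrow> scoped n f \<Longrightarrow> scoped n X \<Longrightarrow> scoped n v \<Longrightarrow> closed_at n (is_coalgebra B A f X v)"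
  unfolding is_coalgebra_def is_poly_def by (intro closed_intros; simp)

lemma closed_at_is_morphism [closed_intros]:
  "scoped n B \<Longrightarrow> scoped n A \<Longrightarrow> scoped n f \<Longrightarrow> scoped n X \<Longrightarrow> scoped n v \<Longrightarrow> scoped n Y \<Longrightarrow> scoped n w \<Longrightarrow> scoped n \<alpha> \<Longrightarrow>
    closed_at n (is_morphism B A f X v Y w \<alpha>)"
  unfolding is_morphism_def is_poly_map_def by (intro closed_intros; simp)

lemma all_M_types_exist_closed: "fv (all_M_types_exist 0) = {}"
proof -
  have "closed_at 0 all_M_types_exist"
    unfolding all_M_types_exist_def is_final_coalgebra_def fo_ex1_def by (intro closed_intros; simp)
  then show ?thesis by (simp add: closed_at_def)
qed

text \<open>Transfers \<open>mor_exists\<close> and \<open>mor_unique\<close> along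
  \<open>morphism_iff\<close>. Uniqueness has to be checked at later worlds, where the data of the
  coalgebra persist.\<close>

lemma (in limit) limit_final:
  assumes "is_structure PX v"
  shows "w0 \<Turnstile> (exi (\<lambda>P. cmp P (isP X) \<sqinter> fn v X P) \<sqinter>
    all (\<lambda>Y. all (\<lambda>u. exi (\<lambda>P. cmp P (isP Y) \<sqinter> fn u Y P) \<rightarrow>
      exi (\<lambda>\<alpha>. morphism Y u X v \<alpha> \<sqinter> all (\<lambda>\<beta>. morphism Y u X v \<beta> \<rightarrow> eq \<beta> \<alpha>)))))"
proof -
  have PX: "w0 \<Turnstile> cmp PX (isP X)" and v: "w0 \<Turnstile> fn v X PX" using assms by (simp_all add: is_structure_def)
  have coalg: "w0 \<Turnstile> exi (\<lambda>P. cmp P (isP X) \<sqinter> fn v X P)"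
    using PX v cmp_ex[OF PX] unfolding holds_exi holds_conj by blast
  have "w \<Turnstile> exi (\<lambda>\<alpha>. morphism Y u X v \<alpha> \<sqinter> all (\<lambda>\<beta>. morphism Y u X v \<beta> \<rightarrow> eq \<beta> \<alpha>))"
    if le: "w0 \<le> w" and coalg: "w \<Turnstile> exi (\<lambda>P. cmp P (isP Y) \<sqinter> fn u Y P)" for w Y u
  proof -
    from coalg obtain PY where PY: "w \<Turnstile> cmp PY (isP Y)" and u: "w \<Turnstile> fn u Y PY"
      unfolding holds_exi holds_conj by blast
    obtain \<alpha> where \<alpha>: "mor w Y u \<alpha>" using mor_exists[OF le PY u] by blast
    then have "w \<Turnstile> morphism Y u X v \<alpha>" unfolding morphism_iff[OF le PY u assms] .
    moreover have "w \<Turnstile> ex \<alpha>" using \<alpha> fn_ex(1) unfolding mor_def by blast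
    moreover have "w \<Turnstile> all (\<lambda>\<beta>. morphism Y u X v \<beta> \<rightarrow> eq \<beta> \<alpha>)"
      unfolding holds_all holds_imp
    proof (intro allI impI)
      fix w1 \<beta> w2 assume "w \<le> w1" "w1 \<le> w2" and \<beta>: "w2 \<Turnstile> morphism Y u X v \<beta>"
      then have le2: "w \<le> w2" by (rule_tac order_trans)
      note le' = order_trans[OF le le2] and PY' = up[OF PY le2] and u' = up[OF u le2]
      have "w2 \<Turnstile> morphism Y u X v \<alpha>" using \<open>w \<Turnstile> morphism Y u X v \<alpha>\<close> le2 by (rule up)
      with \<beta> show "w2 \<Turnstile> eq \<beta> \<alpha>"
        unfolding morphism_iff[OF le' PY' u' assms] by (rule mor_unique[OF le' PY' u'])
    qed
    ultimately show ?thesis unfolding holds_exi holds_conj by blast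
  qed
  then have "w0 \<Turnstile> all (\<lambda>Y. all (\<lambda>u. exi (\<lambda>P. cmp P (isP Y) \<sqinter> fn u Y P) \<rightarrow>
      exi (\<lambda>\<alpha>. morphism Y u X v \<alpha> \<sqinter> all (\<lambda>\<beta>. morphism Y u X v \<beta> \<rightarrow> eq \<beta> \<alpha>))))"
    by (rule all2_impI)
  with coalg show ?thesis unfolding holds_conj by blast
qed

lemma all_M_types_exist_valid:
  assumes ok: "ok w e"
  shows "w \<Turnstile> sem e (all_M_types_exist 0)"
  unfolding all_M_types_exist_def sem_fo holds_all holds_imp
proof (intro allI impI)
  fix w1 B w2 A w3 f w4
  assume le: "w \<le> w1" "w1 \<le> w2" "w2 \<le> w3" "w3 \<le> w4" and B: "w1 \<Turnstile> ex B" and A: "w2 \<Turnstile> ex A" and f: "w3 \<Turnstile> ex f"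
  let ?e = "case_nat f (case_nat A (case_nat B e))"
  have ok': "ok w4 ?e"
    by (rule ok_up[OF ok_extend[OF le(3) ok_extend[OF le(2) ok_extend[OF le(1) ok B] A] f] le(4)])
  interpret container w4 B A f
    by unfold_locales (use ok' in \<open>auto simp: ok_def split: nat.splits dest: spec[of _ 2] spec[of _ 1] spec[of _ 0]\<close>)
  obtain W z0 one P1 R0 \<rho> F N X where "limit w4 B A f W z0 one P1 R0 \<rho> F N X" using limit_exists by blast
  then interpret limit w4 B A f W z0 one P1 R0 \<rho> F N X .
  obtain PX v where v: "is_structure PX v" using structure_exists by blast
  then have ex: "w4 \<Turnstile> ex X" "w4 \<Turnstile> ex v" using fn_ex unfolding is_structure_def by blast+
  let ?e' = "case_nat v (case_nat X ?e)"
  have "ok w4 ?e'" using ok_extend[OF order_refl ok_extend[OF order_refl ok' ex(1)] ex(2)] .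
  \<comment> \<open>The depth is 5 because B, A, f, X and v are the enclosing quantifiers; v is
    innermost and has index 0, and B has index 4.\<close>
  from sameD[OF same_is_final_coalgebra[OF order_refl this, of 5 "\<lambda>m. m - Suc 0" "\<lambda>m. m - Suc (Suc 0)"
        "\<lambda>m. m - Suc (Suc (Suc 0))" "\<lambda>m. m - Suc (Suc (Suc (Suc 0)))" "\<lambda>m. m - Suc (Suc (Suc (Suc (Suc 0))))" X v]]
    limit_final[OF v] ex
  show "w4 \<Turnstile> exi (\<lambda>X. exi (\<lambda>v. sem (case_nat v (case_nat X ?e))
      (is_final_coalgebra (\<lambda>m. m - Suc 0) (\<lambda>m. m - Suc (Suc 0)) (\<lambda>m. m - Suc (Suc (Suc 0)))
        (\<lambda>m. m - Suc (Suc (Suc (Suc 0)))) (\<lambda>m. m - Suc (Suc (Suc (Suc (Suc 0))))) (Suc (Suc (Suc (Suc (Suc 0))))))))"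
    unfolding holds_exi by (auto simp: numeral_eq_Suc simp del: holds_all holds_exi holds_conj holds_imp holds_ball holds_bex)
qed

theorem theorem3p5:
  "derives (insert (elementary_NID 0) CZF) {} (all_M_types_exist 0)"
  by (rule derives_mono_axioms[OF completeness[OF all_M_types_exist_closed all_M_types_exist_valid] subset_insertI])

end
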